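(* Assume that for a.e. $(x,t)\in Q_T$ and all $s,s'\in\mathbb{R}$, $\xi,\xi'\in\mathbb{R}^N$ the following hold: (i) $a(x,t,s,\xi)\cdot\xi\ge\alpha_1|\xi|^p$; (ii) $|a(x,t,s,\xi)|\le\beta_1\left[|s|^{p-1}+|\xi|^{p-1}+a_1(x,t)\right]$; (iii) $|G(x,t,s)|\le c(x,t)|s|^{\lambda}$ with $\lambda=p\frac{N+2}{N+1}$ and $c\in L^{\rho}(Q_T)$, $\rho=\frac{N+p}{N}$; (iv) $\left(a(x,t,s,\xi)-a(x,t,s,\xi')\right)\cdot(\xi-\xi')\ge\alpha\left(\varepsilon+|\xi|+|\xi'|\right)^{p-2}|\xi-\xi'|^2$; (v) $|a(x,t,s,\xi)-a(x,t,s',\xi)|\le\beta\left[\phi+|\xi|^{p-1}+(|s|+|s'|)^{\theta}\right]|s-s'|$; (vi) $|G(x,t,s)-G(x,t,s')|\le\varrho|s-s'|$; where $\alpha_1,\beta_1,\alpha,\beta,\varrho>0$ and $\phi\ge0$ are constants, $a_1\in L^{p'}(Q_T)$, and either (A) $1<p<2$, $\varepsilon=0$, $\theta=0$, or (B) $p\ge2$, $\varepsilon>0$, $0\le\theta\le\frac{p(N+2)}{2N}$. Let $f=f_0-\operatorname{div}F$ with $f_0\in L^{\left(\frac{p(N+2)}{N}\right)'}(Q_T)$ and $F\in (L^{p'}(Q_T))^N$. Let $u$ and $v$ be two weak solutions, with initial data $u(\cdot,0),v(\cdot,0)\in L^2(\Omega)$ respectively, of $$u_t-\operatorname{div}a(x,t,u,\nabla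 u)+G(x,t,u)=f\ \text{in }Q_T,\qquad u=0\ \text{on }\partial\Omega\times(0,T),$$ such that $u(x,0)\le v(x,0)$ a.e. in $\Omega$. Then $u\le v$ a.e. in $Q_T$.
   Context: $\Omega$ is a bounded open subset of $\mathbb{R}^N$, $N\ge2$, $T>0$, $Q_t:=\Omega\times(0,t)$ for $t\in(0,T]$. For an exponent $m>1$, $m'=m/(m-1)$. The functions $a:Q_T\times\mathbb{R}\times\mathbb{R}^N\to\mathbb{R}^N$ and $G:Q_T\times\mathbb{R}\to\mathbb{R}$ are Carathéodory functions (measurable in $(x,t)$, continuous in the remaining variables). A weak solution with initial datum $u_0\in L^2(\Omega)$ is a measurable function $u\in C(0,T;L^2(\Omega))\cap L^p(0,T;W_0^{1,p}(\Omega))$ such that for every $t\in(0,T]$ $$\int_\Omega u(x,t)\psi(x,t)\,dx+\iint_{Q_t}\left[-u\psi_t+a(x,\tau,u,\nabla u)\cdot\nabla \psi+G(x,\tau,u)\psi\right]dx\,d\tau=\int_\Omega u_0(x)\psi(x,0)\,dx+\iint_{Q_t}\left(f_0\psi+F\cdot\nabla \psi\right)dx\,d\tau$$ for each $\psi\in W_0^{1,2}(0,T;L^2(\Omega))\cap L^p(0,T;W_0^{1,p}(\Omega))$. *)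

theory Defs
  imports "HOL-Analysis.Analysis"
begin

definition conj_exp :: "real \<Rightarrow> real" where
  "conj_exp m = m / (m - 1)"

section \<open>Lebesgue and Sobolev spaces\<close>

text \<open>The elements of all function spaces are represented by everywhere defined functions;
  their values outside the set under consideration play no role.\<close>

definition Lp :: "real \<Rightarrow> 'a measure \<Rightarrow> ('a \<Rightarrow> 'b::euclidean_space) set" where
  "Lp p M = {f \<in> borel_measurable M. integrable M (\<lambda>x. norm (f x) powr p)}"

definition Lp_norm :: "real \<Rightarrow> 'a measure \<Rightarrow> ('a \<Rightarrow> 'b::euclidean_space) \<Rightarrow> real" where
  "Lp_norm p M f = (\<integral>x. norm (f x) powr p \<partial>M) powr (1 / p)"

primrec continuously_diff :: "nat \<Rightarrow> ('a::euclidean_space \<Rightarrow> real) \<Rightarrow> bool" where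
  "continuously_diff 0 f \<longleftrightarrow> continuous_on UNIV f"
| "continuously_diff (Suc k) f \<longleftrightarrow>
     (\<forall>x. f differentiable (at x)) \<and>
     (\<forall>b\<in>Basis. continuously_diff k (\<lambda>x. frechet_derivative f (at x) b))"

text \<open>The space of smooth functions with compact support in \<open>S\<close>, extended by zero to the
  whole space.\<close>

definition test_functions :: "'a::euclidean_space set \<Rightarrow> ('a \<Rightarrow> real) set" where
  "test_functions S = {\<phi>. (\<forall>k. continuously_diff k \<phi>) \<and>
     (\<exists>K. compact K \<and> K \<subseteq> S \<and> (\<forall>x. x \<notin> K \<longrightarrow> \<phi> x = 0))}"

definition grad :: "(real^'n \<Rightarrow> real) \<Rightarrow> real^'n \<Rightarrow> real^'n" where
  "grad \<phi> x = (\<chi> i. frechet_derivative \<phi> (at x) (axis i 1))"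

definition weak_gradient ::
  "(real^'n) set \<Rightarrow> (real^'n \<Rightarrow> real) \<Rightarrow> (real^'n \<Rightarrow> real^'n) \<Rightarrow> bool" where
  "weak_gradient \<Omega> w g \<longleftrightarrow>
     (\<forall>K. compact K \<and> K \<subseteq> \<Omega> \<longrightarrow> integrable (lebesgue_on K) w \<and> integrable (lebesgue_on K) g) \<and>
     (\<forall>\<phi>\<in>test_functions \<Omega>. \<forall>i.
        (\<integral>x. w x * grad \<phi> x $ i \<partial>lebesgue_on \<Omega>) = - (\<integral>x. g x $ i * \<phi> x \<partial>lebesgue_on \<Omega>))"

text \<open>\<open>W0_1p \<Omega> p\<close> is the closure of the test functions in the Sobolev space of exponent \<open>p\<close>.\<close>

definition W0_1p :: "(real^'n) set \<Rightarrow> real \<Rightarrow> (real^'n \<Rightarrow> real) set" where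
  "W0_1p \<Omega> p = {w \<in> Lp p (lebesgue_on \<Omega>).
     \<exists>g \<in> Lp p (lebesgue_on \<Omega>). weak_gradient \<Omega> w g \<and>
       (\<exists>\<phi> :: nat \<Rightarrow> real^'n \<Rightarrow> real. (\<forall>k. \<phi> k \<in> test_functions \<Omega>) \<and>
          (\<lambda>k. Lp_norm p (lebesgue_on \<Omega>) (\<lambda>x. \<phi> k x - w x)) \<longlonglongrightarrow> 0 \<and>
          (\<lambda>k. Lp_norm p (lebesgue_on \<Omega>) (\<lambda>x. grad (\<phi> k) x - g x)) \<longlonglongrightarrow> 0)}"

section \<open>Spaces of functions on the space-time cylinder\<close>

text \<open>A point of the cylinder is a pair \<open>(x, t)\<close> of a position and a time.\<close>

abbreviation cylinder :: "(real^'n) set \<Rightarrow> real \<Rightarrow> ((real^'n) \<times> real) set" where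
  "cylinder \<Omega> t \<equiv> \<Omega> \<times> {0<..<t}"

text \<open>\<open>C([0,T]; L\<^sup>2(\<Omega>))\<close>; membership refers to every slice \<open>u(\<cdot>,t)\<close>, the endpoints included, so that
  \<open>u(\<cdot>,0)\<close> is the initial trace of \<open>u\<close>.\<close>

definition C_L2 :: "(real^'n) set \<Rightarrow> real \<Rightarrow> ((real^'n) \<times> real \<Rightarrow> real) set" where
  "C_L2 \<Omega> T = {u.
     (\<forall>t\<in>{0..T}. (\<lambda>x. u (x, t)) \<in> Lp 2 (lebesgue_on \<Omega>)) \<and>
     (\<forall>t\<in>{0..T}. ((\<lambda>s. Lp_norm 2 (lebesgue_on \<Omega>) (\<lambda>x. u (x, s) - u (x, t))) \<longlongrightarrow> 0)
                   (at t within {0..T}))}"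

text \<open>\<open>u \<in> L\<^sup>p(0,T; W\<^sub>0\<^sup>1\<^sup>,\<^sup>p(\<Omega>))\<close> with (jointly measurable) spatial gradient \<open>Du\<close>. As
  \<open>W\<^sub>0\<^sup>1\<^sup>,\<^sup>p(\<Omega>)\<close> is separable, joint measurability is Bochner measurability of \<open>t \<mapsto> u(\<cdot>,t)\<close>, and by
  Tonelli's theorem the two integrability conditions express that the \<open>p\<close>-th power of the
  \<open>W\<^sup>1\<^sup>,\<^sup>p\<close>-norm of \<open>u(\<cdot>,t)\<close> is integrable over \<open>(0,T)\<close>.\<close>

definition Lp_W0_1p :: "(real^'n) set \<Rightarrow> real \<Rightarrow> real \<Rightarrow> ((real^'n) \<times> real \<Rightarrow> real) \<Rightarrow>
    ((real^'n) \<times> real \<Rightarrow> real^'n) \<Rightarrow> bool" where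
  "Lp_W0_1p \<Omega> T p u Du \<longleftrightarrow>
     u \<in> Lp p (lebesgue_on (cylinder \<Omega> T)) \<and>
     Du \<in> Lp p (lebesgue_on (cylinder \<Omega> T)) \<and>
     (AE t in lebesgue_on {0<..<T}. (\<lambda>x. u (x, t)) \<in> W0_1p \<Omega> p \<and>
        weak_gradient \<Omega> (\<lambda>x. u (x, t)) (\<lambda>x. Du (x, t)))"

text \<open>\<open>\<psi> \<in> W\<^sup>1\<^sup>,\<^sup>2(0,T; L\<^sup>2(\<Omega>))\<close> with time derivative \<open>\<psi>t\<close>: the equation
  \<open>\<integral> \<psi>(\<cdot>,t) \<eta>'(t) dt = - \<integral> \<psi>t(\<cdot>,t) \<eta>(t) dt\<close> between elements of \<open>L\<^sup>2(\<Omega>)\<close> holds for all scalar test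
  functions \<open>\<eta>\<close>, with an exceptional null set that may depend on \<open>\<eta>\<close>.\<close>

definition W_12_L2 :: "(real^'n) set \<Rightarrow> real \<Rightarrow> ((real^'n) \<times> real \<Rightarrow> real) \<Rightarrow>
    ((real^'n) \<times> real \<Rightarrow> real) \<Rightarrow> bool" where
  "W_12_L2 \<Omega> T \<psi> \<psi>t \<longleftrightarrow>
     \<psi> \<in> Lp 2 (lebesgue_on (cylinder \<Omega> T)) \<and>
     \<psi>t \<in> Lp 2 (lebesgue_on (cylinder \<Omega> T)) \<and>
     (\<forall>\<eta>\<in>test_functions {0<..<T}. AE x in lebesgue_on \<Omega>.
        (\<integral>t. \<psi> (x, t) * deriv \<eta> t \<partial>lebesgue_on {0<..<T}) =
        - (\<integral>t. \<psi>t (x, t) * \<eta> t \<partial>lebesgue_on {0<..<T}))"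

text \<open>\<open>W\<^sub>0\<^sup>1\<^sup>,\<^sup>2(0,T; L\<^sup>2(\<Omega>))\<close>: the elements of \<open>W\<^sup>1\<^sup>,\<^sup>2(0,T; L\<^sup>2(\<Omega>))\<close>, represented by
  their continuous versions, whose traces at \<open>0\<close> and \<open>T\<close> vanish.\<close>

definition W0_12_L2 :: "(real^'n) set \<Rightarrow> real \<Rightarrow> ((real^'n) \<times> real \<Rightarrow> real) \<Rightarrow>
    ((real^'n) \<times> real \<Rightarrow> real) \<Rightarrow> bool" where
  "W0_12_L2 \<Omega> T \<psi> \<psi>t \<longleftrightarrow> W_12_L2 \<Omega> T \<psi> \<psi>t \<and> \<psi> \<in> C_L2 \<Omega> T \<and>
     (AE x in lebesgue_on \<Omega>. \<psi> (x, 0) = 0) \<and> (AE x in lebesgue_on \<Omega>. \<psi> (x, T) = 0)"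

section \<open>Weak solutions\<close>

definition caratheodory ::
  "'z measure \<Rightarrow> ('z \<Rightarrow> 's::euclidean_space \<Rightarrow> 'b::euclidean_space) \<Rightarrow> bool" where
  "caratheodory M h \<longleftrightarrow>
     (\<forall>s. (\<lambda>z. h z s) \<in> borel_measurable M) \<and> (AE z in M. continuous_on UNIV (h z))"

text \<open>Since the test functions vanish at \<open>t = 0\<close>, the integral identity alone does not see
  \<open>u0\<close>; the initial datum is the initial trace of \<open>u \<in> C([0,T]; L\<^sup>2(\<Omega>))\<close>.
  Given this trace, the identity extends to all test functions in \<open>W\<^sup>1\<^sup>,\<^sup>2(0,T; L\<^sup>2(\<Omega>))\<close> by a
  cut-off in time.\<close>

definition weak_solution :: "(real^'n) set \<Rightarrow> real \<Rightarrow> real \<Rightarrow>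
    ((real^'n) \<times> real \<Rightarrow> real \<Rightarrow> real^'n \<Rightarrow> real^'n) \<Rightarrow> ((real^'n) \<times> real \<Rightarrow> real \<Rightarrow> real) \<Rightarrow>
    ((real^'n) \<times> real \<Rightarrow> real) \<Rightarrow> ((real^'n) \<times> real \<Rightarrow> real^'n) \<Rightarrow>
    (real^'n \<Rightarrow> real) \<Rightarrow> ((real^'n) \<times> real \<Rightarrow> real) \<Rightarrow> bool" where
  "weak_solution \<Omega> T p a G f0 F u0 u \<longleftrightarrow>
     u0 \<in> Lp 2 (lebesgue_on \<Omega>) \<and> u \<in> C_L2 \<Omega> T \<and>
     (AE x in lebesgue_on \<Omega>. u (x, 0) = u0 x) \<and>
     (\<exists>Du. Lp_W0_1p \<Omega> T p u Du \<and>
       (\<forall>t\<in>{0<..T}. \<forall>\<psi> \<psi>t D\<psi>. W0_12_L2 \<Omega> T \<psi> \<psi>t \<and> Lp_W0_1p \<Omega> T p \<psi> D\<psi> \<longrightarrow>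
          (\<integral>x. u (x, t) * \<psi> (x, t) \<partial>lebesgue_on \<Omega>) +
          (\<integral>z. - (u z * \<psi>t z) + a z (u z) (Du z) \<bullet> D\<psi> z + G z (u z) * \<psi> z
             \<partial>lebesgue_on (cylinder \<Omega> t)) =
          (\<integral>x. u0 x * \<psi> (x, 0) \<partial>lebesgue_on \<Omega>) +
          (\<integral>z. f0 z * \<psi> z + F z \<bullet> D\<psi> z \<partial>lebesgue_on (cylinder \<Omega> t))))"

end

theory Submission
  imports Defs
begin

text \<open>Let \<open>w = u - v\<close>. Product test functions with trapezoidal time factors turn the two weak
  formulations into \<open>\<integral> (w(t2) - w(t1)) \<psi> = - \<integral>\<integral> (A \<bullet> \<nabla>\<psi> + \<Gamma> \<psi>)\<close> over \<open>(t1,t2)\<close> for bounded \<open>\<psi>\<close>, where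
  \<open>A\<close> and \<open>\<Gamma>\<close> are the differences of the fluxes and of the reaction terms. Take for \<open>\<psi>\<close> a bounded
  increasing function \<open>H\<close> of \<open>w\<close> that approximates a sign at scale \<open>\<delta>\<close>. By monotonicity of \<open>a\<close> in the
  gradient and its Lipschitz dependence on \<open>s\<close>, the flux term is at most \<open>\<integral>\<integral> R |w| H'(w)\<close> with
  \<open>R = \<beta> (\<phi> + |\<nabla>v|\<^sup>p\<^sup>-\<^sup>1 + (|u| + |v|)\<^sup>\<theta>) |\<nabla>w|\<close>, which is integrable because \<open>u, v \<in> L\<^sup>q\<close> for
  \<open>q = p(N+2)/N\<close> by the parabolic Gagliardo--Nirenberg embedding and \<open>\<theta> p' \<le> q\<close>. Since \<open>|w| H'(w)\<close> is
  bounded and tends to \<open>0\<close> with \<open>\<delta>\<close>, this term disappears in the limit. Gronwall's inequality for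
  the weighted norm \<open>\<integral> w\<^sup>+ + w\<^sup>-/\<kappa>\<close> and then \<open>\<kappa> \<rightarrow> \<infinity>\<close> give \<open>w\<^sup>+ = 0\<close>.\<close>

section \<open>Smooth functions\<close>

text \<open>The definition of a weak solution gives no time derivative of \<open>w\<close> as a
  function, so \<open>H(w)\<close> is not directly admissible as a space-time test function. Instead
  the slice \<open>w(\<cdot>,s)\<close> is frozen and used as a time-independent test on
  \<open>(s - h, s)\<close>. The estimate has to be of L^1 type: \<open>R\<close> is merely
  integrable, so its cofactor must be bounded uniformly in \<delta>, and \<open>|w| H'(w)\<close>
  is, because it behaves like \<open>t exp(-t)\<close> with \<open>t = |w| / \<delta>\<close>. Since
  \<open>W0_1p\<close> is a closure of smooth compactly supported functions, \<open>H\<close> is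
  taken smooth with \<open>H 0 = 0\<close>; composition then acts on the approximating sequence
  itself. The bound \<theta> p' \<le> q is trivial for \<theta> = 0 and follows from p' \<le> 2 when
  p \<ge> 2. The embedding into L^q comes from translation estimates: a large value of a function is
  compared with its mean over a ball whose radius is tuned to the L^2 bound.\<close>

lemma continuously_diff_SucI:
  assumes "\<And>x. (f has_derivative f' x) (at x)" "\<And>b. b \<in> Basis \<Longrightarrow> continuously_diff k (\<lambda>x. f' x b)"
  shows "continuously_diff (Suc k) f"
proof -
  have "frechet_derivative f (at x) = f' x" for x
    using frechet_derivative_at[OF assms(1)] by simp
  then show ?thesis
    using assms by (auto simp: differentiable_def)
qed

lemma continuously_diff_SucD:
  assumes "continuously_diff (Suc k) f"
  shows "(f has_derivative frechet_derivative f (at x)) (at x)"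
    "b \<in> Basis \<Longrightarrow> continuously_diff k (\<lambda>x. frechet_derivative f (at x) b)"
  using assms by (auto simp: frechet_derivative_works[THEN iffD1])

lemma continuously_diff_Suc_imp: "continuously_diff (Suc k) f \<Longrightarrow> continuously_diff k f"
proof (induction k arbitrary: f)
  case 0
  then show ?case
    by (auto intro!: differentiable_imp_continuous_on simp: differentiable_on_def differentiable_at_withinI)
next
  case (Suc k)
  show ?case
    by (rule continuously_diff_SucI[OF continuously_diff_SucD(1)[OF Suc.prems]])
      (use Suc.IH continuously_diff_SucD(2)[OF Suc.prems] in blast)
qed

lemma continuously_diff_const: "continuously_diff k (\<lambda>x. c)"
proof (induction k arbitrary: c)
  case (Suc k)
  show ?case by (rule continuously_diff_SucI[where f'="\<lambda>_ _. 0"]) (use Suc in auto)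
qed auto

lemma continuously_diff_bounded_linear:
  assumes "bounded_linear f" shows "continuously_diff k f"
proof (cases k)
  case 0
  then show ?thesis using assms by (simp add: linear_continuous_on)
next
  case (Suc j)
  show ?thesis unfolding Suc
    by (rule continuously_diff_SucI[where f'="\<lambda>_. f"])
      (auto simp: bounded_linear_imp_has_derivative assms continuously_diff_const)
qed

lemma continuously_diff_add:
  "continuously_diff k f \<Longrightarrow> continuously_diff k g \<Longrightarrow> continuously_diff k (\<lambda>x. f x + g x)"
proof (induction k arbitrary: f g)
  case (Suc k)
  note D = continuously_diff_SucD[OF Suc.prems(1)] continuously_diff_SucD[OF Suc.prems(2)]
  show ?case
    by (rule continuously_diff_SucI, rule has_derivative_add[OF D(1) D(3)])
      (auto intro!: Suc.IH D(2,4))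
qed (auto intro: continuous_intros)

lemma continuously_diff_mult:
  "continuously_diff k f \<Longrightarrow> continuously_diff k g \<Longrightarrow> continuously_diff k (\<lambda>x. f x * g x)"
proof (induction k arbitrary: f g)
  case (Suc k)
  note D = continuously_diff_SucD[OF Suc.prems(1)] continuously_diff_SucD[OF Suc.prems(2)]
  note C = Suc.prems[THEN continuously_diff_Suc_imp]
  show ?case
    by (rule continuously_diff_SucI, rule has_derivative_mult[OF D(1) D(3)])
      (intro continuously_diff_add Suc.IH C D(2,4); assumption)
qed (auto intro: continuous_intros)

lemma continuously_diff_compose:
  fixes H :: "real \<Rightarrow> real"
  shows "continuously_diff k H \<Longrightarrow> continuously_diff k f \<Longrightarrow> continuously_diff k (\<lambda>x. H (f x))"
proof (induction k arbitrary: H f)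
  case 0
  then show ?case by (auto intro: continuous_on_compose2)
next
  case (Suc k)
  note D = continuously_diff_SucD[OF Suc.prems(1)] continuously_diff_SucD[OF Suc.prems(2)]
  \<comment> \<open>A linear map on the reals is multiplication by its value at 1. This turns the
    chain rule into a product of two functions of class k, to which the induction hypothesis and
    closure under products apply.\<close>
  have *: "frechet_derivative H (at y) c = frechet_derivative H (at y) 1 * c" for y c
    using linear_scale[OF has_derivative_linear[OF D(1)], of y c 1] by simp
  show ?case
  proof (rule continuously_diff_SucI, rule has_derivative_compose[OF D(3) D(1)])
    fix b :: 'a assume b: "b \<in> Basis"
    show "continuously_diff k (\<lambda>x. frechet_derivative H (at (f x)) (frechet_derivative f (at x) b))"
      unfolding *[of _ "frechet_derivative f _ b"]
      by (rule continuously_diff_mult[OF Suc.IH D(4)[OF b]])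
        (use D(2)[of 1] Suc.prems(2)[THEN continuously_diff_Suc_imp] in auto)
  qed
qed

lemma continuously_diff_prod:
  "finite I \<Longrightarrow> (\<And>i. i \<in> I \<Longrightarrow> continuously_diff k (f i)) \<Longrightarrow> continuously_diff k (\<lambda>x. \<Prod>i\<in>I. f i x)"
  by (induction rule: finite_induct) (auto intro: continuously_diff_const continuously_diff_mult)

lemma continuously_diff_SucI_real:
  fixes f :: "real \<Rightarrow> real"
  assumes "\<And>x. (f has_real_derivative f' x) (at x)" "continuously_diff k f'"
  shows "continuously_diff (Suc k) f"
  using assms by (intro continuously_diff_SucI[where f'="\<lambda>x h. f' x * h"]) (auto simp: has_field_derivative_def)

lemma continuously_diff_exp: "continuously_diff k (exp :: real \<Rightarrow> real)"
proof (induction k)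
  case (Suc k)
  show ?case by (rule continuously_diff_SucI_real[OF DERIV_exp Suc])
qed (auto intro: continuous_intros)

lemma continuously_diff_inverse:
  fixes f :: "real \<Rightarrow> real"
  assumes "\<And>x. f x \<noteq> 0"
  shows "continuously_diff k f \<Longrightarrow> continuously_diff k (\<lambda>x. inverse (f x))"
proof (induction k)
  case 0
  then show ?case using assms by (auto intro: continuous_intros)
next
  case (Suc k)
  note D = continuously_diff_SucD[OF Suc.prems]
  note C = Suc.IH[OF continuously_diff_Suc_imp[OF Suc.prems]]
  \<comment> \<open>Written as a product of a constant and three factors, the derivative of the
    inverse falls under closure under multiplication.\<close>
  have *: "- (inverse a * b * inverse a) = (-1) * ((inverse a * b) * inverse a)" for a b :: real
    by simp
  show ?case
  proof (rule continuously_diff_SucI, rule Deriv.has_derivative_inverse[OF assms D(1)])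
    fix b :: real assume b: "b \<in> Basis"
    show "continuously_diff k (\<lambda>x. - (inverse (f x) * frechet_derivative f (at x) b * inverse (f x)))"
      unfolding * by (intro continuously_diff_mult continuously_diff_const C D(2)[OF b])
  qed
qed

text \<open>The derivative of \<open>flat m\<close> is \<open>flat (m + 2) - m * flat (m + 1)\<close>, so the family is closed
  under differentiation.\<close>

definition flat :: "nat \<Rightarrow> real \<Rightarrow> real" where
  "flat m x = (if x > 0 then exp (- 1 / x) / x ^ m else 0)"

text \<open>From \<open>exp y \<ge> (1 + y/n)^n\<close> with \<open>y = 1/x\<close> and
  \<open>n = m + 2\<close> one gets \<open>exp(-1/x) \<le> (n x)^n\<close>. The two powers beyond
  \<open>x^m\<close> leave a quadratic bound, which is what differentiability at 0 requires.\<close>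

lemma flat_bound: "\<bar>flat m x\<bar> \<le> real (m + 2) ^ (m + 2) * x\<^sup>2"
proof (cases "x > 0")
  case True
  let ?n = "m + 2"
  have "(1 / (x * real ?n)) ^ ?n \<le> (1 + (1/x) / real ?n) ^ ?n"
    using True by (intro power_mono) (auto simp: field_simps)
  also have "\<dots> \<le> exp (1/x)"
    using True by (intro exp_ge_one_plus_x_over_n_power_n) (auto simp: field_simps add_nonneg_pos less_imp_le intro: order_trans[of _ 0])
  finally have "inverse (exp (1/x)) \<le> inverse ((1 / (x * real ?n)) ^ ?n)"
    using True by (intro le_imp_inverse_le) auto
  then have "exp (- (1/x)) \<le> (x * real ?n) ^ ?n"
    unfolding exp_minus power_inverse[symmetric] by (simp only: inverse_divide div_by_1)
  then have "exp (- (1/x)) / x ^ m \<le> (x * real ?n) ^ ?n / x ^ m"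
    using True by (simp add: divide_right_mono)
  also have "\<dots> = real ?n ^ ?n * x\<^sup>2"
    using True by (simp only: power_mult_distrib) (simp add: power_add power2_eq_square)
  finally show ?thesis using True by (simp add: flat_def)
qed (simp add: flat_def)

lemma DERIV_flat:
  "(flat m has_real_derivative (flat (m + 2) x - real m * flat (m + 1) x)) (at x)"
proof -
  consider "x > 0" | "x < 0" | "x = 0" by linarith
  then show ?thesis
  proof cases
    case 1
    have "((\<lambda>x. exp (- 1 / x) / x ^ m) has_real_derivative (flat (m + 2) x - real m * flat (m + 1) x)) (at x)"
    proof -
      define P E where "P = x ^ m" and "E = exp (- 1 / x)"
      have P: "P \<noteq> 0" using 1 by (simp add: P_def)
      have pow: "real m * x ^ (m - 1) = real m * P / x"
        using 1 by (cases m) (auto simp: P_def)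
      have "((\<lambda>x. exp (- 1 / x) / x ^ m) has_real_derivative
          (E * (1 / (x * x)) * P - E * (real m * x ^ (m - 1))) / (P * P)) (at x)"
        using 1 by (auto intro!: derivative_eq_intros simp: P_def E_def)
      also have "(E * (1 / (x * x)) * P - E * (real m * x ^ (m - 1))) / (P * P) =
          E / (P * (x * x)) - real m * (E / (P * x))"
        unfolding pow using 1 P by (simp add: divide_simps) (simp add: algebra_simps)
      also have "\<dots> = flat (m + 2) x - real m * flat (m + 1) x"
        using 1 by (simp add: flat_def P_def E_def mult_ac)
      finally show ?thesis .
    qed
    then show ?thesis
      by (rule has_field_derivative_transform_within_open[where S="{0<..}"])
        (use 1 in \<open>auto simp: flat_def\<close>)
  next
    case 2
    have "((\<lambda>x. 0) has_real_derivative (flat (m + 2) x - real m * flat (m + 1) x)) (at x)"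
      using 2 by (simp add: flat_def)
    then show ?thesis
      by (rule has_field_derivative_transform_within_open[where S="{..<0}"])
        (use 2 in \<open>auto simp: flat_def\<close>)
  next
    case 3
    let ?C = "real (m + 2) ^ (m + 2)"
    \<comment> \<open>The quadratic bound makes the difference quotient at 0 of order
      \<open>|h|\<close>; the function and both terms of its claimed derivative vanish
      there.\<close>
    have "((\<lambda>h. (flat m h) / h) \<longlongrightarrow> 0) (at 0)"
    proof (rule Lim_null_comparison)
      have "norm (flat m h / h) \<le> ?C * \<bar>h\<bar>" if "h \<noteq> 0" for h
        using flat_bound[of m h] that by (simp add: field_simps power2_eq_square)
      then show "\<forall>\<^sub>F h in at 0. norm (flat m h / h) \<le> ?C * \<bar>h\<bar>"
        by (auto simp: eventually_at_filter)
      show "((\<lambda>h. ?C * \<bar>h\<bar>) \<longlongrightarrow> 0) (at 0)"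
        by (auto intro!: tendsto_eq_intros)
    qed
    then show ?thesis
      using 3 by (simp add: DERIV_def flat_def)
  qed
qed

lemma continuously_diff_flat: "continuously_diff k (flat m)"
proof (induction k arbitrary: m)
  case 0
  show ?case
    using DERIV_flat[of m] by (auto intro!: DERIV_isCont continuous_at_imp_continuous_on)
next
  case (Suc k)
  have "continuously_diff k (\<lambda>x. flat (m + 2) x + (- real m) * flat (m + 1) x)"
    by (intro continuously_diff_add continuously_diff_mult continuously_diff_const Suc)
  then show ?case
    by (intro continuously_diff_SucI_real[OF DERIV_flat]) simp
qed

text \<open>The product \<psi> of one-sided flat functions is smooth and positive exactly on the
  open box. The functions \<open>1 - exp(-n \<psi>)\<close> are then smooth, lie in [0,1], vanish
  outside the box and increase to 1 wherever \<psi> is positive. They approximate box indicators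
  without any convolution.\<close>

lemma test_functions_box_exhaustion:
  fixes a b :: "'a::euclidean_space"
  assumes "cbox a b \<subseteq> S"
  obtains \<sigma> :: "nat \<Rightarrow> 'a \<Rightarrow> real" where
    "\<And>n. \<sigma> n \<in> test_functions S" "\<And>n x. 0 \<le> \<sigma> n x" "\<And>n x. \<sigma> n x \<le> 1"
    "\<And>x. (\<lambda>n. \<sigma> n x) \<longlonglongrightarrow> indicator (box a b) x"
proof -
  define \<psi> where "\<psi> x = (\<Prod>i\<in>Basis. flat 0 (x \<bullet> i - a \<bullet> i) * flat 0 (b \<bullet> i - x \<bullet> i))" for x :: 'a
  have pos: "\<psi> x > 0" if "x \<in> box a b" for x
    using that unfolding \<psi>_def by (auto intro!: prod_pos mult_pos_pos simp: mem_box flat_def)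
  have zero: "\<psi> x = 0" if "x \<notin> box a b" for x
  proof -
    have "\<exists>i\<in>Basis. \<not> (a \<bullet> i < x \<bullet> i \<and> x \<bullet> i < b \<bullet> i)"
      using that unfolding mem_box by blast
    then obtain i where "i \<in> Basis" "\<not> (a \<bullet> i < x \<bullet> i \<and> x \<bullet> i < b \<bullet> i)"
      by blast
    then show ?thesis unfolding \<psi>_def
      by (intro prod_zero bexI[of _ i]) (auto simp: flat_def)
  qed
  have nonneg: "\<psi> x \<ge> 0" for x using pos zero by (metis order.order_iff_strict)
  have lin: "continuously_diff k (\<lambda>x::'a. x \<bullet> i + c)" for k i c
    by (intro continuously_diff_add continuously_diff_const continuously_diff_bounded_linear bounded_linear_inner_left)
  have lin1: "continuously_diff k (\<lambda>x::'a. x \<bullet> i - c)" for k i c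
    using lin[of k i "-c"] by simp
  have lin2: "continuously_diff k (\<lambda>x::'a. c - x \<bullet> i)" for k i c
    using lin[of k "-i" "c"] by simp
  have sm: "continuously_diff k \<psi>" for k
    unfolding \<psi>_def
    by (intro continuously_diff_prod finite_Basis continuously_diff_mult
        continuously_diff_compose[OF continuously_diff_flat lin1]
        continuously_diff_compose[OF continuously_diff_flat lin2])
  define \<sigma> where "\<sigma> n x = 1 + (-1) * exp ((- real n) * \<psi> x)" for n and x :: 'a
  have \<sigma>0: "\<sigma> n x = 0" if "x \<notin> box a b" for n x
    using zero[OF that] by (simp add: \<sigma>_def)
  show ?thesis
  proof
    show "\<sigma> n \<in> test_functions S" for n
    proof -
      have "continuously_diff k (\<sigma> n)" for k
        unfolding \<sigma>_def
        by (intro continuously_diff_add[OF continuously_diff_const]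
            continuously_diff_mult[OF continuously_diff_const]
            continuously_diff_compose[OF continuously_diff_exp]
            continuously_diff_mult[OF continuously_diff_const sm])
      moreover have "\<forall>x. x \<notin> cbox a b \<longrightarrow> \<sigma> n x = 0"
        using \<sigma>0 subsetD[OF box_subset_cbox] by metis
      ultimately show ?thesis
        unfolding test_functions_def using assms by (auto intro!: exI[of _ "cbox a b"] compact_cbox)
    qed
    show "0 \<le> \<sigma> n x" "\<sigma> n x \<le> 1" for n x
      using nonneg[of x] by (auto simp: \<sigma>_def)
    show "(\<lambda>n. \<sigma> n x) \<longlonglongrightarrow> indicator (box a b) x" for x
    proof (cases "x \<in> box a b")
      case True
      have "(\<lambda>n. \<sigma> n x) \<longlonglongrightarrow> 1 + (-1) * 0"
      proof -
        have "filterlim (\<lambda>n. \<psi> x * real n) at_top sequentially"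
          using pos[OF True] by (intro filterlim_tendsto_pos_mult_at_top[OF tendsto_const _ filterlim_real_sequentially])
        then have "(\<lambda>n. exp (- (\<psi> x * real n))) \<longlonglongrightarrow> 0"
          by (intro filterlim_compose[OF exp_at_bot] filterlim_compose[OF filterlim_uminus_at_bot_at_top])
        then show ?thesis unfolding \<sigma>_def
          by (intro tendsto_intros) (simp add: mult.commute)
      qed
      then show ?thesis using True by simp
    qed (simp add: \<sigma>0)
  qed
qed

text \<open>Dynkin's argument: open boxes are stable under intersection and generate the Borel sets,
  while the sets over which \<open>h\<close> integrates to zero are closed under complements and
  disjoint countable unions. The vanishing total integral is what makes complements work. A density
  whose integral over every Borel set is zero vanishes almost everywhere.\<close>

lemma integrable_zero_on_boxes_imp_AE_zero:
  fixes h :: "'a::euclidean_space \<Rightarrow> real"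
  assumes h: "integrable lborel h" "integral\<^sup>L lborel h = 0"
    and box: "\<And>a b. set_lebesgue_integral lborel (box a b) h = 0"
  shows "AE x in lborel. h x = 0"
proof (rule sigma_finite_measure.density_zero[OF sigma_finite_lborel h(1)])
  have sint: "set_integrable lborel A h" if "A \<in> sets borel" for A
    using integrable_mult_indicator[of A lborel h] h(1) that by (simp add: set_integrable_def)
  fix A assume "A \<in> sets (lborel :: 'a measure)"
  then have A: "A \<in> sigma_sets UNIV (range (\<lambda>(a, b). box a b :: 'a set))"
    by (simp add: borel_eq_box)
  have borel: "B \<in> sets borel" if "B \<in> sigma_sets UNIV (range (\<lambda>(a, b). box a b :: 'a set))" for B
    using that by (simp add: borel_eq_box)
  have Int_stable_boxes: "Int_stable (range (\<lambda>(a, b). box a b :: 'a set))"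
    by (auto simp: Int_stable_def box_Int_box intro!: range_eqI[where x="(_,_)"])
  have subset_Pow_UNIV: "range (\<lambda>(a, b). box a b :: 'a set) \<subseteq> Pow UNIV" by simp
  show "set_lebesgue_integral lborel A h = 0"
    using Int_stable_boxes subset_Pow_UNIV A
  proof (induction rule: sigma_sets_induct_disjoint)
    case empty
    then show ?case by (simp add: set_lebesgue_integral_def)
  next
    case (compl A)
    have "set_lebesgue_integral lborel (UNIV - A) h =
        (\<integral>x. h x - indicator A x *\<^sub>R h x \<partial>lborel)"
      unfolding set_lebesgue_integral_def
      by (intro Bochner_Integration.integral_cong) (auto simp: indicator_def)
    also have "\<dots> = integral\<^sup>L lborel h - set_lebesgue_integral lborel A h"
      using sint[OF borel[OF compl(1)]] h(1)
      unfolding set_lebesgue_integral_def set_integrable_def by simp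
    finally have "set_lebesgue_integral lborel (UNIV - A) h =
        integral\<^sup>L lborel h - set_lebesgue_integral lborel A h" .
    then show ?case using compl h(2) by simp
  next
    case (union A)
    have "set_lebesgue_integral lborel (\<Union>(range A)) h = (\<Sum>i. set_lebesgue_integral lborel (A i) h)"
    proof (intro lebesgue_integral_countable_add sint sets.countable_UN)
      have A: "A i \<in> sets borel" for i using union(2) borel by blast
      then show "range A \<subseteq> sets borel" "A i \<in> sets lborel" for i by auto
    qed (use union(1) in \<open>auto simp: disjoint_family_on_def\<close>)
    then show ?case using union by simp
  next
    case (basic A)
    then show ?case using box by auto
  qed
qed

text \<open>This is the fundamental lemma of the calculus of variations. Test functions converge
  boundedly to the indicator of any box whose closure lies in \<open>S\<close>, so \<open>g\<close>
  integrates to zero over such boxes; a countable cover of \<open>S\<close> by closed boxes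
  localizes the Dynkin argument. It is later used to see that two weak gradients coincide.\<close>

lemma test_functions_fundamental:
  fixes g :: "'a::euclidean_space \<Rightarrow> real"
  assumes S: "open S" and g: "integrable lborel g"
    and zero: "\<And>\<zeta>. \<zeta> \<in> test_functions S \<Longrightarrow> (\<integral>x. g x * \<zeta> x \<partial>lborel) = 0"
  shows "AE x in lborel. x \<in> S \<longrightarrow> g x = 0"
proof -
  have [measurable]: "g \<in> borel_measurable borel" using g by auto
  have smooth_meas: "\<zeta> \<in> borel_measurable borel" if "\<zeta> \<in> test_functions S" for \<zeta>
  proof -
    have "continuously_diff 0 \<zeta>" using that by (auto simp: test_functions_def)
    then show ?thesis by (simp add: borel_measurable_continuous_onI)
  qed
  have box0: "set_lebesgue_integral lborel (box a b) g = 0" if sub: "cbox a b \<subseteq> S" for a b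
  proof -
    obtain \<sigma> :: "nat \<Rightarrow> 'a \<Rightarrow> real" where \<sigma>: "\<And>n. \<sigma> n \<in> test_functions S" "\<And>n x. 0 \<le> \<sigma> n x" "\<And>n x. \<sigma> n x \<le> 1"
      "\<And>x. (\<lambda>n. \<sigma> n x) \<longlonglongrightarrow> indicator (box a b) x"
      using test_functions_box_exhaustion[OF sub] by metis
    note [measurable] = smooth_meas[OF \<sigma>(1)]
    have "(\<lambda>n. \<integral>x. g x * \<sigma> n x \<partial>lborel) \<longlonglongrightarrow> (\<integral>x. g x * indicator (box a b) x \<partial>lborel)"
    proof (rule integral_dominated_convergence[where w="\<lambda>x. norm (g x)"])
      show "AE x in lborel. (\<lambda>n. g x * \<sigma> n x) \<longlonglongrightarrow> g x * indicator (box a b) x"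
        using \<sigma>(4) by (auto intro!: tendsto_intros)
      show "AE x in lborel. norm (g x * \<sigma> n x) \<le> norm (g x)" for n
        using \<sigma>(2,3)[of n] by (auto simp: abs_mult intro!: mult_left_le)
    qed (use g in auto)
    then show ?thesis
      using zero[OF \<sigma>(1)] by (simp add: set_lebesgue_integral_def mult.commute LIMSEQ_const_iff)
  qed
  obtain \<D> where D: "countable \<D>" "\<D> \<subseteq> Pow S" "\<And>X. X \<in> \<D> \<Longrightarrow> \<exists>a b. X = cbox a b" "\<Union>\<D> = S"
    using open_countable_Union_open_cbox[OF S] by metis
  have "AE x in lborel. x \<in> X \<longrightarrow> g x = 0" if X: "X \<in> \<D>" for X
  proof -
    obtain c d where X_eq: "X = cbox c d" using D(3)[OF X] by blast
    have sub: "cbox c d \<subseteq> S" using X D(2) X_eq by auto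
    \<comment> \<open>Cutting \<open>g\<close> off to one open box of the cover makes the global box
      lemma applicable: the total integral of \<open>h\<close> is the integral of \<open>g\<close>
      over that box, and a nonempty intersection with another box is a box whose closure stays
      inside \<open>S\<close>.\<close>
    define h where "h x = indicator (box c d) x * g x" for x
    have "AE x in lborel. h x = 0"
    proof (rule integrable_zero_on_boxes_imp_AE_zero)
      show "integrable lborel h"
        unfolding h_def using integrable_mult_indicator[of "box c d" lborel g] g by simp
      show "integral\<^sup>L lborel h = 0"
        using box0[OF sub] by (simp add: set_lebesgue_integral_def h_def[abs_def])
      fix a b :: 'a
      obtain e f where ef: "box a b \<inter> box c d = box e f" "box e f \<noteq> {} \<Longrightarrow> cbox e f \<subseteq> cbox c d"
      proof -
        obtain e f where ef: "box a b \<inter> box c d = box e f" using box_Int_box by blast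
        moreover have "cbox e f \<subseteq> cbox c d" if ne: "box e f \<noteq> {}"
        proof -
          have "closure (box e f) \<subseteq> closure (box c d)"
            using ef by (intro closure_mono) blast
          moreover have "box c d \<noteq> {}" using ef ne by blast
          ultimately show ?thesis using ne by (simp add: closure_box)
        qed
        ultimately show ?thesis using that by blast
      qed
      have "set_lebesgue_integral lborel (box a b) h = set_lebesgue_integral lborel (box e f) g"
        unfolding set_lebesgue_integral_def h_def ef(1)[symmetric]
        by (intro Bochner_Integration.integral_cong) (auto simp: indicator_def)
      also have "\<dots> = 0"
      proof (cases "box e f = {}")
        case True
        then show ?thesis by (simp add: set_lebesgue_integral_def)
      next
        case False
        then show ?thesis using box0 ef(2) sub by blast
      qed
      finally show "set_lebesgue_integral lborel (box a b) h = 0" .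
    qed
    \<comment> \<open>The cover consists of closed boxes, whereas \<open>h\<close> is supported in
      the open one; the faces in between are negligible.\<close>
    moreover have "AE x in lborel. x \<notin> cbox c d - box c d"
      using AE_not_in[of "cbox c d - box c d" lborel]
      by (metis negligible_frontier_interval negligible_iff_null_sets null_sets_completion_iff2
          borel_closed borel_open closed_cbox open_box sets.Diff sets_lborel null_sets_completion_iff)
    ultimately show ?thesis
      by eventually_elim (auto simp: h_def X_eq indicator_def split: if_splits)
  qed
  then have "AE x in lborel. \<forall>X\<in>\<D>. x \<in> X \<longrightarrow> g x = 0"
    unfolding AE_ball_countable[OF D(1)] by blast
  then show ?thesis
    by eventually_elim (use D(4) in blast)
qed

section \<open>Power inequalities and translations\<close>

lemma powr_add_le:
  fixes a b p :: real
  assumes "0 \<le> a" "0 \<le> b" "0 \<le> p"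
  shows "(a + b) powr p \<le> 2 powr p * (a powr p + b powr p)"
proof -
  have "(a + b) powr p \<le> (2 * max a b) powr p"
    using assms by (intro powr_mono2) auto
  also have "\<dots> = 2 powr p * (max a b) powr p"
    using assms by (simp add: powr_mult)
  also have "\<dots> \<le> 2 powr p * (a powr p + b powr p)"
    by (intro mult_left_mono) (auto simp: max_def)
  finally show ?thesis .
qed

lemma norm_add_powr_le:
  "0 \<le> p \<Longrightarrow> norm (x + y) powr p \<le> 2 powr p * (norm x powr p + norm y powr p)"
  by (rule order_trans[OF powr_mono2[OF _ _ norm_triangle_ineq] powr_add_le]) auto

lemma norm_diff_powr_le:
  "0 \<le> p \<Longrightarrow> norm (x - y) powr p \<le> 2 powr p * (norm x powr p + norm y powr p)"
  using norm_add_powr_le[of p x "-y"] by simp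

text \<open>Young's inequality with exponents \<open>p/(p-1)\<close> and \<open>p\<close>, written
  so that the first factor already carries the power \<open>p - 1\<close>. In this form it is the
  tangent inequality for the p-th power and also controls products such as
  \<open>|Dv|^(p-1) |Dw|\<close>.\<close>

lemma powr_conj_mult_le:
  fixes a b :: real
  assumes p: "p > 1" and a: "0 \<le> a" and b: "0 \<le> b"
  shows "a powr (p - 1) * b \<le> (1 - 1 / p) * a powr p + b powr p / p"
proof -
  define q where "q = p / (p - 1)"
  have q: "q > 1" "1 / q + 1 / p = 1" "1 / q = 1 - 1 / p" using p by (auto simp: q_def field_simps)
  have "a powr (p - 1) * b \<le> (a powr (p - 1)) powr q / q + b powr p / p"
    using assms q by (intro Youngs_inequality) auto
  also have "(a powr (p - 1)) powr q = a powr p"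
    using p by (simp add: powr_powr q_def)
  also have "a powr p / q = (1 - 1 / p) * a powr p"
    using q(3) by (metis mult.commute times_divide_eq_right mult_1_right)
  finally show ?thesis by simp
qed

text \<open>With \<open>c\<close> the mean of \<open>F\<close> over \<open>A\<close>, the tangent
  inequality \<open>c^(p-1) F \<le> (1 - 1/p) c^p + F^p / p\<close> is integrated over
  \<open>A\<close>. Its left side becomes \<open>c^p\<close> times the measure, and absorbing the
  first term on the right leaves Jensen's inequality.\<close>

lemma set_Jensen_powr:
  fixes F :: "'a \<Rightarrow> real"
  assumes p: "p > 1" and A[measurable]: "A \<in> sets M" and fin: "emeasure M A < \<infinity>" and pos: "measure M A > 0"
    and F0: "\<And>x. F x \<ge> 0"
    and int1: "integrable M (\<lambda>x. indicator A x * F x)"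
    and int2: "integrable M (\<lambda>x. indicator A x * F x powr p)"
  shows "((\<integral>x. indicator A x * F x \<partial>M) / measure M A) powr p \<le>
    (\<integral>x. indicator A x * F x powr p \<partial>M) / measure M A"
proof -
  define \<mu> where "\<mu> = measure M A"
  define I where "I = (\<integral>x. indicator A x * F x \<partial>M)"
  define c where "c = I / \<mu>"
  have \<mu>: "\<mu> > 0" using pos by (simp add: \<mu>_def)
  have I: "I \<ge> 0" unfolding I_def by (intro Bochner_Integration.integral_nonneg) (auto simp: F0 indicator_def)
  have c: "c \<ge> 0" using I \<mu> by (simp add: c_def)
  have iA: "integrable M (\<lambda>x. indicator A x :: real)"
    using fin by (simp add: integrable_real_indicator)
  have IA: "(\<integral>x. indicator A x \<partial>M) = \<mu>" by (simp add: \<mu>_def)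
  have "(\<integral>x. c powr (p - 1) * (indicator A x * F x) \<partial>M) \<le>
     (\<integral>x. (1 - 1 / p) * c powr p * indicator A x + (1 / p) * (indicator A x * F x powr p) \<partial>M)"
  proof (rule integral_mono)
    fix x
    show "c powr (p - 1) * (indicator A x * F x) \<le>
      (1 - 1 / p) * c powr p * indicator A x + (1 / p) * (indicator A x * F x powr p)"
      using powr_conj_mult_le[OF p c F0[of x]] by (auto simp: indicator_def)
  qed (use int1 int2 iA in auto)
  also have "\<dots> = (1 - 1 / p) * c powr p * \<mu> + (1 / p) * (\<integral>x. indicator A x * F x powr p \<partial>M)"
    using int2 iA IA by simp
  finally have *: "c powr (p - 1) * I \<le>
      (1 - 1 / p) * c powr p * \<mu> + (1 / p) * (\<integral>x. indicator A x * F x powr p \<partial>M)"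
    using int1 by (simp add: I_def)
  have "c powr (p - 1) * I = c powr (p - 1) * c * \<mu>" using \<mu> by (simp add: c_def)
  also have "c powr (p - 1) * c = c powr p"
    using c p by (cases "c = 0") (auto simp: powr_mult_base[symmetric] mult.commute powr_diff)
  finally have "c powr p * \<mu> - (1 - 1 / p) * c powr p * \<mu> \<le> (1 / p) * (\<integral>x. indicator A x * F x powr p \<partial>M)"
    using * by linarith
  then have "(1 / p) * (c powr p * \<mu>) \<le> (1 / p) * (\<integral>x. indicator A x * F x powr p \<partial>M)"
    by (simp add: algebra_simps)
  then have "c powr p * \<mu> \<le> (\<integral>x. indicator A x * F x powr p \<partial>M)"
    using p by (simp add: divide_le_cancel)
  then have "c powr p \<le> (\<integral>x. indicator A x * F x powr p \<partial>M) / \<mu>"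
    using \<mu> by (simp add: field_simps)
  then show ?thesis by (simp add: c_def I_def \<mu>_def)
qed

section \<open>Translation invariance of Lebesgue measure\<close>

lemma distr_lborel_translation: "distr lborel borel (\<lambda>x. x + c) = (lborel :: 'a::euclidean_space measure)"
  using lborel_distr_plus[of c] by (simp add: add.commute[of _ c])

lemma nn_integral_lborel_translation:
  fixes c :: "'a::euclidean_space"
  assumes [measurable]: "f \<in> borel_measurable borel"
  shows "(\<integral>\<^sup>+x. f (x + c) \<partial>lborel) = (\<integral>\<^sup>+x. f x \<partial>lborel)"
proof -
  have "(\<integral>\<^sup>+x. f x \<partial>lborel) = (\<integral>\<^sup>+x. f x \<partial>distr lborel borel (\<lambda>x. x + c))"
    by (simp add: distr_lborel_translation)
  also have "\<dots> = (\<integral>\<^sup>+x. f (x + c) \<partial>lborel)" by (subst nn_integral_distr) auto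
  finally show ?thesis by simp
qed

lemma integrable_lborel_translation:
  fixes c :: "'a::euclidean_space" and f :: "'a \<Rightarrow> 'b::{banach, second_countable_topology}"
  assumes "integrable lborel f"
  shows "integrable lborel (\<lambda>x. f (x + c))"
proof -
  have [measurable]: "f \<in> borel_measurable borel" using assms by auto
  have "integrable (distr lborel borel (\<lambda>x. x + c)) f"
    using assms by (simp add: distr_lborel_translation)
  then show ?thesis by (subst (asm) integrable_distr_eq) auto
qed

lemma integral_lborel_translation:
  fixes c :: "'a::euclidean_space" and f :: "'a \<Rightarrow> 'b::{banach, second_countable_topology}"
  assumes [measurable]: "f \<in> borel_measurable borel"
  shows "(\<integral>x. f (x + c) \<partial>lborel) = (\<integral>x. f x \<partial>lborel)"
proof -
  have "(\<integral>x. f x \<partial>lborel) = (\<integral>x. f x \<partial>distr lborel borel (\<lambda>x. x + c))"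
    by (simp add: distr_lborel_translation)
  also have "\<dots> = (\<integral>x. f (x + c) \<partial>lborel)" by (subst integral_distr) auto
  finally show ?thesis by simp
qed

section \<open>Test functions\<close>

lemma borel_measurable_vec_nth [measurable]:
  fixes f :: "'a \<Rightarrow> real^'n"
  assumes "f \<in> borel_measurable M"
  shows "(\<lambda>x. f x $ i) \<in> borel_measurable M"
  by (rule measurable_compose[OF assms borel_measurable_continuous_onI]) (intro continuous_intros)

lemma test_functions_has_derivative:
  fixes \<phi> :: "real^'n \<Rightarrow> real"
  assumes "\<phi> \<in> test_functions S"
  shows "(\<phi> has_derivative (\<lambda>h. grad \<phi> x \<bullet> h)) (at x)"
proof -
  have "continuously_diff (Suc 0) \<phi>" using assms by (auto simp: test_functions_def)
  then have D: "(\<phi> has_derivative frechet_derivative \<phi> (at x)) (at x)"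
    by (rule continuously_diff_SucD)
  have "frechet_derivative \<phi> (at x) h = grad \<phi> x \<bullet> h" for h
  proof -
    have "frechet_derivative \<phi> (at x) h = frechet_derivative \<phi> (at x) (\<Sum>i\<in>UNIV. h $ i *\<^sub>R axis i 1)"
      by (metis basis_expansion scalar_mult_eq_scaleR)
    also have "\<dots> = (\<Sum>i\<in>UNIV. h $ i * frechet_derivative \<phi> (at x) (axis i 1))"
      using has_derivative_linear[OF D] by (simp add: linear_sum linear_scale)
    also have "\<dots> = grad \<phi> x \<bullet> h" by (simp add: grad_def inner_vec_def mult.commute)
    finally show ?thesis .
  qed
  then have "frechet_derivative \<phi> (at x) = (\<lambda>h. grad \<phi> x \<bullet> h)" by (rule ext)
  then show ?thesis using D by simp
qed

lemma grad_eqI: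
  fixes \<phi> :: "real^'n \<Rightarrow> real"
  assumes "(\<phi> has_derivative (\<lambda>h. g \<bullet> h)) (at x)"
  shows "grad \<phi> x = g"
  using frechet_derivative_at[OF assms, symmetric] by (simp add: grad_def vec_eq_iff inner_axis)

lemma continuous_on_grad:
  fixes \<phi> :: "real^'n \<Rightarrow> real"
  assumes "\<phi> \<in> test_functions S"
  shows "continuous_on UNIV (grad \<phi>)"
proof -
  have "continuously_diff (Suc 0) \<phi>" using assms by (auto simp: test_functions_def)
  then have "continuous_on UNIV (\<lambda>x. frechet_derivative \<phi> (at x) (axis i 1))" for i
    using continuously_diff_SucD(2)[of 0 \<phi> "axis i 1"] by (simp add: axis_in_Basis_iff)
  then show ?thesis unfolding grad_def by (intro continuous_on_vec_lambda) auto
qed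

lemma continuous_on_test_functions: "\<phi> \<in> test_functions S \<Longrightarrow> continuous_on UNIV \<phi>"
  using continuously_diff.simps(1) unfolding test_functions_def by blast

lemma test_functions_support:
  fixes \<phi> :: "real^'n \<Rightarrow> real"
  assumes "\<phi> \<in> test_functions S"
  obtains K where "compact K" "K \<subseteq> S" "\<And>x. x \<notin> K \<Longrightarrow> \<phi> x = 0" "\<And>x. x \<notin> K \<Longrightarrow> grad \<phi> x = 0"
proof -
  obtain K where K: "compact K" "K \<subseteq> S" "\<And>x. x \<notin> K \<Longrightarrow> \<phi> x = 0"
    using assms by (auto simp: test_functions_def)
  have "grad \<phi> x = 0" if "x \<notin> K" for x
  proof (rule grad_eqI)
    have "((\<lambda>x. 0 :: real) has_derivative (\<lambda>h. 0 \<bullet> h)) (at x)" by simp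
    then show "(\<phi> has_derivative (\<lambda>h. 0 \<bullet> h)) (at x)"
      by (rule has_derivative_transform_within_open[where s="- K"])
        (use K that in \<open>auto simp: compact_imp_closed open_Compl\<close>)
  qed
  then show ?thesis using K that by blast
qed

lemma test_functions_bounded:
  fixes \<phi> :: "real^'n \<Rightarrow> real"
  assumes "\<phi> \<in> test_functions S"
  obtains C where "C \<ge> 0" "\<And>x. \<bar>\<phi> x\<bar> \<le> C" "\<And>x. norm (grad \<phi> x) \<le> C"
proof -
  obtain K where K: "compact K" "K \<subseteq> S" "\<And>x. x \<notin> K \<Longrightarrow> \<phi> x = 0" "\<And>x. x \<notin> K \<Longrightarrow> grad \<phi> x = 0"
    using test_functions_support[OF assms] by blast
  have "bounded (\<phi> ` K)" "bounded (grad \<phi> ` K)"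
    using continuous_on_test_functions[OF assms] continuous_on_grad[OF assms] K(1)
    by (auto intro!: compact_imp_bounded compact_continuous_image intro: continuous_on_subset)
  then obtain B1 B2 where B: "\<And>x. x \<in> K \<Longrightarrow> norm (\<phi> x) \<le> B1" "\<And>x. x \<in> K \<Longrightarrow> norm (grad \<phi> x) \<le> B2"
    unfolding bounded_iff by (metis imageI)
  show ?thesis
  proof (rule that[of "max 0 (max B1 B2)"])
    show "\<bar>\<phi> x\<bar> \<le> max 0 (max B1 B2)" "norm (grad \<phi> x) \<le> max 0 (max B1 B2)" for x
      using B[of x] K(3,4)[of x] by (cases "x \<in> K"; force simp: max_def)+
  qed auto
qed

lemma borel_measurable_test_functions:
  "\<phi> \<in> test_functions S \<Longrightarrow> \<phi> \<in> borel_measurable borel"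
  by (rule borel_measurable_continuous_onI[OF continuous_on_test_functions])

lemma borel_measurable_grad:
  fixes \<phi> :: "real^'n \<Rightarrow> real"
  shows "\<phi> \<in> test_functions S \<Longrightarrow> grad \<phi> \<in> borel_measurable borel"
  by (rule borel_measurable_continuous_onI[OF continuous_on_grad])

lemma integrable_bounded_compact_support:
  fixes f :: "'a::euclidean_space \<Rightarrow> 'b::{banach, second_countable_topology}"
  assumes "f \<in> borel_measurable borel" "compact K" "\<And>x. x \<notin> K \<Longrightarrow> f x = 0" "\<And>x. norm (f x) \<le> C"
  shows "integrable lborel f"
proof (rule Bochner_Integration.integrable_bound)
  have "emeasure lborel K < \<infinity>" using assms(2) by (rule emeasure_compact_finite)
  then show "integrable lborel (\<lambda>x. C * indicator K x :: real)"
    using assms(2) by (auto simp: integrable_real_indicator borel_compact)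
  show "AE x in lborel. norm (f x) \<le> norm (C * indicator K x :: real)"
    using assms(3,4) by (intro AE_I2) (auto simp: indicator_def intro: order_trans[OF _ abs_ge_self])
qed (use assms in auto)

lemma test_functions_integrable_powr:
  fixes \<phi> :: "real^'n \<Rightarrow> real"
  assumes \<phi>: "\<phi> \<in> test_functions S" and p: "p \<ge> 0"
  shows "integrable lborel (\<lambda>x. \<bar>\<phi> x\<bar> powr p)" "integrable lborel (\<lambda>x. norm (grad \<phi> x) powr p)"
proof -
  obtain K where K: "compact K" "K \<subseteq> S" "\<And>x. x \<notin> K \<Longrightarrow> \<phi> x = 0" "\<And>x. x \<notin> K \<Longrightarrow> grad \<phi> x = 0"
    using test_functions_support[OF \<phi>] by blast
  obtain C where C: "C \<ge> 0" "\<And>x. \<bar>\<phi> x\<bar> \<le> C" "\<And>x. norm (grad \<phi> x) \<le> C"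
    using test_functions_bounded[OF \<phi>] by blast
  note [measurable] = borel_measurable_test_functions[OF \<phi>] borel_measurable_grad[OF \<phi>]
  show "integrable lborel (\<lambda>x. \<bar>\<phi> x\<bar> powr p)"
    by (rule integrable_bounded_compact_support[OF _ K(1), where C="C powr p"])
      (use K C p in \<open>auto intro: powr_mono2\<close>)
  show "integrable lborel (\<lambda>x. norm (grad \<phi> x) powr p)"
    by (rule integrable_bounded_compact_support[OF _ K(1), where C="C powr p"])
      (use K C p in \<open>auto intro: powr_mono2\<close>)
qed

lemma test_functions_mult:
  "\<phi> \<in> test_functions S \<Longrightarrow> \<zeta> \<in> test_functions S \<Longrightarrow> (\<lambda>x. \<phi> x * \<zeta> x) \<in> test_functions S"
  unfolding test_functions_def by (auto intro: continuously_diff_mult)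

lemma test_functions_diff:
  assumes "\<phi> \<in> test_functions S" "\<zeta> \<in> test_functions S"
  shows "(\<lambda>x. \<phi> x - \<zeta> x) \<in> test_functions S"
proof -
  obtain K L where "compact K" "K \<subseteq> S" "\<forall>x. x \<notin> K \<longrightarrow> \<phi> x = 0" "compact L" "L \<subseteq> S" "\<forall>x. x \<notin> L \<longrightarrow> \<zeta> x = 0"
    using assms by (auto simp: test_functions_def)
  moreover have "continuously_diff k (\<lambda>x. \<phi> x - \<zeta> x)" for k
  proof -
    have "continuously_diff k (\<lambda>x. \<phi> x + (-1) * \<zeta> x)"
      using assms by (intro continuously_diff_add continuously_diff_mult continuously_diff_const)
        (auto simp: test_functions_def)
    then show ?thesis by simp
  qed
  ultimately show ?thesis
    unfolding test_functions_def by (auto intro!: exI[of _ "K \<union> L"])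
qed

lemma test_functions_compose:
  fixes H :: "real \<Rightarrow> real"
  assumes "\<phi> \<in> test_functions S" "\<And>k. continuously_diff k H" "H 0 = 0"
  shows "(\<lambda>x. H (\<phi> x)) \<in> test_functions S"
proof -
  obtain K where "compact K" "K \<subseteq> S" "\<forall>x. x \<notin> K \<longrightarrow> \<phi> x = 0" "\<forall>k. continuously_diff k \<phi>"
    using assms(1) by (auto simp: test_functions_def)
  then show ?thesis
    unfolding test_functions_def using assms(3)
    by (auto intro!: exI[of _ K] continuously_diff_compose[OF assms(2)])
qed

text \<open>The mean value inequality on the whole space, the operator norm of the derivative being
  controlled by the gradient through Cauchy-Schwarz. It supplies the uniform bound on difference
  quotients needed for dominated convergence.\<close>

lemma test_functions_lipschitz:
  fixes \<phi> :: "real^'n \<Rightarrow> real"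
  assumes \<phi>: "\<phi> \<in> test_functions S" and C: "\<And>x. norm (grad \<phi> x) \<le> C"
  shows "\<bar>\<phi> (x + y) - \<phi> x\<bar> \<le> C * norm y"
proof -
  have "norm (\<phi> (x + y) - \<phi> x) \<le> C * norm (x + y - x)"
  proof (rule differentiable_bound[where S=UNIV])
    show "onorm ((\<bullet>) (grad \<phi> z)) \<le> C" for z
    proof (rule onorm_le)
      show "norm (grad \<phi> z \<bullet> h) \<le> C * norm h" for h
        using Cauchy_Schwarz_ineq2[of "grad \<phi> z" h] mult_right_mono[OF C[of z], of "norm h"] by simp
    qed
  qed (use test_functions_has_derivative[OF \<phi>] in auto)
  then show ?thesis by simp
qed

text \<open>Difference quotients in direction \<open>i\<close> have integral zero because Lebesgue
  measure is translation invariant. They converge to the partial derivative and are uniformly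
  bounded with a common bounded support, so the integral of the limit is zero as well.\<close>

lemma test_functions_integral_grad:
  fixes \<phi> :: "real^'n \<Rightarrow> real"
  assumes \<phi>: "\<phi> \<in> test_functions S"
  shows "(\<integral>x. grad \<phi> x $ i \<partial>lborel) = 0"
proof -
  obtain K where K: "compact K" "K \<subseteq> S" "\<And>x. x \<notin> K \<Longrightarrow> \<phi> x = 0" "\<And>x. x \<notin> K \<Longrightarrow> grad \<phi> x = 0"
    using test_functions_support[OF \<phi>] by blast
  obtain C where C: "C \<ge> 0" "\<And>x. \<bar>\<phi> x\<bar> \<le> C" "\<And>x. norm (grad \<phi> x) \<le> C"
    using test_functions_bounded[OF \<phi>] by blast
  note [measurable] = borel_measurable_test_functions[OF \<phi>] borel_measurable_grad[OF \<phi>]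
  obtain R where "\<forall>x\<in>K. norm x \<le> R"
    using compact_imp_bounded[OF K(1)] unfolding bounded_iff by metis
  then have R: "K \<subseteq> cball 0 R" by auto
  define e where "e = (axis i 1 :: real^'n)"
  have e: "norm e = 1" by (simp add: e_def)
  define t where "t n = inverse (real (Suc n))" for n
  have t: "0 < t n" "t n \<le> 1" for n by (auto simp: t_def field_simps)
  have int\<phi>: "integrable lborel \<phi>"
    by (rule integrable_bounded_compact_support[OF _ K(1,3)]) (use C in auto)
  have "(\<lambda>n. \<integral>x. (\<phi> (x + t n *\<^sub>R e) - \<phi> x) / t n \<partial>lborel) \<longlonglongrightarrow> (\<integral>x. grad \<phi> x $ i \<partial>lborel)"
  proof (rule integral_dominated_convergence)
    \<comment> \<open>All steps satisfy \<open>t n \<le> 1\<close>, so the quotients vanish outside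
      the ball of radius \<open>R + 1\<close> when the support of \<phi> lies in the ball of radius
      \<open>R\<close>.\<close>
    show "integrable lborel (\<lambda>x. C * indicator (cball 0 (R + 1) :: (real^'n) set) x :: real)"
      by (auto simp: integrable_real_indicator intro!: emeasure_compact_finite)
    show "AE x in lborel. (\<lambda>n. (\<phi> (x + t n *\<^sub>R e) - \<phi> x) / t n) \<longlonglongrightarrow> grad \<phi> x $ i"
    proof (rule AE_I2)
      fix x
      have "((\<lambda>h. \<phi> (x + h *\<^sub>R e)) has_derivative (\<lambda>h. grad \<phi> x \<bullet> (h *\<^sub>R e))) (at 0)"
        by (rule has_derivative_compose[where g=\<phi> and f="\<lambda>h. x + h *\<^sub>R e" and f'="\<lambda>h. h *\<^sub>R e" and x=0])
          (auto intro!: derivative_eq_intros test_functions_has_derivative[OF \<phi>])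
      then have "((\<lambda>h. \<phi> (x + h *\<^sub>R e)) has_real_derivative grad \<phi> x $ i) (at 0)"
        unfolding has_field_derivative_def
        by (rule has_derivative_eq_rhs) (auto simp: e_def inner_axis fun_eq_iff)
      then have "((\<lambda>h. (\<phi> (x + h *\<^sub>R e) - \<phi> x) / h) \<longlongrightarrow> grad \<phi> x $ i) (at 0)"
        by (simp add: DERIV_def)
      moreover have "filterlim t (at 0) sequentially"
      proof -
        have "t \<longlonglongrightarrow> 0" unfolding t_def[abs_def] by (rule LIMSEQ_inverse_real_of_nat)
        then show ?thesis using t by (auto simp: filterlim_at intro!: always_eventually less_imp_neq[THEN not_sym])
      qed
      ultimately show "(\<lambda>n. (\<phi> (x + t n *\<^sub>R e) - \<phi> x) / t n) \<longlonglongrightarrow> grad \<phi> x $ i"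
        by (rule filterlim_compose)
    qed
    show "AE x in lborel. norm ((\<phi> (x + t n *\<^sub>R e) - \<phi> x) / t n) \<le> C * indicator (cball 0 (R + 1)) x" for n
    proof (rule AE_I2)
      fix x
      show "norm ((\<phi> (x + t n *\<^sub>R e) - \<phi> x) / t n) \<le> C * indicator (cball 0 (R + 1)) x"
      proof (cases "x \<in> cball 0 (R + 1)")
        case True
        then show ?thesis
          using test_functions_lipschitz[OF \<phi> C(3), of x "t n *\<^sub>R e"] t[of n] e
          by (simp add: divide_le_eq)
      next
        case False
        have "norm x \<le> norm (x + t n *\<^sub>R e) + norm (t n *\<^sub>R e)"
          using norm_triangle_ineq4[of "x + t n *\<^sub>R e" "t n *\<^sub>R e"] by simp
        then have "norm (x + t n *\<^sub>R e) > R" using False t[of n] e by simp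
        then have "x + t n *\<^sub>R e \<notin> K" "x \<notin> K" using False R by auto
        then show ?thesis using K(3) False by simp
      qed
    qed
  qed auto
  moreover have "(\<integral>x. (\<phi> (x + t n *\<^sub>R e) - \<phi> x) / t n \<partial>lborel) = 0" for n
    using int\<phi> integrable_lborel_translation[OF int\<phi>, of "t n *\<^sub>R e"]
      integral_lborel_translation[of \<phi> "t n *\<^sub>R e"] by simp
  ultimately have "(\<lambda>n. 0) \<longlonglongrightarrow> (\<integral>x. grad \<phi> x $ i \<partial>lborel)" by (simp only:)
  then show ?thesis by (simp add: LIMSEQ_const_iff)
qed

text \<open>The product of the two test functions is again a test function, so the integral of its
  gradient vanishes; the product rule splits that integral into the two sides.\<close>

lemma test_functions_integration_by_parts:
  fixes \<phi> :: "real^'n \<Rightarrow> real"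
  assumes \<phi>: "\<phi> \<in> test_functions S" and \<zeta>: "\<zeta> \<in> test_functions S"
  shows "(\<integral>x. \<phi> x * grad \<zeta> x $ i \<partial>lborel) = - (\<integral>x. grad \<phi> x $ i * \<zeta> x \<partial>lborel)"
proof -
  have g: "grad (\<lambda>x. \<phi> x * \<zeta> x) x = \<phi> x *\<^sub>R grad \<zeta> x + \<zeta> x *\<^sub>R grad \<phi> x" for x
    by (rule grad_eqI, rule has_derivative_eq_rhs,
        rule has_derivative_mult[OF test_functions_has_derivative[OF \<phi>] test_functions_has_derivative[OF \<zeta>]])
      (auto simp: fun_eq_iff inner_add_left)
  obtain K where K: "compact K" "K \<subseteq> S" "\<And>x. x \<notin> K \<Longrightarrow> \<phi> x = 0" "\<And>x. x \<notin> K \<Longrightarrow> grad \<phi> x = 0"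
    using test_functions_support[OF \<phi>] by blast
  obtain C where C: "C \<ge> 0" "\<And>x. \<bar>\<phi> x\<bar> \<le> C" "\<And>x. norm (grad \<phi> x) \<le> C"
    using test_functions_bounded[OF \<phi>] by blast
  obtain D where D: "D \<ge> 0" "\<And>x. \<bar>\<zeta> x\<bar> \<le> D" "\<And>x. norm (grad \<zeta> x) \<le> D"
    using test_functions_bounded[OF \<zeta>] by blast
  note [measurable] = borel_measurable_test_functions[OF \<phi>] borel_measurable_grad[OF \<phi>]
    borel_measurable_test_functions[OF \<zeta>] borel_measurable_grad[OF \<zeta>]
  have i1: "integrable lborel (\<lambda>x. \<phi> x * grad \<zeta> x $ i)"
    by (rule integrable_bounded_compact_support[OF _ K(1), where C="C * D"])
      (use K C D order_trans[OF component_le_norm_cart D(3)] in \<open>auto simp: abs_mult intro!: mult_mono\<close>)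
  have i2: "integrable lborel (\<lambda>x. grad \<phi> x $ i * \<zeta> x)"
    by (rule integrable_bounded_compact_support[OF _ K(1), where C="C * D"])
      (use K C D order_trans[OF component_le_norm_cart C(3)] in \<open>auto simp: abs_mult intro!: mult_mono\<close>)
  have "(\<integral>x. \<phi> x * grad \<zeta> x $ i + grad \<phi> x $ i * \<zeta> x \<partial>lborel) = 0"
    using test_functions_integral_grad[OF test_functions_mult[OF \<phi> \<zeta>], of i] by (simp add: g mult.commute)
  then show ?thesis using i1 i2 by simp
qed

lemma test_functions_outside:
  fixes \<phi> :: "real^'n \<Rightarrow> real"
  assumes "\<phi> \<in> test_functions S" "x \<notin> S"
  shows "\<phi> x = 0" "grad \<phi> x = 0"
proof -
  obtain K where K: "compact K" "K \<subseteq> S" "\<And>x. x \<notin> K \<Longrightarrow> \<phi> x = 0" "\<And>x. x \<notin> K \<Longrightarrow> grad \<phi> x = 0"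
    using test_functions_support[OF assms(1)] by blast
  have "x \<notin> K" using K(2) assms(2) by auto
  then show "\<phi> x = 0" "grad \<phi> x = 0" by (auto intro: K(3,4))
qed

section \<open>Lebesgue spaces\<close>

lemma integrable_mult_bounded:
  fixes u h :: "'a \<Rightarrow> real"
  assumes u: "integrable M u" and h: "h \<in> borel_measurable M" and C: "\<And>x. \<bar>h x\<bar> \<le> C"
  shows "integrable M (\<lambda>x. u x * h x)"
proof (rule Bochner_Integration.integrable_bound)
  show "integrable M (\<lambda>x. C * u x)" using u by simp
  have "\<bar>u x\<bar> * \<bar>h x\<bar> \<le> \<bar>C\<bar> * \<bar>u x\<bar>" for x
    using mult_left_mono[OF order_trans[OF C abs_ge_self], of "\<bar>u x\<bar>" x] by (simp only: mult.commute abs_ge_zero)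
  then show "AE x in M. norm (u x * h x) \<le> norm (C * u x)" by (simp add: abs_mult)
qed (use u h in auto)

text \<open>Young's inequality with a free parameter: a small additive constant \<eta> is traded for
  a large factor on the p-th power. On sets of finite measure it yields the passage from L^p to L^1
  that Hoelder's inequality would give.\<close>

lemma le_add_powr:
  fixes x :: real
  assumes "p > 1" "\<eta> > 0" "x \<ge> 0"
  shows "x \<le> \<eta> + \<eta> powr (1 - p) * x powr p"
proof -
  have "\<eta> powr (p - 1) * x \<le> (1 - 1 / p) * \<eta> powr p + x powr p / p"
    using assms by (intro powr_conj_mult_le) auto
  also have "\<dots> \<le> 1 * \<eta> powr p + x powr p"
    using assms by (intro add_mono mult_right_mono) (auto simp: divide_le_eq mult_le_cancel_left1)
  finally have "\<eta> powr (1 - p) * (\<eta> powr (p - 1) * x) \<le> \<eta> powr (1 - p) * (1 * \<eta> powr p + x powr p)"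
    by (intro mult_left_mono) auto
  moreover have "\<eta> powr (1 - p) * \<eta> powr (p - 1) = 1" "\<eta> powr (1 - p) * \<eta> powr p = \<eta>"
    using assms by (auto simp: powr_add[symmetric])
  ultimately show ?thesis by (simp add: distrib_left mult.assoc[symmetric])
qed

lemma le_one_add_powr:
  fixes x :: real
  assumes "p > 1" "x \<ge> 0"
  shows "x \<le> 1 + x powr p"
  using le_add_powr[of p 1 x] assms by simp

lemma integrable_norm_powr_imp_integrable:
  fixes f :: "'a::euclidean_space \<Rightarrow> 'b::euclidean_space"
  assumes p: "p > 1" and f[measurable]: "f \<in> borel_measurable borel" and S[measurable]: "S \<in> sets borel"
    and fin: "emeasure lborel S < \<infinity>" and zero: "\<And>x. x \<notin> S \<Longrightarrow> f x = 0"
    and int: "integrable lborel (\<lambda>x. norm (f x) powr p)"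
  shows "integrable lborel f"
proof (rule Bochner_Integration.integrable_bound)
  show "integrable lborel (\<lambda>x. indicator S x + norm (f x) powr p)"
    using int fin by (auto simp: integrable_real_indicator)
  show "AE x in lborel. norm (f x) \<le> norm (indicator S x + norm (f x) powr p)"
    using le_one_add_powr[OF p, of "norm (f _)"] zero by (intro AE_I2) (auto simp: indicator_def)
qed auto

lemma L1_le_of_powr:
  fixes f :: "'a::euclidean_space \<Rightarrow> 'b::euclidean_space"
  assumes p: "p > 1" and f[measurable]: "f \<in> borel_measurable borel" and S[measurable]: "S \<in> sets borel"
    and fin: "emeasure lborel S < \<infinity>" and zero: "\<And>x. x \<notin> S \<Longrightarrow> f x = 0"
    and int: "integrable lborel (\<lambda>x. norm (f x) powr p)" and \<eta>: "\<eta> > 0"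
  shows "(\<integral>x. norm (f x) \<partial>lborel) \<le> \<eta> * measure lborel S + \<eta> powr (1 - p) * (\<integral>x. norm (f x) powr p \<partial>lborel)"
proof -
  have iS: "integrable lborel (\<lambda>x. indicator S x :: real)" using fin by (auto simp: integrable_real_indicator)
  have "(\<integral>x. norm (f x) \<partial>lborel) \<le> (\<integral>x. \<eta> * indicator S x + \<eta> powr (1 - p) * norm (f x) powr p \<partial>lborel)"
  proof (rule integral_mono)
    show "integrable lborel (\<lambda>x. norm (f x))"
      using integrable_norm_powr_imp_integrable[OF p f S fin zero int] by simp
    show "norm (f x) \<le> \<eta> * indicator S x + \<eta> powr (1 - p) * norm (f x) powr p" for x
      using le_add_powr[OF p \<eta>, of "norm (f x)"] zero[of x] by (auto simp: indicator_def)
  qed (use iS int in auto)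
  also have "\<dots> = \<eta> * measure lborel S + \<eta> powr (1 - p) * (\<integral>x. norm (f x) powr p \<partial>lborel)"
    using iS int by simp
  finally show ?thesis .
qed

text \<open>First \<eta> is fixed so small that its contribution over \<open>S\<close> is at most
  \<open>e/2\<close>; the remaining term is a fixed multiple of the p-th power integral, which tends
  to zero.\<close>

lemma L1_tendsto_of_powr:
  fixes f :: "nat \<Rightarrow> 'a::euclidean_space \<Rightarrow> 'b::euclidean_space"
  assumes p: "p > 1" and f: "\<And>k. f k \<in> borel_measurable borel" and S: "S \<in> sets borel"
    and fin: "emeasure lborel S < \<infinity>" and zero: "\<And>k x. x \<notin> S \<Longrightarrow> f k x = 0"
    and int: "\<And>k. integrable lborel (\<lambda>x. norm (f k x) powr p)"
    and lim: "(\<lambda>k. \<integral>x. norm (f k x) powr p \<partial>lborel) \<longlonglongrightarrow> 0"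
  shows "(\<lambda>k. \<integral>x. norm (f k x) \<partial>lborel) \<longlonglongrightarrow> 0"
proof (rule order_tendstoI)
  fix e :: real assume e: "0 < e"
  \<comment> \<open>Adding 1 to the measure keeps the quotient meaningful when \<open>S\<close> is a
    null set.\<close>
  define \<eta> where "\<eta> = e / (2 * (measure lborel S + 1))"
  have \<eta>: "\<eta> > 0" using e by (simp add: \<eta>_def add_nonneg_pos)
  have "\<eta> * measure lborel S \<le> \<eta> * (measure lborel S + 1)" using \<eta> by simp
  also have "\<dots> = e / 2" using measure_nonneg[of lborel S] unfolding \<eta>_def
    by (simp only: times_divide_eq_left times_divide_eq_right mult_divide_mult_cancel_right)
  finally have \<eta>2: "\<eta> * measure lborel S \<le> e / 2" .
  have "(\<lambda>k. \<eta> powr (1 - p) * (\<integral>x. norm (f k x) powr p \<partial>lborel)) \<longlonglongrightarrow> \<eta> powr (1 - p) * 0"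
    by (intro tendsto_intros lim)
  then have "eventually (\<lambda>k. \<eta> powr (1 - p) * (\<integral>x. norm (f k x) powr p \<partial>lborel) < e / 2) sequentially"
    using e by (intro order_tendstoD(2)) auto
  then show "eventually (\<lambda>k. (\<integral>x. norm (f k x) \<partial>lborel) < e) sequentially"
  proof eventually_elim
    case (elim k)
    then show ?case using L1_le_of_powr[OF p f S fin zero int \<eta>, of k] \<eta>2 by fastforce
  qed
next
  fix e :: real assume "e < 0"
  then show "eventually (\<lambda>k. e < (\<integral>x. norm (f k x) \<partial>lborel)) sequentially"
    by (intro always_eventually) (auto intro: less_le_trans Bochner_Integration.integral_nonneg)
qed

section \<open>Passage between Lebesgue measure on a set and the Borel measure on the whole
  space\<close>

lemma AE_lebesgue_on_iff:
  assumes "S \<in> sets borel"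
  shows "(AE x in lebesgue_on S. P x) \<longleftrightarrow> (AE x in lborel. x \<in> S \<longrightarrow> P x)"
  using assms by (simp add: AE_restrict_space_iff AE_completion_iff)

lemma integrable_lebesgue_on_iff:
  fixes f :: "'a::euclidean_space \<Rightarrow> 'b::euclidean_space"
  assumes [measurable]: "f \<in> borel_measurable borel" "S \<in> sets borel"
  shows "integrable (lebesgue_on S) f \<longleftrightarrow> integrable lborel (\<lambda>x. indicator S x *\<^sub>R f x)"
  by (simp add: integrable_restrict_space integrable_completion)

lemma integral_lebesgue_on_eq:
  fixes f :: "'a::euclidean_space \<Rightarrow> 'b::euclidean_space"
  assumes [measurable]: "f \<in> borel_measurable borel" "S \<in> sets borel"
  shows "integral\<^sup>L (lebesgue_on S) f = integral\<^sup>L lborel (\<lambda>x. indicator S x *\<^sub>R f x)"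
  by (simp add: integral_restrict_space integral_completion)

lemma integral_lebesgue_on_eq_lborel:
  fixes f :: "'a::euclidean_space \<Rightarrow> 'b::euclidean_space"
  assumes "f \<in> borel_measurable borel" "S \<in> sets borel" "\<And>x. x \<notin> S \<Longrightarrow> f x = 0"
  shows "integral\<^sup>L (lebesgue_on S) f = integral\<^sup>L lborel f"
  unfolding integral_lebesgue_on_eq[OF assms(1,2)]
  using assms(3) by (intro Bochner_Integration.integral_cong) (auto simp: indicator_def)

lemma integrable_lebesgue_on_iff_lborel:
  fixes f :: "'a::euclidean_space \<Rightarrow> 'b::euclidean_space"
  assumes "f \<in> borel_measurable borel" "S \<in> sets borel" "\<And>x. x \<notin> S \<Longrightarrow> f x = 0"
  shows "integrable (lebesgue_on S) f \<longleftrightarrow> integrable lborel f"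
  unfolding integrable_lebesgue_on_iff[OF assms(1,2)]
  using assms(3) by (intro Bochner_Integration.integrable_cong) (auto simp: indicator_def)

lemma borel_measurable_lebesgue_onI:
  "f \<in> borel_measurable borel \<Longrightarrow> f \<in> borel_measurable (lebesgue_on S)"
  by (intro measurable_restrict_space1 measurable_completion) simp

text \<open>Every real Lebesgue measurable function equals a Borel function almost everywhere; this
  is applied to each coordinate, and the pieces are reassembled and set to zero outside
  \<open>S\<close>. Borel representatives are wanted because slices and Fubini arguments work
  directly with them on the product space.\<close>

lemma lebesgue_on_borel_representative:
  fixes f :: "'a::euclidean_space \<Rightarrow> 'b::euclidean_space"
  assumes f: "f \<in> borel_measurable (lebesgue_on S)" and S[measurable]: "S \<in> sets borel"
  obtains f' where "f' \<in> borel_measurable borel" "\<And>x. x \<notin> S \<Longrightarrow> f' x = 0" "AE x in lebesgue_on S. f x = f' x"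
proof -
  define f0 where "f0 x = (if x \<in> S then f x else 0)" for x
  have f0: "f0 \<in> borel_measurable lebesgue"
    unfolding f0_def using f S by (intro borel_measurable_if_I) auto
  have "\<exists>g\<in>borel_measurable lborel. (AE x in lborel. f0 x \<bullet> b = g x)" for b
    using f0 by (intro completion_ex_borel_measurable_real) auto
  then obtain g where g: "\<And>b. g b \<in> borel_measurable lborel" "\<And>b. AE x in lborel. f0 x \<bullet> b = g b x"
    by metis
  define f' where "f' x = indicator S x *\<^sub>R (\<Sum>b\<in>Basis. g b x *\<^sub>R b)" for x
  have [measurable]: "g b \<in> borel_measurable borel" for b using g(1)[of b] by simp
  have m: "f' \<in> borel_measurable borel" unfolding f'_def by measurable
  have "AE x in lborel. \<forall>b\<in>Basis. f0 x \<bullet> b = g b x"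
    using g(2) by (subst AE_ball_countable) (auto intro: countable_finite)
  then have "AE x in lborel. x \<in> S \<longrightarrow> f x = f' x"
  proof eventually_elim
    case (elim x)
    show ?case
    proof
      assume x: "x \<in> S"
      have "f x = (\<Sum>b\<in>Basis. (f0 x \<bullet> b) *\<^sub>R b)" using x by (simp add: f0_def euclidean_representation)
      also have "\<dots> = f' x" using x elim by (simp add: f'_def)
      finally show "f x = f' x" .
    qed
  qed
  then have "AE x in lebesgue_on S. f x = f' x" by (simp add: AE_lebesgue_on_iff)
  moreover have "f' x = 0" if "x \<notin> S" for x using that by (simp add: f'_def)
  ultimately show ?thesis using m that by blast
qed

text \<open>Completeness of Lebesgue measure: changing a function on a null set preserves
  measurability.\<close>

lemma borel_measurable_lebesgue_on_cong_AE:
  fixes f g :: "'a::euclidean_space \<Rightarrow> 'b::euclidean_space"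
  assumes f: "f \<in> borel_measurable (lebesgue_on S)" and S: "S \<in> sets borel"
    and eq: "AE x in lebesgue_on S. f x = g x"
  shows "g \<in> borel_measurable (lebesgue_on S)"
proof -
  have S': "S \<in> sets lebesgue" using S by simp
  have "(\<lambda>x. if x \<in> S then g x else 0) \<in> borel_measurable lebesgue"
  proof (rule borel_measurable_AE)
    show "(\<lambda>x. if x \<in> S then f x else 0) \<in> borel_measurable lebesgue"
      using f S' by (rule borel_measurable_if_I)
    have "AE x in lebesgue. x \<in> S \<longrightarrow> f x = g x"
      using eq S by (simp add: AE_restrict_space_iff)
    then show "AE x in lebesgue. (if x \<in> S then f x else 0) = (if x \<in> S then g x else 0)"
      by eventually_elim auto
  qed
  then show ?thesis using S' by (simp add: borel_measurable_if)
qed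

section \<open>Sobolev functions and their gradients\<close>

text \<open>\<open>W0_pair p \<Omega> f g\<close> is \<open>f \<in> W0_1p \<Omega> p\<close> with gradient \<open>g\<close> for Borel representatives that vanish
  outside \<open>\<Omega>\<close>, so that all integrals may be taken with respect to \<open>lborel\<close>.\<close>

definition W0_pair :: "real \<Rightarrow> (real^'n) set \<Rightarrow> (real^'n \<Rightarrow> real) \<Rightarrow> (real^'n \<Rightarrow> real^'n) \<Rightarrow> bool" where
  "W0_pair p \<Omega> f g \<longleftrightarrow>
     f \<in> borel_measurable borel \<and> g \<in> borel_measurable borel \<and>
     (\<forall>x. x \<notin> \<Omega> \<longrightarrow> f x = 0 \<and> g x = 0) \<and>
     integrable lborel (\<lambda>x. \<bar>f x\<bar> powr p) \<and> integrable lborel (\<lambda>x. norm (g x) powr p) \<and>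
     (\<exists>\<phi>. (\<forall>k::nat. \<phi> k \<in> test_functions \<Omega>) \<and>
        (\<lambda>k. \<integral>x. \<bar>\<phi> k x - f x\<bar> powr p \<partial>lborel) \<longlonglongrightarrow> 0 \<and>
        (\<lambda>k. \<integral>x. norm (grad (\<phi> k) x - g x) powr p \<partial>lborel) \<longlonglongrightarrow> 0)"

lemma W0_pairE:
  fixes f :: "real^'n \<Rightarrow> real"
  assumes "W0_pair p \<Omega> f g" "p > 0"
  obtains \<phi> where "f \<in> borel_measurable borel" "g \<in> borel_measurable borel"
    "\<And>x. x \<notin> \<Omega> \<Longrightarrow> f x = 0" "\<And>x. x \<notin> \<Omega> \<Longrightarrow> g x = 0"
    "integrable lborel (\<lambda>x. \<bar>f x\<bar> powr p)" "integrable lborel (\<lambda>x. norm (g x) powr p)"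
    "\<And>k::nat. \<phi> k \<in> test_functions \<Omega>"
    "\<And>k. \<phi> k \<in> borel_measurable borel" "\<And>k. grad (\<phi> k) \<in> borel_measurable borel"
    "\<And>k x. x \<notin> \<Omega> \<Longrightarrow> \<phi> k x = 0" "\<And>k x. x \<notin> \<Omega> \<Longrightarrow> grad (\<phi> k) x = 0"
    "(\<lambda>k. \<integral>x. \<bar>\<phi> k x - f x\<bar> powr p \<partial>lborel) \<longlonglongrightarrow> 0"
    "(\<lambda>k. \<integral>x. norm (grad (\<phi> k) x - g x) powr p \<partial>lborel) \<longlonglongrightarrow> 0"
    "\<And>k. integrable lborel (\<lambda>x. \<bar>\<phi> k x - f x\<bar> powr p)"
    "\<And>k. integrable lborel (\<lambda>x. norm (grad (\<phi> k) x - g x) powr p)"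
proof -
  from assms(1) obtain \<phi> where fg:
    "f \<in> borel_measurable borel" "g \<in> borel_measurable borel"
    "\<And>x. x \<notin> \<Omega> \<Longrightarrow> f x = 0" "\<And>x. x \<notin> \<Omega> \<Longrightarrow> g x = 0"
    "integrable lborel (\<lambda>x. \<bar>f x\<bar> powr p)" "integrable lborel (\<lambda>x. norm (g x) powr p)" and
    \<phi>: "\<And>k::nat. \<phi> k \<in> test_functions \<Omega>"
    "(\<lambda>k. \<integral>x. \<bar>\<phi> k x - f x\<bar> powr p \<partial>lborel) \<longlonglongrightarrow> 0"
    "(\<lambda>k. \<integral>x. norm (grad (\<phi> k) x - g x) powr p \<partial>lborel) \<longlonglongrightarrow> 0"
    unfolding W0_pair_def by blast
  note m[measurable] = fg(1,2) borel_measurable_test_functions[OF \<phi>(1)] borel_measurable_grad[OF \<phi>(1)]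
  have i1: "integrable lborel (\<lambda>x. \<bar>\<phi> k x - f x\<bar> powr p)" for k
  proof (rule Bochner_Integration.integrable_bound)
    show "integrable lborel (\<lambda>x. 2 powr p * (\<bar>\<phi> k x\<bar> powr p + \<bar>f x\<bar> powr p))"
      using fg(5) test_functions_integrable_powr(1)[OF \<phi>(1)] assms(2) by auto
    show "AE x in lborel. norm (\<bar>\<phi> k x - f x\<bar> powr p) \<le> norm (2 powr p * (\<bar>\<phi> k x\<bar> powr p + \<bar>f x\<bar> powr p))"
      using norm_diff_powr_le[of p "\<phi> k _" "f _"] assms(2) by (intro AE_I2) auto
  qed auto
  have i2: "integrable lborel (\<lambda>x. norm (grad (\<phi> k) x - g x) powr p)" for k
  proof (rule Bochner_Integration.integrable_bound)
    show "integrable lborel (\<lambda>x. 2 powr p * (norm (grad (\<phi> k) x) powr p + norm (g x) powr p))"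
      using fg(6) test_functions_integrable_powr(2)[OF \<phi>(1)] assms(2) by auto
    show "AE x in lborel. norm (norm (grad (\<phi> k) x - g x) powr p) \<le> norm (2 powr p * (norm (grad (\<phi> k) x) powr p + norm (g x) powr p))"
      using norm_diff_powr_le[of p "grad (\<phi> k) _" "g _"] assms(2) by (intro AE_I2) auto
  qed auto
  have z: "\<phi> k x = 0" "grad (\<phi> k) x = 0" if "x \<notin> \<Omega>" for k x
    by (rule test_functions_outside[OF \<phi>(1)[of k] that])+
  show ?thesis by (rule that[OF fg \<phi>(1) m(3,4) z \<phi>(2,3) i1 i2])
qed

text \<open>Integration by parts holds for the approximating test functions and passes to the limit:
  on a bounded domain convergence in L^p implies convergence in L^1, and the multipliers, a test
  function and its gradient, are bounded.\<close>

lemma W0_pair_weak_gradient: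
  fixes f :: "real^'n \<Rightarrow> real"
  assumes W: "W0_pair p \<Omega> f g" and p: "p > 1" and \<Omega>: "open \<Omega>" "bounded \<Omega>"
  shows "weak_gradient \<Omega> f g"
proof -
  have p0: "p > 0" using p by simp
  obtain \<phi> where fg[measurable]: "f \<in> borel_measurable borel" "g \<in> borel_measurable borel" and
    fg0: "\<And>x. x \<notin> \<Omega> \<Longrightarrow> f x = 0" "\<And>x. x \<notin> \<Omega> \<Longrightarrow> g x = 0" and
    fgi: "integrable lborel (\<lambda>x. \<bar>f x\<bar> powr p)" "integrable lborel (\<lambda>x. norm (g x) powr p)" and
    \<phi>: "\<And>k::nat. \<phi> k \<in> test_functions \<Omega>" and
    \<phi>m[measurable]: "\<And>k. \<phi> k \<in> borel_measurable borel" "\<And>k. grad (\<phi> k) \<in> borel_measurable borel" and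
    \<phi>0: "\<And>k x. x \<notin> \<Omega> \<Longrightarrow> \<phi> k x = 0" "\<And>k x. x \<notin> \<Omega> \<Longrightarrow> grad (\<phi> k) x = 0" and
    \<phi>l: "(\<lambda>k. \<integral>x. \<bar>\<phi> k x - f x\<bar> powr p \<partial>lborel) \<longlonglongrightarrow> 0"
    "(\<lambda>k. \<integral>x. norm (grad (\<phi> k) x - g x) powr p \<partial>lborel) \<longlonglongrightarrow> 0" and
    \<phi>i: "\<And>k. integrable lborel (\<lambda>x. \<bar>\<phi> k x - f x\<bar> powr p)"
    "\<And>k. integrable lborel (\<lambda>x. norm (grad (\<phi> k) x - g x) powr p)"
    proof (rule W0_pairE[OF W p0], goal_cases)
    case (1 \<phi>)
    show thesis by (rule that[OF 1(2-)])
  qed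
  have \<Omega>b[measurable]: "\<Omega> \<in> sets borel" using \<Omega> by simp
  have fin: "emeasure lborel \<Omega> < \<infinity>" by (rule emeasure_bounded_finite[OF \<Omega>(2)])
  have f1: "integrable lborel f"
    by (rule integrable_norm_powr_imp_integrable[OF p fg(1) \<Omega>b fin fg0(1)]) (use fgi in auto)
  have g1: "integrable lborel g"
    by (rule integrable_norm_powr_imp_integrable[OF p fg(2) \<Omega>b fin fg0(2)]) (use fgi in auto)
  have L1: "(\<lambda>k. \<integral>x. norm (\<phi> k x - f x) \<partial>lborel) \<longlonglongrightarrow> 0"
    by (rule L1_tendsto_of_powr[OF p _ \<Omega>b fin]) (use \<phi>0 fg0 \<phi>l \<phi>i in auto)
  have L2: "(\<lambda>k. \<integral>x. norm (grad (\<phi> k) x - g x) \<partial>lborel) \<longlonglongrightarrow> 0"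
    by (rule L1_tendsto_of_powr[OF p _ \<Omega>b fin]) (use \<phi>0 fg0 \<phi>l \<phi>i in auto)
  have I1: "integrable lborel (\<lambda>x. \<phi> k x - f x)" for k
    by (rule integrable_norm_powr_imp_integrable[OF p _ \<Omega>b fin]) (use \<phi>0 fg0 \<phi>i in auto)
  have I2: "integrable lborel (\<lambda>x. grad (\<phi> k) x - g x)" for k
    by (rule integrable_norm_powr_imp_integrable[OF p _ \<Omega>b fin]) (use \<phi>0 fg0 \<phi>i in auto)
  \<comment> \<open>Convergence in L^1 allows passing to the limit in integrals against a fixed
    bounded measurable function. It is used once for the functions and once for each gradient
    component.\<close>
  have key: "(\<lambda>k. \<integral>x. F k x * h x \<partial>lborel) \<longlonglongrightarrow> (\<integral>x. F0 x * h x \<partial>lborel)"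
    if F: "\<And>k. integrable lborel (\<lambda>x. F k x - F0 x)" and F0: "integrable lborel F0"
      and lim: "(\<lambda>k. \<integral>x. norm (F k x - F0 x) \<partial>lborel) \<longlonglongrightarrow> 0"
      and h[measurable]: "h \<in> borel_measurable borel" and hC: "\<And>x. \<bar>h x\<bar> \<le> C"
    for F :: "nat \<Rightarrow> real^'n \<Rightarrow> real" and F0 h :: "real^'n \<Rightarrow> real" and C :: real
  proof -
    have FF: "integrable lborel (F k)" for k
      using Bochner_Integration.integrable_add[OF F[of k] F0] by simp
    have [measurable]: "F k \<in> borel_measurable borel" "F0 \<in> borel_measurable borel" for k
      using FF F0 by auto
    have ih: "integrable lborel (\<lambda>x. u x * h x)" if "integrable lborel u" for u
      by (rule integrable_mult_bounded[OF that _ hC]) simp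
    have "(\<lambda>k. (\<integral>x. F k x * h x \<partial>lborel) - (\<integral>x. F0 x * h x \<partial>lborel)) \<longlonglongrightarrow> 0"
    proof (rule Lim_null_comparison)
      show "\<forall>\<^sub>F k in sequentially. norm ((\<integral>x. F k x * h x \<partial>lborel) - (\<integral>x. F0 x * h x \<partial>lborel)) \<le>
          C * (\<integral>x. norm (F k x - F0 x) \<partial>lborel)"
      proof (intro always_eventually allI)
        fix k
        have "norm ((\<integral>x. F k x * h x \<partial>lborel) - (\<integral>x. F0 x * h x \<partial>lborel)) =
          norm (\<integral>x. (F k x - F0 x) * h x \<partial>lborel)"
          using ih[OF FF] ih[OF F0] by (simp add: left_diff_distrib)
        also have "\<dots> \<le> (\<integral>x. norm ((F k x - F0 x) * h x) \<partial>lborel)"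
          by (rule integral_norm_bound)
        also have "\<dots> \<le> (\<integral>x. C * norm (F k x - F0 x) \<partial>lborel)"
        proof (rule integral_mono)
          show "norm ((F k x - F0 x) * h x) \<le> C * norm (F k x - F0 x)" for x
            using mult_right_mono[OF hC[of x], of "\<bar>F k x - F0 x\<bar>"] by (simp add: abs_mult mult.commute)
        qed (use ih[OF F] F in auto)
        finally show "norm ((\<integral>x. F k x * h x \<partial>lborel) - (\<integral>x. F0 x * h x \<partial>lborel)) \<le>
          C * (\<integral>x. norm (F k x - F0 x) \<partial>lborel)" by simp
      qed
      show "(\<lambda>k. C * (\<integral>x. norm (F k x - F0 x) \<partial>lborel)) \<longlonglongrightarrow> 0"
        using tendsto_mult_left[OF lim, of C] by simp
    qed
    then show ?thesis by (rule LIM_zero_cancel)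
  qed
  show ?thesis unfolding weak_gradient_def
  proof (intro conjI allI impI ballI)
    fix K :: "(real^'n) set" assume "compact K \<and> K \<subseteq> \<Omega>"
    then have [measurable]: "K \<in> sets borel" by (auto intro: borel_compact)
    show "integrable (lebesgue_on K) f" "integrable (lebesgue_on K) g"
      unfolding integrable_lebesgue_on_iff[OF fg(1) \<open>K \<in> sets borel\<close>] integrable_lebesgue_on_iff[OF fg(2) \<open>K \<in> sets borel\<close>]
      by (intro integrable_mult_indicator f1 g1; simp)+
  next
    fix \<zeta> :: "real^'n \<Rightarrow> real" and i assume \<zeta>: "\<zeta> \<in> test_functions \<Omega>"
    note [measurable] = borel_measurable_test_functions[OF \<zeta>] borel_measurable_grad[OF \<zeta>]
    obtain C where C: "C \<ge> 0" "\<And>x. \<bar>\<zeta> x\<bar> \<le> C" "\<And>x. norm (grad \<zeta> x) \<le> C"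
      using test_functions_bounded[OF \<zeta>] by blast
    have "(\<lambda>k. \<integral>x. \<phi> k x * grad \<zeta> x $ i \<partial>lborel) \<longlonglongrightarrow> (\<integral>x. f x * grad \<zeta> x $ i \<partial>lborel)"
      by (rule key[OF I1 f1 L1, where C=C]) (use order_trans[OF component_le_norm_cart C(3)] in auto)
    moreover have "(\<lambda>k. \<integral>x. grad (\<phi> k) x $ i * \<zeta> x \<partial>lborel) \<longlonglongrightarrow> (\<integral>x. g x $ i * \<zeta> x \<partial>lborel)"
    proof (rule key[where C=C])
      have bl: "bounded_linear (\<lambda>x::real^'n. x $ i)" by (rule bounded_linear_vec_nth)
      have 1: "integrable lborel (\<lambda>x. (grad (\<phi> k) x - g x) $ i)" for k
        by (rule integrable_bounded_linear[OF bl I2])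
      then show "integrable lborel (\<lambda>x. grad (\<phi> k) x $ i - g x $ i)" for k by simp
      show "integrable lborel (\<lambda>x. g x $ i)" by (rule integrable_bounded_linear[OF bl g1])
      show "(\<lambda>k. \<integral>x. norm (grad (\<phi> k) x $ i - g x $ i) \<partial>lborel) \<longlonglongrightarrow> 0"
      proof (rule tendsto_sandwich[OF _ _ tendsto_const L2])
        show "\<forall>\<^sub>F k in sequentially. (\<integral>x. norm (grad (\<phi> k) x $ i - g x $ i) \<partial>lborel) \<le> (\<integral>x. norm (grad (\<phi> k) x - g x) \<partial>lborel)"
          using 1 I2 component_le_norm_cart[of "grad (\<phi> _) _ - g _" i]
          by (intro always_eventually allI integral_mono) auto
      qed (auto intro!: always_eventually)
    qed (use C in auto)
    ultimately have "(\<integral>x. f x * grad \<zeta> x $ i \<partial>lborel) = - (\<integral>x. g x $ i * \<zeta> x \<partial>lborel)"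
      unfolding test_functions_integration_by_parts[OF \<phi> \<zeta>]
      using LIMSEQ_unique tendsto_minus by blast
    moreover have "(\<integral>x. f x * grad \<zeta> x $ i \<partial>lebesgue_on \<Omega>) = (\<integral>x. f x * grad \<zeta> x $ i \<partial>lborel)"
      by (rule integral_lebesgue_on_eq_lborel) (use fg0 in auto)
    moreover have "(\<integral>x. g x $ i * \<zeta> x \<partial>lebesgue_on \<Omega>) = (\<integral>x. g x $ i * \<zeta> x \<partial>lborel)"
      by (rule integral_lebesgue_on_eq_lborel) (use fg0 in auto)
    ultimately show "(\<integral>x. f x * grad \<zeta> x $ i \<partial>lebesgue_on \<Omega>) = - (\<integral>x. g x $ i * \<zeta> x \<partial>lebesgue_on \<Omega>)"
      by (simp only:)
  qed
qed

lemma tendsto_Lp_norm_zero_iff: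
  assumes "p > 0"
  shows "((\<lambda>k. Lp_norm p M (f k)) \<longlongrightarrow> 0) F \<longleftrightarrow> ((\<lambda>k. \<integral>x. norm (f k x) powr p \<partial>M) \<longlongrightarrow> 0) F"
proof
  assume "((\<lambda>k. Lp_norm p M (f k)) \<longlongrightarrow> 0) F"
  then have "((\<lambda>k. Lp_norm p M (f k) powr p) \<longlongrightarrow> 0 powr p) F"
    using assms by (intro tendsto_powr' tendsto_intros) (auto simp: Lp_norm_def)
  moreover have "Lp_norm p M (f k) powr p = (\<integral>x. norm (f k x) powr p \<partial>M)" for k
    using assms by (simp add: Lp_norm_def powr_powr)
  ultimately show "((\<lambda>k. \<integral>x. norm (f k x) powr p \<partial>M) \<longlongrightarrow> 0) F" using assms by simp
next
  assume "((\<lambda>k. \<integral>x. norm (f k x) powr p \<partial>M) \<longlongrightarrow> 0) F"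
  then have "((\<lambda>k. (\<integral>x. norm (f k x) powr p \<partial>M) powr (1 / p)) \<longlongrightarrow> 0 powr (1 / p)) F"
    using assms by (intro tendsto_powr' tendsto_intros) auto
  then show "((\<lambda>k. Lp_norm p M (f k)) \<longlongrightarrow> 0) F" by (simp add: Lp_norm_def)
qed

lemma W0_pair_imp_W0_1p:
  fixes f :: "real^'n \<Rightarrow> real"
  assumes W: "W0_pair p \<Omega> f g" and p: "p > 1" and \<Omega>: "open \<Omega>" "bounded \<Omega>"
  shows "f \<in> W0_1p \<Omega> p"
proof -
  have p0: "p > 0" using p by simp
  obtain \<phi> where fg[measurable]: "f \<in> borel_measurable borel" "g \<in> borel_measurable borel" and
    fg0: "\<And>x. x \<notin> \<Omega> \<Longrightarrow> f x = 0" "\<And>x. x \<notin> \<Omega> \<Longrightarrow> g x = 0" and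
    fgi: "integrable lborel (\<lambda>x. \<bar>f x\<bar> powr p)" "integrable lborel (\<lambda>x. norm (g x) powr p)" and
    \<phi>: "\<And>k::nat. \<phi> k \<in> test_functions \<Omega>" and
    \<phi>m[measurable]: "\<And>k. \<phi> k \<in> borel_measurable borel" "\<And>k. grad (\<phi> k) \<in> borel_measurable borel" and
    \<phi>0: "\<And>k x. x \<notin> \<Omega> \<Longrightarrow> \<phi> k x = 0" "\<And>k x. x \<notin> \<Omega> \<Longrightarrow> grad (\<phi> k) x = 0" and
    \<phi>l: "(\<lambda>k. \<integral>x. \<bar>\<phi> k x - f x\<bar> powr p \<partial>lborel) \<longlonglongrightarrow> 0"
    "(\<lambda>k. \<integral>x. norm (grad (\<phi> k) x - g x) powr p \<partial>lborel) \<longlonglongrightarrow> 0" and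
    "\<And>k. integrable lborel (\<lambda>x. \<bar>\<phi> k x - f x\<bar> powr p)"
    "\<And>k. integrable lborel (\<lambda>x. norm (grad (\<phi> k) x - g x) powr p)"
    proof (rule W0_pairE[OF W p0], goal_cases)
    case (1 \<phi>)
    show thesis by (rule that[OF 1(2-)])
  qed
  have \<Omega>b[measurable]: "\<Omega> \<in> sets borel" using \<Omega> by simp
  have ind: "indicator \<Omega> x * (\<bar>f x\<bar> powr p) = \<bar>f x\<bar> powr p"
    "indicator \<Omega> x * (norm (g x) powr p) = norm (g x) powr p"
    "indicator \<Omega> x * (\<bar>\<phi> k x - f x\<bar> powr p) = \<bar>\<phi> k x - f x\<bar> powr p"
    "indicator \<Omega> x * (norm (grad (\<phi> k) x - g x) powr p) = norm (grad (\<phi> k) x - g x) powr p" for x k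
    using fg0 \<phi>0 by (auto simp: indicator_def)
  have 1: "f \<in> Lp p (lebesgue_on \<Omega>)" "g \<in> Lp p (lebesgue_on \<Omega>)"
    using fgi by (auto simp: Lp_def borel_measurable_lebesgue_onI integrable_lebesgue_on_iff ind)
  have 2: "(\<lambda>k. Lp_norm p (lebesgue_on \<Omega>) (\<lambda>x. \<phi> k x - f x)) \<longlonglongrightarrow> 0"
    "(\<lambda>k. Lp_norm p (lebesgue_on \<Omega>) (\<lambda>x. grad (\<phi> k) x - g x)) \<longlonglongrightarrow> 0"
    using \<phi>l by (auto simp: tendsto_Lp_norm_zero_iff[OF p0] integral_lebesgue_on_eq ind)
  show ?thesis
    unfolding W0_1p_def using 1 2 \<phi> W0_pair_weak_gradient[OF W p \<Omega>] by blast
qed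

text \<open>Membership in \<open>W0_1p\<close> provides some gradient \<open>G\<close> as limit of
  the gradients of approximants, while \<open>Dw\<close> is a gradient given separately. Both are
  weak gradients of \<open>w\<close>, so \<open>G\<close> and \<open>g\<close> agree almost
  everywhere by the fundamental lemma, and the same approximants converge to the given pair.\<close>

lemma W0_1p_imp_W0_pair:
  fixes f :: "real^'n \<Rightarrow> real"
  assumes w: "w \<in> W0_1p \<Omega> p" and Dw: "weak_gradient \<Omega> w Dw" and p: "p > 1" and \<Omega>: "open \<Omega>" "bounded \<Omega>"
    and f[measurable]: "f \<in> borel_measurable borel" and g[measurable]: "g \<in> borel_measurable borel"
    and f0: "\<And>x. x \<notin> \<Omega> \<Longrightarrow> f x = 0" and g0: "\<And>x. x \<notin> \<Omega> \<Longrightarrow> g x = 0"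
    and fw: "AE x in lebesgue_on \<Omega>. w x = f x" and gw: "AE x in lebesgue_on \<Omega>. Dw x = g x"
    and gi: "integrable lborel (\<lambda>x. norm (g x) powr p)"
  shows "W0_pair p \<Omega> f g"
proof -
  have p0: "p > 0" using p by simp
  have \<Omega>b[measurable]: "\<Omega> \<in> sets borel" using \<Omega> by simp
  have fin: "emeasure lborel \<Omega> < \<infinity>" by (rule emeasure_bounded_finite[OF \<Omega>(2)])
  obtain G \<phi> where wL: "w \<in> Lp p (lebesgue_on \<Omega>)" and GL: "G \<in> Lp p (lebesgue_on \<Omega>)" and G: "weak_gradient \<Omega> w G" and
    \<phi>: "\<And>k::nat. \<phi> k \<in> test_functions \<Omega>" and
    \<phi>l: "(\<lambda>k. Lp_norm p (lebesgue_on \<Omega>) (\<lambda>x. \<phi> k x - w x)) \<longlonglongrightarrow> 0"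
     "(\<lambda>k. Lp_norm p (lebesgue_on \<Omega>) (\<lambda>x. grad (\<phi> k) x - G x)) \<longlonglongrightarrow> 0"
    using w unfolding W0_1p_def by blast
  note [measurable] = borel_measurable_test_functions[OF \<phi>] borel_measurable_grad[OF \<phi>]
  have wm[measurable]: "w \<in> borel_measurable (lebesgue_on \<Omega>)" and Gm[measurable]: "G \<in> borel_measurable (lebesgue_on \<Omega>)"
    using wL GL by (auto simp: Lp_def)
  obtain G' where G'[measurable]: "G' \<in> borel_measurable borel" and G'0: "\<And>x. x \<notin> \<Omega> \<Longrightarrow> G' x = 0"
    and GG': "AE x in lebesgue_on \<Omega>. G x = G' x"
    using lebesgue_on_borel_representative[OF Gm \<Omega>b] by blast
  note [measurable] = borel_measurable_lebesgue_onI[OF f] borel_measurable_lebesgue_onI[OF g]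
    borel_measurable_lebesgue_onI[OF G'] borel_measurable_lebesgue_onI[OF borel_measurable_test_functions[OF \<phi>]]
    borel_measurable_lebesgue_onI[OF borel_measurable_grad[OF \<phi>]]
  have z: "\<phi> k x = 0" "grad (\<phi> k) x = 0" if "x \<notin> \<Omega>" for k x
    by (rule test_functions_outside[OF \<phi>[of k] that])+
  have "integrable (lebesgue_on \<Omega>) (\<lambda>x. norm (G' x) powr p)"
    by (rule integrable_cong_AE_imp[of _ "\<lambda>x. norm (G x) powr p"]) (use GL GG' in \<open>auto simp: Lp_def\<close>)
  moreover have "indicator \<Omega> x * norm (G' x) powr p = norm (G' x) powr p" for x
    using G'0 by (auto simp: indicator_def)
  ultimately have G'i: "integrable lborel (\<lambda>x. norm (G' x) powr p)"
    by (simp add: integrable_lebesgue_on_iff)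
  have "integrable (lebesgue_on \<Omega>) (\<lambda>x. \<bar>f x\<bar> powr p)"
    by (rule integrable_cong_AE_imp[of _ "\<lambda>x. \<bar>w x\<bar> powr p"]) (use wL fw in \<open>auto simp: Lp_def\<close>)
  moreover have "indicator \<Omega> x * \<bar>f x\<bar> powr p = \<bar>f x\<bar> powr p" for x
    using f0 by (auto simp: indicator_def)
  ultimately have fi: "integrable lborel (\<lambda>x. \<bar>f x\<bar> powr p)"
    by (simp add: integrable_lebesgue_on_iff)
  have G1: "integrable lborel G'"
    by (rule integrable_norm_powr_imp_integrable[OF p G' \<Omega>b fin G'0 G'i])
  have g1: "integrable lborel g"
    by (rule integrable_norm_powr_imp_integrable[OF p g \<Omega>b fin g0 gi])
  have comp: "AE x in lborel. x \<in> \<Omega> \<longrightarrow> G' x $ i - g x $ i = 0" for i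
  proof (rule test_functions_fundamental[OF \<Omega>(1)])
    have bl: "bounded_linear (\<lambda>x::real^'n. x $ i)" by (rule bounded_linear_vec_nth)
    have c1: "integrable lborel (\<lambda>x. G' x $ i)" "integrable lborel (\<lambda>x. g x $ i)"
      by (rule integrable_bounded_linear[OF bl G1] integrable_bounded_linear[OF bl g1])+
    then show "integrable lborel (\<lambda>x. G' x $ i - g x $ i)" by simp
    fix \<zeta> :: "real^'n \<Rightarrow> real" assume \<zeta>: "\<zeta> \<in> test_functions \<Omega>"
    note [measurable] = borel_measurable_test_functions[OF \<zeta>] borel_measurable_lebesgue_onI[OF borel_measurable_test_functions[OF \<zeta>]]
    obtain C where C: "C \<ge> 0" "\<And>x. \<bar>\<zeta> x\<bar> \<le> C" "\<And>x. norm (grad \<zeta> x) \<le> C"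
      using test_functions_bounded[OF \<zeta>] by blast
    have ih: "integrable lborel (\<lambda>x. u x * \<zeta> x)" if "integrable lborel u" for u
      by (rule integrable_mult_bounded[OF that _ C(2)]) simp
    have "(\<integral>x. G' x $ i * \<zeta> x \<partial>lborel) = (\<integral>x. G' x $ i * \<zeta> x \<partial>lebesgue_on \<Omega>)"
      using G'0 by (subst integral_lebesgue_on_eq) (auto intro!: Bochner_Integration.integral_cong simp: indicator_def)
    also have "\<dots> = (\<integral>x. G x $ i * \<zeta> x \<partial>lebesgue_on \<Omega>)"
      using GG' by (intro integral_cong_AE) auto
    also have "\<dots> = - (\<integral>x. w x * grad \<zeta> x $ i \<partial>lebesgue_on \<Omega>)"
      using G \<zeta> by (auto simp: weak_gradient_def)
    also have "\<dots> = (\<integral>x. Dw x $ i * \<zeta> x \<partial>lebesgue_on \<Omega>)"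
      using Dw \<zeta> by (auto simp: weak_gradient_def)
    also have "\<dots> = (\<integral>x. g x $ i * \<zeta> x \<partial>lebesgue_on \<Omega>)"
    proof (rule integral_cong_AE)
      have [measurable]: "Dw \<in> borel_measurable (lebesgue_on \<Omega>)"
        by (rule borel_measurable_lebesgue_on_cong_AE[OF borel_measurable_lebesgue_onI[OF g] \<Omega>b])
          (use gw in auto)
      show "(\<lambda>x. Dw x $ i * \<zeta> x) \<in> borel_measurable (lebesgue_on \<Omega>)" by measurable
    qed (use gw in auto)
    also have "\<dots> = (\<integral>x. g x $ i * \<zeta> x \<partial>lborel)"
      using g0 by (subst integral_lebesgue_on_eq) (auto intro!: Bochner_Integration.integral_cong simp: indicator_def)
    finally show "(\<integral>x. (G' x $ i - g x $ i) * \<zeta> x \<partial>lborel) = 0"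
      using ih[OF c1(1)] ih[OF c1(2)] by (simp add: left_diff_distrib)
  qed
  have "AE x in lborel. \<forall>i. x \<in> \<Omega> \<longrightarrow> G' x $ i - g x $ i = 0"
    using comp by (subst AE_all_countable) auto
  then have Gg: "AE x in lebesgue_on \<Omega>. G x = g x"
    using GG' unfolding AE_lebesgue_on_iff[OF \<Omega>b]
    by eventually_elim (auto simp: vec_eq_iff)
  have l1: "(\<integral>x. \<bar>\<phi> k x - f x\<bar> powr p \<partial>lborel) = (\<integral>x. norm (\<phi> k x - w x) powr p \<partial>lebesgue_on \<Omega>)" for k
  proof -
    have "(\<integral>x. norm (\<phi> k x - w x) powr p \<partial>lebesgue_on \<Omega>) = (\<integral>x. norm (\<phi> k x - f x) powr p \<partial>lebesgue_on \<Omega>)"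
      using fw by (intro integral_cong_AE) auto
    also have "\<dots> = (\<integral>x. \<bar>\<phi> k x - f x\<bar> powr p \<partial>lborel)"
      using f0 z by (subst integral_lebesgue_on_eq) (auto intro!: Bochner_Integration.integral_cong simp: indicator_def)
    finally show ?thesis by simp
  qed
  have l2: "(\<integral>x. norm (grad (\<phi> k) x - g x) powr p \<partial>lborel) = (\<integral>x. norm (grad (\<phi> k) x - G x) powr p \<partial>lebesgue_on \<Omega>)" for k
  proof -
    have "(\<integral>x. norm (grad (\<phi> k) x - G x) powr p \<partial>lebesgue_on \<Omega>) = (\<integral>x. norm (grad (\<phi> k) x - g x) powr p \<partial>lebesgue_on \<Omega>)"
      using Gg by (intro integral_cong_AE) auto
    also have "\<dots> = (\<integral>x. norm (grad (\<phi> k) x - g x) powr p \<partial>lborel)"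
      using g0 z by (subst integral_lebesgue_on_eq) (auto intro!: Bochner_Integration.integral_cong simp: indicator_def)
    finally show ?thesis by simp
  qed
  have "(\<lambda>k. \<integral>x. \<bar>\<phi> k x - f x\<bar> powr p \<partial>lborel) \<longlonglongrightarrow> 0"
    "(\<lambda>k. \<integral>x. norm (grad (\<phi> k) x - g x) powr p \<partial>lborel) \<longlonglongrightarrow> 0"
    unfolding l1 l2 using \<phi>l by (auto simp: tendsto_Lp_norm_zero_iff[OF p0])
  then show ?thesis
    unfolding W0_pair_def using fi gi f0 g0 \<phi> by auto
qed

section \<open>Differences and smooth compositions of Sobolev functions\<close>

lemma W0_pair_diff:
  fixes f h :: "real^'n \<Rightarrow> real"
  assumes W: "W0_pair p \<Omega> f g" and W': "W0_pair p \<Omega> h l" and p: "p > 1"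
  shows "W0_pair p \<Omega> (\<lambda>x. f x - h x) (\<lambda>x. g x - l x)"
proof -
  have p0: "p > 0" using p by simp
  show ?thesis
  proof (rule W0_pairE[OF W p0], rule W0_pairE[OF W' p0], goal_cases)
    case (1 \<phi> \<psi>)
    \<comment> \<open>Facts 1 to 15 of this case belong to \<open>f\<close>, \<open>g\<close> and
      \<phi>; facts 16 to 30 repeat the same list for \<open>h\<close>, \<open>l\<close> and
      \<psi>.\<close>
    note [measurable] = 1(1,2,8,9,16,17,23,24)
    have test: "(\<lambda>x. \<phi> k x - \<psi> k x) \<in> test_functions \<Omega>" for k by (rule test_functions_diff[OF 1(7) 1(22)])
    have grad: "grad (\<lambda>x. \<phi> k x - \<psi> k x) x = grad (\<phi> k) x - grad (\<psi> k) x" for k x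
      by (rule grad_eqI) (auto intro!: derivative_eq_intros test_functions_has_derivative[OF 1(7)]
          test_functions_has_derivative[OF 1(22)] simp: inner_diff_left fun_eq_iff)
    have i1: "integrable lborel (\<lambda>x. norm (f x - h x) powr p)"
    proof (rule Bochner_Integration.integrable_bound)
      show "integrable lborel (\<lambda>x. 2 powr p * (norm (f x) powr p + norm (h x) powr p))" using 1(5,20) by simp
    qed (use norm_diff_powr_le[of p "f _" "h _"] p0 in auto)
    have i2: "integrable lborel (\<lambda>x. norm (g x - l x) powr p)"
    proof (rule Bochner_Integration.integrable_bound)
      show "integrable lborel (\<lambda>x. 2 powr p * (norm (g x) powr p + norm (l x) powr p))" using 1(6,21) by simp
    qed (use norm_diff_powr_le[of p "g _" "l _"] p0 in auto)
    have l1: "(\<lambda>k. \<integral>x. norm ((\<phi> k x - \<psi> k x) - (f x - h x)) powr p \<partial>lborel) \<longlonglongrightarrow> 0"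
    proof (rule tendsto_sandwich[OF _ _ tendsto_const])
      show "(\<lambda>k. 2 powr p * ((\<integral>x. \<bar>\<phi> k x - f x\<bar> powr p \<partial>lborel) + (\<integral>x. \<bar>\<psi> k x - h x\<bar> powr p \<partial>lborel))) \<longlonglongrightarrow> 0"
        using tendsto_mult_left[OF tendsto_add[OF 1(12) 1(27)], of "2 powr p"] by simp
      have "(\<integral>x. norm ((\<phi> k x - \<psi> k x) - (f x - h x)) powr p \<partial>lborel) \<le>
          (\<integral>x. 2 powr p * (\<bar>\<phi> k x - f x\<bar> powr p + \<bar>\<psi> k x - h x\<bar> powr p) \<partial>lborel)" for k
      proof (rule integral_mono')
        show "norm ((\<phi> k x - \<psi> k x) - (f x - h x)) powr p \<le>
            2 powr p * (\<bar>\<phi> k x - f x\<bar> powr p + \<bar>\<psi> k x - h x\<bar> powr p)" for x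
          using norm_diff_powr_le[of p "\<phi> k x - f x" "\<psi> k x - h x"] p0 by (simp add: algebra_simps)
      qed (use 1(14,29) in auto)
      then show "\<forall>\<^sub>F k in sequentially. (\<integral>x. norm ((\<phi> k x - \<psi> k x) - (f x - h x)) powr p \<partial>lborel) \<le>
          2 powr p * ((\<integral>x. \<bar>\<phi> k x - f x\<bar> powr p \<partial>lborel) + (\<integral>x. \<bar>\<psi> k x - h x\<bar> powr p \<partial>lborel))"
        using 1(14,29) by (intro always_eventually) simp
    qed auto
    have l2: "(\<lambda>k. \<integral>x. norm ((grad (\<phi> k) x - grad (\<psi> k) x) - (g x - l x)) powr p \<partial>lborel) \<longlonglongrightarrow> 0"
    proof (rule tendsto_sandwich[OF _ _ tendsto_const])
      show "(\<lambda>k. 2 powr p * ((\<integral>x. norm (grad (\<phi> k) x - g x) powr p \<partial>lborel) + (\<integral>x. norm (grad (\<psi> k) x - l x) powr p \<partial>lborel))) \<longlonglongrightarrow> 0"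
        using tendsto_mult_left[OF tendsto_add[OF 1(13) 1(28)], of "2 powr p"] by simp
      have "(\<integral>x. norm ((grad (\<phi> k) x - grad (\<psi> k) x) - (g x - l x)) powr p \<partial>lborel) \<le>
          (\<integral>x. 2 powr p * (norm (grad (\<phi> k) x - g x) powr p + norm (grad (\<psi> k) x - l x) powr p) \<partial>lborel)" for k
      proof (rule integral_mono')
        show "norm ((grad (\<phi> k) x - grad (\<psi> k) x) - (g x - l x)) powr p \<le>
            2 powr p * (norm (grad (\<phi> k) x - g x) powr p + norm (grad (\<psi> k) x - l x) powr p)" for x
          using norm_diff_powr_le[of p "grad (\<phi> k) x - g x" "grad (\<psi> k) x - l x"] p0 by (simp add: algebra_simps)
      qed (use 1(15,30) in auto)
      then show "\<forall>\<^sub>F k in sequentially. (\<integral>x. norm ((grad (\<phi> k) x - grad (\<psi> k) x) - (g x - l x)) powr p \<partial>lborel) \<le>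
          2 powr p * ((\<integral>x. norm (grad (\<phi> k) x - g x) powr p \<partial>lborel) + (\<integral>x. norm (grad (\<psi> k) x - l x) powr p \<partial>lborel))"
        using 1(15,30) by (intro always_eventually) simp
    qed auto
    show ?case unfolding W0_pair_def
      using i1 i2 l1 l2 1(3,4,18,19) by (auto intro!: exI[of _ "\<lambda>k x. \<phi> k x - \<psi> k x"] test simp: grad)
  qed
qed

text \<open>Since \<open>H\<close> is smooth with \<open>H 0 = 0\<close>, composing an approximating
  sequence with \<open>H\<close> gives test functions again. The error of the gradients splits into
  \<open>H'(\<phi>)\<close> times the old error, controlled by the bound \<open>M\<close>, and
  \<open>H'(\<phi>) - H'(f)\<close> times the fixed function \<open>g\<close>, which vanishes by
  dominated convergence.\<close>

lemma W0_pair_compose: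
  fixes f :: "real^'n \<Rightarrow> real" and H H' :: "real \<Rightarrow> real"
  assumes W: "W0_pair p \<Omega> f g" and p: "p > 1"
    and H: "\<And>k. continuously_diff k H" "H 0 = 0" and H': "\<And>s. (H has_real_derivative H' s) (at s)"
    and cont: "continuous_on UNIV H'" and M: "\<And>s. \<bar>H' s\<bar> \<le> M"
  shows "W0_pair p \<Omega> (\<lambda>x. H (f x)) (\<lambda>x. H' (f x) *\<^sub>R g x)"
proof -
  have p0: "p > 0" using p by simp
  have M0: "M \<ge> 0" using M[of 0] by simp
  have lip: "\<bar>H a - H b\<bar> \<le> M * \<bar>a - b\<bar>" for a b
    using field_differentiable_bound[of UNIV H H' M a b] H' M by auto
  have [measurable]: "H \<in> borel_measurable borel" "H' \<in> borel_measurable borel"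
    using H(1)[of 0] cont by (auto intro: borel_measurable_continuous_onI)
  show ?thesis
  proof (rule W0_pairE[OF W p0], goal_cases)
    case (1 \<phi>)
    note [measurable] = 1(1,2,8,9)
    \<comment> \<open>Convergence in L^p gives pointwise convergence only along a subsequence; it is
      needed so that continuity of \<open>H'\<close> can be applied at almost every point.\<close>
    obtain r where r: "strict_mono r" "AE x in lborel. (\<lambda>k. \<bar>\<phi> (r k) x - f x\<bar> powr p) \<longlonglongrightarrow> 0"
      using tendsto_L1_AE_subseq[of lborel "\<lambda>k x. \<bar>\<phi> k x - f x\<bar> powr p"] 1(12,14) by auto
    have conv: "AE x in lborel. (\<lambda>k. \<phi> (r k) x) \<longlonglongrightarrow> f x"
      using r(2)
    proof eventually_elim
      case (elim x)
      have "(\<lambda>k. (\<bar>\<phi> (r k) x - f x\<bar> powr p) powr (1 / p)) \<longlonglongrightarrow> 0 powr (1 / p)"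
        using p0 by (intro tendsto_powr' elim tendsto_const) auto
      then have "(\<lambda>k. \<bar>\<phi> (r k) x - f x\<bar>) \<longlonglongrightarrow> 0" using p0 by (simp add: powr_powr)
      then show ?case using LIM_zero_cancel tendsto_rabs_zero_iff by blast
    qed
    have l0: "(\<lambda>k. \<integral>x. \<bar>\<phi> (r k) x - f x\<bar> powr p \<partial>lborel) \<longlonglongrightarrow> 0"
      "(\<lambda>k. \<integral>x. norm (grad (\<phi> (r k)) x - g x) powr p \<partial>lborel) \<longlonglongrightarrow> 0"
      using LIMSEQ_subseq_LIMSEQ[OF 1(12) r(1)] LIMSEQ_subseq_LIMSEQ[OF 1(13) r(1)] by (auto simp: o_def)
    have test: "(\<lambda>x. H (\<phi> (r k) x)) \<in> test_functions \<Omega>" for k by (rule test_functions_compose[OF 1(7) H])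
    have grad: "grad (\<lambda>x. H (\<phi> (r k) x)) x = H' (\<phi> (r k) x) *\<^sub>R grad (\<phi> (r k)) x" for k x
    proof (rule grad_eqI)
      show "((\<lambda>x. H (\<phi> (r k) x)) has_derivative (\<lambda>h. (H' (\<phi> (r k) x) *\<^sub>R grad (\<phi> (r k)) x) \<bullet> h)) (at x)"
        using has_derivative_compose[OF test_functions_has_derivative[OF 1(7)[of "r k"]] has_field_derivative_imp_has_derivative[OF H'], of x]
        by simp
    qed
    have i1: "integrable lborel (\<lambda>x. \<bar>H (f x)\<bar> powr p)"
    proof (rule Bochner_Integration.integrable_bound)
      show "integrable lborel (\<lambda>x. M powr p * \<bar>f x\<bar> powr p)" using 1(5) by auto
      have "\<bar>H (f x)\<bar> powr p \<le> M powr p * \<bar>f x\<bar> powr p" for x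
        using powr_mono2[of p "\<bar>H (f x)\<bar>" "M * \<bar>f x\<bar>"] lip[of "f x" 0] H(2) p0 M0 by (simp add: powr_mult)
      then show "AE x in lborel. norm (\<bar>H (f x)\<bar> powr p) \<le> norm (M powr p * \<bar>f x\<bar> powr p)" by auto
    qed auto
    have i2: "integrable lborel (\<lambda>x. norm (H' (f x) *\<^sub>R g x) powr p)"
    proof (rule Bochner_Integration.integrable_bound)
      show "integrable lborel (\<lambda>x. M powr p * norm (g x) powr p)" using 1(6) by auto
      have "norm (H' (f x) *\<^sub>R g x) powr p \<le> M powr p * norm (g x) powr p" for x
        using M[of "f x"] p0 M0 by (auto simp: powr_mult intro!: mult_right_mono powr_mono2)
      then show "AE x in lborel. norm (norm (H' (f x) *\<^sub>R g x) powr p) \<le> norm (M powr p * norm (g x) powr p)" by auto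
    qed auto
    have l1: "(\<lambda>k. \<integral>x. \<bar>H (\<phi> (r k) x) - H (f x)\<bar> powr p \<partial>lborel) \<longlonglongrightarrow> 0"
    proof (rule tendsto_sandwich[OF _ _ tendsto_const])
      show "(\<lambda>k. M powr p * (\<integral>x. \<bar>\<phi> (r k) x - f x\<bar> powr p \<partial>lborel)) \<longlonglongrightarrow> 0"
        using tendsto_mult_left[OF l0(1), of "M powr p"] by simp
      have "(\<integral>x. \<bar>H (\<phi> (r k) x) - H (f x)\<bar> powr p \<partial>lborel) \<le> (\<integral>x. M powr p * \<bar>\<phi> (r k) x - f x\<bar> powr p \<partial>lborel)" for k
      proof (rule integral_mono')
        show "\<bar>H (\<phi> (r k) x) - H (f x)\<bar> powr p \<le> M powr p * \<bar>\<phi> (r k) x - f x\<bar> powr p" for x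
          using powr_mono2[of p, OF _ _ lip[of "\<phi> (r k) x" "f x"]] p0 M0 by (simp add: powr_mult)
      qed (use 1(14) in auto)
      then show "\<forall>\<^sub>F k in sequentially. (\<integral>x. \<bar>H (\<phi> (r k) x) - H (f x)\<bar> powr p \<partial>lborel) \<le>
          M powr p * (\<integral>x. \<bar>\<phi> (r k) x - f x\<bar> powr p \<partial>lborel)"
        by (intro always_eventually) simp
    qed auto
    have dct: "(\<lambda>k. \<integral>x. \<bar>H' (\<phi> (r k) x) - H' (f x)\<bar> powr p * norm (g x) powr p \<partial>lborel) \<longlonglongrightarrow> (\<integral>x. 0 \<partial>(lborel :: (real^'n) measure))"
      and dcti: "\<And>k. integrable lborel (\<lambda>x. \<bar>H' (\<phi> (r k) x) - H' (f x)\<bar> powr p * norm (g x) powr p)"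
    proof -
      have bd: "AE x in lborel. norm (\<bar>H' (\<phi> (r k) x) - H' (f x)\<bar> powr p * norm (g x) powr p) \<le> (2 * M) powr p * norm (g x) powr p" for k
      proof (rule AE_I2)
        fix x
        have "\<bar>H' (\<phi> (r k) x) - H' (f x)\<bar> \<le> 2 * M" using M[of "\<phi> (r k) x"] M[of "f x"] by linarith
        then show "norm (\<bar>H' (\<phi> (r k) x) - H' (f x)\<bar> powr p * norm (g x) powr p) \<le> (2 * M) powr p * norm (g x) powr p"
          using p0 by (auto intro!: mult_right_mono powr_mono2)
      qed
      have w: "integrable lborel (\<lambda>x. (2 * M) powr p * norm (g x) powr p)" using 1(6) by simp
      show "(\<lambda>k. \<integral>x. \<bar>H' (\<phi> (r k) x) - H' (f x)\<bar> powr p * norm (g x) powr p \<partial>lborel) \<longlonglongrightarrow> (\<integral>x. 0 \<partial>(lborel :: (real^'n) measure))"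
      proof (rule integral_dominated_convergence[OF _ _ w _ bd])
        show "AE x in lborel. (\<lambda>k. \<bar>H' (\<phi> (r k) x) - H' (f x)\<bar> powr p * norm (g x) powr p) \<longlonglongrightarrow> 0"
          using conv
        proof eventually_elim
          case (elim x)
          have "(\<lambda>k. H' (\<phi> (r k) x)) \<longlonglongrightarrow> H' (f x)"
            using cont elim by (intro isCont_tendsto_compose[of _ H']) (auto simp: continuous_on_eq_continuous_at)
          then have "(\<lambda>k. \<bar>H' (\<phi> (r k) x) - H' (f x)\<bar>) \<longlonglongrightarrow> 0"
            using LIM_zero tendsto_rabs_zero by blast
          then have "(\<lambda>k. \<bar>H' (\<phi> (r k) x) - H' (f x)\<bar> powr p) \<longlonglongrightarrow> 0 powr p"
            using p0 by (intro tendsto_powr' tendsto_const) auto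
          then show ?case using tendsto_mult_right[of _ 0 sequentially "norm (g x) powr p"] p0 by simp
        qed
      qed auto
      show "integrable lborel (\<lambda>x. \<bar>H' (\<phi> (r k) x) - H' (f x)\<bar> powr p * norm (g x) powr p)" for k
        by (rule Bochner_Integration.integrable_bound[OF w])
          (use bd[of k] M0 in \<open>auto elim!: AE_mp\<close>)
    qed
    have l2: "(\<lambda>k. \<integral>x. norm (H' (\<phi> (r k) x) *\<^sub>R grad (\<phi> (r k)) x - H' (f x) *\<^sub>R g x) powr p \<partial>lborel) \<longlonglongrightarrow> 0"
    proof (rule tendsto_sandwich[OF _ _ tendsto_const])
      let ?A = "\<lambda>k. \<integral>x. norm (grad (\<phi> (r k)) x - g x) powr p \<partial>lborel"
      let ?B = "\<lambda>k. \<integral>x. \<bar>H' (\<phi> (r k) x) - H' (f x)\<bar> powr p * norm (g x) powr p \<partial>lborel"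
      show "(\<lambda>k. 2 powr p * (M powr p * ?A k + ?B k)) \<longlonglongrightarrow> 0"
        using tendsto_mult_left[OF tendsto_add[OF tendsto_mult_left[OF l0(2), of "M powr p"] dct], of "2 powr p"] by simp
      have "(\<integral>x. norm (H' (\<phi> (r k) x) *\<^sub>R grad (\<phi> (r k)) x - H' (f x) *\<^sub>R g x) powr p \<partial>lborel) \<le>
         (\<integral>x. 2 powr p * (M powr p * norm (grad (\<phi> (r k)) x - g x) powr p + \<bar>H' (\<phi> (r k) x) - H' (f x)\<bar> powr p * norm (g x) powr p) \<partial>lborel)" for k
      proof (rule integral_mono')
        fix x
        have "norm (H' (\<phi> (r k) x) *\<^sub>R grad (\<phi> (r k)) x - H' (f x) *\<^sub>R g x) powr p =
          norm (H' (\<phi> (r k) x) *\<^sub>R (grad (\<phi> (r k)) x - g x) + (H' (\<phi> (r k) x) - H' (f x)) *\<^sub>R g x) powr p"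
          by (simp add: algebra_simps)
        also have "\<dots> \<le> 2 powr p * (norm (H' (\<phi> (r k) x) *\<^sub>R (grad (\<phi> (r k)) x - g x)) powr p + norm ((H' (\<phi> (r k) x) - H' (f x)) *\<^sub>R g x) powr p)"
          using p0 by (intro norm_add_powr_le) auto
        also have "\<dots> \<le> 2 powr p * (M powr p * norm (grad (\<phi> (r k)) x - g x) powr p + \<bar>H' (\<phi> (r k) x) - H' (f x)\<bar> powr p * norm (g x) powr p)"
          using p0 M[of "\<phi> (r k) x"] by (intro mult_left_mono add_mono) (auto simp: powr_mult intro!: mult_right_mono powr_mono2)
        finally show "norm (H' (\<phi> (r k) x) *\<^sub>R grad (\<phi> (r k)) x - H' (f x) *\<^sub>R g x) powr p \<le> \<dots>" .
      qed (use 1(15) dcti in auto)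
      then show "\<forall>\<^sub>F k in sequentially. (\<integral>x. norm (H' (\<phi> (r k) x) *\<^sub>R grad (\<phi> (r k)) x - H' (f x) *\<^sub>R g x) powr p \<partial>lborel) \<le>
          2 powr p * (M powr p * ?A k + ?B k)"
        using 1(15) dcti by (intro always_eventually) simp
    qed auto
    show ?case unfolding W0_pair_def
      using i1 i2 l1 l2 1(3,4) H(2) by (auto intro!: exI[of _ "\<lambda>k x. H (\<phi> (r k) x)"] test simp: grad)
  qed
qed

text \<open>The increment is the integral over \<open>s\<close> in [0,1] of
  \<open>grad \<phi> (x + s y) \<bullet> y\<close>. Jensen's inequality in \<open>s\<close>,
  Tonelli's theorem and translation invariance in \<open>x\<close> remove the shift
  \<open>s y\<close>.\<close>

lemma test_functions_translation_powr:
  fixes \<phi> :: "real^'n \<Rightarrow> real"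
  assumes \<phi>: "\<phi> \<in> test_functions S" and p: "p > 1"
  shows "(\<integral>\<^sup>+x. ennreal (\<bar>\<phi> (x + y) - \<phi> x\<bar> powr p) \<partial>lborel) \<le>
    ennreal (norm y powr p) * (\<integral>\<^sup>+x. ennreal (norm (grad \<phi> x) powr p) \<partial>lborel)"
proof -
  note [measurable] = borel_measurable_test_functions[OF \<phi>] borel_measurable_grad[OF \<phi>]
  have contg: "continuous_on UNIV (\<lambda>s::real. grad \<phi> (x + s *\<^sub>R y))" for x
    by (rule continuous_on_compose2[OF continuous_on_grad[OF \<phi>]]) (auto intro!: continuous_intros)
  have pt: "ennreal (\<bar>\<phi> (x + y) - \<phi> x\<bar> powr p) \<le>
     ennreal (norm y powr p) * (\<integral>\<^sup>+s. indicator {0..1} s * ennreal (norm (grad \<phi> (x + s *\<^sub>R y)) powr p) \<partial>lborel)" for x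
  proof -
    define \<gamma> where "\<gamma> s = grad \<phi> (x + s *\<^sub>R y) \<bullet> y" for s :: real
    have cont\<gamma>: "continuous_on UNIV \<gamma>" unfolding \<gamma>_def by (intro continuous_intros contg)
    have [measurable]: "\<gamma> \<in> borel_measurable borel" by (rule borel_measurable_continuous_onI[OF cont\<gamma>])
    have der: "((\<lambda>s. \<phi> (x + s *\<^sub>R y)) has_vector_derivative \<gamma> s) (at s within A)" for s A
    proof -
      have "((\<lambda>s. \<phi> (x + s *\<^sub>R y)) has_derivative (\<lambda>h. grad \<phi> (x + s *\<^sub>R y) \<bullet> (h *\<^sub>R y))) (at s)"
      proof (rule has_derivative_compose[OF _ test_functions_has_derivative[OF \<phi>]])
        show "((\<lambda>h. x + h *\<^sub>R y) has_derivative (\<lambda>h. h *\<^sub>R y)) (at s)"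
          by (auto intro!: derivative_eq_intros)
      qed
      then have "((\<lambda>s. \<phi> (x + s *\<^sub>R y)) has_derivative (\<lambda>h. h *\<^sub>R \<gamma> s)) (at s)" by (simp add: \<gamma>_def)
      then show ?thesis unfolding has_vector_derivative_def by (rule has_derivative_at_withinI)
    qed
    have ci: "integrable lborel (\<lambda>s. indicator {0..1} s *\<^sub>R h s)" if "continuous_on UNIV h" for h :: "real \<Rightarrow> real"
      using that borel_integrable_compact[of "{0..1::real}" h] by (auto intro: continuous_on_subset simp: indicator_scaleR_eq_if)
    have i1: "integrable lborel (\<lambda>s. indicator {0..1} s * \<bar>\<gamma> s\<bar>)"
      using ci[of "\<lambda>s. \<bar>\<gamma> s\<bar>"] cont\<gamma> by (auto intro: continuous_intros)
    have i2: "integrable lborel (\<lambda>s. indicator {0..1} s * \<bar>\<gamma> s\<bar> powr p)"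
    proof -
      have "continuous_on UNIV (\<lambda>s. \<bar>\<gamma> s\<bar> powr p)"
        by (intro continuous_on_powr' continuous_intros cont\<gamma>) (use p in auto)
      from ci[OF this] show ?thesis by simp
    qed
    have i3: "integrable lborel (\<lambda>s. indicator {0..1} s * norm (grad \<phi> (x + s *\<^sub>R y)) powr p)"
    proof -
      have "continuous_on UNIV (\<lambda>s. norm (grad \<phi> (x + s *\<^sub>R y)) powr p)"
        by (intro continuous_on_powr' continuous_on_norm continuous_on_const contg) (use p in auto)
      from ci[OF this] show ?thesis by simp
    qed
    have "(\<integral>s. indicator {0..1} s *\<^sub>R \<gamma> s \<partial>lborel) = \<phi> (x + 1 *\<^sub>R y) - \<phi> (x + 0 *\<^sub>R y)"
      by (rule integral_FTC_Icc) (use der cont\<gamma> in \<open>auto intro: continuous_on_subset\<close>)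
    then have eq: "\<phi> (x + y) - \<phi> x = (\<integral>s. indicator {0..1} s *\<^sub>R \<gamma> s \<partial>lborel)" by simp
    have "\<bar>\<phi> (x + y) - \<phi> x\<bar> \<le> (\<integral>s. norm (indicator {0..1} s *\<^sub>R \<gamma> s) \<partial>lborel)"
      unfolding eq real_norm_def[symmetric] by (rule integral_norm_bound)
    also have "\<dots> = (\<integral>s. indicator {0..1} s * \<bar>\<gamma> s\<bar> \<partial>lborel)" by (simp add: abs_mult)
    finally have "\<bar>\<phi> (x + y) - \<phi> x\<bar> powr p \<le> (\<integral>s. indicator {0..1} s * \<bar>\<gamma> s\<bar> \<partial>lborel) powr p"
      using p by (intro powr_mono2) auto
    also have "\<dots> \<le> (\<integral>s. indicator {0..1} s * \<bar>\<gamma> s\<bar> powr p \<partial>lborel)"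
      using set_Jensen_powr[of p "{0..1::real}" lborel "\<lambda>s. \<bar>\<gamma> s\<bar>"] p i1 i2 by simp
    also have "\<dots> \<le> (\<integral>s. norm y powr p * (indicator {0..1} s * norm (grad \<phi> (x + s *\<^sub>R y)) powr p) \<partial>lborel)"
    proof (rule integral_mono)
      fix s :: real
      have "\<bar>\<gamma> s\<bar> \<le> norm y * norm (grad \<phi> (x + s *\<^sub>R y))"
        unfolding \<gamma>_def using Cauchy_Schwarz_ineq2[of "grad \<phi> (x + s *\<^sub>R y)" y] by (simp add: mult.commute)
      then have "\<bar>\<gamma> s\<bar> powr p \<le> norm y powr p * norm (grad \<phi> (x + s *\<^sub>R y)) powr p"
        using powr_mono2[of p "\<bar>\<gamma> s\<bar>"] p by (simp add: powr_mult[symmetric])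
      then show "indicator {0..1} s * \<bar>\<gamma> s\<bar> powr p \<le> norm y powr p * (indicator {0..1} s * norm (grad \<phi> (x + s *\<^sub>R y)) powr p)"
        by (simp add: indicator_def)
    qed (use i2 i3 in auto)
    also have "\<dots> = norm y powr p * (\<integral>s. indicator {0..1} s * norm (grad \<phi> (x + s *\<^sub>R y)) powr p \<partial>lborel)" by simp
    finally have "ennreal (\<bar>\<phi> (x + y) - \<phi> x\<bar> powr p) \<le>
      ennreal (norm y powr p) * ennreal (\<integral>s. indicator {0..1} s * norm (grad \<phi> (x + s *\<^sub>R y)) powr p \<partial>lborel)"
      by (simp add: ennreal_mult'[symmetric] ennreal_leI)
    also have "ennreal (\<integral>s. indicator {0..1} s * norm (grad \<phi> (x + s *\<^sub>R y)) powr p \<partial>lborel) =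
       (\<integral>\<^sup>+s. ennreal (indicator {0..1} s * norm (grad \<phi> (x + s *\<^sub>R y)) powr p) \<partial>lborel)"
      by (rule nn_integral_eq_integral[symmetric, OF i3]) auto
    also have "\<dots> = (\<integral>\<^sup>+s. indicator {0..1} s * ennreal (norm (grad \<phi> (x + s *\<^sub>R y)) powr p) \<partial>lborel)"
      by (intro nn_integral_cong) (auto simp: indicator_def)
    finally show ?thesis .
  qed
  have gm: "(\<lambda>(x, s). grad \<phi> (x + s *\<^sub>R y)) \<in> borel_measurable (lborel \<Otimes>\<^sub>M lborel)"
    by measurable
  have "(\<integral>\<^sup>+x. ennreal (\<bar>\<phi> (x + y) - \<phi> x\<bar> powr p) \<partial>lborel) \<le>
    (\<integral>\<^sup>+x. ennreal (norm y powr p) * (\<integral>\<^sup>+s. indicator {0..1} s * ennreal (norm (grad \<phi> (x + s *\<^sub>R y)) powr p) \<partial>lborel) \<partial>lborel)"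
    by (intro nn_integral_mono pt)
  also have "\<dots> = ennreal (norm y powr p) * (\<integral>\<^sup>+x. (\<integral>\<^sup>+s. indicator {0..1} s * ennreal (norm (grad \<phi> (x + s *\<^sub>R y)) powr p) \<partial>lborel) \<partial>lborel)"
    by (rule nn_integral_cmult) measurable
  also have "(\<integral>\<^sup>+x. (\<integral>\<^sup>+s. indicator {0..1} s * ennreal (norm (grad \<phi> (x + s *\<^sub>R y)) powr p) \<partial>lborel) \<partial>lborel) =
     (\<integral>\<^sup>+s. (\<integral>\<^sup>+x. indicator {0..1::real} s * ennreal (norm (grad \<phi> (x + s *\<^sub>R y)) powr p) \<partial>lborel) \<partial>lborel)"
    by (rule lborel_pair.Fubini'[symmetric]) measurable
  also have "\<dots> = (\<integral>\<^sup>+s. indicator {0..1::real} s * (\<integral>\<^sup>+x. ennreal (norm (grad \<phi> x) powr p) \<partial>lborel) \<partial>lborel)"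
  proof (intro nn_integral_cong)
    fix s :: real
    have "(\<integral>\<^sup>+x. indicator {0..1::real} s * ennreal (norm (grad \<phi> (x + s *\<^sub>R y)) powr p) \<partial>lborel) =
      indicator {0..1::real} s * (\<integral>\<^sup>+x. ennreal (norm (grad \<phi> (x + s *\<^sub>R y)) powr p) \<partial>lborel)"
      by (rule nn_integral_cmult) measurable
    then show "(\<integral>\<^sup>+x. indicator {0..1::real} s * ennreal (norm (grad \<phi> (x + s *\<^sub>R y)) powr p) \<partial>lborel) =
      indicator {0..1::real} s * (\<integral>\<^sup>+x. ennreal (norm (grad \<phi> x) powr p) \<partial>lborel)"
      using nn_integral_lborel_translation[of "\<lambda>x. ennreal (norm (grad \<phi> x) powr p)" "s *\<^sub>R y"] by simp
  qed
  also have "\<dots> = (\<integral>\<^sup>+x. ennreal (norm (grad \<phi> x) powr p) \<partial>lborel)"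
    by (subst nn_integral_multc) auto
  finally show ?thesis .
qed

text \<open>The estimate for test functions survives the limit. The factor \<open>8 powr p\<close>
  is \<open>4 powr p\<close>, from splitting the increment of \<open>f\<close> into three pieces,
  times \<open>2 powr p\<close>, from comparing \<open>grad (\<phi> k)\<close> with
  \<open>g\<close>.\<close>

lemma W0_pair_translation_powr:
  fixes f :: "real^'n \<Rightarrow> real"
  assumes W: "W0_pair p \<Omega> f g" and p: "p > 1"
  shows "(\<integral>\<^sup>+x. ennreal (\<bar>f (x + y) - f x\<bar> powr p) \<partial>lborel) \<le>
    ennreal (8 powr p * norm y powr p * (\<integral>x. norm (g x) powr p \<partial>lborel))"
proof -
  have p0: "p > 0" using p by simp
  show ?thesis
  proof (rule W0_pairE[OF W p0], goal_cases)
    case (1 \<phi>)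
    note [measurable] = 1(1,2,8,9)
    define e e' G where "e k = (\<integral>x. \<bar>\<phi> k x - f x\<bar> powr p \<partial>lborel)"
      and "e' k = (\<integral>x. norm (grad (\<phi> k) x - g x) powr p \<partial>lborel)"
      and "G = (\<integral>x. norm (g x) powr p \<partial>lborel)" for k
    have G0: "G \<ge> 0" "e k \<ge> 0" "e' k \<ge> 0" for k by (auto simp: G_def e_def e'_def)
    have two: "2 powr p \<ge> (1::real)" using p0 by (intro ge_one_powr_ge_zero) auto
    have bd: "(\<integral>\<^sup>+x. ennreal (\<bar>f (x + y) - f x\<bar> powr p) \<partial>lborel) \<le>
       ennreal (4 powr p * (2 * e k + norm y powr p * (2 powr p * (e' k + G))))" for k
    proof -
      have pt: "\<bar>f (x + y) - f x\<bar> powr p \<le> 4 powr p * (\<bar>\<phi> k (x + y) - f (x + y)\<bar> powr p + (\<bar>\<phi> k (x + y) - \<phi> k x\<bar> powr p + \<bar>\<phi> k x - f x\<bar> powr p))" for x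
      proof -
        have "\<bar>f (x + y) - f x\<bar> powr p = norm (((\<phi> k (x + y) - \<phi> k x) + (\<phi> k x - f x)) - (\<phi> k (x + y) - f (x + y))) powr p"
          by simp
        also have "\<dots> \<le> 2 powr p * (norm ((\<phi> k (x + y) - \<phi> k x) + (\<phi> k x - f x)) powr p + \<bar>\<phi> k (x + y) - f (x + y)\<bar> powr p)"
          using norm_diff_powr_le[of p "(\<phi> k (x + y) - \<phi> k x) + (\<phi> k x - f x)" "\<phi> k (x + y) - f (x + y)"] p0 by simp
        also have "\<dots> \<le> 2 powr p * (2 powr p * (\<bar>\<phi> k (x + y) - \<phi> k x\<bar> powr p + \<bar>\<phi> k x - f x\<bar> powr p) + 2 powr p * \<bar>\<phi> k (x + y) - f (x + y)\<bar> powr p)"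
          using norm_add_powr_le[of p "\<phi> k (x + y) - \<phi> k x" "\<phi> k x - f x"] p0 two
          by (intro mult_left_mono add_mono) (auto simp: mult_le_cancel_right1)
        also have "\<dots> = (2 powr p * 2 powr p) * (\<bar>\<phi> k (x + y) - f (x + y)\<bar> powr p + (\<bar>\<phi> k (x + y) - \<phi> k x\<bar> powr p + \<bar>\<phi> k x - f x\<bar> powr p))"
          by (simp add: algebra_simps)
        also have "2 powr p * 2 powr p = (4::real) powr p" by (simp add: powr_mult[symmetric])
        finally show ?thesis .
      qed
      have n1: "(\<integral>\<^sup>+x. ennreal (\<bar>\<phi> k x - f x\<bar> powr p) \<partial>lborel) = ennreal (e k)"
        unfolding e_def by (rule nn_integral_eq_integral[OF 1(14)]) auto
      have n1': "(\<integral>\<^sup>+x. ennreal (\<bar>\<phi> k (x + y) - f (x + y)\<bar> powr p) \<partial>lborel) = ennreal (e k)"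
        using nn_integral_lborel_translation[of "\<lambda>x. ennreal (\<bar>\<phi> k x - f x\<bar> powr p)" y] n1 by simp
      have n2: "(\<integral>\<^sup>+x. ennreal (\<bar>\<phi> k (x + y) - \<phi> k x\<bar> powr p) \<partial>lborel) \<le> ennreal (norm y powr p * (2 powr p * (e' k + G)))"
      proof -
        have "(\<integral>\<^sup>+x. ennreal (norm (grad (\<phi> k) x) powr p) \<partial>lborel) \<le>
           (\<integral>\<^sup>+x. ennreal (2 powr p * (norm (grad (\<phi> k) x - g x) powr p + norm (g x) powr p)) \<partial>lborel)"
        proof (intro nn_integral_mono ennreal_leI)
          show "norm (grad (\<phi> k) x) powr p \<le> 2 powr p * (norm (grad (\<phi> k) x - g x) powr p + norm (g x) powr p)" for x
            using norm_add_powr_le[of p "grad (\<phi> k) x - g x" "g x"] p0 by simp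
        qed
        also have "\<dots> = ennreal (\<integral>x. 2 powr p * (norm (grad (\<phi> k) x - g x) powr p + norm (g x) powr p) \<partial>lborel)"
          by (rule nn_integral_eq_integral) (use 1(6,15) in auto)
        also have "\<dots> = ennreal (2 powr p * (e' k + G))"
          using 1(6,15) by (simp add: e'_def G_def)
        finally have *: "(\<integral>\<^sup>+x. ennreal (norm (grad (\<phi> k) x) powr p) \<partial>lborel) \<le> ennreal (2 powr p * (e' k + G))" .
        show ?thesis
          using order_trans[OF test_functions_translation_powr[OF 1(7) p, of k y] mult_left_mono[OF *]]
          by (simp add: ennreal_mult'[symmetric])
      qed
      have "(\<integral>\<^sup>+x. ennreal (\<bar>f (x + y) - f x\<bar> powr p) \<partial>lborel) \<le>
        (\<integral>\<^sup>+x. ennreal (4 powr p) * (ennreal (\<bar>\<phi> k (x + y) - f (x + y)\<bar> powr p) + (ennreal (\<bar>\<phi> k (x + y) - \<phi> k x\<bar> powr p) + ennreal (\<bar>\<phi> k x - f x\<bar> powr p))) \<partial>lborel)"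
        using pt by (intro nn_integral_mono) (simp add: ennreal_mult'[symmetric] ennreal_plus[symmetric] ennreal_leI del: ennreal_plus)
      also have "\<dots> = ennreal (4 powr p) * ((\<integral>\<^sup>+x. ennreal (\<bar>\<phi> k (x + y) - f (x + y)\<bar> powr p) \<partial>lborel) + ((\<integral>\<^sup>+x. ennreal (\<bar>\<phi> k (x + y) - \<phi> k x\<bar> powr p) \<partial>lborel) + (\<integral>\<^sup>+x. ennreal (\<bar>\<phi> k x - f x\<bar> powr p) \<partial>lborel)))"
        by (subst nn_integral_cmult, measurable, subst nn_integral_add, measurable, subst nn_integral_add, measurable)
      also have "\<dots> \<le> ennreal (4 powr p) * (ennreal (e k) + (ennreal (norm y powr p * (2 powr p * (e' k + G))) + ennreal (e k)))"
        unfolding n1 n1' by (intro mult_left_mono add_mono n2 order_refl) auto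
      also have "\<dots> = ennreal (4 powr p * (2 * e k + norm y powr p * (2 powr p * (e' k + G))))"
        using G0 by (simp add: ennreal_mult'[symmetric] ennreal_plus[symmetric] del: ennreal_plus)
      finally show ?thesis .
    qed
    have el: "e \<longlonglongrightarrow> 0" "e' \<longlonglongrightarrow> 0" using 1(12,13) by (auto simp: e_def[abs_def] e'_def[abs_def])
    have "(\<lambda>k. ennreal (4 powr p * (2 * e k + norm y powr p * (2 powr p * (e' k + G))))) \<longlonglongrightarrow>
      ennreal (4 powr p * (2 * 0 + norm y powr p * (2 powr p * (0 + G))))"
      by (intro tendsto_ennrealI tendsto_intros el)
    then have "(\<integral>\<^sup>+x. ennreal (\<bar>f (x + y) - f x\<bar> powr p) \<partial>lborel) \<le> ennreal (4 powr p * (2 * 0 + norm y powr p * (2 powr p * (0 + G))))"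
      by (rule tendsto_lowerbound) (use bd in \<open>auto intro: always_eventually\<close>)
    also have "4 powr p * (2 * 0 + norm y powr p * (2 powr p * (0 + G))) = 8 powr p * norm y powr p * G"
      using powr_mult[of 4 2 p] by simp
    finally show ?case by (simp add: G_def)
  qed
qed

section \<open>The Gagliardo--Nirenberg inequality\<close>

text \<open>Where \<open>|f x| > L\<close>, the value is compared with the mean of
  \<open>|f|\<close> over the ball of radius \<open>r\<close> around \<open>x\<close>. The radius is
  chosen so that the L^2 bound forces this mean to be at most \<open>L/2\<close>; hence the mean of
  \<open>|f (x + y) - f x|\<close> over the ball is at least \<open>L/2\<close>. Raising to the
  power \<open>p\<close> by Jensen, integrating in \<open>x\<close> and applying the translation
  estimate for \<open>norm y < r\<close> bounds the measure of the level set.\<close>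

lemma W0_pair_weak_type:
  fixes f :: "real^'n \<Rightarrow> real"
  defines "c1 \<equiv> measure lborel (ball 0 1 :: (real^'n) set)"
  assumes W: "W0_pair p \<Omega> f g" and p: "p > 1"
    and f2: "integrable lborel (\<lambda>x. (f x)\<^sup>2)" and b: "(\<integral>x. (f x)\<^sup>2 \<partial>lborel) \<le> b" "b > 0" and L: "L > 0"
  shows "emeasure lborel {x. L < \<bar>f x\<bar>} \<le>
    ennreal (16 powr p * L powr (- p) * (4 * b / (c1 * L\<^sup>2)) powr (p / real CARD('n)) * (\<integral>x. norm (g x) powr p \<partial>lborel))"
proof -
  define N where "N = CARD('n)"
  \<comment> \<open>\<open>X\<close> is \<open>r^N\<close> for the radius that makes the volume of
    the ball equal to \<open>4 b / L^2\<close>.\<close>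
  define X where "X = 4 * b / (c1 * L\<^sup>2)"
  define r where "r = X powr (1 / real N)"
  define V where "V = measure lborel (ball 0 r :: (real^'n) set)"
  define G where "G = (\<integral>x. norm (g x) powr p \<partial>lborel)"
  have G0: "G \<ge> 0" by (simp add: G_def)
  have N: "N > 0" by (simp add: N_def)
  have c1: "c1 > 0" unfolding c1_def by simp
  have X: "X > 0" using b L c1 by (simp add: X_def)
  have r: "r > 0" using X by (simp add: r_def)
  have rN: "r ^ N = X" using X N by (simp add: r_def powr_realpow[symmetric] powr_powr)
  have V: "V = 4 * b / L\<^sup>2"
  proof -
    have "V = r ^ N * c1" unfolding V_def c1_def N_def
      using content_ball_conv_unit_ball[of r "0 :: real^'n"] r by simp
    then show ?thesis using c1 by (simp add: rN X_def)
  qed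
  have V0: "V > 0" using V b L by simp
  have fm[measurable]: "f \<in> borel_measurable borel" and fp: "integrable lborel (\<lambda>x. \<bar>f x\<bar> powr p)"
    using W by (auto simp: W0_pair_def)
  let ?B = "ball 0 r :: (real^'n) set"
  have Bm[measurable]: "?B \<in> sets borel" by simp
  have finB: "emeasure lborel ?B < \<infinity>" by (rule emeasure_bounded_finite) simp
  have iB: "integrable lborel (\<lambda>y. indicator ?B y :: real)" using finB by (simp add: integrable_real_indicator)
  have t2: "integrable lborel (\<lambda>y. (f (x + y))\<^sup>2)" for x
    using integrable_lborel_translation[OF f2, of x] by (simp add: add.commute)
  have tp: "integrable lborel (\<lambda>y. \<bar>f (x + y)\<bar> powr p)" for x
    using integrable_lborel_translation[OF fp, of x] by (simp add: add.commute)
  have pt: "ennreal ((L / 2) powr p) \<le> ennreal (1 / V) * (\<integral>\<^sup>+y. indicator ?B y * ennreal (\<bar>f (x + y) - f x\<bar> powr p) \<partial>lborel)"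
    if x: "L < \<bar>f x\<bar>" for x
  proof -
    have i2: "integrable lborel (\<lambda>y. indicator ?B y * \<bar>f (x + y)\<bar> powr 2)"
      using integrable_mult_indicator[OF _ t2, of ?B x] by simp
    have i1: "integrable lborel (\<lambda>y. indicator ?B y * \<bar>f (x + y)\<bar>)"
    proof (rule Bochner_Integration.integrable_bound)
      show "integrable lborel (\<lambda>y. indicator ?B y + indicator ?B y * \<bar>f (x + y)\<bar> powr 2)" using iB i2 by simp
      show "AE y in lborel. norm (indicator ?B y * \<bar>f (x + y)\<bar>) \<le> norm (indicator ?B y + indicator ?B y * \<bar>f (x + y)\<bar> powr 2)"
        using le_one_add_powr[of 2 "\<bar>f (x + _)\<bar>"] by (intro AE_I2) (auto simp: indicator_def)
    qed measurable
    \<comment> \<open>Jensen with exponent 2 bounds the square of the mean by \<open>b / V\<close>,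
      which is \<open>(L/2)^2\<close> by the choice of the radius.\<close>
    have "((\<integral>y. indicator ?B y * \<bar>f (x + y)\<bar> \<partial>lborel) / V) powr 2 \<le> (\<integral>y. indicator ?B y * \<bar>f (x + y)\<bar> powr 2 \<partial>lborel) / V"
      unfolding V_def by (rule set_Jensen_powr) (use i1 i2 finB V0 in \<open>auto simp: V_def\<close>)
    also have "\<dots> \<le> b / V"
    proof (rule divide_right_mono)
      have "(\<integral>y. indicator ?B y * \<bar>f (x + y)\<bar> powr 2 \<partial>lborel) \<le> (\<integral>y. (f (x + y))\<^sup>2 \<partial>lborel)"
        by (rule integral_mono[OF i2 t2]) (auto simp: indicator_def)
      also have "\<dots> = (\<integral>y. (f y)\<^sup>2 \<partial>lborel)"
        using integral_lborel_translation[of "\<lambda>y. (f y)\<^sup>2" x] by (simp add: add.commute)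
      finally show "(\<integral>y. indicator ?B y * \<bar>f (x + y)\<bar> powr 2 \<partial>lborel) \<le> b" using b by simp
    qed (use V0 in simp)
    also have "\<dots> = (L / 2)\<^sup>2" using V b L by (simp add: power_divide)
    finally have "((\<integral>y. indicator ?B y * \<bar>f (x + y)\<bar> \<partial>lborel) / V)\<^sup>2 \<le> (L / 2)\<^sup>2"
      using V0 by (simp add: powr_numeral)
    then have "(\<integral>y. indicator ?B y * \<bar>f (x + y)\<bar> \<partial>lborel) / V \<le> L / 2"
      by (rule power2_le_imp_le) (use L in simp)
    then have avg: "(\<integral>y. indicator ?B y * \<bar>f (x + y)\<bar> \<partial>lborel) \<le> V * L / 2"
      using V0 by (simp add: pos_divide_le_eq mult.commute)
    define D where "D y = \<bar>f (x + y) - f x\<bar>" for y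
    have [measurable]: "D \<in> borel_measurable borel" unfolding D_def by measurable
    have i3: "integrable lborel (\<lambda>y. indicator ?B y * D y)"
    proof (rule Bochner_Integration.integrable_bound)
      show "integrable lborel (\<lambda>y. indicator ?B y * \<bar>f (x + y)\<bar> + \<bar>f x\<bar> * indicator ?B y)" using iB i1 by simp
      show "AE y in lborel. norm (indicator ?B y * D y) \<le> norm (indicator ?B y * \<bar>f (x + y)\<bar> + \<bar>f x\<bar> * indicator ?B y)"
        by (intro AE_I2) (auto simp: indicator_def D_def)
    qed measurable
    have i4: "integrable lborel (\<lambda>y. indicator ?B y * D y powr p)"
    proof (rule Bochner_Integration.integrable_bound)
      have "integrable lborel (\<lambda>y. indicator ?B y * \<bar>f (x + y)\<bar> powr p)"
        using integrable_mult_indicator[OF _ tp, of ?B x] by simp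
      then show "integrable lborel (\<lambda>y. 2 powr p * (indicator ?B y * \<bar>f (x + y)\<bar> powr p + \<bar>f x\<bar> powr p * indicator ?B y))" using iB by simp
      have "D y powr p \<le> 2 powr p * (\<bar>f (x + y)\<bar> powr p + \<bar>f x\<bar> powr p)" for y
        unfolding D_def using norm_diff_powr_le[of p "f (x + y)" "f x"] p by simp
      then show "AE y in lborel. norm (indicator ?B y * D y powr p) \<le> norm (2 powr p * (indicator ?B y * \<bar>f (x + y)\<bar> powr p + \<bar>f x\<bar> powr p * indicator ?B y))"
        by (intro AE_I2) (auto simp: indicator_def)
    qed measurable
    \<comment> \<open>The reverse triangle inequality, integrated over the ball: what
      \<open>|f x|\<close> exceeds of the mean is paid for by the oscillation.\<close>
    have "\<bar>f x\<bar> * V - (\<integral>y. indicator ?B y * \<bar>f (x + y)\<bar> \<partial>lborel) =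
        (\<integral>y. \<bar>f x\<bar> * indicator ?B y - indicator ?B y * \<bar>f (x + y)\<bar> \<partial>lborel)"
      using iB i1 by (simp add: V_def)
    also have "\<dots> \<le> (\<integral>y. indicator ?B y * D y \<partial>lborel)"
      by (rule integral_mono) (use iB i1 i3 in \<open>auto simp: indicator_def D_def\<close>)
    finally have "\<bar>f x\<bar> * V - V * L / 2 \<le> (\<integral>y. indicator ?B y * D y \<partial>lborel)" using avg by simp
    moreover have "L * V \<le> \<bar>f x\<bar> * V" using x V0 by simp
    ultimately have "V * (L / 2) \<le> (\<integral>y. indicator ?B y * D y \<partial>lborel)" by (simp add: algebra_simps)
    then have "L / 2 \<le> (\<integral>y. indicator ?B y * D y \<partial>lborel) / V" using V0 by (simp add: field_simps)
    then have "(L / 2) powr p \<le> ((\<integral>y. indicator ?B y * D y \<partial>lborel) / V) powr p"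
      using L p by (intro powr_mono2) auto
    also have "\<dots> \<le> (\<integral>y. indicator ?B y * D y powr p \<partial>lborel) / V"
      unfolding V_def by (rule set_Jensen_powr) (use i3 i4 finB V0 p in \<open>auto simp: V_def D_def\<close>)
    finally have "ennreal ((L / 2) powr p) \<le> ennreal (1 / V) * ennreal (\<integral>y. indicator ?B y * D y powr p \<partial>lborel)"
      using V0 by (simp add: ennreal_mult'[symmetric] ennreal_leI)
    also have "ennreal (\<integral>y. indicator ?B y * D y powr p \<partial>lborel) = (\<integral>\<^sup>+y. ennreal (indicator ?B y * D y powr p) \<partial>lborel)"
      by (rule nn_integral_eq_integral[symmetric, OF i4]) auto
    also have "\<dots> = (\<integral>\<^sup>+y. indicator ?B y * ennreal (\<bar>f (x + y) - f x\<bar> powr p) \<partial>lborel)"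
      by (intro nn_integral_cong) (auto simp: indicator_def D_def)
    finally show ?thesis .
  qed
  let ?E = "{x. L < \<bar>f x\<bar>}"
  have [measurable]: "?E \<in> sets borel" by measurable
  have "ennreal ((L / 2) powr p) * emeasure lborel ?E = (\<integral>\<^sup>+x. ennreal ((L / 2) powr p) * indicator ?E x \<partial>lborel)"
    by (subst nn_integral_cmult_indicator) auto
  also have "\<dots> \<le> (\<integral>\<^sup>+x. ennreal (1 / V) * (\<integral>\<^sup>+y. indicator ?B y * ennreal (\<bar>f (x + y) - f x\<bar> powr p) \<partial>lborel) \<partial>lborel)"
    using pt by (intro nn_integral_mono) (auto simp: indicator_def)
  also have "\<dots> = ennreal (1 / V) * (\<integral>\<^sup>+x. (\<integral>\<^sup>+y. indicator ?B y * ennreal (\<bar>f (x + y) - f x\<bar> powr p) \<partial>lborel) \<partial>lborel)"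
    by (rule nn_integral_cmult) measurable
  also have "(\<integral>\<^sup>+x. (\<integral>\<^sup>+y. indicator ?B y * ennreal (\<bar>f (x + y) - f x\<bar> powr p) \<partial>lborel) \<partial>lborel) =
     (\<integral>\<^sup>+y. (\<integral>\<^sup>+x. indicator ?B y * ennreal (\<bar>f (x + y) - f x\<bar> powr p) \<partial>lborel) \<partial>lborel)"
    by (rule lborel_pair.Fubini'[symmetric]) measurable
  also have "\<dots> \<le> (\<integral>\<^sup>+y. ennreal (8 powr p * r powr p * G) * indicator ?B y \<partial>lborel)"
  proof (rule nn_integral_mono)
    fix y :: "real^'n"
    have "(\<integral>\<^sup>+x. indicator ?B y * ennreal (\<bar>f (x + y) - f x\<bar> powr p) \<partial>lborel) =
        indicator ?B y * (\<integral>\<^sup>+x. ennreal (\<bar>f (x + y) - f x\<bar> powr p) \<partial>lborel)"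
      by (rule nn_integral_cmult) measurable
    also have "\<dots> \<le> ennreal (8 powr p * r powr p * G) * indicator ?B y"
    proof (cases "y \<in> ?B")
      case True
      then have "norm y powr p \<le> r powr p" using p by (intro powr_mono2) auto
      then have "8 powr p * norm y powr p * G \<le> 8 powr p * r powr p * G"
        using G0 by (intro mult_right_mono mult_left_mono) auto
      then show ?thesis
        using order_trans[OF W0_pair_translation_powr[OF W p, of y] ennreal_leI] True by (simp add: G_def)
    qed simp
    finally show "(\<integral>\<^sup>+x. indicator ?B y * ennreal (\<bar>f (x + y) - f x\<bar> powr p) \<partial>lborel) \<le> ennreal (8 powr p * r powr p * G) * indicator ?B y" .
  qed
  also have "(\<integral>\<^sup>+y. ennreal (8 powr p * r powr p * G) * indicator ?B y \<partial>lborel) = ennreal (8 powr p * r powr p * G) * ennreal V"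
    using finB by (subst nn_integral_cmult_indicator) (auto simp: V_def emeasure_eq_ennreal_measure)
  also have "ennreal (1 / V) * (ennreal (8 powr p * r powr p * G) * ennreal V) = ennreal (8 powr p * r powr p * G)"
    using V0 G0 by (simp add: ennreal_mult'[symmetric])
  finally have main: "ennreal ((L / 2) powr p) * emeasure lborel ?E \<le> ennreal (8 powr p * r powr p * G)"
    by (simp add: mult_left_mono)
  have "emeasure lborel ?E = ennreal ((L / 2) powr (- p)) * (ennreal ((L / 2) powr p) * emeasure lborel ?E)"
    using L by (simp add: mult.assoc[symmetric] ennreal_mult'[symmetric] powr_add[symmetric])
  also have "\<dots> \<le> ennreal ((L / 2) powr (- p)) * ennreal (8 powr p * r powr p * G)"
    by (intro mult_left_mono main) auto
  also have "\<dots> = ennreal ((L / 2) powr (- p) * (8 powr p * r powr p * G))"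
    by (simp add: ennreal_mult'[symmetric])
  \<comment> \<open>The constant 16 collects the 8 of the translation estimate and the 2 from the
    level \<open>L/2\<close>.\<close>
  also have "(L / 2) powr (- p) * (8 powr p * r powr p * G) = 16 powr p * L powr (- p) * X powr (p / real N) * G"
  proof -
    have A: "(L / 2) powr (- p) = L powr (- p) * 2 powr p" using L by (simp add: powr_divide powr_minus_divide)
    have B: "r powr p = X powr (p / real N)" by (simp add: r_def powr_powr)
    have C: "2 powr p * 8 powr p = (16::real) powr p" by (simp add: powr_mult[symmetric])
    show ?thesis unfolding A B C[symmetric] by (simp only: mult_ac)
  qed
  finally show ?thesis by (simp add: X_def G_def N_def)
qed

text \<open>The quantity \<open>d\<close> is the derivative at \<open>s\<close> of the truncation
  \<open>L s^2 / (L^2 + s^2)\<close>. With \<open>a = |s|\<close>, the first bound is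
  \<open>2 L a \<le> L^2 + a^2\<close>. The bracket in the second is a difference between the levels
  \<open>L\<close> and \<open>2 L\<close> of one and the same expression and equals
  \<open>L a / ((L + 2 a)(L + a))\<close>; summed over dyadic levels it telescopes.\<close>

lemma truncation_derivative_bounds:
  fixes L s :: real
  assumes L: "L > 0"
  defines "d \<equiv> 2 * L ^ 3 * s / (L\<^sup>2 + s\<^sup>2)\<^sup>2"
  shows "\<bar>d\<bar> \<le> 1" "\<bar>d\<bar> \<le> 7 * (2 * \<bar>s\<bar> / (L + 2 * \<bar>s\<bar>) - 2 * \<bar>s\<bar> / (2 * L + 2 * \<bar>s\<bar>))"
proof -
  define a where "a = \<bar>s\<bar>"
  have a: "a \<ge> 0" "s\<^sup>2 = a\<^sup>2" by (auto simp: a_def)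
  have pos: "L\<^sup>2 + a\<^sup>2 > 0" using L by (simp add: add_pos_nonneg)
  have d: "\<bar>d\<bar> = 2 * L ^ 3 * a / (L\<^sup>2 + a\<^sup>2)\<^sup>2"
    unfolding d_def a(2) using L by (simp add: abs_mult a_def[symmetric])
  have "2 * (L * a) \<le> L\<^sup>2 + a\<^sup>2" using sum_squares_bound[of L a] by simp
  then have "2 * (L * a) * L\<^sup>2 \<le> (L\<^sup>2 + a\<^sup>2) * (L\<^sup>2 + a\<^sup>2)"
    using L a by (intro mult_mono) auto
  then have "2 * L ^ 3 * a \<le> (L\<^sup>2 + a\<^sup>2)\<^sup>2" by (simp add: power2_eq_square power3_eq_cube mult_ac)
  moreover have "(L\<^sup>2 + a\<^sup>2)\<^sup>2 > 0" using pos by (rule zero_less_power)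
  ultimately show "\<bar>d\<bar> \<le> 1" by (simp only: d divide_le_eq_1_pos)
  \<comment> \<open>After clearing denominators the claim reduces to
    \<open>2 L^2 + 6 L a + 4 a^2 \<le> 7 (L^2 + a^2)\<close>; the mixed term is estimated by
    \<open>3 (L^2 + a^2)\<close>, so 7 is the largest resulting coefficient.\<close>
  have "2 * L ^ 3 * a * ((L + 2 * a) * (L + a)) \<le> 7 * (L * a) * (L\<^sup>2 + a\<^sup>2)\<^sup>2"
  proof -
    have sq: "2 * (L * a) \<le> L\<^sup>2 + a\<^sup>2" using sum_squares_bound[of L a] by simp
    have "2 * L\<^sup>2 * ((L + 2 * a) * (L + a)) = L\<^sup>2 * (2 * L\<^sup>2 + 6 * (L * a) + 4 * a\<^sup>2)"
      by (simp add: power2_eq_square algebra_simps)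
    also have "\<dots> \<le> L\<^sup>2 * (7 * (L\<^sup>2 + a\<^sup>2))"
    proof (rule mult_left_mono)
      show "2 * L\<^sup>2 + 6 * (L * a) + 4 * a\<^sup>2 \<le> 7 * (L\<^sup>2 + a\<^sup>2)"
      proof -
        have "2 * l + 6 * m + 4 * n \<le> 7 * (l + n)" if "2 * m \<le> l + n" "0 \<le> l" "0 \<le> n" for l m n :: real
          using that by (simp add: field_simps)
        from this[OF sq] show ?thesis by simp
      qed
    qed simp
    also have "\<dots> \<le> (L\<^sup>2 + a\<^sup>2) * (7 * (L\<^sup>2 + a\<^sup>2))" by (intro mult_right_mono) auto
    also have "\<dots> = 7 * (L\<^sup>2 + a\<^sup>2)\<^sup>2" unfolding power2_eq_square[of "L\<^sup>2 + a\<^sup>2"] by simp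
    finally have "2 * L\<^sup>2 * ((L + 2 * a) * (L + a)) \<le> 7 * (L\<^sup>2 + a\<^sup>2)\<^sup>2" .
    then have "(L * a) * (2 * L\<^sup>2 * ((L + 2 * a) * (L + a))) \<le> (L * a) * (7 * (L\<^sup>2 + a\<^sup>2)\<^sup>2)"
      using L a by (intro mult_left_mono) auto
    moreover have "2 * L ^ 3 * a * P = (L * a) * (2 * L\<^sup>2 * P)" "7 * (L * a) * P = (L * a) * (7 * P)" for P
      by (simp_all add: power2_eq_square power3_eq_cube)
    ultimately show ?thesis by (simp only:)
  qed
  then have "2 * L ^ 3 * a / (L\<^sup>2 + a\<^sup>2)\<^sup>2 \<le> 7 * (L * a) / ((L + 2 * a) * (L + a))"
    using pos L a by (simp add: divide_le_eq le_divide_eq mult_ac)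
  also have "\<dots> = 7 * (2 * a / (L + 2 * a) - 2 * a / (2 * L + 2 * a))"
  proof -
    have "L + 2 * a \<noteq> 0" "L + a \<noteq> 0" using L a by auto
    moreover have "2 * a / (2 * L + 2 * a) = a / (L + a)"
      by (metis distrib_left mult_divide_mult_cancel_left zero_neq_numeral)
    ultimately show ?thesis by (simp add: divide_simps) (simp add: algebra_simps)
  qed
  finally show "\<bar>d\<bar> \<le> 7 * (2 * \<bar>s\<bar> / (L + 2 * \<bar>s\<bar>) - 2 * \<bar>s\<bar> / (2 * L + 2 * \<bar>s\<bar>))"
    by (simp only: d a_def)
qed

text \<open>Maz'ya's truncation method: the weak type estimate is applied to the smooth truncations
  \<open>L f\<^sup>2 / (L\<^sup>2 + f\<^sup>2)\<close> at the dyadic levels \<open>L = 2\<^sup>j\<close>; the derivatives sum up to a bounded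
  quantity by a telescoping estimate.\<close>

lemma W0_pair_Gagliardo_Nirenberg:
  fixes f :: "real^'n \<Rightarrow> real" and p :: real
  defines "c1 \<equiv> measure lborel (ball 0 1 :: (real^'n) set)"
  defines "q \<equiv> p * (real CARD('n) + 2) / real CARD('n)"
  assumes W: "W0_pair p \<Omega> f g" and p: "p > 1" and \<Omega>: "\<Omega> \<in> sets borel"
    and f2: "integrable lborel (\<lambda>x. (f x)\<^sup>2)" and b: "(\<integral>x. (f x)\<^sup>2 \<partial>lborel) \<le> b" "b > 0"
  shows "(\<integral>\<^sup>+x. ennreal (\<bar>f x\<bar> powr q) \<partial>lborel) \<le> emeasure lborel \<Omega> +
    ennreal (7 * 4 powr q * 16 powr p * (4 * b / c1) powr (p / real CARD('n))) * (\<integral>\<^sup>+x. ennreal (norm (g x) powr p) \<partial>lborel)"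
proof -
  define N where "N = real CARD('n)"
  have N: "N > 0" by (simp add: N_def)
  have q: "q = p + 2 * (p / N)" using N by (simp add: q_def N_def field_simps)
  have q0: "q > 0" using p N by (simp add: q add_pos_nonneg)
  have c1: "c1 > 0" unfolding c1_def by simp
  have fm[measurable]: "f \<in> borel_measurable borel" and gm[measurable]: "g \<in> borel_measurable borel"
    and f0: "\<And>x. x \<notin> \<Omega> \<Longrightarrow> f x = 0" and gp: "integrable lborel (\<lambda>x. norm (g x) powr p)"
    using W by (auto simp: W0_pair_def)
  define K where "K = 4 powr q * 16 powr p * (4 * b / c1) powr (p / N)"
  define d where "d j x = 2 * (2 ^ j) ^ 3 * f x / ((2 ^ j)\<^sup>2 + (f x)\<^sup>2)\<^sup>2" for j :: nat and x
  have [measurable]: "d j \<in> borel_measurable borel" for j unfolding d_def by measurable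
  define E where "E j = {x. (2::real) ^ j < \<bar>f x\<bar>}" for j :: nat
  have [measurable]: "E j \<in> sets borel" for j unfolding E_def by measurable
  have level: "ennreal ((2 * 2 ^ j) powr q) * emeasure lborel (E j) \<le>
      ennreal K * (\<integral>\<^sup>+x. ennreal (\<bar>d j x\<bar> powr p * norm (g x) powr p) \<partial>lborel)" for j
  proof -
    define L :: real where "L = 2 ^ j"
    have L: "L > 0" by (simp add: L_def)
    have pos: "L\<^sup>2 + s\<^sup>2 > 0" for s using L by (simp add: add_pos_nonneg)
    then have ne: "L\<^sup>2 + s\<^sup>2 \<noteq> 0" for s by (metis less_irrefl)
    \<comment> \<open>\<open>H\<close> is smooth, vanishes at 0 and satisfies
      \<open>|H s| \<le> |s|\<close>, so \<open>H \<circ> f\<close> inherits both the Sobolev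
      property and the L^2 bound \<open>b\<close>. Its gradient is concentrated where
      \<open>|f|\<close> is comparable to \<open>L\<close>.\<close>
    define H where "H s = L * s\<^sup>2 / (L\<^sup>2 + s\<^sup>2)" for s
    define H' where "H' s = 2 * L ^ 3 * s / (L\<^sup>2 + s\<^sup>2)\<^sup>2" for s
    have smooth: "continuously_diff k H" for k
    proof -
      have ne': "L * L + s * s \<noteq> 0" for s using ne[of s] by (simp add: power2_eq_square)
      have id: "continuously_diff k (\<lambda>s::real. s)" by (rule continuously_diff_bounded_linear) (rule bounded_linear_ident)
      have "continuously_diff k (\<lambda>s. (L * (s * s)) * inverse (L * L + s * s))"
        by (intro continuously_diff_mult continuously_diff_inverse continuously_diff_add continuously_diff_const id ne')
      moreover have "(\<lambda>s. (L * (s * s)) * inverse (L * L + s * s)) = H"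
        by (auto simp: H_def power2_eq_square divide_inverse)
      ultimately show ?thesis by simp
    qed
    have der: "(H has_real_derivative H' s) (at s)" for s
    proof -
      have "(H has_real_derivative (L * (2 * s) * (L\<^sup>2 + s\<^sup>2) - L * s\<^sup>2 * (2 * s)) / ((L\<^sup>2 + s\<^sup>2) * (L\<^sup>2 + s\<^sup>2))) (at s)"
        unfolding H_def[abs_def] using ne[of s] by (auto intro!: derivative_eq_intros)
      also have "(L * (2 * s) * (L\<^sup>2 + s\<^sup>2) - L * s\<^sup>2 * (2 * s)) / ((L\<^sup>2 + s\<^sup>2) * (L\<^sup>2 + s\<^sup>2)) = H' s"
        unfolding H'_def by (rule arg_cong2[where f="(/)"]) (simp_all add: power2_eq_square power3_eq_cube algebra_simps)
      finally show ?thesis .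
    qed
    have cont: "continuous_on UNIV H'" unfolding H'_def using ne by (intro continuous_intros) auto
    have H'1: "\<bar>H' s\<bar> \<le> 1" for s unfolding H'_def by (rule truncation_derivative_bounds(1)[OF L])
    have Hle: "\<bar>H s\<bar> \<le> \<bar>s\<bar>" for s
    proof -
      have "L * \<bar>s\<bar> \<le> L\<^sup>2 + s\<^sup>2"
      proof -
        have "0 \<le> L * \<bar>s\<bar>" using L by simp
        moreover have "2 * (L * \<bar>s\<bar>) \<le> L\<^sup>2 + s\<^sup>2"
          using sum_squares_bound[of L "\<bar>s\<bar>"] by (simp add: mult.assoc)
        ultimately show ?thesis by linarith
      qed
      then have "\<bar>s\<bar> * (L * \<bar>s\<bar>) \<le> \<bar>s\<bar> * (L\<^sup>2 + s\<^sup>2)" by (intro mult_left_mono) auto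
      then have "L * s\<^sup>2 \<le> \<bar>s\<bar> * (L\<^sup>2 + s\<^sup>2)" by (simp add: power2_eq_square abs_mult[symmetric] mult_ac)
      then show ?thesis using L pos[of s] by (simp add: H_def abs_mult divide_le_eq)
    qed
    have Hgt: "L / 2 < \<bar>H s\<bar>" if "L < \<bar>s\<bar>" for s
    proof -
      have "L\<^sup>2 < s\<^sup>2" using that L by (metis abs_le_square_iff abs_of_pos not_le)
      then have "L * (L\<^sup>2 + s\<^sup>2) < L * s\<^sup>2 * 2" using L by simp
      then have "L / 2 < H s" unfolding H_def using pos[of s] by (simp add: less_divide_eq)
      then show ?thesis by linarith
    qed
    have WH: "W0_pair p \<Omega> (\<lambda>x. H (f x)) (\<lambda>x. H' (f x) *\<^sub>R g x)"
      by (rule W0_pair_compose[OF W p smooth _ der cont H'1]) (simp add: H_def)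
    have [measurable]: "H \<in> borel_measurable borel" using smooth[of 0] by (auto intro: borel_measurable_continuous_onI)
    have Hsq: "(H s)\<^sup>2 \<le> s\<^sup>2" for s using Hle[of s] by (simp add: abs_le_square_iff)
    have H2: "integrable lborel (\<lambda>x. (H (f x))\<^sup>2)"
      by (rule Bochner_Integration.integrable_bound[OF f2]) (use Hsq in auto)
    have "(\<integral>x. (H (f x))\<^sup>2 \<partial>lborel) \<le> (\<integral>x. (f x)\<^sup>2 \<partial>lborel)"
      by (rule integral_mono[OF H2 f2]) (use Hsq in auto)
    then have Hb: "(\<integral>x. (H (f x))\<^sup>2 \<partial>lborel) \<le> b" using b by simp
    have iWH: "integrable lborel (\<lambda>x. norm (H' (f x) *\<^sub>R g x) powr p)" using WH by (auto simp: W0_pair_def)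
    have "emeasure lborel (E j) \<le> emeasure lborel {x. L / 2 < \<bar>H (f x)\<bar>}"
      by (rule emeasure_mono) (use Hgt in \<open>auto simp: E_def L_def\<close>)
    \<comment> \<open>The weak type estimate is used at level \<open>L/2\<close>, since
      \<open>|f| > L\<close> implies only \<open>H(f) > L/2\<close>.\<close>
    also have "\<dots> \<le> ennreal (16 powr p * (L / 2) powr (- p) * (4 * b / (c1 * (L / 2)\<^sup>2)) powr (p / real CARD('n)) * (\<integral>x. norm (H' (f x) *\<^sub>R g x) powr p \<partial>lborel))"
      unfolding c1_def by (rule W0_pair_weak_type[OF WH p H2 Hb b(2)]) (use L in simp)
    finally have "ennreal ((2 * L) powr q) * emeasure lborel (E j) \<le>
       ennreal ((2 * L) powr q) * ennreal (16 powr p * (L / 2) powr (- p) * (4 * b / (c1 * (L / 2)\<^sup>2)) powr (p / N) * (\<integral>x. norm (H' (f x) *\<^sub>R g x) powr p \<partial>lborel))"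
      unfolding N_def by (intro mult_left_mono) auto
    also have "\<dots> = ennreal (K * (\<integral>x. norm (H' (f x) *\<^sub>R g x) powr p \<partial>lborel))"
    proof -
      have 1: "(4 * b / (c1 * (L / 2)\<^sup>2)) powr (p / N) = (4 * b / c1) powr (p / N) * (L / 2) powr (- (2 * (p / N)))"
      proof -
        have "4 * b / (c1 * (L / 2)\<^sup>2) = (4 * b / c1) * (L / 2) powr (-2)"
        proof -
          have "(L / 2) powr (-2) = inverse ((L / 2)\<^sup>2)"
            unfolding powr_minus using L by (subst powr_numeral) auto
          then show ?thesis by (simp only: divide_inverse[of _ "c1 * _"] inverse_mult_distrib) (simp only: divide_inverse mult.assoc)
        qed
        then have "(4 * b / (c1 * (L / 2)\<^sup>2)) powr (p / N) = ((4 * b / c1) * (L / 2) powr (-2)) powr (p / N)"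
          by (simp only:)
        also have "\<dots> = (4 * b / c1) powr (p / N) * ((L / 2) powr (-2)) powr (p / N)"
          by (rule powr_mult)
        also have "((L / 2) powr (-2)) powr (p / N) = (L / 2) powr (- (2 * (p / N)))"
          unfolding powr_powr by simp
        finally show ?thesis .
      qed
      \<comment> \<open>Since \<open>q = p + 2 p / N\<close>, the powers of \<open>L/2\<close>
        cancel exactly against those from the weak type estimate. Only \<open>4 powr q\<close>
        remains, so the constant \<open>K\<close> is the same at every level.\<close>
      have "(2 * L) powr q = 4 powr q * (L / 2) powr q"
        using powr_mult[of 4 "L/2" q] L by simp
      also have "\<dots> = 4 powr q * ((L / 2) powr p * (L / 2) powr (2 * (p / N)))"
        by (simp only: q powr_add)
      finally have 2: "(2 * L) powr q = 4 powr q * ((L / 2) powr p * (L / 2) powr (2 * (p / N)))" .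
      have 3: "(L / 2) powr p * (L / 2) powr (- p) = 1" "(L / 2) powr (2 * (p / N)) * (L / 2) powr (- (2 * (p / N))) = 1"
        using L by (simp_all add: powr_add[symmetric])
      have "(2 * L) powr q * (16 powr p * (L / 2) powr (- p) * (4 * b / (c1 * (L / 2)\<^sup>2)) powr (p / N)) =
        K * ((L / 2) powr p * (L / 2) powr (- p)) * ((L / 2) powr (2 * (p / N)) * (L / 2) powr (- (2 * (p / N))))"
        unfolding 1 2 K_def by (simp only: mult_ac)
      then have "(2 * L) powr q * (16 powr p * (L / 2) powr (- p) * (4 * b / (c1 * (L / 2)\<^sup>2)) powr (p / N)) = K"
        unfolding 3 by simp
      then have "(2 * L) powr q * (16 powr p * (L / 2) powr (- p) * (4 * b / (c1 * (L / 2)\<^sup>2)) powr (p / N) * (\<integral>x. norm (H' (f x) *\<^sub>R g x) powr p \<partial>lborel)) =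
        K * (\<integral>x. norm (H' (f x) *\<^sub>R g x) powr p \<partial>lborel)"
        by (simp only: mult.assoc[symmetric])
      then show ?thesis by (simp only: ennreal_mult'[symmetric] powr_ge_zero)
    qed
    also have "\<dots> = ennreal K * ennreal (\<integral>x. norm (H' (f x) *\<^sub>R g x) powr p \<partial>lborel)"
      by (intro ennreal_mult) (auto simp: K_def)
    also have "ennreal (\<integral>x. norm (H' (f x) *\<^sub>R g x) powr p \<partial>lborel) = (\<integral>\<^sup>+x. ennreal (norm (H' (f x) *\<^sub>R g x) powr p) \<partial>lborel)"
      by (rule nn_integral_eq_integral[symmetric, OF iWH]) auto
    also have "\<dots> = (\<integral>\<^sup>+x. ennreal (\<bar>d j x\<bar> powr p * norm (g x) powr p) \<partial>lborel)"
    proof -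
      have "H' (f x) = d j x" for x by (simp add: H'_def d_def L_def)
      then show ?thesis by (simp only: norm_scaleR powr_mult)
    qed
    finally show ?thesis by (simp add: L_def)
  qed
  \<comment> \<open>Because \<open>|d j x| \<le> 1\<close> and \<open>p > 1\<close>, the p-th powers
    are at most \<open>|d j x|\<close> itself, and the telescoping bound leaves
    \<open>7 (k 0 - k n) \<le> 7\<close>.\<close>
  have dsum: "(\<Sum>j. ennreal (\<bar>d j x\<bar> powr p)) \<le> 7" for x
  proof (rule suminf_le_const)
    fix n
    define k where "k j = 2 * \<bar>f x\<bar> / (2 ^ j + 2 * \<bar>f x\<bar>)" for j :: nat
    have dk: "\<bar>d j x\<bar> powr p \<le> 7 * (k j - k (Suc j))" for j
    proof -
      have 1: "\<bar>d j x\<bar> \<le> 1" "\<bar>d j x\<bar> \<le> 7 * (k j - k (Suc j))"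
        using truncation_derivative_bounds[of "2 ^ j" "f x"] by (auto simp: d_def k_def)
      have "\<bar>d j x\<bar> powr p \<le> \<bar>d j x\<bar> powr 1"
        using 1(1) p by (intro powr_mono') auto
      then show ?thesis using 1(2) by simp
    qed
    have "(\<Sum>j<n. ennreal (\<bar>d j x\<bar> powr p)) = ennreal (\<Sum>j<n. \<bar>d j x\<bar> powr p)"
      by (intro sum_ennreal) auto
    also have "\<dots> \<le> ennreal (\<Sum>j<n. 7 * (k j - k (Suc j)))"
      by (intro ennreal_leI sum_mono dk)
    also have "(\<Sum>j<n. 7 * (k j - k (Suc j))) = 7 * (k 0 - k n)"
      by (simp only: sum_distrib_left[symmetric] sum_lessThan_telescope')
    also have "ennreal (7 * (k 0 - k n)) \<le> ennreal 7"
    proof (rule ennreal_leI)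
      have "k 0 \<le> 1" "k n \<ge> 0" by (auto simp: k_def add_nonneg_nonneg)
      then show "7 * (k 0 - k n) \<le> 7" by simp
    qed
    finally show "(\<Sum>j<n. ennreal (\<bar>d j x\<bar> powr p)) \<le> 7" by simp
  qed simp
  \<comment> \<open>Values of size at most 1 are paid for by the indicator of \<Omega>. A larger
    value lies in a dyadic shell \<open>2^j < |f x| \<le> 2^(j+1)\<close>, which explains the factor
    \<open>2 * 2 ^ j\<close>; the exponent \<open>j\<close> is one less than the least
    \<open>n\<close> with \<open>|f x| \<le> 2^n\<close>.\<close>
  have pt: "ennreal (\<bar>f x\<bar> powr q) \<le> indicator \<Omega> x + (\<Sum>j. ennreal ((2 * 2 ^ j) powr q) * indicator (E j) x)" for x
  proof (cases "\<bar>f x\<bar> \<le> 1")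
    case True
    have "ennreal (\<bar>f x\<bar> powr q) \<le> indicator \<Omega> x"
    proof (cases "x \<in> \<Omega>")
      case True
      have "\<bar>f x\<bar> powr q \<le> 1" using \<open>\<bar>f x\<bar> \<le> 1\<close> powr_mono2[of q "\<bar>f x\<bar>" 1] q0 by simp
      then show ?thesis using True by simp
    next
      case False
      then show ?thesis using f0 by simp
    qed
    then show ?thesis by (rule order_trans) simp
  next
    case False
    define n where "n = (LEAST n. \<bar>f x\<bar> \<le> 2 ^ n)"
    obtain m where "\<bar>f x\<bar> < 2 ^ m" using real_arch_pow[of 2 "\<bar>f x\<bar>"] by auto
    then have n: "\<bar>f x\<bar> \<le> 2 ^ n" unfolding n_def by (metis LeastI less_imp_le)
    have "n \<noteq> 0"
    proof
      assume "n = 0"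
      with n False show False by simp
    qed
    then obtain j where j: "n = Suc j" by (metis not0_implies_Suc)
    have "\<not> \<bar>f x\<bar> \<le> 2 ^ j" using not_less_Least[of j "\<lambda>n. \<bar>f x\<bar> \<le> 2 ^ n"] j unfolding n_def by simp
    then have xE: "x \<in> E j" by (simp add: E_def)
    have "\<bar>f x\<bar> powr q \<le> (2 * 2 ^ j) powr q" using n j q0 by (intro powr_mono2) auto
    then have "ennreal (\<bar>f x\<bar> powr q) \<le> ennreal ((2 * 2 ^ j) powr q) * indicator (E j) x"
      using xE by (simp add: ennreal_leI)
    also have "\<dots> \<le> (\<Sum>j. ennreal ((2 * 2 ^ j) powr q) * indicator (E j) x)"
    proof -
      have "h j \<le> suminf h" for h :: "nat \<Rightarrow> ennreal" using sum_le_suminf[of h "{j}"] by simp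
      then show ?thesis .
    qed
    finally show ?thesis by (rule order_trans) simp
  qed
  have "(\<integral>\<^sup>+x. ennreal (\<bar>f x\<bar> powr q) \<partial>lborel) \<le> (\<integral>\<^sup>+x. indicator \<Omega> x + (\<Sum>j. ennreal ((2 * 2 ^ j) powr q) * indicator (E j) x) \<partial>lborel)"
    by (intro nn_integral_mono pt)
  also have "\<dots> = (\<integral>\<^sup>+x. indicator \<Omega> x \<partial>lborel) + (\<integral>\<^sup>+x. (\<Sum>j. ennreal ((2 * 2 ^ j) powr q) * indicator (E j) x) \<partial>lborel)"
    using \<Omega> by (intro nn_integral_add) auto
  also have "(\<integral>\<^sup>+x. (\<Sum>j. ennreal ((2 * 2 ^ j) powr q) * indicator (E j) x) \<partial>lborel) =
      (\<Sum>j. \<integral>\<^sup>+x. ennreal ((2 * 2 ^ j) powr q) * indicator (E j) x \<partial>lborel)"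
    by (intro nn_integral_suminf) auto
  also have "\<dots> = (\<Sum>j. ennreal ((2 * 2 ^ j) powr q) * emeasure lborel (E j))"
    by (simp add: nn_integral_cmult_indicator)
  also have "\<dots> \<le> (\<Sum>j. ennreal K * (\<integral>\<^sup>+x. ennreal (\<bar>d j x\<bar> powr p * norm (g x) powr p) \<partial>lborel))"
    by (intro suminf_le level) auto
  also have "\<dots> = (\<integral>\<^sup>+x. (\<Sum>j. ennreal K * ennreal (\<bar>d j x\<bar> powr p * norm (g x) powr p)) \<partial>lborel)"
    by (subst nn_integral_suminf) (auto simp: nn_integral_cmult)
  also have "\<dots> \<le> (\<integral>\<^sup>+x. ennreal (7 * K) * ennreal (norm (g x) powr p) \<partial>lborel)"
  proof (rule nn_integral_mono)
    fix x
    have "(\<Sum>j. ennreal K * ennreal (\<bar>d j x\<bar> powr p * norm (g x) powr p)) =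
       (\<Sum>j. (ennreal K * ennreal (norm (g x) powr p)) * ennreal (\<bar>d j x\<bar> powr p))"
      by (simp add: ennreal_mult mult_ac)
    also have "\<dots> = (ennreal K * ennreal (norm (g x) powr p)) * (\<Sum>j. ennreal (\<bar>d j x\<bar> powr p))"
      by (rule ennreal_suminf_cmult)
    also have "\<dots> \<le> (ennreal K * ennreal (norm (g x) powr p)) * 7"
      by (intro mult_left_mono dsum) auto
    also have "\<dots> = ennreal (7 * K) * ennreal (norm (g x) powr p)"
    proof -
      have "ennreal (7 * K) = 7 * ennreal K" by (subst ennreal_mult) (auto simp: K_def)
      then show ?thesis by (simp only: mult_ac)
    qed
    finally show "(\<Sum>j. ennreal K * ennreal (\<bar>d j x\<bar> powr p * norm (g x) powr p)) \<le> ennreal (7 * K) * ennreal (norm (g x) powr p)" .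
  qed
  also have "\<dots> = ennreal (7 * K) * (\<integral>\<^sup>+x. ennreal (norm (g x) powr p) \<partial>lborel)"
    by (rule nn_integral_cmult) measurable
  finally show ?thesis using \<Omega> by (simp add: K_def N_def mult.assoc add_left_mono)
qed

section \<open>Superposition and translation in Lebesgue spaces\<close>

text \<open>For an argument with finitely many values the composition is measurable piece by piece.
  Simple functions converge pointwise to \<open>s\<close>, and continuity in the second argument
  carries the limit through for almost every point.\<close>

lemma caratheodory_compose_measurable:
  fixes h :: "'z::euclidean_space \<Rightarrow> 's::euclidean_space \<Rightarrow> 'b::euclidean_space"
  assumes car: "caratheodory (lebesgue_on S) h" and S: "S \<in> sets borel"
    and s: "s \<in> borel_measurable (lebesgue_on S)"
  shows "(\<lambda>z. h z (s z)) \<in> borel_measurable (lebesgue_on S)"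
proof -
  let ?M = "lebesgue_on S"
  obtain F where F: "\<And>i. simple_function ?M (F i)" "\<And>x. x \<in> space ?M \<Longrightarrow> (\<lambda>i. F i x) \<longlonglongrightarrow> s x"
    using borel_measurable_implies_sequence_metric[OF s, of 0] by blast
  have m: "(\<lambda>z. h z (F i z)) \<in> borel_measurable ?M" for i
  proof (rule measurable_compose_countable'[where I="F i ` space ?M" and g="F i" and f="\<lambda>a z. h z a"])
    show "(\<lambda>z. h z a) \<in> borel_measurable ?M" for a
      using car by (simp add: caratheodory_def)
    have fin: "finite (F i ` space ?M)" and pre: "\<And>a. a \<in> F i ` space ?M \<Longrightarrow> F i -` {a} \<inter> space ?M \<in> sets ?M"
      using F(1)[of i] by (auto simp: simple_function_def)
    show "F i \<in> measurable ?M (count_space (F i ` space ?M))"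
      unfolding measurable_count_space_eq2[OF fin] using pre by auto
    show "countable (F i ` space ?M)" using fin by (rule countable_finite)
  qed
  \<comment> \<open>The total function \<open>lim\<close> is measurable in any case; it equals the
    composition only where \<open>h z\<close> is continuous, that is almost everywhere.\<close>
  have lim: "(\<lambda>z. lim (\<lambda>i. h z (F i z))) \<in> borel_measurable ?M"
    by (rule borel_measurable_lim_metric[OF m])
  have "AE z in ?M. continuous_on UNIV (h z)" using car by (simp add: caratheodory_def)
  then have "AE z in ?M. lim (\<lambda>i. h z (F i z)) = h z (s z)"
    using AE_space
  proof eventually_elim
    case (elim z)
    have "(\<lambda>i. h z (F i z)) \<longlonglongrightarrow> h z (s z)"
      using elim(1) F(2)[OF elim(2)]
      by (intro isCont_tendsto_compose[of _ "h z"]) (auto simp: continuous_on_eq_continuous_at)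
    then show ?case by (rule limI)
  qed
  then show ?thesis by (rule borel_measurable_lebesgue_on_cong_AE[OF lim S])
qed

section \<open>Duality pairings, density of continuous functions and continuity of
  translations\<close>

lemma conj_exp_bounds:
  assumes "p > 1"
  shows "conj_exp p > 1" "1 / conj_exp p + 1 / p = 1" "(p - 1) * conj_exp p = p" "conj_exp (conj_exp p) = p"
  using assms by (auto simp: conj_exp_def field_simps)

text \<open>The scale \<open>s\<close> redistributes weight between the two factors. A factor that
  is bounded but not small can be given a small coefficient, at the price of a large one on a factor
  that can be made arbitrarily small.\<close>

lemma Young_inner:
  fixes a b :: "'b::real_inner"
  assumes p: "p > 1" and s: "s > 0"
  shows "\<bar>a \<bullet> b\<bar> \<le> s powr (- conj_exp p) * norm a powr conj_exp p + s powr p * norm b powr p"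
proof -
  have "\<bar>a \<bullet> b\<bar> \<le> norm a * norm b" by (rule Cauchy_Schwarz_ineq2)
  also have "\<dots> = (norm a / s) * (s * norm b)" using s by simp
  also have "\<dots> \<le> (norm a / s) powr conj_exp p / conj_exp p + (s * norm b) powr p / p"
    using p s conj_exp_bounds[OF p] by (intro Youngs_inequality) auto
  also have "\<dots> \<le> (norm a / s) powr conj_exp p + (s * norm b) powr p"
    using p conj_exp_bounds(1)[OF p] by (intro add_mono) (auto simp: divide_le_eq mult_le_cancel_left1)
  also have "(norm a / s) powr conj_exp p = s powr (- conj_exp p) * norm a powr conj_exp p"
    using s by (simp add: powr_divide powr_minus_divide)
  also have "(s * norm b) powr p = s powr p * norm b powr p" using s by (simp add: powr_mult)
  finally show ?thesis .
qed

lemma integrable_inner_conj_exp: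
  fixes A B :: "'a \<Rightarrow> 'b::euclidean_space"
  assumes p: "p > 1" and [measurable]: "A \<in> borel_measurable M" "B \<in> borel_measurable M"
    and A: "integrable M (\<lambda>x. norm (A x) powr conj_exp p)" and B: "integrable M (\<lambda>x. norm (B x) powr p)"
  shows "integrable M (\<lambda>x. A x \<bullet> B x)"
proof (rule Bochner_Integration.integrable_bound)
  show "integrable M (\<lambda>x. norm (A x) powr conj_exp p + norm (B x) powr p)" using A B by simp
  have "\<bar>a \<bullet> b\<bar> \<le> \<bar>norm a powr conj_exp p + norm b powr p\<bar>" for a b :: 'b
    using Young_inner[OF p, of 1 a b] by simp
  then show "AE x in M. norm (A x \<bullet> B x) \<le> norm (norm (A x) powr conj_exp p + norm (B x) powr p)" by simp
qed simp

text \<open>A Lebesgue measurable function is an almost everywhere limit of continuous functions.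
  Cutting these off in space and in size keeps them continuous and dominated by a multiple of the
  indicator of a ball, so the convergence also holds in the sense of p-th powers.\<close>

lemma Lp_dense_bounded_continuous_aux:
  fixes g :: "'a::euclidean_space \<Rightarrow> 'b::euclidean_space"
  assumes p: "p > 1" and gm[measurable]: "g \<in> borel_measurable borel"
    and bound: "\<And>x. norm (g x) \<le> n" "\<And>x. n < norm x \<Longrightarrow> g x = 0" and n: "n > 0" and e: "e > 0"
  obtains k where "continuous_on UNIV k" "\<And>x. norm (k x) \<le> n"
    "integrable lborel (\<lambda>x. norm (g x - k x) powr p)" "(\<integral>x. norm (g x - k x) powr p \<partial>lborel) < e"
proof -
  have "g measurable_on UNIV"
    by (rule lebesgue_measurable_imp_measurable_on) (auto intro: measurable_completion)
  then obtain Z h where Z: "negligible Z" and h: "\<And>m::nat. continuous_on UNIV (h m)"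
    "\<And>x. x \<notin> Z \<Longrightarrow> (\<lambda>m. h m x) \<longlonglongrightarrow> g x"
    unfolding measurable_on_def by auto
  define cut where "cut x = max 0 (min 1 (n + 1 - norm x))" for x :: 'a
  have cut: "0 \<le> cut x" "cut x \<le> 1" "norm x \<le> n \<Longrightarrow> cut x = 1" "n + 1 < norm x \<Longrightarrow> cut x = 0" for x
    by (auto simp: cut_def)
  \<comment> \<open>The factor \<open>n / max n (norm (h m x))\<close> is the radial projection of
    the values onto the ball of radius \<open>n\<close>; \<open>cut\<close> removes everything
    outside the ball of radius \<open>n + 1\<close>. Neither changes the limit, because
    \<open>g\<close> is bounded by \<open>n\<close> and vanishes outside radius
    \<open>n\<close>.\<close>
  define k where "k m x = (cut x * (n / max n (norm (h m x)))) *\<^sub>R h m x" for m x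
  have kc: "continuous_on UNIV (k m)" for m
    unfolding k_def cut_def using n by (intro continuous_intros h) (auto simp: max_def)
  have [measurable]: "k m \<in> borel_measurable borel" for m by (rule borel_measurable_continuous_onI[OF kc])
  have kn: "norm (k m x) \<le> n" for m x
  proof -
    have "norm (k m x) = cut x * (n * (norm (h m x) / max n (norm (h m x))))"
      unfolding k_def using cut(1)[of x] n by (simp add: abs_mult)
    also have "\<dots> \<le> 1 * (n * 1)"
      using cut(1,2)[of x] n by (intro mult_mono) (auto simp: divide_le_eq)
    finally show ?thesis by simp
  qed
  have k0: "k m x = 0" if "n + 1 < norm x" for m x using cut(4)[OF that] by (simp add: k_def)
  have w: "integrable lborel (\<lambda>x. (2 * n) powr p * indicator (cball 0 (n + 1) :: 'a set) x :: real)"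
    by (auto simp: integrable_real_indicator intro!: emeasure_compact_finite)
  have bd: "norm (g x - k m x) powr p \<le> (2 * n) powr p * indicator (cball 0 (n + 1)) x" for m x
  proof (cases "x \<in> cball 0 (n + 1)")
    case True
    have "norm (g x - k m x) \<le> 2 * n" using norm_triangle_ineq4[of "g x" "k m x"] bound(1)[of x] kn[of m x] by linarith
    then show ?thesis using True p by (auto intro!: powr_mono2)
  next
    case False
    then show ?thesis using bound(2)[of x] k0[of x m] n by simp
  qed
  have int: "integrable lborel (\<lambda>x. norm (g x - k m x) powr p)" for m
    by (rule Bochner_Integration.integrable_bound[OF w]) (use bd in auto)
  have "(\<lambda>m. \<integral>x. norm (g x - k m x) powr p \<partial>lborel) \<longlonglongrightarrow> (\<integral>x. 0 \<partial>(lborel :: 'a measure))"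
  proof (rule integral_dominated_convergence[OF _ _ w])
    have "AE x in lebesgue. x \<notin> Z" using Z by (simp add: negligible_iff_null_sets AE_not_in)
    then have "AE x in lborel. x \<notin> Z" by (simp add: AE_completion_iff)
    then show "AE x in lborel. (\<lambda>m. norm (g x - k m x) powr p) \<longlonglongrightarrow> 0"
    proof eventually_elim
      case (elim x)
      have "(\<lambda>m. k m x) \<longlonglongrightarrow> (cut x * (n / max n (norm (g x)))) *\<^sub>R g x"
        unfolding k_def using n by (intro tendsto_intros h(2)[OF elim]) (auto simp: max_def)
      also have "(cut x * (n / max n (norm (g x)))) *\<^sub>R g x = g x"
        using bound(1)[of x] bound(2)[of x] cut(3)[of x] n by (cases "norm x \<le> n") (auto simp: max_def)
      finally have "(\<lambda>m. norm (g x - k m x)) \<longlonglongrightarrow> norm (g x - g x)"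
        by (intro tendsto_intros)
      then have "(\<lambda>m. norm (g x - k m x) powr p) \<longlonglongrightarrow> 0 powr p"
        using p by (intro tendsto_powr' tendsto_const) auto
      then show ?case using p by simp
    qed
  qed (use bd in auto)
  then have "eventually (\<lambda>m. (\<integral>x. norm (g x - k m x) powr p \<partial>lborel) < e) sequentially"
    using e by (intro order_tendstoD(2)) auto
  then obtain m where "(\<integral>x. norm (g x - k m x) powr p \<partial>lborel) < e"
    by (auto simp: eventually_sequentially)
  then show ?thesis using that[OF kc kn int] by blast
qed

lemma Lp_dense_bounded_continuous:
  fixes g :: "'a::euclidean_space \<Rightarrow> 'b::euclidean_space"
  assumes p: "p > 1" and gm[measurable]: "g \<in> borel_measurable borel"
    and gi: "integrable lborel (\<lambda>x. norm (g x) powr p)" and e: "e > 0"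
  obtains k C where "continuous_on UNIV k" "\<And>x. norm (k x) \<le> C"
    "integrable lborel (\<lambda>x. norm (g x - k x) powr p)" "(\<integral>x. norm (g x - k x) powr p \<partial>lborel) < e"
proof -
  \<comment> \<open>Truncation in space and in size reduces to the bounded, compactly supported
    case; it converges by dominated convergence with \<open>|g|^p\<close>.\<close>
  define G where "G n x = (if norm x \<le> real n \<and> norm (g x) \<le> real n then g x else 0)" for n x
  have [measurable]: "G n \<in> borel_measurable borel" for n unfolding G_def by measurable
  have bd: "norm (g x - G n x) powr p \<le> norm (g x) powr p" for n x by (auto simp: G_def)
  have int: "integrable lborel (\<lambda>x. norm (g x - G n x) powr p)" for n
    by (rule Bochner_Integration.integrable_bound[OF gi]) (use bd in auto)
  have "(\<lambda>n. \<integral>x. norm (g x - G n x) powr p \<partial>lborel) \<longlonglongrightarrow> (\<integral>x. 0 \<partial>(lborel :: 'a measure))"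
  proof (rule integral_dominated_convergence[OF _ _ gi])
    show "AE x in lborel. (\<lambda>n. norm (g x - G n x) powr p) \<longlonglongrightarrow> 0"
    proof (rule AE_I2)
      fix x
      obtain m where m: "max (norm x) (norm (g x)) \<le> real m" using real_arch_simple by blast
      have "eventually (\<lambda>n. norm (g x - G n x) powr p = 0) sequentially"
        using eventually_ge_at_top[of m]
      proof eventually_elim
        case (elim n)
        then have "norm x \<le> real n" "norm (g x) \<le> real n" using m by auto
        then show ?case by (simp add: G_def)
      qed
      then show "(\<lambda>n. norm (g x - G n x) powr p) \<longlonglongrightarrow> 0" by (rule tendsto_eventually)
    qed
  qed (use bd in auto)
  moreover have "e / (2 * 2 powr p) > 0" using e by simp
  ultimately have "eventually (\<lambda>n. (\<integral>x. norm (g x - G n x) powr p \<partial>lborel) < e / (2 * 2 powr p)) sequentially"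
    by (intro order_tendstoD(2)) auto
  then obtain n0 where n0: "\<And>n. n \<ge> n0 \<Longrightarrow> (\<integral>x. norm (g x - G n x) powr p \<partial>lborel) < e / (2 * 2 powr p)"
    by (auto simp: eventually_sequentially)
  define n where "n = Suc n0"
  have n: "(\<integral>x. norm (g x - G n x) powr p \<partial>lborel) < e / (2 * 2 powr p)" "real n > 0" using n0 by (auto simp: n_def)
  show ?thesis
  proof (rule Lp_dense_bounded_continuous_aux[of p "G n" "real n" "e / (2 * 2 powr p)"], goal_cases)
    case (7 k)
    have [measurable]: "k \<in> borel_measurable borel" by (rule borel_measurable_continuous_onI[OF 7(1)])
    have le: "norm (g x - k x) powr p \<le> 2 powr p * (norm (g x - G n x) powr p + norm (G n x - k x) powr p)" for x
      using norm_add_powr_le[of p "g x - G n x" "G n x - k x"] p by simp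
    have iw: "integrable lborel (\<lambda>x. 2 powr p * (norm (g x - G n x) powr p + norm (G n x - k x) powr p))"
      using int 7(3) by simp
    have i: "integrable lborel (\<lambda>x. norm (g x - k x) powr p)"
      by (rule Bochner_Integration.integrable_bound[OF iw]) (use le in auto)
    have "(\<integral>x. norm (g x - k x) powr p \<partial>lborel) \<le> (\<integral>x. 2 powr p * (norm (g x - G n x) powr p + norm (G n x - k x) powr p) \<partial>lborel)"
      by (rule integral_mono[OF i iw le])
    also have "\<dots> = 2 powr p * ((\<integral>x. norm (g x - G n x) powr p \<partial>lborel) + (\<integral>x. norm (G n x - k x) powr p \<partial>lborel))"
      using int 7(3) by simp
    also have "\<dots> < 2 powr p * (e / (2 * 2 powr p) + e / (2 * 2 powr p))"
      using n(1) 7(4) by (intro mult_strict_left_mono add_strict_mono) auto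
    also have "\<dots> = e" by (simp add: field_simps)
    finally show thesis using that[OF 7(1,2) i] by blast
  qed (use p n e in \<open>auto simp: G_def\<close>)
qed

text \<open>For a bounded continuous function in place of \<open>A\<close> the claim is dominated
  convergence with majorant a multiple of \<open>|B|\<close>. Replacing \<open>A\<close> by such a
  function costs an error in the conjugate exponent that is the same for all shifts by translation
  invariance, hence uniformly small in \<tau>.\<close>

lemma tendsto_integral_inner_translation:
  fixes A B :: "'a::euclidean_space \<Rightarrow> 'b::euclidean_space"
  assumes p: "p > 1" and Am[measurable]: "A \<in> borel_measurable borel" and Bm[measurable]: "B \<in> borel_measurable borel"
    and A: "integrable lborel (\<lambda>x. norm (A x) powr conj_exp p)" and B: "integrable lborel (\<lambda>x. norm (B x) powr p)"
    and B1: "integrable lborel B"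
  shows "((\<lambda>\<tau>. \<integral>z. A (z + \<tau> *\<^sub>R d) \<bullet> B z \<partial>lborel) \<longlongrightarrow> (\<integral>z. A z \<bullet> B z \<partial>lborel)) (at 0)"
proof (rule tendstoI)
  fix e :: real assume e: "e > 0"
  let ?q = "conj_exp p"
  have q: "?q > 1" by (rule conj_exp_bounds(1)[OF p])
  define IB where "IB = (\<integral>x. norm (B x) powr p \<partial>lborel)"
  have IB: "IB \<ge> 0" by (simp add: IB_def)
  \<comment> \<open>This scale makes \<open>s^p\<close> times the integral of \<open>|B|^p\<close>
    at most \<open>e/8\<close>; the approximant \<open>k\<close> is chosen afterwards so that the
    other half of Young's inequality is at most \<open>e/8\<close> too.\<close>
  define s where "s = (e / (8 * (IB + 1))) powr (1 / p)"
  have s: "s > 0" using e IB by (simp add: s_def)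
  have "s powr p = e / (8 * (IB + 1))" using e IB p by (simp add: s_def powr_powr)
  moreover have "e / (8 * (IB + 1)) * IB \<le> e / 8"
    using e IB by (simp add: divide_le_eq mult_left_mono)
  ultimately have sB: "s powr p * IB \<le> e / 8" by (simp only:)
  obtain k C where k: "continuous_on UNIV k" "\<And>x. norm (k x) \<le> C"
    "integrable lborel (\<lambda>x. norm (A x - k x) powr ?q)" "(\<integral>x. norm (A x - k x) powr ?q \<partial>lborel) < e / 8 * s powr ?q"
    using Lp_dense_bounded_continuous[OF q Am A, of "e / 8 * s powr ?q"] e s by auto
  have km[measurable]: "k \<in> borel_measurable borel" by (rule borel_measurable_continuous_onI[OF k(1)])
  have iAk: "integrable lborel (\<lambda>z. (A (z + y) - k (z + y)) \<bullet> B z)" for y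
    using integrable_lborel_translation[OF k(3), of y]
    by (intro integrable_inner_conj_exp[OF p _ _ _ B]) auto
  have ik: "integrable lborel (\<lambda>z. k (z + y) \<bullet> B z)" for y
  proof (rule Bochner_Integration.integrable_bound)
    show "integrable lborel (\<lambda>z. C * norm (B z))" using B1 by simp
    have "\<bar>k (z + y) \<bullet> B z\<bar> \<le> \<bar>C * norm (B z)\<bar>" for z
      using order_trans[OF Cauchy_Schwarz_ineq2 mult_right_mono[OF k(2) norm_ge_zero]] abs_ge_self order_trans by blast
    then show "AE z in lborel. norm (k (z + y) \<bullet> B z) \<le> norm (C * norm (B z))" by simp
  qed simp
  have iA: "integrable lborel (\<lambda>z. A (z + y) \<bullet> B z)" for y
    using Bochner_Integration.integrable_add[OF iAk[of y] ik[of y]] by (simp add: inner_diff_left)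
  have small: "\<bar>\<integral>z. (A (z + y) - k (z + y)) \<bullet> B z \<partial>lborel\<bar> \<le> e / 4" for y
  proof -
    have it: "integrable lborel (\<lambda>z. norm (A (z + y) - k (z + y)) powr ?q)"
      using integrable_lborel_translation[OF k(3), of y] by simp
    have "\<bar>\<integral>z. (A (z + y) - k (z + y)) \<bullet> B z \<partial>lborel\<bar> \<le> (\<integral>z. norm ((A (z + y) - k (z + y)) \<bullet> B z) \<partial>lborel)"
      unfolding real_norm_def[symmetric] by (rule integral_norm_bound)
    also have "\<dots> \<le> (\<integral>z. s powr (- ?q) * norm (A (z + y) - k (z + y)) powr ?q + s powr p * norm (B z) powr p \<partial>lborel)"
    proof (rule integral_mono)
      show "norm ((A (z + y) - k (z + y)) \<bullet> B z) \<le> s powr (- ?q) * norm (A (z + y) - k (z + y)) powr ?q + s powr p * norm (B z) powr p" for z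
        using Young_inner[OF p s, of "A (z + y) - k (z + y)" "B z"] by simp
    qed (use iAk it B in auto)
    also have "\<dots> = s powr (- ?q) * (\<integral>z. norm (A (z + y) - k (z + y)) powr ?q \<partial>lborel) + s powr p * IB"
      using it B by (simp add: IB_def)
    also have "(\<integral>z. norm (A (z + y) - k (z + y)) powr ?q \<partial>lborel) = (\<integral>z. norm (A z - k z) powr ?q \<partial>lborel)"
      by (rule integral_lborel_translation[where f="\<lambda>z. norm (A z - k z) powr ?q"]) simp
    also have "s powr (- ?q) * (\<integral>z. norm (A z - k z) powr ?q \<partial>lborel) \<le> s powr (- ?q) * (e / 8 * s powr ?q)"
      using k(4) by (intro mult_left_mono) auto
    also have "\<dots> = e / 8" using s by (simp add: powr_minus field_simps)
    finally show ?thesis using sB by simp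
  qed
  have "((\<lambda>\<tau>. \<integral>z. k (z + \<tau> *\<^sub>R d) \<bullet> B z \<partial>lborel) \<longlongrightarrow> (\<integral>z. k z \<bullet> B z \<partial>lborel)) (at 0)"
    unfolding tendsto_at_iff_sequentially o_def
  proof (intro allI impI)
    fix X :: "nat \<Rightarrow> real" assume X: "X \<longlonglongrightarrow> 0"
    show "(\<lambda>i. \<integral>z. k (z + X i *\<^sub>R d) \<bullet> B z \<partial>lborel) \<longlonglongrightarrow> (\<integral>z. k z \<bullet> B z \<partial>lborel)"
    proof (rule integral_dominated_convergence[where w="\<lambda>z. C * norm (B z)"])
      show "AE z in lborel. norm (k (z + X i *\<^sub>R d) \<bullet> B z) \<le> C * norm (B z)" for i
      proof (rule AE_I2)
        fix z
        show "norm (k (z + X i *\<^sub>R d) \<bullet> B z) \<le> C * norm (B z)"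
          using order_trans[OF Cauchy_Schwarz_ineq2 mult_right_mono[OF k(2) norm_ge_zero], of "z + X i *\<^sub>R d" "B z"] by simp
      qed
      show "AE z in lborel. (\<lambda>i. k (z + X i *\<^sub>R d) \<bullet> B z) \<longlonglongrightarrow> k z \<bullet> B z"
      proof (rule AE_I2)
        fix z
        have "(\<lambda>i. z + X i *\<^sub>R d) \<longlonglongrightarrow> z + 0 *\<^sub>R d" by (intro tendsto_intros X)
        then have "(\<lambda>i. k (z + X i *\<^sub>R d)) \<longlonglongrightarrow> k z"
          using k(1) by (intro isCont_tendsto_compose[of _ k]) (auto simp: continuous_on_eq_continuous_at)
        then show "(\<lambda>i. k (z + X i *\<^sub>R d) \<bullet> B z) \<longlonglongrightarrow> k z \<bullet> B z" by (intro tendsto_intros)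
      qed
    qed (use B1 in auto)
  qed
  then have "\<forall>\<^sub>F \<tau> in at 0. dist (\<integral>z. k (z + \<tau> *\<^sub>R d) \<bullet> B z \<partial>lborel) (\<integral>z. k z \<bullet> B z \<partial>lborel) < e / 2"
    using e by (intro tendstoD) auto
  then show "\<forall>\<^sub>F \<tau> in at 0. dist (\<integral>z. A (z + \<tau> *\<^sub>R d) \<bullet> B z \<partial>lborel) (\<integral>z. A z \<bullet> B z \<partial>lborel) < e"
  proof eventually_elim
    case (elim \<tau>)
    have d: "(\<integral>z. (A (z + y) - k (z + y)) \<bullet> B z \<partial>lborel) = (\<integral>z. A (z + y) \<bullet> B z \<partial>lborel) - (\<integral>z. k (z + y) \<bullet> B z \<partial>lborel)" for y
      using iA[of y] ik[of y] by (simp add: inner_diff_left)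
    have d0: "\<bar>(\<integral>z. A z \<bullet> B z \<partial>lborel) - (\<integral>z. k z \<bullet> B z \<partial>lborel)\<bar> \<le> e / 4" using small[of 0] d[of 0] by simp
    have d1: "\<bar>(\<integral>z. A (z + \<tau> *\<^sub>R d) \<bullet> B z \<partial>lborel) - (\<integral>z. k (z + \<tau> *\<^sub>R d) \<bullet> B z \<partial>lborel)\<bar> \<le> e / 4"
      using small[of "\<tau> *\<^sub>R d"] d[of "\<tau> *\<^sub>R d"] by simp
    show ?case using elim d0 d1 unfolding dist_real_def by arith
  qed
qed

section \<open>Regularized sign functions and a Gronwall inequality\<close>

text \<open>As \<open>\<delta> \<rightarrow> 0\<close>, \<open>reg_sign \<delta> \<kappa>\<close> tends to \<open>1\<close> on the positive and to \<open>-1/\<kappa>\<close> on the negative axis.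
  Unlike a regularized positive part it is an analytic function vanishing at \<open>0\<close>, so that it maps test
  functions to test functions; the negative values are removed by \<open>\<kappa> \<rightarrow> \<infinity>\<close> in the end.\<close>

definition reg_sign :: "real \<Rightarrow> real \<Rightarrow> real \<Rightarrow> real" where
  "reg_sign \<delta> \<kappa> s = (exp (s / \<delta>) - 1) / (exp (s / \<delta>) + \<kappa>)"

definition reg_sign_deriv :: "real \<Rightarrow> real \<Rightarrow> real \<Rightarrow> real" where
  "reg_sign_deriv \<delta> \<kappa> s = (1 + \<kappa>) * exp (s / \<delta>) / (\<delta> * (exp (s / \<delta>) + \<kappa>)\<^sup>2)"

text \<open>The primitive of \<open>reg_sign \<delta> \<kappa>\<close> that vanishes at 0. As
  \<delta> tends to 0 it converges uniformly to \<open>weighted_abs \<kappa>\<close>.\<close>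

definition reg_abs :: "real \<Rightarrow> real \<Rightarrow> real \<Rightarrow> real" where
  "reg_abs \<delta> \<kappa> s = (1 + 1 / \<kappa>) * (\<delta> * ln ((exp (s / \<delta>) + \<kappa>) / (1 + \<kappa>))) - s / \<kappa>"

definition weighted_abs :: "real \<Rightarrow> real \<Rightarrow> real" where
  "weighted_abs \<kappa> s = max s 0 + max (- s) 0 / \<kappa>"

section \<open>Bounds for the regularized sign, its derivative and its primitive\<close>

lemma exp_add_pos: "\<kappa> \<ge> 1 \<Longrightarrow> exp (s::real) + \<kappa> > 0"
  by (simp add: add_pos_pos)

lemma reg_sign_zero: "reg_sign \<delta> \<kappa> 0 = 0"
  by (simp add: reg_sign_def)

lemma continuously_diff_reg_sign:
  assumes "\<kappa> \<ge> 1" shows "continuously_diff k (reg_sign \<delta> \<kappa>)"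
proof -
  have ne: "exp ((1 / \<delta>) * s) + \<kappa> \<noteq> 0" for s using exp_add_pos[OF assms, of "(1 / \<delta>) * s"] by simp
  have lin: "continuously_diff k (\<lambda>s::real. (1 / \<delta>) * s)"
    by (rule continuously_diff_bounded_linear) (rule bounded_linear_mult_right)
  have e: "continuously_diff k (\<lambda>s. exp ((1 / \<delta>) * s))"
    by (rule continuously_diff_compose[OF continuously_diff_exp lin])
  have "continuously_diff k (\<lambda>s. (exp ((1 / \<delta>) * s) + (-1)) * inverse (exp ((1 / \<delta>) * s) + \<kappa>))"
    by (intro continuously_diff_mult continuously_diff_inverse continuously_diff_add continuously_diff_const e ne)
  moreover have "(\<lambda>s. (exp ((1 / \<delta>) * s) + (-1)) * inverse (exp ((1 / \<delta>) * s) + \<kappa>)) = reg_sign \<delta> \<kappa>"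
    by (auto simp: reg_sign_def divide_inverse mult.commute)
  ultimately show ?thesis by simp
qed

lemma DERIV_reg_sign:
  assumes "\<kappa> \<ge> 1" "\<delta> > 0"
  shows "(reg_sign \<delta> \<kappa> has_real_derivative reg_sign_deriv \<delta> \<kappa> s) (at s)"
proof -
  define E where "E = exp (s / \<delta>)"
  have ne: "E + \<kappa> \<noteq> 0" using exp_add_pos[OF assms(1), of "s / \<delta>"] by (simp add: E_def)
  have "(reg_sign \<delta> \<kappa> has_real_derivative ((E * (1 / \<delta>)) * (E + \<kappa>) - (E - 1) * (E * (1 / \<delta>))) / ((E + \<kappa>) * (E + \<kappa>))) (at s)"
    unfolding reg_sign_def[abs_def] E_def using assms ne[unfolded E_def]
    by (auto intro!: derivative_eq_intros)
  also have "((E * (1 / \<delta>)) * (E + \<kappa>) - (E - 1) * (E * (1 / \<delta>))) / ((E + \<kappa>) * (E + \<kappa>)) = reg_sign_deriv \<delta> \<kappa> s"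
    unfolding reg_sign_deriv_def E_def[symmetric] power2_eq_square using ne assms(2)
    by (simp add: divide_simps) (simp add: algebra_simps)
  finally show ?thesis .
qed

lemma continuous_on_reg_sign_deriv:
  assumes "\<kappa> \<ge> 1" "\<delta> > 0"
  shows "continuous_on UNIV (reg_sign_deriv \<delta> \<kappa>)"
proof -
  have "exp (s / \<delta>) + \<kappa> \<noteq> 0" for s using exp_add_pos[OF assms(1), of "s / \<delta>"] by simp
  then show ?thesis unfolding reg_sign_deriv_def[abs_def] using assms by (intro continuous_intros) auto
qed

lemma reg_sign_deriv_nonneg:
  "\<kappa> \<ge> 1 \<Longrightarrow> \<delta> > 0 \<Longrightarrow> reg_sign_deriv \<delta> \<kappa> s \<ge> 0"
  unfolding reg_sign_deriv_def by (intro divide_nonneg_nonneg mult_nonneg_nonneg) auto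

text \<open>With \<open>E = exp (s / \<delta>)\<close>, the denominator satisfies
  \<open>(E + \<kappa>)^2 \<ge> E^2\<close>, used for \<open>s \<ge> 0\<close>, and
  \<open>(E + \<kappa>)^2 \<ge> 1\<close>, used for \<open>s < 0\<close>. Either way the derivative
  decays exponentially in \<open>|s| / \<delta>\<close>.\<close>

lemma reg_sign_deriv_le_exp:
  assumes "\<kappa> \<ge> 1" "\<delta> > 0"
  shows "reg_sign_deriv \<delta> \<kappa> s \<le> (1 + \<kappa>) / \<delta> * exp (- (\<bar>s\<bar> / \<delta>))"
proof -
  define E where "E = exp (s / \<delta>)"
  have E: "E > 0" by (simp add: E_def)
  have "E \<le> exp (- (\<bar>s\<bar> / \<delta>)) * (E + \<kappa>)\<^sup>2"
  proof (cases "s \<ge> 0")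
    case True
    then have "exp (- (\<bar>s\<bar> / \<delta>)) = inverse E" by (simp add: E_def exp_minus)
    moreover have "E * E \<le> (E + \<kappa>)\<^sup>2" unfolding power2_eq_square using E assms by (intro mult_mono) auto
    then have "inverse E * (E * E) \<le> inverse E * (E + \<kappa>)\<^sup>2" using E by (intro mult_left_mono) auto
    ultimately show ?thesis using E by (simp add: mult.assoc[symmetric])
  next
    case False
    then have "exp (- (\<bar>s\<bar> / \<delta>)) = E" by (simp add: E_def)
    moreover have "1 * 1 \<le> (E + \<kappa>)\<^sup>2" unfolding power2_eq_square using E assms by (intro mult_mono) auto
    ultimately show ?thesis using E by simp
  qed
  moreover have "(E + \<kappa>)\<^sup>2 > 0" using E assms by simp
  ultimately have "E / (E + \<kappa>)\<^sup>2 \<le> exp (- (\<bar>s\<bar> / \<delta>))" by (simp add: pos_divide_le_eq)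
  then have "(1 + \<kappa>) / \<delta> * (E / (E + \<kappa>)\<^sup>2) \<le> (1 + \<kappa>) / \<delta> * exp (- (\<bar>s\<bar> / \<delta>))"
    using assms by (intro mult_left_mono) auto
  then show ?thesis by (simp add: reg_sign_deriv_def E_def)
qed

lemma reg_sign_deriv_bound:
  assumes "\<kappa> \<ge> 1" "\<delta> > 0"
  shows "\<bar>reg_sign_deriv \<delta> \<kappa> s\<bar> \<le> (1 + \<kappa>) / \<delta>"
proof -
  have "(1 + \<kappa>) / \<delta> * exp (- (\<bar>s\<bar> / \<delta>)) \<le> (1 + \<kappa>) / \<delta> * 1"
    using assms by (intro mult_left_mono) auto
  then show ?thesis using reg_sign_deriv_le_exp[OF assms, of s] reg_sign_deriv_nonneg[OF assms, of s] by simp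
qed

text \<open>The function \<open>t exp(-t)\<close> of \<open>t = |s| / \<delta>\<close> is at most 1,
  so the factor \<open>1/\<delta>\<close> of the derivative is compensated by \<open>|s|\<close>.
  The bound \<open>1 + \<kappa>\<close> is independent of \<delta> and serves as majorant when the
  flux term is sent to zero.\<close>

lemma reg_sign_deriv_mult_bound:
  assumes "\<kappa> \<ge> 1" "\<delta> > 0"
  shows "\<bar>s\<bar> * reg_sign_deriv \<delta> \<kappa> s \<le> (1 + \<kappa>) * (\<bar>s\<bar> / \<delta> * exp (- (\<bar>s\<bar> / \<delta>)))"
    and "\<bar>s\<bar> * reg_sign_deriv \<delta> \<kappa> s \<le> 1 + \<kappa>"
proof -
  show 1: "\<bar>s\<bar> * reg_sign_deriv \<delta> \<kappa> s \<le> (1 + \<kappa>) * (\<bar>s\<bar> / \<delta> * exp (- (\<bar>s\<bar> / \<delta>)))"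
    using mult_left_mono[OF reg_sign_deriv_le_exp[OF assms, of s], of "\<bar>s\<bar>"] by (simp add: mult_ac)
  have "\<bar>s\<bar> / \<delta> \<le> exp (\<bar>s\<bar> / \<delta>)" using exp_ge_add_one_self[of "\<bar>s\<bar> / \<delta>"] by linarith
  then have "\<bar>s\<bar> / \<delta> * exp (- (\<bar>s\<bar> / \<delta>)) \<le> exp (\<bar>s\<bar> / \<delta>) * exp (- (\<bar>s\<bar> / \<delta>))"
    by (rule mult_right_mono) simp
  then have "\<bar>s\<bar> / \<delta> * exp (- (\<bar>s\<bar> / \<delta>)) \<le> 1" by (simp only: exp_minus_inverse)
  then have "(1 + \<kappa>) * (\<bar>s\<bar> / \<delta> * exp (- (\<bar>s\<bar> / \<delta>))) \<le> (1 + \<kappa>) * 1"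
    using assms by (intro mult_left_mono) auto
  then show "\<bar>s\<bar> * reg_sign_deriv \<delta> \<kappa> s \<le> 1 + \<kappa>" using 1 by simp
qed

text \<open>For \<open>s \<noteq> 0\<close> the quantity is dominated by a multiple of
  \<open>t exp(-t)\<close> with \<open>t = |s| (n + 1)\<close> tending to infinity; for
  \<open>s = 0\<close> it is zero.\<close>

lemma reg_sign_deriv_mult_tendsto:
  assumes "\<kappa> \<ge> 1"
  shows "(\<lambda>n. \<bar>s\<bar> * reg_sign_deriv (1 / real (Suc n)) \<kappa> s) \<longlonglongrightarrow> 0"
proof (cases "s = 0")
  case False
  have lim: "filterlim (\<lambda>n. \<bar>s\<bar> * real (Suc n)) at_top sequentially"
    using False by (intro filterlim_tendsto_pos_mult_at_top[OF tendsto_const] filterlim_compose[OF filterlim_real_sequentially filterlim_Suc]) auto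
  have "((\<lambda>y::real. y ^ 1 / exp y) \<longlongrightarrow> 0) at_top" by (rule tendsto_power_div_exp_0)
  from filterlim_compose[OF this lim]
  have "(\<lambda>n. (\<bar>s\<bar> * real (Suc n)) * exp (- (\<bar>s\<bar> * real (Suc n)))) \<longlonglongrightarrow> 0"
    by (simp add: exp_minus divide_inverse)
  from tendsto_mult_left[OF this, of "1 + \<kappa>"]
  have up: "(\<lambda>n. (1 + \<kappa>) * ((\<bar>s\<bar> * real (Suc n)) * exp (- (\<bar>s\<bar> * real (Suc n))))) \<longlonglongrightarrow> 0" by simp
  show ?thesis
  proof (rule tendsto_sandwich[OF _ _ tendsto_const up])
    show "\<forall>\<^sub>F n in sequentially. 0 \<le> \<bar>s\<bar> * reg_sign_deriv (1 / real (Suc n)) \<kappa> s"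
      using assms by (intro always_eventually allI mult_nonneg_nonneg reg_sign_deriv_nonneg) auto
    show "\<forall>\<^sub>F n in sequentially. \<bar>s\<bar> * reg_sign_deriv (1 / real (Suc n)) \<kappa> s \<le> (1 + \<kappa>) * ((\<bar>s\<bar> * real (Suc n)) * exp (- (\<bar>s\<bar> * real (Suc n))))"
    proof (intro always_eventually allI)
      fix n
      have "1 / real (Suc n) > 0" by simp
      from reg_sign_deriv_mult_bound(1)[OF assms this, of s]
      show "\<bar>s\<bar> * reg_sign_deriv (1 / real (Suc n)) \<kappa> s \<le> (1 + \<kappa>) * ((\<bar>s\<bar> * real (Suc n)) * exp (- (\<bar>s\<bar> * real (Suc n))))"
        by (simp only: divide_divide_eq_right div_by_1)
    qed
  qed
qed simp

text \<open>On the negative axis \<open>reg_sign\<close> is bounded by \<open>1/\<kappa>\<close>,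
  not only by 1. The product is therefore controlled by the weighted absolute value, the same
  quantity whose evolution is estimated, and the Gronwall argument closes with a constant
  independent of \<kappa>.\<close>

lemma reg_sign_mult_bound:
  assumes "\<kappa> \<ge> 1" "\<delta> > 0"
  shows "\<bar>s * reg_sign \<delta> \<kappa> s\<bar> \<le> weighted_abs \<kappa> s" "\<bar>reg_sign \<delta> \<kappa> s\<bar> \<le> 1"
proof -
  define E where "E = exp (s / \<delta>)"
  have E: "E > 0" "E + \<kappa> > 0" using assms by (auto simp: E_def intro: add_pos_pos)
  have H: "reg_sign \<delta> \<kappa> s = (E - 1) / (E + \<kappa>)" by (simp add: reg_sign_def E_def)
  have "\<bar>s * reg_sign \<delta> \<kappa> s\<bar> \<le> weighted_abs \<kappa> s \<and> \<bar>reg_sign \<delta> \<kappa> s\<bar> \<le> 1"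
  proof (cases "s \<ge> 0")
    case True
    then have "E \<ge> 1" using assms by (simp add: E_def)
    then have "\<bar>reg_sign \<delta> \<kappa> s\<bar> \<le> 1" using E assms by (simp add: H)
    moreover from this have "\<bar>s\<bar> * \<bar>reg_sign \<delta> \<kappa> s\<bar> \<le> \<bar>s\<bar> * 1" by (intro mult_left_mono) auto
    ultimately show ?thesis using True by (simp add: weighted_abs_def abs_mult)
  next
    case False
    then have "E \<le> 1" using assms by (simp add: E_def divide_nonpos_pos)
    then have "\<bar>reg_sign \<delta> \<kappa> s\<bar> = (1 - E) / (E + \<kappa>)" using E by (simp add: H abs_div_pos)
    also have "\<dots> \<le> 1 / \<kappa>" using E assms by (intro frac_le) auto
    finally have 1: "\<bar>reg_sign \<delta> \<kappa> s\<bar> \<le> 1 / \<kappa>" .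
    also have "1 / \<kappa> \<le> 1" using assms by simp
    finally have 2: "\<bar>reg_sign \<delta> \<kappa> s\<bar> \<le> 1" .
    have "\<bar>s\<bar> * \<bar>reg_sign \<delta> \<kappa> s\<bar> \<le> \<bar>s\<bar> * (1 / \<kappa>)" using 1 by (intro mult_left_mono) auto
    then show ?thesis using 2 False by (simp add: weighted_abs_def abs_mult)
  qed
  then show "\<bar>s * reg_sign \<delta> \<kappa> s\<bar> \<le> weighted_abs \<kappa> s" "\<bar>reg_sign \<delta> \<kappa> s\<bar> \<le> 1" by auto
qed

lemma DERIV_reg_abs:
  assumes "\<kappa> \<ge> 1" "\<delta> > 0"
  shows "(reg_abs \<delta> \<kappa> has_real_derivative reg_sign \<delta> \<kappa> s) (at s)"
proof -
  define E where "E = exp (s / \<delta>)"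
  have E: "E + \<kappa> > 0" using assms by (auto simp: E_def intro: add_pos_pos)
  have d: "((\<lambda>s. (exp (s / \<delta>) + \<kappa>) / (1 + \<kappa>)) has_real_derivative (E * (1 / \<delta>)) / (1 + \<kappa>)) (at s)"
    unfolding E_def using assms by (auto intro!: derivative_eq_intros)
  have "(exp (s / \<delta>) + \<kappa>) / (1 + \<kappa>) > 0" using E assms by (simp add: E_def)
  from DERIV_ln_divide[OF this]
  have l: "((\<lambda>s. ln ((exp (s / \<delta>) + \<kappa>) / (1 + \<kappa>))) has_real_derivative (1 / ((E + \<kappa>) / (1 + \<kappa>))) * ((E * (1 / \<delta>)) / (1 + \<kappa>))) (at s)"
    unfolding E_def by (rule DERIV_chain2[OF _ d[unfolded E_def]])
  have "(reg_abs \<delta> \<kappa> has_real_derivative (1 + 1 / \<kappa>) * (\<delta> * ((1 / ((E + \<kappa>) / (1 + \<kappa>))) * ((E * (1 / \<delta>)) / (1 + \<kappa>)))) - 1 / \<kappa>) (at s)"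
    unfolding reg_abs_def[abs_def]
    by (intro DERIV_diff DERIV_cmult l DERIV_cdivide DERIV_ident)
  also have "(1 + 1 / \<kappa>) * (\<delta> * ((1 / ((E + \<kappa>) / (1 + \<kappa>))) * ((E * (1 / \<delta>)) / (1 + \<kappa>)))) - 1 / \<kappa> = (1 + 1 / \<kappa>) * (E / (E + \<kappa>)) - 1 / \<kappa>"
    using assms E by simp
  also have "\<dots> = reg_sign \<delta> \<kappa> s"
    unfolding reg_sign_def E_def[symmetric] using assms E by (simp add: divide_simps) (simp add: algebra_simps)
  finally show ?thesis .
qed

text \<open>The derivative \<open>reg_sign\<close> is nondecreasing, so the graph lies above its
  tangent at \<open>a\<close>.\<close>

lemma reg_abs_convex:
  assumes "\<kappa> \<ge> 1" "\<delta> > 0"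
  shows "reg_abs \<delta> \<kappa> a - reg_abs \<delta> \<kappa> b \<le> (a - b) * reg_sign \<delta> \<kappa> a"
proof -
  have "reg_sign \<delta> \<kappa> a * (b - a) \<le> reg_abs \<delta> \<kappa> b - reg_abs \<delta> \<kappa> a"
    by (rule f''_imp_f'[where C=UNIV and f''="reg_sign_deriv \<delta> \<kappa>"])
      (use DERIV_reg_abs[OF assms] DERIV_reg_sign[OF assms] reg_sign_deriv_nonneg[OF assms] in auto)
  then show ?thesis by (simp add: algebra_simps)
qed

lemma reg_abs_lipschitz:
  assumes "\<kappa> \<ge> 1" "\<delta> > 0"
  shows "\<bar>reg_abs \<delta> \<kappa> a - reg_abs \<delta> \<kappa> b\<bar> \<le> \<bar>a - b\<bar>"
  using field_differentiable_bound[of UNIV "reg_abs \<delta> \<kappa>" "reg_sign \<delta> \<kappa>" 1 a b]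
    DERIV_reg_abs[OF assms] reg_sign_mult_bound(2)[OF assms] by auto

lemma reg_abs_zero: "\<kappa> \<ge> 1 \<Longrightarrow> reg_abs \<delta> \<kappa> 0 = 0"
  by (simp add: reg_abs_def)

text \<open>With \<open>m = max s 0\<close>, the sum \<open>exp (s / \<delta>) + \<kappa>\<close>
  lies between \<open>exp (m / \<delta>)\<close> and
  \<open>(1 + \<kappa>) exp (m / \<delta>)\<close>. Taking logarithms, \<delta> times the logarithm
  in \<open>reg_abs\<close> differs from \<open>m\<close> by at most
  \<open>\<delta> ln (1 + \<kappa>)\<close>; the factor 2 bounds
  \<open>1 + 1/\<kappa>\<close>.\<close>

lemma reg_abs_approx:
  assumes k: "\<kappa> \<ge> 1" and d: "\<delta> > 0"
  shows "\<bar>reg_abs \<delta> \<kappa> s - weighted_abs \<kappa> s\<bar> \<le> 2 * \<delta> * ln (1 + \<kappa>)"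
proof -
  define m where "m = max s 0"
  define E where "E = exp (s / \<delta>)"
  have E: "E > 0" "E + \<kappa> > 0" using assms by (auto simp: E_def intro: add_pos_pos)
  define l where "l = ln ((E + \<kappa>) / (1 + \<kappa>))"
  have lk: "ln (1 + \<kappa>) \<ge> 0" using k by simp
  have em: "exp (m / \<delta>) \<ge> 1" "exp (m / \<delta>) \<ge> E" "exp (m / \<delta>) \<le> E + \<kappa>"
    using d k exp_ge_zero[of "s / \<delta>"] by (auto simp: m_def E_def max_def divide_right_mono simp del: exp_ge_zero)
  have "E + \<kappa> \<le> exp (m / \<delta>) * (1 + \<kappa>)"
  proof -
    have "1 * \<kappa> \<le> exp (m / \<delta>) * \<kappa>" by (rule mult_right_mono[OF em(1)]) (use k in simp)
    from add_mono[OF em(2) this] show ?thesis by (simp only: distrib_left mult_1_right mult_1_left)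
  qed
  then have "(E + \<kappa>) / (1 + \<kappa>) \<le> exp (m / \<delta>)" using k by (simp add: divide_le_eq)
  moreover have "(E + \<kappa>) / (1 + \<kappa>) > 0" using E k by simp
  ultimately have "l \<le> ln (exp (m / \<delta>))" unfolding l_def by (subst ln_le_cancel_iff) auto
  then have up: "l \<le> m / \<delta>" by simp
  have "m / \<delta> = ln (exp (m / \<delta>))" by simp
  also have "\<dots> \<le> ln (E + \<kappa>)" using em(3) E by (subst ln_le_cancel_iff) auto
  also have "ln (E + \<kappa>) = l + ln (1 + \<kappa>)" unfolding l_def using E k by (subst ln_div) auto
  finally have low: "m / \<delta> - ln (1 + \<kappa>) \<le> l" by simp
  have up': "\<delta> * l \<le> m" using mult_left_mono[OF up, of \<delta>] d by simp
  have low': "m - \<delta> * ln (1 + \<kappa>) \<le> \<delta> * l" using mult_left_mono[OF low, of \<delta>] d by (simp add: right_diff_distrib)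
  have c: "0 \<le> 1 + 1 / \<kappa>" "1 + 1 / \<kappa> \<le> 2" using k by auto
  have w: "weighted_abs \<kappa> s = (1 + 1 / \<kappa>) * m - s / \<kappa>"
    by (auto simp: weighted_abs_def m_def max_def distrib_right)
  have eq: "reg_abs \<delta> \<kappa> s - weighted_abs \<kappa> s = (1 + 1 / \<kappa>) * (\<delta> * l - m)"
    unfolding w reg_abs_def E_def[symmetric] l_def[symmetric] by (simp add: algebra_simps)
  have "\<bar>\<delta> * l - m\<bar> \<le> \<delta> * ln (1 + \<kappa>)" using up' low' by linarith
  then have "(1 + 1 / \<kappa>) * \<bar>\<delta> * l - m\<bar> \<le> 2 * (\<delta> * ln (1 + \<kappa>))"
    using c by (intro mult_mono) auto
  then show ?thesis unfolding eq abs_mult using c by simp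
qed

lemma weighted_abs_bounds:
  assumes "\<kappa> \<ge> 1"
  shows "0 \<le> weighted_abs \<kappa> s" "weighted_abs \<kappa> s \<le> \<bar>s\<bar>" "max s 0 \<le> weighted_abs \<kappa> s"
    "s \<le> 0 \<Longrightarrow> weighted_abs \<kappa> s = \<bar>s\<bar> / \<kappa>"
proof -
  have "max (- s) 0 / \<kappa> \<le> max (- s) 0" using assms by (simp add: divide_le_eq mult_le_cancel_left1)
  then show "0 \<le> weighted_abs \<kappa> s" "weighted_abs \<kappa> s \<le> \<bar>s\<bar>" "max s 0 \<le> weighted_abs \<kappa> s"
    "s \<le> 0 \<Longrightarrow> weighted_abs \<kappa> s = \<bar>s\<bar> / \<kappa>"
    using assms by (auto simp: weighted_abs_def max_def)
qed

lemma weighted_abs_lipschitz: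
  assumes "\<kappa> \<ge> 1"
  shows "\<bar>weighted_abs \<kappa> a - weighted_abs \<kappa> b\<bar> \<le> 2 * \<bar>a - b\<bar>"
proof -
  have "\<bar>max (- a) 0 / \<kappa> - max (- b) 0 / \<kappa>\<bar> = \<bar>max (- a) 0 - max (- b) 0\<bar> / \<kappa>"
    using assms by (simp add: diff_divide_distrib[symmetric] abs_divide)
  also have "\<dots> \<le> \<bar>max (- a) 0 - max (- b) 0\<bar>" using assms by (simp add: divide_le_eq mult_le_cancel_left1)
  also have "\<dots> \<le> \<bar>a - b\<bar>" by (auto simp: max_def)
  finally have "\<bar>max (- a) 0 / \<kappa> - max (- b) 0 / \<kappa>\<bar> \<le> \<bar>a - b\<bar>" .
  moreover have "\<bar>max a 0 - max b 0\<bar> \<le> \<bar>a - b\<bar>" by (auto simp: max_def)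
  moreover have "weighted_abs \<kappa> a - weighted_abs \<kappa> b = (max a 0 - max b 0) + (max (- a) 0 / \<kappa> - max (- b) 0 / \<kappa>)"
    by (simp add: weighted_abs_def)
  moreover have "\<bar>A + B\<bar> \<le> 2 * D" if "\<bar>B\<bar> \<le> D" "\<bar>A\<bar> \<le> D" for A B D :: real
    using that by linarith
  ultimately show ?thesis by presburger
qed

text \<open>The integral of \<open>y s - y (s - h)\<close> over \<open>[t1, t2]\<close> telescopes
  to the integral of \<open>y\<close> over \<open>[t2 - h, t2]\<close> minus that over
  \<open>[t1 - h, t1]\<close>. Divided by \<open>h\<close>, the two terms tend to
  \<open>y t2\<close> and \<open>y t1\<close> by continuity, and the right side is the negative of a
  mean of \<open>J\<close> near 0, which tends to \<open>- J0\<close>. The increments of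
  \<open>y\<close> thus need to be controlled only on average over \<open>s\<close>.\<close>

lemma increment_le_of_mean_increments:
  fixes y J :: "real \<Rightarrow> real"
  assumes y: "continuous_on {0..T} y" and t: "0 < t1" "t1 < t2" "t2 < T"
    and J: "(J \<longlongrightarrow> J0) (at 0)" and Ji: "\<And>h. 0 < h \<Longrightarrow> integrable lborel (\<lambda>\<tau>. indicator {0<..<h} \<tau> * J \<tau>)"
    and le: "\<And>h. 0 < h \<Longrightarrow> h < t1 \<Longrightarrow>
      integral {t1..t2} (\<lambda>s. y s - y (s - h)) \<le> - (\<integral>\<tau>. indicator {0<..<h} \<tau> * J \<tau> \<partial>lborel)"
  shows "y t2 - y t1 \<le> - J0"
proof (rule field_le_epsilon)
  fix e :: real assume e: "e > 0"
  define e' where "e' = e / 3"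
  have e': "e' > 0" using e by (simp add: e'_def)
  obtain d where d: "d > 0" "\<And>\<tau>. \<tau> \<noteq> 0 \<Longrightarrow> \<bar>\<tau>\<bar> < d \<Longrightarrow> \<bar>J \<tau> - J0\<bar> < e'"
    using J e' unfolding tendsto_iff eventually_at by (force simp: dist_real_def)
  have near: "\<exists>d>0. \<forall>s\<in>{0..T}. \<bar>s - t\<bar> < d \<longrightarrow> \<bar>y s - y t\<bar> < e'" if "t \<in> {0..T}" for t
    using y that e' unfolding continuous_on_iff dist_real_def by blast
  obtain d1 where d1: "d1 > 0" "\<And>s. s \<in> {0..T} \<Longrightarrow> \<bar>s - t1\<bar> < d1 \<Longrightarrow> \<bar>y s - y t1\<bar> < e'"
    using near[of t1] t by auto
  obtain d2 where d2: "d2 > 0" "\<And>s. s \<in> {0..T} \<Longrightarrow> \<bar>s - t2\<bar> < d2 \<Longrightarrow> \<bar>y s - y t2\<bar> < e'"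
    using near[of t2] t by auto
  \<comment> \<open>Half the minimum makes \<open>h\<close> strictly smaller than each of the three
    continuity radii and leaves room in \<open>(0, t1)\<close> and \<open>(t1, t2)\<close>.\<close>
  define h where "h = min (min d d1) (min d2 (min t1 (t2 - t1))) / 2"
  have h: "h > 0" "h < d" "h < d1" "h < d2" "h < t1" "h < t2 - t1"
    using d(1) d1(1) d2(1) t by (auto simp: h_def min_def)
  have io: "y integrable_on {a..b}" if "0 \<le> a" "b \<le> T" for a b
    by (rule integrable_continuous_interval, rule continuous_on_subset[OF y]) (use that in auto)
  have ish: "((\<lambda>s. y (s - h)) has_integral integral {t1 - h..t2 - h} y) {t1..t2}"
    using has_integral_shift_Icc_real[of y "-h" "integral {t1 - h..t2 - h} y" t1 t2]
      integrable_integral[OF io[of "t1 - h" "t2 - h"]] h t by (simp add: o_def)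
  have "integral {t1..t2} (\<lambda>s. y s - y (s - h)) = integral {t1..t2} y - integral {t1 - h..t2 - h} y"
    using Henstock_Kurzweil_Integration.integral_diff[OF io[of t1 t2] has_integral_integrable[OF ish]] integral_unique[OF ish] t by simp
  also have "\<dots> = integral {t2 - h..t2} y - integral {t1 - h..t1} y"
    using Henstock_Kurzweil_Integration.integral_combine[of "t1" "t2 - h" t2 y] Henstock_Kurzweil_Integration.integral_combine[of "t1 - h" t1 "t2 - h" y] io h t by simp
  finally have eq: "integral {t1..t2} (\<lambda>s. y s - y (s - h)) = integral {t2 - h..t2} y - integral {t1 - h..t1} y" .
  have "integral {t2 - h..t2} (\<lambda>s. y t2 - e') \<le> integral {t2 - h..t2} y"
  proof (rule integral_le)
    fix s assume "s \<in> {t2 - h..t2}"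
    then have "\<bar>y s - y t2\<bar> < e'" using d2(2)[of s] h t by auto
    then show "y t2 - e' \<le> y s" by linarith
  qed (use io h t in auto)
  then have A: "h * (y t2 - e') \<le> integral {t2 - h..t2} y" using h by simp
  have "integral {t1 - h..t1} y \<le> integral {t1 - h..t1} (\<lambda>s. y t1 + e')"
  proof (rule integral_le)
    fix s assume "s \<in> {t1 - h..t1}"
    then have "\<bar>y s - y t1\<bar> < e'" using d1(2)[of s] h t by auto
    then show "y s \<le> y t1 + e'" by linarith
  qed (use io h t in auto)
  then have B: "integral {t1 - h..t1} y \<le> h * (y t1 + e')" using h by simp
  have ind: "integrable lborel (\<lambda>\<tau>. indicator {0<..<h} \<tau> :: real)"
    by (rule integrable_real_indicator) (use h in auto)
  have "(\<integral>\<tau>. (J0 - e') * indicator {0<..<h} \<tau> \<partial>lborel) \<le> (\<integral>\<tau>. indicator {0<..<h} \<tau> * J \<tau> \<partial>lborel)"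
  proof (rule integral_mono)
    fix \<tau> :: real
    show "(J0 - e') * indicator {0<..<h} \<tau> \<le> indicator {0<..<h} \<tau> * J \<tau>"
    proof (cases "\<tau> \<in> {0<..<h}")
      case True
      then have "\<bar>J \<tau> - J0\<bar> < e'" using d(2)[of \<tau>] h by auto
      then show ?thesis using True by simp
    qed simp
  qed (use Ji h ind in auto)
  then have C: "h * (J0 - e') \<le> (\<integral>\<tau>. indicator {0<..<h} \<tau> * J \<tau> \<partial>lborel)" using h by (simp add: mult.commute)
  have "h * (y t2 - e') - h * (y t1 + e') \<le> - (h * (J0 - e'))"
    using le[OF h(1,5)] eq A B C by linarith
  then have "h * (y t2 - y t1) \<le> h * (- J0 + 3 * e')" by (simp add: algebra_simps)
  then show "y t2 - y t1 \<le> - J0 + e" using h by (simp add: e'_def)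
qed

text \<open>With \<open>Z\<close> the right-hand side of the hypothesis,
  \<open>exp (- r t) Z t\<close> has nonpositive derivative because \<open>Y \<le> Z\<close>. Its
  value at 0 is \<open>C\<close>.\<close>

lemma Gronwall_integral:
  fixes Y :: "real \<Rightarrow> real"
  assumes Y: "continuous_on {0..b} Y" and r: "r \<ge> 0" and b: "b \<ge> 0"
    and le: "\<And>t. t \<in> {0..b} \<Longrightarrow> Y t \<le> C + r * integral {0..t} Y"
  shows "Y b \<le> C * exp (r * b)"
proof -
  define Z where "Z t = C + r * integral {0..t} Y" for t
  have dZ: "(Z has_real_derivative r * Y t) (at t within {0..b})" if "t \<in> {0..b}" for t
    unfolding Z_def has_real_derivative_iff_has_vector_derivative
    using integral_has_vector_derivative[OF Y that] by (auto intro!: derivative_eq_intros)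
  have dE: "((\<lambda>t. exp (- (r * t)) * Z t) has_real_derivative exp (- (r * t)) * (r * (Y t - Z t))) (at t within {0..b})" if "t \<in> {0..b}" for t
    by (rule derivative_eq_intros refl dZ[OF that])+ (simp add: algebra_simps)
  have "exp (- (r * b)) * Z b \<le> exp (- (r * 0)) * Z 0"
  proof (rule DERIV_nonpos_imp_decreasing_open[OF b])
    fix t assume t: "0 < t" "t < b"
    then have tb: "t \<in> {0..b}" by auto
    have "at t within {0..b} = at t" using t by (intro at_within_interior) auto
    then have "((\<lambda>t. exp (- (r * t)) * Z t) has_real_derivative exp (- (r * t)) * (r * (Y t - Z t))) (at t)"
      using dE[OF tb] by simp
    moreover have "exp (- (r * t)) * (r * (Y t - Z t)) \<le> 0"
      using le[OF tb] r by (intro mult_nonneg_nonpos) (auto simp: Z_def)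
    ultimately show "\<exists>D. ((\<lambda>t. exp (- (r * t)) * Z t) has_real_derivative D) (at t) \<and> D \<le> 0" by blast
  next
    show "continuous_on {0..b} (\<lambda>t. exp (- (r * t)) * Z t)"
      using dE by (intro DERIV_continuous_on) blast
  qed
  then have "exp (r * b) * (exp (- (r * b)) * Z b) \<le> exp (r * b) * C" by (intro mult_left_mono) (auto simp: Z_def)
  moreover have "exp (r * b) * (exp (- (r * b)) * Z b) = Z b"
    unfolding mult.assoc[symmetric] exp_minus_inverse by simp
  ultimately have "Z b \<le> C * exp (r * b)" by (simp only: mult.commute)
  then show ?thesis using le[of b] b by (simp add: Z_def)
qed

section \<open>The energy inequality\<close>

lemma borel_measurable_fst_snd [measurable]:
  "fst \<in> borel_measurable (borel :: ('a::euclidean_space \<times> 'b::euclidean_space) measure)"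
  "snd \<in> borel_measurable (borel :: ('a::euclidean_space \<times> 'b::euclidean_space) measure)"
  by (auto intro!: borel_measurable_continuous_onI continuous_intros)

context
  fixes f :: "'a::euclidean_space \<times> 'b::euclidean_space \<Rightarrow> 'c::euclidean_space"
begin

lemma lborel_prod_integrableI:
  assumes "f \<in> borel_measurable borel" "integrable lborel (\<lambda>x. \<integral>y. norm (f (x, y)) \<partial>lborel)"
    "\<And>x. integrable lborel (\<lambda>y. f (x, y))"
  shows "integrable lborel f"
  using lborel_pair.Fubini_integrable[of f] assms by (simp add: lborel_prod)

lemma
  assumes "integrable lborel f"
  shows lborel_prod_integrable_fst: "integrable lborel (\<lambda>x. \<integral>y. f (x, y) \<partial>lborel)"
    and lborel_prod_integral_fst: "(\<integral>x. (\<integral>y. f (x, y) \<partial>lborel) \<partial>lborel) = integral\<^sup>L lborel f"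
    and lborel_prod_integrable_snd: "integrable lborel (\<lambda>y. \<integral>x. f (x, y) \<partial>lborel)"
    and lborel_prod_integral_snd: "(\<integral>y. (\<integral>x. f (x, y) \<partial>lborel) \<partial>lborel) = integral\<^sup>L lborel f"
    and lborel_prod_AE_integrable_snd: "AE y in lborel. integrable lborel (\<lambda>x. f (x, y))"
proof -
  have i: "integrable (lborel \<Otimes>\<^sub>M lborel) (case_prod (\<lambda>x y. f (x, y)))"
    using assms by (simp add: lborel_prod)
  show "integrable lborel (\<lambda>x. \<integral>y. f (x, y) \<partial>lborel)" by (rule lborel_pair.integrable_fst[OF i])
  show "(\<integral>x. (\<integral>y. f (x, y) \<partial>lborel) \<partial>lborel) = integral\<^sup>L lborel f"
    using lborel_pair.integral_fst[OF i] by (simp add: lborel_prod)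
  show "integrable lborel (\<lambda>y. \<integral>x. f (x, y) \<partial>lborel)" by (rule lborel_pair.integrable_snd[OF i])
  show "(\<integral>y. (\<integral>x. f (x, y) \<partial>lborel) \<partial>lborel) = integral\<^sup>L lborel f"
    using lborel_pair.integral_snd[OF i] by (simp add: lborel_prod)
  show "AE y in lborel. integrable lborel (\<lambda>x. f (x, y))" by (rule lborel_pair.AE_integrable_snd[OF i])
qed

end

lemma integrable_indicator_Ioo: "integrable lborel (\<lambda>s::real. indicator {a<..<b} s :: real)"
  using emeasure_bounded_finite[of "{a<..<b}"] by (intro integrable_real_indicator) auto

text \<open>The exceptional set of \<open>P\<close> may fail to be Borel, so it is first covered by
  a Borel null set \<open>N\<close>; the order of the two almost-everywhere quantifiers is exchanged
  for the complement of \<open>N\<close>.\<close>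

lemma lborel_prod_AE_snd:
  fixes P :: "'a::euclidean_space \<times> 'b::euclidean_space \<Rightarrow> bool"
  assumes "AE z in lborel. P z"
  shows "AE y in lborel. AE x in lborel. P (x, y)"
proof -
  obtain N where N: "N \<in> null_sets lborel" "{z. \<not> P z} \<subseteq> N"
    using assms by (auto elim!: AE_E simp: null_sets_def)
  have [measurable]: "N \<in> sets borel" using N(1) by auto
  have "AE z in lborel. z \<notin> N" by (rule AE_not_in[OF N(1)])
  then have "AE z in lborel \<Otimes>\<^sub>M lborel. z \<notin> N" unfolding lborel_prod .
  then have "AE x in lborel. AE y in lborel. (x, y) \<notin> N" by (rule lborel_pair.AE_pair)
  moreover have "(AE x in lborel. AE y in lborel. (x, y) \<notin> N) \<longleftrightarrow> (AE y in lborel. AE x in lborel. (x, y) \<notin> N)"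
  proof (rule lborel_pair.AE_commute, goal_cases)
    case 1
    have "{x \<in> space lborel. (fst x, snd x) \<notin> N} = - N" by auto
    then show ?case unfolding lborel_prod using N(1) by auto
  qed
  ultimately have "AE y in lborel. AE x in lborel. (x, y) \<notin> N" by simp
  then show ?thesis
  proof eventually_elim
    case (elim y)
    then show ?case by (rule AE_mp) (use N(2) in auto)
  qed
qed

text \<open>The difference of two solutions appears twice. \<open>W t\<close> is its slice at every
  time \<open>t\<close>, including 0, and carries the continuity in time and the initial trace;
  \<open>w\<close> is a jointly Borel function used in space-time integrals, and the two agree only
  for almost every time. \<open>A\<close> and \<Gamma> stand for the differences of fluxes and
  reaction terms, and the fact \<open>weak\<close> is the increment identity for bounded tests that
  do not depend on time.\<close>

locale parabolic_difference =
  fixes \<Omega> :: "(real^'n) set" and T p \<rho> :: real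
    and W :: "real \<Rightarrow> real^'n \<Rightarrow> real"
    and w \<Gamma> R :: "(real^'n) \<times> real \<Rightarrow> real"
    and Dw A :: "(real^'n) \<times> real \<Rightarrow> real^'n"
  assumes p: "p > 1" and \<Omega>: "open \<Omega>" "bounded \<Omega>" and T: "T > 0" and \<rho>: "\<rho> \<ge> 0"
    and W_integrable: "\<And>t. t \<in> {0..T} \<Longrightarrow> integrable (lebesgue_on \<Omega>) (W t)"
    and W_continuous: "\<And>t. t \<in> {0..T} \<Longrightarrow>
      ((\<lambda>s. \<integral>x. \<bar>W s x - W t x\<bar> \<partial>lebesgue_on \<Omega>) \<longlongrightarrow> 0) (at t within {0..T})"
    and w_meas [measurable]: "w \<in> borel_measurable borel"
    and \<Gamma>_meas [measurable]: "\<Gamma> \<in> borel_measurable borel"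
    and R_meas [measurable]: "R \<in> borel_measurable borel"
    and Dw_meas [measurable]: "Dw \<in> borel_measurable borel"
    and A_meas [measurable]: "A \<in> borel_measurable borel"
    and outside: "\<And>z. z \<notin> cylinder \<Omega> T \<Longrightarrow> w z = 0 \<and> \<Gamma> z = 0 \<and> Dw z = 0 \<and> A z = 0"
    and w_p: "integrable lborel (\<lambda>z. norm (w z) powr p)"
    and Dw_p: "integrable lborel (\<lambda>z. norm (Dw z) powr p)"
    and \<Gamma>_p: "integrable lborel (\<lambda>z. norm (\<Gamma> z) powr p)"
    and A_p: "integrable lborel (\<lambda>z. norm (A z) powr conj_exp p)"
    and R_integrable: "integrable lborel R"
    and slices: "AE t in lborel. t \<in> {0<..<T} \<longrightarrow> (AE x in lebesgue_on \<Omega>. W t x = w (x, t))"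
    and W0: "AE t in lborel. t \<in> {0<..<T} \<longrightarrow> W0_pair p \<Omega> (\<lambda>x. w (x, t)) (\<lambda>x. Dw (x, t))"
    and weak: "\<And>\<phi> g M t1 t2. W0_pair p \<Omega> \<phi> g \<Longrightarrow> (\<And>x. \<bar>\<phi> x\<bar> \<le> M) \<Longrightarrow> 0 < t1 \<Longrightarrow> t1 < t2 \<Longrightarrow> t2 < T \<Longrightarrow>
        (\<integral>x. (W t2 x - W t1 x) * \<phi> x \<partial>lebesgue_on \<Omega>) =
        - (\<integral>z. indicator {t1<..<t2} (snd z) * (A z \<bullet> g (fst z) + \<Gamma> z * \<phi> (fst z)) \<partial>lborel)"
    and coercive: "AE z in lborel. - (A z \<bullet> Dw z) \<le> R z * \<bar>w z\<bar>"
    and growth: "AE z in lborel. \<bar>\<Gamma> z\<bar> \<le> \<rho> * \<bar>w z\<bar>"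
begin

lemma Q_borel: "cylinder \<Omega> T \<in> sets borel" and Q_finite: "emeasure lborel (cylinder \<Omega> T) < \<infinity>"
  and \<Omega>_borel [measurable]: "\<Omega> \<in> sets borel" and \<Omega>_finite: "emeasure lborel \<Omega> < \<infinity>"
  using \<Omega> by (auto intro!: borel_open open_Times emeasure_bounded_finite[unfolded infinity_ennreal_def] bounded_Times)

lemma \<Omega>_integrable_const: "integrable (lebesgue_on \<Omega>) (\<lambda>x. c :: real)"
  using \<Omega>_finite by (simp add: integrable_lebesgue_on_iff integrable_real_indicator)

lemma integrable_compose_W:
  assumes \<Phi>: "continuous_on UNIV \<Phi>" "\<And>a b. \<bar>\<Phi> a - \<Phi> b\<bar> \<le> L * \<bar>a - b\<bar>" "\<Phi> 0 = (0::real)" and t: "t \<in> {0..T}"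
  shows "integrable (lebesgue_on \<Omega>) (\<lambda>x. \<Phi> (W t x))"
proof (rule Bochner_Integration.integrable_bound)
  show "integrable (lebesgue_on \<Omega>) (\<lambda>x. L * W t x)" using W_integrable[OF t] by simp
  have [measurable]: "\<Phi> \<in> borel_measurable borel" by (rule borel_measurable_continuous_onI[OF \<Phi>(1)])
  have [measurable]: "W t \<in> borel_measurable (lebesgue_on \<Omega>)" using W_integrable[OF t] by auto
  show "(\<lambda>x. \<Phi> (W t x)) \<in> borel_measurable (lebesgue_on \<Omega>)" by measurable
  have "\<bar>\<Phi> a\<bar> \<le> \<bar>L\<bar> * \<bar>a\<bar>" for a
    using \<Phi>(2)[of a 0] \<Phi>(3) mult_right_mono[OF abs_ge_self[of L] abs_ge_zero[of a]] by simp
  then show "AE x in lebesgue_on \<Omega>. norm (\<Phi> (W t x)) \<le> norm (L * W t x)" by (simp add: abs_mult)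
qed

lemma continuous_on_integral_compose_W:
  assumes \<Phi>: "continuous_on UNIV \<Phi>" "\<And>a b. \<bar>\<Phi> a - \<Phi> b\<bar> \<le> L * \<bar>a - b\<bar>" "\<Phi> 0 = (0::real)"
  shows "continuous_on {0..T} (\<lambda>t. \<integral>x. \<Phi> (W t x) \<partial>lebesgue_on \<Omega>)"
  unfolding continuous_on_def
proof
  fix t assume t: "t \<in> {0..T}"
  note i = integrable_compose_W[OF \<Phi>]
  have "((\<lambda>s. (\<integral>x. \<Phi> (W s x) \<partial>lebesgue_on \<Omega>) - (\<integral>x. \<Phi> (W t x) \<partial>lebesgue_on \<Omega>)) \<longlongrightarrow> 0) (at t within {0..T})"
  proof (rule Lim_null_comparison)
    show "((\<lambda>s. L * (\<integral>x. \<bar>W s x - W t x\<bar> \<partial>lebesgue_on \<Omega>)) \<longlongrightarrow> 0) (at t within {0..T})"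
      using tendsto_mult_left[OF W_continuous[OF t], of L] by simp
    have "norm ((\<integral>x. \<Phi> (W s x) \<partial>lebesgue_on \<Omega>) - (\<integral>x. \<Phi> (W t x) \<partial>lebesgue_on \<Omega>)) \<le> L * (\<integral>x. \<bar>W s x - W t x\<bar> \<partial>lebesgue_on \<Omega>)"
      if s: "s \<in> {0..T}" for s
    proof -
      have "norm ((\<integral>x. \<Phi> (W s x) \<partial>lebesgue_on \<Omega>) - (\<integral>x. \<Phi> (W t x) \<partial>lebesgue_on \<Omega>)) = norm (\<integral>x. \<Phi> (W s x) - \<Phi> (W t x) \<partial>lebesgue_on \<Omega>)"
        using i[OF s] i[OF t] by simp
      also have "\<dots> \<le> (\<integral>x. norm (\<Phi> (W s x) - \<Phi> (W t x)) \<partial>lebesgue_on \<Omega>)" by (rule integral_norm_bound)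
      also have "\<dots> \<le> (\<integral>x. L * \<bar>W s x - W t x\<bar> \<partial>lebesgue_on \<Omega>)"
        by (rule integral_mono) (use i[OF s] i[OF t] W_integrable[OF s] W_integrable[OF t] \<Phi>(2) in auto)
      finally show ?thesis by simp
    qed
    then show "\<forall>\<^sub>F s in at t within {0..T}. norm ((\<integral>x. \<Phi> (W s x) \<partial>lebesgue_on \<Omega>) - (\<integral>x. \<Phi> (W t x) \<partial>lebesgue_on \<Omega>)) \<le> L * (\<integral>x. \<bar>W s x - W t x\<bar> \<partial>lebesgue_on \<Omega>)"
      by (auto simp: eventually_at_filter)
  qed
  then show "((\<lambda>t. \<integral>x. \<Phi> (W t x) \<partial>lebesgue_on \<Omega>) \<longlongrightarrow> (\<integral>x. \<Phi> (W t x) \<partial>lebesgue_on \<Omega>)) (at t within {0..T})"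
    by (rule LIM_zero_cancel)
qed

lemma \<Gamma>_integrable: "integrable lborel \<Gamma>"
  by (rule integrable_norm_powr_imp_integrable[OF p \<Gamma>_meas Q_borel Q_finite _ \<Gamma>_p]) (use outside in blast)

text \<open>Testing at time \<open>s\<close> with \<open>H(w(\<cdot>,s))\<close>, the increments over \<open>(s - h, s)\<close> are estimated by convexity.
  After averaging over \<open>s\<close>, the limit \<open>h \<rightarrow> 0\<close> only requires the continuity of translations.\<close>

lemma energy_inequality:
  assumes H: "\<And>k. continuously_diff k H" "H 0 = 0" and H': "\<And>s. (H has_real_derivative H' s) (at s)"
    and cont: "continuous_on UNIV H'" and M: "\<And>s. \<bar>H' s\<bar> \<le> M" and H1: "\<And>s. \<bar>H s\<bar> \<le> 1"
    and \<Phi>: "continuous_on UNIV \<Phi>" "\<And>a b. \<bar>\<Phi> a - \<Phi> b\<bar> \<le> \<bar>a - b\<bar>" "\<Phi> 0 = 0"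
    and convex: "\<And>a b. \<Phi> a - \<Phi> b \<le> (a - b) * H a"
    and t: "0 < t1" "t1 < t2" "t2 < T"
  shows "(\<integral>x. \<Phi> (W t2 x) \<partial>lebesgue_on \<Omega>) - (\<integral>x. \<Phi> (W t1 x) \<partial>lebesgue_on \<Omega>) \<le>
    - (\<integral>z. indicator {t1<..<t2} (snd z) * (H' (w z) * (A z \<bullet> Dw z) + \<Gamma> z * H (w z)) \<partial>lborel)"
proof -
  let ?q = "conj_exp p"
  have q: "?q > 1" "conj_exp ?q = p" using conj_exp_bounds[OF p] by auto
  have M0: "M \<ge> 0" using M[of 0] by simp
  have Hm[measurable]: "H \<in> borel_measurable borel" "H' \<in> borel_measurable borel"
    using H(1)[of 0] cont by (auto intro: borel_measurable_continuous_onI)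
  define I where "I = {t1<..<t2}"
  have [measurable]: "I \<in> sets borel" by (simp add: I_def)
  define B0 where "B0 z = indicator I (snd z) * H (w z)" for z
  define DB where "DB z = (indicator I (snd z) * H' (w z)) *\<^sub>R Dw z" for z
  have B0m[measurable]: "B0 \<in> borel_measurable borel" unfolding B0_def by measurable
  have DBm[measurable]: "DB \<in> borel_measurable borel" unfolding DB_def by measurable
  have B00: "B0 z = 0" if "z \<notin> cylinder \<Omega> T" for z using outside[OF that] H(2) by (simp add: B0_def)
  have DB0: "DB z = 0" if "z \<notin> cylinder \<Omega> T" for z using outside[OF that] by (simp add: DB_def)
  have B01: "\<bar>B0 z\<bar> \<le> 1" for z using H1 by (auto simp: B0_def indicator_def)
  have iQ: "integrable lborel (\<lambda>z. indicator (cylinder \<Omega> T) z :: real)"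
    using Q_finite Q_borel by (simp add: integrable_real_indicator)
  have DBp: "integrable lborel (\<lambda>z. norm (DB z) powr p)"
  proof (rule Bochner_Integration.integrable_bound)
    show "integrable lborel (\<lambda>z. M powr p * norm (Dw z) powr p)" using Dw_p by simp
    have "norm (DB z) powr p \<le> M powr p * norm (Dw z) powr p" for z
    proof -
      have "norm (DB z) \<le> M * norm (Dw z)"
        using mult_right_mono[OF M[of "w z"], of "norm (Dw z)"] M0 by (auto simp: DB_def indicator_def)
      then have "norm (DB z) powr p \<le> (M * norm (Dw z)) powr p" using p by (intro powr_mono2) auto
      then show ?thesis by (simp add: powr_mult)
    qed
    then show "AE z in lborel. norm (norm (DB z) powr p) \<le> norm (M powr p * norm (Dw z) powr p)" by simp
  qed measurable
  have DB1: "integrable lborel DB"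
    by (rule integrable_norm_powr_imp_integrable[OF p DBm Q_borel Q_finite DB0 DBp])
  have B0q: "integrable lborel (\<lambda>z. norm (B0 z) powr ?q)"
  proof (rule Bochner_Integration.integrable_bound[OF iQ])
    have "norm (B0 z) powr ?q \<le> indicator (cylinder \<Omega> T) z" for z
      using B00[of z] B01[of z] powr_mono2[of ?q "\<bar>B0 z\<bar>" 1] q by (auto simp: indicator_def)
    then show "AE z in lborel. norm (norm (B0 z) powr ?q) \<le> norm (indicator (cylinder \<Omega> T) z :: real)" by simp
  qed measurable
  have B0i: "integrable lborel B0"
    by (rule integrable_norm_powr_imp_integrable[OF q(1) B0m Q_borel Q_finite B00 B0q])
  \<comment> \<open>Adding \<open>\<tau> d\<close> moves a point back in time by \<tau>: the flux is
    evaluated earlier than the test it is paired with.\<close>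
  define d where "d = (0 :: real^'n, -1 :: real)"
  have iA: "integrable lborel (\<lambda>z. A (z + y) \<bullet> DB z)" for y
    using integrable_lborel_translation[OF A_p, of y] by (intro integrable_inner_conj_exp[OF p _ _ _ DBp]) auto
  have i\<Gamma>: "integrable lborel (\<lambda>z. \<Gamma> (z + y) * B0 z)" for y
    using integrable_mult_bounded[OF integrable_lborel_translation[OF \<Gamma>_integrable, of y] _ B01] by simp
  \<comment> \<open>At \<tau> = 0 this is the integral on the right-hand side of the claim; for
    \<tau> > 0 it pairs the test at time \<open>s\<close> with the flux at time
    \<open>s - \<tau>\<close>.\<close>
  define J where "J \<tau> = (\<integral>z. A (z + \<tau> *\<^sub>R d) \<bullet> DB z + \<Gamma> (z + \<tau> *\<^sub>R d) * B0 z \<partial>lborel)" for \<tau>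
  have J_eq: "J \<tau> = (\<integral>z. A (z + \<tau> *\<^sub>R d) \<bullet> DB z \<partial>lborel) + (\<integral>z. \<Gamma> (z + \<tau> *\<^sub>R d) \<bullet> B0 z \<partial>lborel)" for \<tau>
    using iA[of "\<tau> *\<^sub>R d"] i\<Gamma>[of "\<tau> *\<^sub>R d"] by (simp add: J_def)
  \<comment> \<open>The translation lemma is applied twice with opposite roles: \<open>A\<close>
    lies in the conjugate space of \<open>DB\<close>, and \<Gamma> lies in L^p while the bounded
    \<open>B0\<close> is taken in the conjugate space. The scalar product of reals is written as an
    inner product for this purpose.\<close>
  have J_lim: "(J \<longlongrightarrow> (\<integral>z. A z \<bullet> DB z \<partial>lborel) + (\<integral>z. \<Gamma> z \<bullet> B0 z \<partial>lborel)) (at 0)"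
    unfolding J_eq[abs_def]
    by (intro tendsto_add tendsto_integral_inner_translation[OF p A_meas DBm A_p DBp DB1]
        tendsto_integral_inner_translation[OF q(1) \<Gamma>_meas B0m _ B0q B0i]) (simp add: q \<Gamma>_p[unfolded real_norm_def])
  have J0_eq: "(\<integral>z. A z \<bullet> DB z \<partial>lborel) + (\<integral>z. \<Gamma> z \<bullet> B0 z \<partial>lborel) =
      (\<integral>z. indicator {t1<..<t2} (snd z) * (H' (w z) * (A z \<bullet> Dw z) + \<Gamma> z * H (w z)) \<partial>lborel)"
  proof -
    have "(\<integral>z. A z \<bullet> DB z \<partial>lborel) + (\<integral>z. \<Gamma> z \<bullet> B0 z \<partial>lborel) = (\<integral>z. A z \<bullet> DB z + \<Gamma> z \<bullet> B0 z \<partial>lborel)"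
      using iA[of 0] i\<Gamma>[of 0] by simp
    also have "\<dots> = (\<integral>z. indicator {t1<..<t2} (snd z) * (H' (w z) * (A z \<bullet> Dw z) + \<Gamma> z * H (w z)) \<partial>lborel)"
      by (intro Bochner_Integration.integral_cong) (auto simp: DB_def B0_def I_def algebra_simps)
    finally show ?thesis .
  qed
  define y where "y t = (\<integral>x. \<Phi> (W t x) \<partial>lebesgue_on \<Omega>)" for t
  have yc: "continuous_on {0..T} y"
    unfolding y_def[abs_def] by (rule continuous_on_integral_compose_W[where L=1]) (use \<Phi> in auto)
  define \<Psi> where "\<Psi> h = (\<lambda>(\<tau>, z). indicator {0<..<h} \<tau> * (A (z + \<tau> *\<^sub>R d) \<bullet> DB z + \<Gamma> (z + \<tau> *\<^sub>R d) * B0 z))" for h :: real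
  have \<Psi>i: "integrable lborel (\<Psi> h)" for h
  proof (rule Bochner_Integration.integrable_bound)
    let ?b = "\<lambda>(\<tau>::real, z). indicator {0<..<h} \<tau> * (norm (A (z + \<tau> *\<^sub>R d)) powr ?q + norm (DB z) powr p + norm (\<Gamma> (z + \<tau> *\<^sub>R d)))"
    show "integrable lborel ?b"
    proof (rule lborel_prod_integrableI)
      have iz: "integrable lborel (\<lambda>z. norm (A (z + \<tau> *\<^sub>R d)) powr ?q)" "integrable lborel (\<lambda>z. norm (\<Gamma> (z + \<tau> *\<^sub>R d)))" for \<tau>
        using integrable_lborel_translation[OF A_p, of "\<tau> *\<^sub>R d"] integrable_lborel_translation[OF \<Gamma>_integrable, of "\<tau> *\<^sub>R d"] by auto
      show "integrable lborel (\<lambda>z. ?b (\<tau>, z))" for \<tau> using iz[of \<tau>] DBp by simp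
      have n1: "(\<integral>z. norm (?b (\<tau>, z)) \<partial>lborel) = indicator {0<..<h} \<tau> * ((\<integral>z. norm (A z) powr ?q \<partial>lborel) + (\<integral>z. norm (DB z) powr p \<partial>lborel) + (\<integral>z. norm (\<Gamma> z) \<partial>lborel))" for \<tau>
      proof -
        have "(\<integral>z. norm (?b (\<tau>, z)) \<partial>lborel) = (\<integral>z. ?b (\<tau>, z) \<partial>lborel)"
          by (intro Bochner_Integration.integral_cong) auto
        also have "\<dots> = indicator {0<..<h} \<tau> * ((\<integral>z. norm (A (z + \<tau> *\<^sub>R d)) powr ?q \<partial>lborel) + (\<integral>z. norm (DB z) powr p \<partial>lborel) + (\<integral>z. norm (\<Gamma> (z + \<tau> *\<^sub>R d)) \<partial>lborel))"
          using iz[of \<tau>] DBp by simp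
        also have "(\<integral>z. norm (A (z + \<tau> *\<^sub>R d)) powr ?q \<partial>lborel) = (\<integral>z. norm (A z) powr ?q \<partial>lborel)"
          by (rule integral_lborel_translation[where f="\<lambda>z. norm (A z) powr ?q"]) measurable
        also have "(\<integral>z. norm (\<Gamma> (z + \<tau> *\<^sub>R d)) \<partial>lborel) = (\<integral>z. norm (\<Gamma> z) \<partial>lborel)"
          by (rule integral_lborel_translation[where f="\<lambda>z. norm (\<Gamma> z)"]) measurable
        finally show ?thesis .
      qed
      show "integrable lborel (\<lambda>\<tau>. \<integral>z. norm (?b (\<tau>, z)) \<partial>lborel)"
        unfolding n1 by (intro integrable_mult_left integrable_indicator_Ioo)
    qed (unfold case_prod_beta', measurable)
    have "\<bar>A (z + \<tau> *\<^sub>R d) \<bullet> DB z + \<Gamma> (z + \<tau> *\<^sub>R d) * B0 z\<bar> \<le> norm (A (z + \<tau> *\<^sub>R d)) powr ?q + norm (DB z) powr p + norm (\<Gamma> (z + \<tau> *\<^sub>R d))" for \<tau> z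
    proof -
      have "\<bar>\<Gamma> (z + \<tau> *\<^sub>R d) * B0 z\<bar> \<le> \<bar>\<Gamma> (z + \<tau> *\<^sub>R d)\<bar> * 1"
        unfolding abs_mult by (intro mult_left_mono B01) auto
      then show ?thesis using Young_inner[OF p, of 1 "A (z + \<tau> *\<^sub>R d)" "DB z"] by simp
    qed
    then show "AE x in lborel. norm (\<Psi> h x) \<le> norm (?b x)"
      by (intro AE_I2) (auto simp: \<Psi>_def abs_mult indicator_def split: prod.splits intro: order_trans[OF _ abs_ge_self])
    show "\<Psi> h \<in> borel_measurable lborel" unfolding \<Psi>_def case_prod_beta' by measurable
  qed
  define G where "G h z = (\<integral>\<tau>. \<Psi> h (\<tau>, z) \<partial>lborel)" for h z
  have Gi: "integrable lborel (G h)" for h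
    unfolding G_def[abs_def] by (rule lborel_prod_integrable_snd[OF \<Psi>i])
  have \<Psi>J: "(\<integral>z. \<Psi> h (\<tau>, z) \<partial>lborel) = indicator {0<..<h} \<tau> * J \<tau>" for h \<tau> by (simp add: \<Psi>_def J_def)
  have GJ: "(\<integral>z. G h z \<partial>lborel) = (\<integral>\<tau>. indicator {0<..<h} \<tau> * J \<tau> \<partial>lborel)" for h
    using lborel_prod_integral_fst[OF \<Psi>i[of h]] lborel_prod_integral_snd[OF \<Psi>i[of h]] by (simp add: \<Psi>J G_def)
  have J_int: "integrable lborel (\<lambda>\<tau>. indicator {0<..<h} \<tau> * J \<tau>)" for h
    using lborel_prod_integrable_fst[OF \<Psi>i[of h]] by (simp add: \<Psi>J)
  have good: "AE s in lborel. s \<in> I \<longrightarrow> y s - y (s - h) \<le> - (\<integral>x. G h (x, s) \<partial>lborel)" if h: "0 < h" "h < t1" for h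
    using slices W0
  proof eventually_elim
    case (elim s)
    show ?case
    proof
      assume s: "s \<in> I"
      then have sT: "s \<in> {0<..<T}" "s \<in> {0..T}" "s - h \<in> {0..T}" "0 < s - h" "s < T" using t h by (auto simp: I_def)
      have sl: "AE x in lebesgue_on \<Omega>. W s x = w (x, s)" and W0s: "W0_pair p \<Omega> (\<lambda>x. w (x, s)) (\<lambda>x. Dw (x, s))"
        using elim sT(1) by auto
      define \<phi> where "\<phi> x = H (w (x, s))" for x
      define g where "g x = H' (w (x, s)) *\<^sub>R Dw (x, s)" for x
      have W0\<phi>: "W0_pair p \<Omega> \<phi> g"
        unfolding \<phi>_def g_def by (rule W0_pair_compose[OF W0s p H H' cont M])
      have \<phi>1: "\<bar>\<phi> x\<bar> \<le> 1" for x using H1 by (simp add: \<phi>_def)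
      have [measurable]: "\<phi> \<in> borel_measurable borel" "g \<in> borel_measurable borel"
        and gp: "integrable lborel (\<lambda>x. norm (g x) powr p)" using W0\<phi> by (auto simp: W0_pair_def)
      note \<Phi>i = integrable_compose_W[of \<Phi> 1, OF \<Phi>(1) _ \<Phi>(3)]
      have [measurable]: "W s \<in> borel_measurable (lebesgue_on \<Omega>)" "W (s - h) \<in> borel_measurable (lebesgue_on \<Omega>)"
        using W_integrable[OF sT(2)] W_integrable[OF sT(3)] by auto
      have "y s - y (s - h) = (\<integral>x. \<Phi> (W s x) - \<Phi> (W (s - h) x) \<partial>lebesgue_on \<Omega>)"
        unfolding y_def using \<Phi>i[of s] \<Phi>i[of "s - h"] sT \<Phi>(2) by simp
      \<comment> \<open>Convexity at the later time \<open>s\<close>: the tangent slope is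
        \<open>H (W s x)\<close>, which is exactly the test function that was frozen at time
        \<open>s\<close>.\<close>
      also have "\<dots> \<le> (\<integral>x. (W s x - W (s - h) x) * H (W s x) \<partial>lebesgue_on \<Omega>)"
      proof (rule integral_mono)
        show "integrable (lebesgue_on \<Omega>) (\<lambda>x. \<Phi> (W s x) - \<Phi> (W (s - h) x))"
          using \<Phi>i[of s] \<Phi>i[of "s - h"] sT \<Phi>(2) by simp
        show "integrable (lebesgue_on \<Omega>) (\<lambda>x. (W s x - W (s - h) x) * H (W s x))"
          using W_integrable[OF sT(2)] W_integrable[OF sT(3)] H1
          by (intro integrable_mult_bounded[where C=1]) auto
      qed (rule convex)
      also have "\<dots> = (\<integral>x. (W s x - W (s - h) x) * \<phi> x \<partial>lebesgue_on \<Omega>)"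
      proof (rule integral_cong_AE)
        show "(\<lambda>x. (W s x - W (s - h) x) * \<phi> x) \<in> borel_measurable (lebesgue_on \<Omega>)"
          using borel_measurable_lebesgue_onI[of \<phi> \<Omega>] by simp
      qed (use sl in \<open>auto simp: \<phi>_def\<close>)
      also have "\<dots> = - (\<integral>z. indicator {s - h<..<s} (snd z) * (A z \<bullet> g (fst z) + \<Gamma> z * \<phi> (fst z)) \<partial>lborel)"
        by (rule weak[OF W0\<phi> \<phi>1 sT(4) _ sT(5)]) (use h in simp)
      also have "(\<integral>z. indicator {s - h<..<s} (snd z) * (A z \<bullet> g (fst z) + \<Gamma> z * \<phi> (fst z)) \<partial>lborel) = (\<integral>x. G h (x, s) \<partial>lborel)"
      proof -
        let ?k = "\<lambda>z. indicator {s - h<..<s} (snd z) * (A z \<bullet> g (fst z) + \<Gamma> z * \<phi> (fst z))"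
        have ki: "integrable lborel ?k"
        proof (rule Bochner_Integration.integrable_bound)
          let ?c = "\<lambda>z::(real^'n)\<times>real. indicator {s - h<..<s} (snd z) * norm (g (fst z)) powr p"
          have ii: "integrable lborel (\<lambda>\<sigma>::real. indicator {s - h<..<s} \<sigma> :: real)"
            by (rule integrable_indicator_Ioo)
          have "integrable lborel ?c"
          proof (rule lborel_prod_integrableI)
            have "(\<integral>\<sigma>. norm (?c (x, \<sigma>)) \<partial>lborel) = h * norm (g x) powr p" for x
              using h by (simp add: abs_mult)
            then show "integrable lborel (\<lambda>x. \<integral>\<sigma>. norm (?c (x, \<sigma>)) \<partial>lborel)" using gp by simp
            show "integrable lborel (\<lambda>\<sigma>. ?c (x, \<sigma>))" for x using ii by simp
          qed measurable
          then show "integrable lborel (\<lambda>z. norm (A z) powr ?q + ?c z + norm (\<Gamma> z))"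
            using A_p \<Gamma>_integrable by simp
          have "\<bar>?k z\<bar> \<le> norm (A z) powr ?q + ?c z + norm (\<Gamma> z)" for z
          proof (cases "snd z \<in> {s - h<..<s}")
            case True
            have "\<bar>\<Gamma> z * \<phi> (fst z)\<bar> \<le> \<bar>\<Gamma> z\<bar> * 1"
              unfolding abs_mult by (intro mult_left_mono \<phi>1) auto
            then show ?thesis using Young_inner[OF p, of 1 "A z" "g (fst z)"] True by simp
          qed simp
          then show "AE z in lborel. norm (?k z) \<le> norm (norm (A z) powr ?q + ?c z + norm (\<Gamma> z))"
            by (intro AE_I2) (auto intro: order_trans[OF _ abs_ge_self])
        qed measurable
        have "integral\<^sup>L lborel ?k = (\<integral>x. (\<integral>\<sigma>. ?k (x, \<sigma>) \<partial>lborel) \<partial>lborel)"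
          by (rule lborel_prod_integral_fst[OF ki, symmetric])
        also have "\<dots> = (\<integral>x. G h (x, s) \<partial>lborel)"
        proof (rule Bochner_Integration.integral_cong[OF refl])
          fix x
          \<comment> \<open>The substitution \<sigma> = s - \<tau> turns integration over
            \<open>(s - h, s)\<close> into integration over the delay \<tau> in
            \<open>(0, h)\<close>.\<close>
          have "(\<integral>\<sigma>. ?k (x, \<sigma>) \<partial>lborel) = \<bar>-1\<bar> *\<^sub>R (\<integral>\<tau>. ?k (x, s + (-1) * \<tau>) \<partial>lborel)"
            by (rule lborel_integral_real_affine) simp
          also have "\<dots> = (\<integral>\<tau>. \<Psi> h (\<tau>, (x, s)) \<partial>lborel)"
            unfolding abs_minus abs_one scaleR_one
          proof (rule Bochner_Integration.integral_cong[OF refl])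
            fix \<tau>
            show "?k (x, s + (-1) * \<tau>) = \<Psi> h (\<tau>, (x, s))"
              using s by (auto simp: \<Psi>_def d_def DB_def B0_def g_def \<phi>_def indicator_def)
          qed
          finally show "(\<integral>\<sigma>. ?k (x, \<sigma>) \<partial>lborel) = G h (x, s)" by (simp add: G_def)
        qed
        finally show ?thesis .
      qed
      finally show "y s - y (s - h) \<le> - (\<integral>x. G h (x, s) \<partial>lborel)" .
    qed
  qed
  have "y t2 - y t1 \<le> - ((\<integral>z. A z \<bullet> DB z \<partial>lborel) + (\<integral>z. \<Gamma> z \<bullet> B0 z \<partial>lborel))"
  proof (rule increment_le_of_mean_increments[OF yc t J_lim])
    show "integrable lborel (\<lambda>\<tau>. indicator {0<..<h} \<tau> * J \<tau>)" for h by (rule J_int)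
    fix h :: real assume h: "0 < h" "h < t1"
    have c: "continuous_on {t1..t2} (\<lambda>s. y s - y (s - h))"
      by (intro continuous_intros continuous_on_compose2[OF yc] continuous_on_subset[OF yc]) (use t h in auto)
    have si: "set_integrable lborel {t1..t2} (\<lambda>s. y s - y (s - h))"
      unfolding set_integrable_def by (rule borel_integrable_compact[OF _ c, unfolded indicator_scaleR_eq_if[symmetric]]) simp
    have "integral {t1..t2} (\<lambda>s. y s - y (s - h)) = (\<integral>s. indicator {t1..t2} s *\<^sub>R (y s - y (s - h)) \<partial>lborel)"
      using set_borel_integral_eq_integral(2)[OF si] by (simp add: set_lebesgue_integral_def)
    also have "\<dots> \<le> (\<integral>s. - (\<integral>x. G h (x, s) \<partial>lborel) \<partial>lborel)"
    proof (rule integral_mono_AE)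
      show "integrable lborel (\<lambda>s. indicator {t1..t2} s *\<^sub>R (y s - y (s - h)))" using si by (simp add: set_integrable_def)
      show "integrable lborel (\<lambda>s. - (\<integral>x. G h (x, s) \<partial>lborel))" using lborel_prod_integrable_snd[OF Gi[of h]] by simp
      show "AE s in lborel. indicator {t1..t2} s *\<^sub>R (y s - y (s - h)) \<le> - (\<integral>x. G h (x, s) \<partial>lborel)"
        \<comment> \<open>The estimate is available on the open interval, while the integral runs
          over the closed one; the two endpoints are null sets.\<close>
        using good[OF h] AE_lborel_singleton[of t1] AE_lborel_singleton[of t2]
      proof eventually_elim
        case (elim s)
        show ?case
        proof (cases "s \<in> I")
          case True
          then have "s \<in> {t1..t2}" by (auto simp: I_def)
          then show ?thesis using elim True by simp
        next
          case False
          then have "s \<notin> {t1..t2}" using elim by (auto simp: I_def)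
          moreover have "G h (x, s) = 0" for x using False by (simp add: G_def \<Psi>_def DB_def B0_def)
          ultimately show ?thesis by simp
        qed
      qed
    qed
    also have "\<dots> = - (\<integral>\<tau>. indicator {0<..<h} \<tau> * J \<tau> \<partial>lborel)"
      using lborel_prod_integral_snd[OF Gi[of h]] GJ[of h] by simp
    finally show "integral {t1..t2} (\<lambda>s. y s - y (s - h)) \<le> - (\<integral>\<tau>. indicator {0<..<h} \<tau> * J \<tau> \<partial>lborel)" .
  qed
  then show ?thesis unfolding J0_eq by (simp add: y_def)
qed

end

section \<open>Evolution of the weighted L^1 norm and nonpositivity\<close>

lemma continuous_on_weighted_abs: "continuous_on UNIV (weighted_abs \<kappa>)"
  unfolding weighted_abs_def[abs_def] divide_inverse by (intro continuous_intros)

lemma weighted_abs_zero: "weighted_abs \<kappa> 0 = 0"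
  by (simp add: weighted_abs_def)

lemma continuous_on_reg_abs:
  assumes "\<kappa> \<ge> 1" "\<delta> > 0" shows "continuous_on UNIV (reg_abs \<delta> \<kappa>)"
  using DERIV_reg_abs[OF assms] by (auto intro!: continuous_at_imp_continuous_on DERIV_isCont)

context parabolic_difference
begin

definition weighted_L1 :: "real \<Rightarrow> real \<Rightarrow> real" where
  "weighted_L1 \<kappa> t = (\<integral>x. weighted_abs \<kappa> (W t x) \<partial>lebesgue_on \<Omega>)"

lemma w_integrable: "integrable lborel w"
  by (rule integrable_norm_powr_imp_integrable[OF p w_meas Q_borel Q_finite _ w_p]) (use outside in blast)

lemma continuous_on_weighted_L1: "\<kappa> \<ge> 1 \<Longrightarrow> continuous_on {0..T} (weighted_L1 \<kappa>)"
  unfolding weighted_L1_def[abs_def]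
  by (rule continuous_on_integral_compose_W[OF continuous_on_weighted_abs weighted_abs_lipschitz weighted_abs_zero])

lemma weighted_abs_W_integrable:
  "\<kappa> \<ge> 1 \<Longrightarrow> t \<in> {0..T} \<Longrightarrow> integrable (lebesgue_on \<Omega>) (\<lambda>x. weighted_abs \<kappa> (W t x))"
  by (rule integrable_compose_W[OF continuous_on_weighted_abs weighted_abs_lipschitz weighted_abs_zero])

lemma weighted_abs_measurable [measurable]: "weighted_abs \<kappa> \<in> borel_measurable borel"
  by (rule borel_measurable_continuous_onI[OF continuous_on_weighted_abs])

lemma weighted_abs_w_integrable:
  assumes "\<kappa> \<ge> 1" shows "integrable lborel (\<lambda>z. weighted_abs \<kappa> (w z))"
  by (rule Bochner_Integration.integrable_bound[OF w_integrable]) (use weighted_abs_bounds[OF assms] in auto)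

lemma integral_compose_slice:
  assumes \<Phi>: "continuous_on UNIV \<Phi>" "\<Phi> 0 = (0::real)" and s: "s \<in> {0..T}"
    and eq: "AE x in lebesgue_on \<Omega>. W s x = w (x, s)"
  shows "(\<integral>x. \<Phi> (w (x, s)) \<partial>lborel) = (\<integral>x. \<Phi> (W s x) \<partial>lebesgue_on \<Omega>)"
proof -
  have [measurable]: "\<Phi> \<in> borel_measurable borel" by (rule borel_measurable_continuous_onI[OF \<Phi>(1)])
  have [measurable]: "W s \<in> borel_measurable (lebesgue_on \<Omega>)" using W_integrable[OF s] by auto
  have z: "\<Phi> (w (x, s)) = 0" if "x \<notin> \<Omega>" for x using outside[of "(x, s)"] that \<Phi>(2) by auto
  have m: "(\<lambda>x. \<Phi> (w (x, s))) \<in> borel_measurable borel" by measurable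
  have "(\<integral>x. \<Phi> (w (x, s)) \<partial>lborel) = (\<integral>x. \<Phi> (w (x, s)) \<partial>lebesgue_on \<Omega>)"
    by (rule integral_lebesgue_on_eq_lborel[symmetric, OF m \<Omega>_borel z])
  also have "\<dots> = (\<integral>x. \<Phi> (W s x) \<partial>lebesgue_on \<Omega>)"
    by (rule integral_cong_AE) (use eq borel_measurable_lebesgue_onI[OF m, of \<Omega>] in auto)
  finally show ?thesis .
qed

text \<open>The energy inequality is used with \<delta> = 1/(n+1). Its left side converges because
  \<open>reg_abs\<close> converges uniformly to \<open>weighted_abs\<close> on a domain of finite
  measure. The reaction term is at most \<rho> times the weighted absolute value for every
  \<open>n\<close>. The flux error is dominated by \<open>(1 + \<kappa>) |R|\<close> and vanishes
  pointwise, so only the reaction term survives.\<close>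

lemma weighted_L1_increment:
  assumes k: "\<kappa> \<ge> 1" and t: "0 < t1" "t1 < t2" "t2 < T"
  shows "weighted_L1 \<kappa> t2 - weighted_L1 \<kappa> t1 \<le> \<rho> * integral {t1..t2} (weighted_L1 \<kappa>)"
proof -
  define \<delta> where "\<delta> n = 1 / real (Suc n)" for n
  have \<delta>: "\<delta> n > 0" for n by (simp add: \<delta>_def)
  let ?i = "\<lambda>z::(real^'n)\<times>real. indicator {t1<..<t2} (snd z) :: real"
  define S where "S = (\<integral>z. ?i z * weighted_abs \<kappa> (w z) \<partial>lborel)"
  \<comment> \<open>An upper bound for the flux contribution: coercivity up to \<open>R |w|\<close>,
    multiplied by the nonnegative derivative of \<open>reg_sign\<close>.\<close>
  define E where "E n = (\<integral>z. R z * (\<bar>w z\<bar> * reg_sign_deriv (\<delta> n) \<kappa> (w z)) * ?i z \<partial>lborel)" for n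
  define y where "y n s = (\<integral>x. reg_abs (\<delta> n) \<kappa> (W s x) \<partial>lebesgue_on \<Omega>)" for n s
  have Hm[measurable]: "reg_sign (\<delta> n) \<kappa> \<in> borel_measurable borel" "reg_sign_deriv (\<delta> n) \<kappa> \<in> borel_measurable borel" for n
    using continuously_diff_reg_sign[OF k, of 0 "\<delta> n"] continuous_on_reg_sign_deriv[OF k \<delta>]
    by (auto intro: borel_measurable_continuous_onI)
  have i1: "\<bar>?i z\<bar> \<le> 1" for z by (simp add: indicator_def)
  have iS: "integrable lborel (\<lambda>z. ?i z * weighted_abs \<kappa> (w z))"
    using integrable_mult_bounded[OF weighted_abs_w_integrable[OF k] _ i1] by (simp add: mult.commute)
  have iE: "integrable lborel (\<lambda>z. R z * (\<bar>w z\<bar> * reg_sign_deriv (\<delta> n) \<kappa> (w z)) * ?i z)" for n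
  proof (rule integrable_mult_bounded[OF integrable_mult_bounded[OF R_integrable] _ i1])
    show "\<bar>\<bar>w z\<bar> * reg_sign_deriv (\<delta> n) \<kappa> (w z)\<bar> \<le> 1 + \<kappa>" for z
      using reg_sign_deriv_mult_bound(2)[OF k \<delta>, of "w z"] reg_sign_deriv_nonneg[OF k \<delta>, of n "w z"] by simp
  qed measurable
  have step: "y n t2 - y n t1 \<le> E n + \<rho> * S" for n
  proof -
    have AD: "integrable lborel (\<lambda>z. A z \<bullet> Dw z)"
      by (rule integrable_inner_conj_exp[OF p _ _ A_p Dw_p]) auto
    have iL: "integrable lborel (\<lambda>z. ?i z * (reg_sign_deriv (\<delta> n) \<kappa> (w z) * (A z \<bullet> Dw z) + \<Gamma> z * reg_sign (\<delta> n) \<kappa> (w z)))"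
    proof -
      have a: "integrable lborel (\<lambda>z. (A z \<bullet> Dw z) * reg_sign_deriv (\<delta> n) \<kappa> (w z))"
        by (rule integrable_mult_bounded[OF AD _ reg_sign_deriv_bound[OF k \<delta>]]) measurable
      have b: "integrable lborel (\<lambda>z. \<Gamma> z * reg_sign (\<delta> n) \<kappa> (w z))"
        by (rule integrable_mult_bounded[OF \<Gamma>_integrable _ reg_sign_mult_bound(2)[OF k \<delta>]]) measurable
      from integrable_mult_bounded[OF Bochner_Integration.integrable_add[OF a b] _ i1]
      show ?thesis by (simp add: mult.commute)
    qed
    have "y n t2 - y n t1 \<le> - (\<integral>z. ?i z * (reg_sign_deriv (\<delta> n) \<kappa> (w z) * (A z \<bullet> Dw z) + \<Gamma> z * reg_sign (\<delta> n) \<kappa> (w z)) \<partial>lborel)"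
      unfolding y_def
      by (rule energy_inequality[OF continuously_diff_reg_sign[OF k] reg_sign_zero DERIV_reg_sign[OF k \<delta>]
            continuous_on_reg_sign_deriv[OF k \<delta>] reg_sign_deriv_bound[OF k \<delta>] reg_sign_mult_bound(2)[OF k \<delta>]
            continuous_on_reg_abs[OF k \<delta>] reg_abs_lipschitz[OF k \<delta>] reg_abs_zero[OF k] reg_abs_convex[OF k \<delta>] t])
    also have "\<dots> = (\<integral>z. - (?i z * (reg_sign_deriv (\<delta> n) \<kappa> (w z) * (A z \<bullet> Dw z) + \<Gamma> z * reg_sign (\<delta> n) \<kappa> (w z))) \<partial>lborel)"
      by simp
    also have "\<dots> \<le> (\<integral>z. R z * (\<bar>w z\<bar> * reg_sign_deriv (\<delta> n) \<kappa> (w z)) * ?i z + \<rho> * (?i z * weighted_abs \<kappa> (w z)) \<partial>lborel)"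
    proof (rule integral_mono_AE)
      show "AE z in lborel. - (?i z * (reg_sign_deriv (\<delta> n) \<kappa> (w z) * (A z \<bullet> Dw z) + \<Gamma> z * reg_sign (\<delta> n) \<kappa> (w z))) \<le>
          R z * (\<bar>w z\<bar> * reg_sign_deriv (\<delta> n) \<kappa> (w z)) * ?i z + \<rho> * (?i z * weighted_abs \<kappa> (w z))"
        using coercive growth
      proof eventually_elim
        case (elim z)
        have 1: "reg_sign_deriv (\<delta> n) \<kappa> (w z) * (- (A z \<bullet> Dw z)) \<le> reg_sign_deriv (\<delta> n) \<kappa> (w z) * (R z * \<bar>w z\<bar>)"
          by (rule mult_left_mono[OF elim(1) reg_sign_deriv_nonneg[OF k \<delta>]])
        have "- (\<Gamma> z * reg_sign (\<delta> n) \<kappa> (w z)) \<le> \<bar>\<Gamma> z\<bar> * \<bar>reg_sign (\<delta> n) \<kappa> (w z)\<bar>"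
          using abs_ge_minus_self[of "\<Gamma> z * reg_sign (\<delta> n) \<kappa> (w z)"] by (simp add: abs_mult)
        also have "\<dots> \<le> \<rho> * \<bar>w z\<bar> * \<bar>reg_sign (\<delta> n) \<kappa> (w z)\<bar>" by (rule mult_right_mono[OF elim(2)]) simp
        also have "\<dots> = \<rho> * \<bar>w z * reg_sign (\<delta> n) \<kappa> (w z)\<bar>" by (simp add: abs_mult)
        also have "\<dots> \<le> \<rho> * weighted_abs \<kappa> (w z)"
          by (rule mult_left_mono[OF reg_sign_mult_bound(1)[OF k \<delta>] \<rho>])
        finally have "- (reg_sign_deriv (\<delta> n) \<kappa> (w z) * (A z \<bullet> Dw z) + \<Gamma> z * reg_sign (\<delta> n) \<kappa> (w z)) \<le>
            R z * (\<bar>w z\<bar> * reg_sign_deriv (\<delta> n) \<kappa> (w z)) + \<rho> * weighted_abs \<kappa> (w z)"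
          using 1 by (simp add: mult_ac)
        then show ?case by (simp add: indicator_def)
      qed
    qed (use iL iE iS in auto)
    also have "\<dots> = E n + \<rho> * S" using iE iS by (simp add: E_def S_def)
    finally show ?thesis .
  qed
  have E_lim: "E \<longlonglongrightarrow> 0"
  proof -
    have "(\<lambda>n. \<integral>z. R z * (\<bar>w z\<bar> * reg_sign_deriv (\<delta> n) \<kappa> (w z)) * ?i z \<partial>lborel) \<longlonglongrightarrow> (\<integral>z. 0 \<partial>(lborel :: ((real^'n)\<times>real) measure))"
    proof (rule integral_dominated_convergence[where w="\<lambda>z. (1 + \<kappa>) * \<bar>R z\<bar>"])
      show "integrable lborel (\<lambda>z. (1 + \<kappa>) * \<bar>R z\<bar>)" using R_integrable by simp
      show "AE z in lborel. (\<lambda>n. R z * (\<bar>w z\<bar> * reg_sign_deriv (\<delta> n) \<kappa> (w z)) * ?i z) \<longlonglongrightarrow> 0"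
      proof (rule AE_I2)
        fix z
        have "(\<lambda>n. \<bar>w z\<bar> * reg_sign_deriv (\<delta> n) \<kappa> (w z)) \<longlonglongrightarrow> 0"
          unfolding \<delta>_def by (rule reg_sign_deriv_mult_tendsto[OF k])
        then have "(\<lambda>n. R z * (\<bar>w z\<bar> * reg_sign_deriv (\<delta> n) \<kappa> (w z)) * ?i z) \<longlonglongrightarrow> R z * 0 * ?i z"
          by (intro tendsto_intros)
        then show "(\<lambda>n. R z * (\<bar>w z\<bar> * reg_sign_deriv (\<delta> n) \<kappa> (w z)) * ?i z) \<longlonglongrightarrow> 0" by simp
      qed
      show "AE z in lborel. norm (R z * (\<bar>w z\<bar> * reg_sign_deriv (\<delta> n) \<kappa> (w z)) * ?i z) \<le> (1 + \<kappa>) * \<bar>R z\<bar>" for n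
      proof (rule AE_I2)
        fix z
        have b: "\<bar>\<bar>w z\<bar> * reg_sign_deriv (\<delta> n) \<kappa> (w z)\<bar> \<le> 1 + \<kappa>"
          using reg_sign_deriv_mult_bound(2)[OF k \<delta>, of "w z"] reg_sign_deriv_nonneg[OF k \<delta>, of n "w z"] by simp
        have "\<bar>R z * (\<bar>w z\<bar> * reg_sign_deriv (\<delta> n) \<kappa> (w z)) * ?i z\<bar> = \<bar>R z\<bar> * \<bar>\<bar>w z\<bar> * reg_sign_deriv (\<delta> n) \<kappa> (w z)\<bar> * \<bar>?i z\<bar>"
          by (simp only: abs_mult)
        also have "\<dots> \<le> \<bar>R z\<bar> * (1 + \<kappa>) * 1"
          using k by (intro mult_mono b i1 order_refl) auto
        finally show "norm (R z * (\<bar>w z\<bar> * reg_sign_deriv (\<delta> n) \<kappa> (w z)) * ?i z) \<le> (1 + \<kappa>) * \<bar>R z\<bar>"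
          by (simp add: mult.commute)
      qed
    qed auto
    then show ?thesis by (simp add: E_def[abs_def])
  qed
  have y_lim: "(\<lambda>n. y n s) \<longlonglongrightarrow> weighted_L1 \<kappa> s" if s: "s \<in> {0..T}" for s
  proof -
    define m :: real where "m = (\<integral>x. 1 \<partial>lebesgue_on \<Omega>)"
    have "(\<lambda>n. y n s - weighted_L1 \<kappa> s) \<longlonglongrightarrow> 0"
    proof (rule Lim_null_comparison)
      have iy: "integrable (lebesgue_on \<Omega>) (\<lambda>x. reg_abs (\<delta> n) \<kappa> (W s x))" for n
        by (rule integrable_compose_W[where L=1]) (use continuous_on_reg_abs[OF k \<delta>] reg_abs_lipschitz[OF k \<delta>] reg_abs_zero[OF k] s in auto)
      note iY = weighted_abs_W_integrable[OF k s]
      have "norm (y n s - weighted_L1 \<kappa> s) \<le> 2 * ln (1 + \<kappa>) * m * \<delta> n" for n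
      proof -
        have "norm (y n s - weighted_L1 \<kappa> s) = norm (\<integral>x. reg_abs (\<delta> n) \<kappa> (W s x) - weighted_abs \<kappa> (W s x) \<partial>lebesgue_on \<Omega>)"
          unfolding y_def weighted_L1_def using iy iY by simp
        also have "\<dots> \<le> (\<integral>x. norm (reg_abs (\<delta> n) \<kappa> (W s x) - weighted_abs \<kappa> (W s x)) \<partial>lebesgue_on \<Omega>)"
          by (rule integral_norm_bound)
        also have "\<dots> \<le> (\<integral>x. 2 * \<delta> n * ln (1 + \<kappa>) * 1 \<partial>lebesgue_on \<Omega>)"
        proof (rule integral_mono)
          show "integrable (lebesgue_on \<Omega>) (\<lambda>x. 2 * \<delta> n * ln (1 + \<kappa>) * 1)" by (rule \<Omega>_integrable_const)
          show "norm (reg_abs (\<delta> n) \<kappa> (W s x) - weighted_abs \<kappa> (W s x)) \<le> 2 * \<delta> n * ln (1 + \<kappa>) * 1" for x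
            using reg_abs_approx[OF k \<delta>, of n "W s x"] by simp
        qed (use iy iY in simp)
        also have "\<dots> = 2 * \<delta> n * ln (1 + \<kappa>) * m" unfolding m_def by (rule integral_mult_right_zero)
        finally show ?thesis by (simp only: mult_ac)
      qed
      then show "\<forall>\<^sub>F n in sequentially. norm (y n s - weighted_L1 \<kappa> s) \<le> 2 * ln (1 + \<kappa>) * m * \<delta> n" by (intro always_eventually) auto
      have "\<delta> \<longlonglongrightarrow> 0" unfolding \<delta>_def[abs_def] using LIMSEQ_inverse_real_of_nat by (simp add: divide_inverse)
      from tendsto_mult_left[OF this, of "2 * ln (1 + \<kappa>) * m"]
      show "(\<lambda>n. 2 * ln (1 + \<kappa>) * m * \<delta> n) \<longlonglongrightarrow> 0" by simp
    qed
    then show ?thesis by (rule LIM_zero_cancel)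
  qed
  have "(\<lambda>n. y n t2 - y n t1) \<longlonglongrightarrow> weighted_L1 \<kappa> t2 - weighted_L1 \<kappa> t1"
    by (intro tendsto_diff y_lim) (use t in auto)
  moreover have "(\<lambda>n. E n + \<rho> * S) \<longlonglongrightarrow> 0 + \<rho> * S" by (intro tendsto_intros E_lim)
  ultimately have "weighted_L1 \<kappa> t2 - weighted_L1 \<kappa> t1 \<le> 0 + \<rho> * S"
    by (rule LIMSEQ_le) (use step in auto)
  \<comment> \<open>\<open>S\<close> is a space-time integral of \<open>w\<close>, while the right
    side integrates the slices of \<open>W\<close>; they are matched slice by slice at almost every
    time.\<close>
  also have "S = integral {t1..t2} (weighted_L1 \<kappa>)"
  proof -
    have c: "continuous_on {t1..t2} (weighted_L1 \<kappa>)" by (rule continuous_on_subset[OF continuous_on_weighted_L1[OF k]]) (use t in auto)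
    have si: "set_integrable lborel {t1..t2} (weighted_L1 \<kappa>)"
      unfolding set_integrable_def by (rule borel_integrable_compact[OF _ c, unfolded indicator_scaleR_eq_if[symmetric]]) simp
    have "S = (\<integral>s. (\<integral>x. ?i (x, s) * weighted_abs \<kappa> (w (x, s)) \<partial>lborel) \<partial>lborel)"
      unfolding S_def by (rule lborel_prod_integral_snd[OF iS, symmetric])
    also have "\<dots> = (\<integral>s. indicator {t1..t2} s *\<^sub>R weighted_L1 \<kappa> s \<partial>lborel)"
    proof (rule integral_cong_AE)
      show "(\<lambda>s. \<integral>x. ?i (x, s) * weighted_abs \<kappa> (w (x, s)) \<partial>lborel) \<in> borel_measurable lborel"
        using lborel_prod_integrable_snd[OF iS] by auto
      show "(\<lambda>s. indicator {t1..t2} s *\<^sub>R weighted_L1 \<kappa> s) \<in> borel_measurable lborel" using si by (auto simp: set_integrable_def)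
      show "AE s in lborel. (\<integral>x. ?i (x, s) * weighted_abs \<kappa> (w (x, s)) \<partial>lborel) = indicator {t1..t2} s *\<^sub>R weighted_L1 \<kappa> s"
        using slices AE_lborel_singleton[of t1] AE_lborel_singleton[of t2]
      proof eventually_elim
        case (elim s)
        show ?case
        proof (cases "s \<in> {t1<..<t2}")
          case True
          then have "AE x in lebesgue_on \<Omega>. W s x = w (x, s)" using elim t by auto
          from integral_compose_slice[OF continuous_on_weighted_abs weighted_abs_zero _ this, of \<kappa>]
          have "(\<integral>x. weighted_abs \<kappa> (w (x, s)) \<partial>lborel) = weighted_L1 \<kappa> s" using True t by (simp add: weighted_L1_def)
          then show ?thesis using True by simp
        next
          case False
          then have "s \<notin> {t1..t2}" using elim by auto
          then show ?thesis using False by simp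
        qed
      qed
    qed
    also have "\<dots> = integral {t1..t2} (weighted_L1 \<kappa>)"
      using set_borel_integral_eq_integral(2)[OF si] by (simp add: set_lebesgue_integral_def)
    finally show ?thesis .
  qed
  finally show ?thesis by simp
qed

text \<open>The increment estimate starts at positive times. Continuity of the weighted norm at 0
  lets the lower endpoint tend to 0, and Gronwall's inequality then applies on
  \<open>[0, t]\<close>.\<close>

lemma weighted_L1_bound:
  assumes k: "\<kappa> \<ge> 1" and t: "0 < t" "t < T"
  shows "weighted_L1 \<kappa> t \<le> weighted_L1 \<kappa> 0 * exp (\<rho> * t)"
proof (rule Gronwall_integral)
  note c = continuous_on_weighted_L1[OF k]
  show "continuous_on {0..t} (weighted_L1 \<kappa>)" by (rule continuous_on_subset[OF c]) (use t in auto)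
  show "\<rho> \<ge> 0" by (rule \<rho>)
  show "t \<ge> 0" using t by simp
  have Y0: "weighted_L1 \<kappa> s \<ge> 0" for s unfolding weighted_L1_def
    by (rule Bochner_Integration.integral_nonneg) (rule weighted_abs_bounds(1)[OF k])
  have io: "weighted_L1 \<kappa> integrable_on {a..b}" if "0 \<le> a" "b \<le> T" for a b
    by (rule integrable_continuous_interval, rule continuous_on_subset[OF c]) (use that in auto)
  fix s assume s: "s \<in> {0..t}"
  show "weighted_L1 \<kappa> s \<le> weighted_L1 \<kappa> 0 + \<rho> * integral {0..s} (weighted_L1 \<kappa>)"
  proof (cases "s = 0")
    case False
    then have s': "0 < s" "s < T" using s t by auto
    have "(weighted_L1 \<kappa> \<longlongrightarrow> weighted_L1 \<kappa> 0) (at 0 within {0..T})" using c T by (auto simp: continuous_on_def)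
    then have lim: "(weighted_L1 \<kappa> \<longlongrightarrow> weighted_L1 \<kappa> 0) (at_right 0)" using T by (simp add: at_within_Icc_at_right)
    \<comment> \<open>The integral is enlarged to start at 0, which is allowed because the weighted
      norm is nonnegative; the left side no longer depends on \<open>r\<close> and the limit is
      taken only on the right.\<close>
    have "weighted_L1 \<kappa> s - \<rho> * integral {0..s} (weighted_L1 \<kappa>) \<le> weighted_L1 \<kappa> 0"
    proof (rule tendsto_lowerbound[OF lim])
      have "weighted_L1 \<kappa> s - \<rho> * integral {0..s} (weighted_L1 \<kappa>) \<le> weighted_L1 \<kappa> r" if r: "0 < r" "r < s" for r
      proof -
        have "integral {r..s} (weighted_L1 \<kappa>) \<le> integral {0..s} (weighted_L1 \<kappa>)"
          by (rule integral_subset_le) (use io[of r s] io[of 0 s] r s' Y0 in auto)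
        from mult_left_mono[OF this \<rho>] weighted_L1_increment[OF k r s'(2)] show ?thesis by linarith
      qed
      then show "\<forall>\<^sub>F r in at_right 0. weighted_L1 \<kappa> s - \<rho> * integral {0..s} (weighted_L1 \<kappa>) \<le> weighted_L1 \<kappa> r"
        using s' unfolding eventually_at_right_field by blast
    qed simp
    then show ?thesis by simp
  qed simp
qed

text \<open>Initially \<open>W\<close> is nonpositive, so the weighted norm at 0 equals
  \<open>C / \<kappa>\<close>. The exponential growth factor does not involve \<kappa>, and the
  weighted absolute value dominates the positive part. Letting \<kappa> = n + 1 tend to infinity
  annihilates the positive part at every time in \<open>(0, T)\<close>.\<close>

theorem nonpositive:
  assumes init: "AE x in lebesgue_on \<Omega>. W 0 x \<le> 0"
  shows "AE z in lborel. w z \<le> 0"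
proof -
  define C where "C = (\<integral>x. \<bar>W 0 x\<bar> \<partial>lebesgue_on \<Omega>)"
  have W0i: "integrable (lebesgue_on \<Omega>) (W 0)" using W_integrable[of 0] T by auto
  have Y0: "weighted_L1 \<kappa> 0 = C / \<kappa>" if k: "\<kappa> \<ge> 1" for \<kappa>
  proof -
    have "weighted_L1 \<kappa> 0 = (\<integral>x. \<bar>W 0 x\<bar> / \<kappa> \<partial>lebesgue_on \<Omega>)"
      unfolding weighted_L1_def
    proof (rule integral_cong_AE)
      show "AE x in lebesgue_on \<Omega>. weighted_abs \<kappa> (W 0 x) = \<bar>W 0 x\<bar> / \<kappa>"
        using init by eventually_elim (rule weighted_abs_bounds(4)[OF k])
    qed (use weighted_abs_W_integrable[OF k, of 0] W0i T in auto)
    then show ?thesis by (simp add: C_def)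
  qed
  have pos: "continuous_on UNIV (\<lambda>a::real. max a 0)" "\<bar>max a 0 - max b 0\<bar> \<le> 1 * \<bar>a - b\<bar>" "max 0 0 = (0::real)" for a b :: real
    by (intro continuous_on_max continuous_on_id continuous_on_const) (auto simp: max_def)
  have zero: "(\<integral>x. max (W t x) 0 \<partial>lebesgue_on \<Omega>) = 0" if t: "t \<in> {0<..<T}" for t
  proof -
    have tT: "t \<in> {0..T}" "0 < t" "t < T" using t by auto
    have i: "integrable (lebesgue_on \<Omega>) (\<lambda>x. max (W t x) 0)" by (rule integrable_compose_W[OF pos tT(1)])
    have le: "(\<integral>x. max (W t x) 0 \<partial>lebesgue_on \<Omega>) \<le> C * exp (\<rho> * t) * inverse (real (Suc n))" for n
    proof -
      have k: "real (Suc n) \<ge> 1" by simp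
      have "(\<integral>x. max (W t x) 0 \<partial>lebesgue_on \<Omega>) \<le> weighted_L1 (real (Suc n)) t"
        unfolding weighted_L1_def by (rule integral_mono[OF i weighted_abs_W_integrable[OF k tT(1)] weighted_abs_bounds(3)[OF k]])
      also have "\<dots> \<le> weighted_L1 (real (Suc n)) 0 * exp (\<rho> * t)" by (rule weighted_L1_bound[OF k tT(2,3)])
      also have "\<dots> = C * exp (\<rho> * t) * inverse (real (Suc n))" unfolding Y0[OF k] divide_inverse by (simp only: mult_ac)
      finally show ?thesis .
    qed
    have "(\<lambda>n. C * exp (\<rho> * t) * inverse (real (Suc n))) \<longlonglongrightarrow> C * exp (\<rho> * t) * 0"
      by (intro tendsto_intros LIMSEQ_inverse_real_of_nat)
    then have "(\<integral>x. max (W t x) 0 \<partial>lebesgue_on \<Omega>) \<le> C * exp (\<rho> * t) * 0"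
      by (rule LIMSEQ_le_const) (use le in auto)
    moreover have "0 \<le> (\<integral>x. max (W t x) 0 \<partial>lebesgue_on \<Omega>)"
      by (rule Bochner_Integration.integral_nonneg) simp
    ultimately show ?thesis by simp
  qed
  have iw: "integrable lborel (\<lambda>z. max (w z) 0)"
    by (rule Bochner_Integration.integrable_bound[OF w_integrable]) auto
  have "(\<integral>z. max (w z) 0 \<partial>lborel) = (\<integral>s. (\<integral>x. max (w (x, s)) 0 \<partial>lborel) \<partial>lborel)"
    by (rule lborel_prod_integral_snd[OF iw, symmetric])
  also have "\<dots> = 0"
  proof (rule integral_eq_zero_AE)
    show "AE s in lborel. (\<integral>x. max (w (x, s)) 0 \<partial>lborel) = 0"
      using slices
    proof eventually_elim
      case (elim s)
      show ?case
      proof (cases "s \<in> {0<..<T}")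
        case True
        then have "s \<in> {0..T}" "AE x in lebesgue_on \<Omega>. W s x = w (x, s)" using elim by auto
        from integral_compose_slice[OF pos(1,3) this] zero[OF True] show ?thesis by simp
      next
        case False
        then have "w (x, s) = 0" for x using outside[of "(x, s)"] by auto
        then show ?thesis by simp
      qed
    qed
  qed
  finally have "AE z in lborel. max (w z) 0 = 0"
    using iw by (subst (asm) integral_nonneg_eq_0_iff_AE) auto
  then show ?thesis by eventually_elim (auto simp: max_def split: if_splits)
qed

end

section \<open>Weak solutions\<close>

text \<open>The pointwise bound \<open>|f| \<le> \<eta> + f^2 / \<eta>\<close> is integrated and
  \<eta> is taken to be the L^2 norm, which produces the factor measure plus 1. A vanishing norm is
  treated separately because \<eta> must be positive.\<close>

lemma Lp_two_L1_bound:
  fixes f :: "'a \<Rightarrow> real"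
  assumes f: "f \<in> Lp 2 M" and fin: "emeasure M (space M) < \<infinity>"
  shows "integrable M f" "(\<integral>x. \<bar>f x\<bar> \<partial>M) \<le> (measure M (space M) + 1) * Lp_norm 2 M f"
proof -
  have [measurable]: "f \<in> borel_measurable M" and f2: "integrable M (\<lambda>x. (f x)\<^sup>2)"
    using f by (auto simp: Lp_def)
  interpret finite_measure M by (rule finite_measureI) (use fin in auto)
  have c: "integrable M (\<lambda>x. c :: real)" for c by simp
  define L where "L = Lp_norm 2 M f"
  have L0: "L \<ge> 0" by (simp add: L_def Lp_norm_def)
  have "L\<^sup>2 = (\<integral>x. (f x)\<^sup>2 \<partial>M)"
  proof -
    have "L powr 2 = (\<integral>x. \<bar>f x\<bar> powr 2 \<partial>M)" by (simp add: L_def Lp_norm_def powr_powr)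
    then show ?thesis using L0 by (cases "L = 0") (auto simp: powr_numeral)
  qed
  show fi: "integrable M f"
  proof (rule Bochner_Integration.integrable_bound)
    show "integrable M (\<lambda>x. 1 + (f x)\<^sup>2)" using c f2 by simp
    have "\<bar>a\<bar> \<le> 1 + a\<^sup>2" for a :: real using le_one_add_powr[of 2 "\<bar>a\<bar>"] by simp
    then show "AE x in M. norm (f x) \<le> norm (1 + (f x)\<^sup>2)" by (simp add: abs_of_nonneg)
  qed simp
  have le: "(\<integral>x. \<bar>f x\<bar> \<partial>M) \<le> \<eta> * measure M (space M) + L\<^sup>2 / \<eta>" if \<eta>: "\<eta> > 0" for \<eta>
  proof -
    have "(\<integral>x. \<bar>f x\<bar> \<partial>M) \<le> (\<integral>x. \<eta> + (f x)\<^sup>2 / \<eta> \<partial>M)"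
    proof (rule integral_mono)
      show "\<bar>f x\<bar> \<le> \<eta> + (f x)\<^sup>2 / \<eta>" for x
        using le_add_powr[of 2 \<eta> "\<bar>f x\<bar>"] \<eta> by (simp add: powr_minus_divide mult.commute)
    qed (use fi c f2 in auto)
    also have "\<dots> = \<eta> * measure M (space M) + L\<^sup>2 / \<eta>" using c f2 \<open>L\<^sup>2 = _\<close> by (simp add: mult.commute)
    finally show ?thesis .
  qed
  show "(\<integral>x. \<bar>f x\<bar> \<partial>M) \<le> (measure M (space M) + 1) * Lp_norm 2 M f"
  proof (cases "L = 0")
    case True
    have "(\<integral>x. (f x)\<^sup>2 \<partial>M) = 0" using \<open>L\<^sup>2 = _\<close> True by simp
    then have "AE x in M. (f x)\<^sup>2 = 0" using f2 by (subst (asm) integral_nonneg_eq_0_iff_AE) auto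
    then have "(\<integral>x. \<bar>f x\<bar> \<partial>M) = 0" by (intro integral_eq_zero_AE) auto
    then show ?thesis using True by (simp add: L_def)
  next
    case False
    then have "L > 0" using L0 by simp
    from le[OF this] show ?thesis using False by (simp add: L_def[symmetric] power2_eq_square algebra_simps)
  qed
qed

section \<open>Time cut-offs and product test functions\<close>

definition ramp :: "real \<Rightarrow> real \<Rightarrow> real \<Rightarrow> real" where
  "ramp s e t = max 0 (min 1 ((t - s) / e))"

lemma ramp_bounds: "0 \<le> ramp s e t" "ramp s e t \<le> 1" "e > 0 \<Longrightarrow> t \<le> s \<Longrightarrow> ramp s e t = 0" "e > 0 \<Longrightarrow> s + e \<le> t \<Longrightarrow> ramp s e t = 1"
  by (auto simp: ramp_def divide_nonpos_pos)

lemma continuous_on_ramp: "continuous_on S (ramp s e)"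
  unfolding ramp_def[abs_def] divide_inverse by (intro continuous_intros)

text \<open>The fundamental theorem of calculus for the product of the ramp with \<eta> on
  \<open>[0, T]\<close>; the boundary terms vanish with \<eta>. The ramp thus has the weak
  derivative \<open>1/e\<close> on its rising part and 0 elsewhere.\<close>

lemma ramp_integration_by_parts:
  assumes \<eta>: "\<eta> \<in> test_functions {0<..<T}" and s: "0 < s" "e > 0" "s + e < T"
  shows "(\<integral>t. ramp s e t * deriv \<eta> t \<partial>lebesgue_on {0<..<T}) =
    - (\<integral>t. indicator {s<..<s + e} t / e * \<eta> t \<partial>lebesgue_on {0<..<T})" (is ?parts)
    and "integrable (lebesgue_on {0<..<T}) (\<lambda>t. ramp s e t * deriv \<eta> t)" (is ?int1)
    and "integrable (lebesgue_on {0<..<T}) (\<lambda>t. indicator {s<..<s + e} t / e * \<eta> t)" (is ?int2)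
proof -
  have "continuously_diff (Suc 0) \<eta>" using \<eta> by (auto simp: test_functions_def)
  note D = continuously_diff_SucD[OF this]
  have lin: "frechet_derivative \<eta> (at t) x = x * frechet_derivative \<eta> (at t) 1" for t x
    using linear_scale[OF has_derivative_linear[OF D(1)], of t x 1] by simp
  have fd: "frechet_derivative \<eta> (at t) 1 = deriv \<eta> t" for t
  proof -
    have "(\<eta> has_real_derivative frechet_derivative \<eta> (at t) 1) (at t)"
      unfolding has_field_derivative_def
      by (rule has_derivative_eq_rhs[OF D(1)])
        (rule ext, subst lin, rule mult.commute)
    then show ?thesis by (simp add: DERIV_imp_deriv)
  qed
  have der: "(\<eta> has_real_derivative deriv \<eta> t) (at t)" for t
    unfolding has_field_derivative_def fd[symmetric]
    by (rule has_derivative_eq_rhs[OF D(1)])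
      (rule ext, subst lin, rule mult.commute)
  have cd: "continuous_on UNIV (deriv \<eta>)" using D(2)[of 1] by (simp add: fd)
  have c\<eta>: "continuous_on UNIV \<eta>" by (rule continuous_on_test_functions[OF \<eta>])
  have \<eta>0: "\<eta> t = 0" if "t \<notin> {0<..<T}" for t using \<eta> that by (auto simp: test_functions_def)
  have d0: "deriv \<eta> t = 0" if "t \<notin> {0<..<T}" for t
  proof -
    obtain K where K: "compact K" "K \<subseteq> {0<..<T}" "\<And>x. x \<notin> K \<Longrightarrow> \<eta> x = 0"
      using \<eta> by (auto simp: test_functions_def)
    have "(\<eta> has_real_derivative 0) (at t)"
    proof (rule has_field_derivative_transform_within_open[where S="- K"])
      show "((\<lambda>_. 0) has_real_derivative 0) (at t)" by simp
    qed (use K that in \<open>auto simp: compact_imp_closed open_Compl\<close>)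
    then show ?thesis by (rule DERIV_imp_deriv)
  qed
  note [measurable] = borel_measurable_continuous_onI[OF c\<eta>] borel_measurable_continuous_onI[OF cd]
    borel_measurable_continuous_onI[OF continuous_on_ramp[of UNIV s e]]
  define k where "k t = ramp s e t * deriv \<eta> t" for t
  define l where "l t = indicator {s<..<s + e} t / e * \<eta> t" for t
  have si: "integrable lborel (\<lambda>t. indicator {0..T} t *\<^sub>R k t)" unfolding k_def
    by (rule borel_integrable_compact[unfolded indicator_scaleR_eq_if[symmetric]])
      (auto intro!: continuous_intros continuous_on_ramp continuous_on_subset[OF cd])
  have k0: "indicator {0..T} t *\<^sub>R k t = k t" "indicator {0..T} t *\<^sub>R l t = l t" for t
    by (cases "t \<in> {0<..<T}"; simp add: d0 \<eta>0 k_def l_def)+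
  have ki: "integrable lborel k" using si unfolding k0 .
  have li: "integrable lborel l"
  proof -
    have "integrable lborel (\<lambda>t. indicator {0..T} t *\<^sub>R \<eta> t)"
      by (rule borel_integrable_compact[unfolded indicator_scaleR_eq_if[symmetric]]) (auto intro!: continuous_on_subset[OF c\<eta>])
    then have "integrable lborel (\<lambda>t. (indicator {0..T} t *\<^sub>R \<eta> t) * (indicator {s<..<s + e} t / e))"
      by (rule integrable_mult_bounded[where C="1 / e"]) (use s in \<open>auto simp: indicator_def\<close>)
    moreover have "(indicator {0..T} t *\<^sub>R \<eta> t) * (indicator {s<..<s + e} t / e) = l t" for t
      by (cases "t \<in> {0<..<T}"; simp add: \<eta>0 l_def)
    ultimately show ?thesis by simp
  qed
  have "((\<lambda>t. k t + l t) has_integral (ramp s e T * \<eta> T - ramp s e 0 * \<eta> 0)) {0..T}"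
  \<comment> \<open>The exceptional set holds the two corners of the ramp, where it is continuous
    but not differentiable.\<close>
  proof (rule fundamental_theorem_of_calculus_interior_strong[where S="{s, s + e}"])
    fix t assume t: "t \<in> {0<..<T} - {s, s + e}"
    have r: "(ramp s e has_real_derivative (indicator {s<..<s + e} t / e)) (at t)"
    proof -
      consider "t < s" | "s < t" "t < s + e" | "s + e < t" using t by fastforce
      then show ?thesis
      proof cases
        case 1
        have "((\<lambda>_. 0) has_real_derivative (indicator {s<..<s + e} t / e)) (at t)" using 1 by simp
        then show ?thesis
          by (rule has_field_derivative_transform_within_open[where S="{..<s}"]) (use 1 s in \<open>auto simp: ramp_bounds\<close>)
      next
        case 2
        have "((\<lambda>t. (t - s) / e) has_real_derivative (indicator {s<..<s + e} t / e)) (at t)"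
          using 2 s by (auto intro!: derivative_eq_intros)
        then show ?thesis
          by (rule has_field_derivative_transform_within_open[where S="{s<..<s + e}"]) (use 2 s in \<open>auto simp: ramp_def min_def max_def field_simps\<close>)
      next
        case 3
        have "((\<lambda>_. 1) has_real_derivative (indicator {s<..<s + e} t / e)) (at t)" using 3 by simp
        then show ?thesis
          by (rule has_field_derivative_transform_within_open[where S="{s + e<..}"]) (use 3 s in \<open>auto simp: ramp_bounds\<close>)
      qed
    qed
    have "((\<lambda>t. ramp s e t * \<eta> t) has_real_derivative (k t + l t)) (at t)"
      using DERIV_mult[OF r der[of t]] by (simp add: k_def l_def add.commute mult.commute)
    then show "((\<lambda>t. ramp s e t * \<eta> t) has_vector_derivative (k t + l t)) (at t)"
      by (simp add: has_real_derivative_iff_has_vector_derivative)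
  qed (use s in \<open>auto intro!: continuous_intros continuous_on_ramp continuous_on_subset[OF c\<eta>]\<close>)
  then have "((\<lambda>t. k t + l t) has_integral 0) {0..T}" using \<eta>0[of 0] \<eta>0[of T] by simp
  moreover have "set_integrable lborel {0..T} (\<lambda>t. k t + l t)"
    unfolding set_integrable_def scaleR_add_right k0 using ki li by simp
  ultimately have "(\<integral>t. indicator {0..T} t *\<^sub>R (k t + l t) \<partial>lborel) = 0"
    using set_borel_integral_eq_integral(2)[of "{0..T}" "\<lambda>t. k t + l t"] by (simp add: set_lebesgue_integral_def integral_unique)
  then have "(\<integral>t. k t \<partial>lborel) = - (\<integral>t. l t \<partial>lborel)"
    unfolding scaleR_add_right k0 using ki li by simp
  moreover have "(\<integral>t. k t \<partial>lebesgue_on {0<..<T}) = (\<integral>t. k t \<partial>lborel)"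
  proof (rule integral_lebesgue_on_eq_lborel)
    show "k \<in> borel_measurable borel" unfolding k_def by measurable
  qed (use d0 in \<open>auto simp: k_def\<close>)
  moreover have "(\<integral>t. l t \<partial>lebesgue_on {0<..<T}) = (\<integral>t. l t \<partial>lborel)"
  proof (rule integral_lebesgue_on_eq_lborel)
    show "l \<in> borel_measurable borel" unfolding l_def by measurable
  qed (use \<eta>0 in \<open>auto simp: l_def\<close>)
  ultimately have "(\<integral>t. k t \<partial>lebesgue_on {0<..<T}) = - (\<integral>t. l t \<partial>lebesgue_on {0<..<T})" by (simp only:)
  then show ?parts unfolding k_def l_def .
  have "integrable (lebesgue_on {0<..<T}) k"
    by (subst integrable_lebesgue_on_iff_lborel) (use ki d0 in \<open>auto simp: k_def\<close>)
  then show ?int1 by (simp add: k_def[abs_def])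
  have "integrable (lebesgue_on {0<..<T}) l"
    by (subst integrable_lebesgue_on_iff_lborel) (use li \<eta>0 in \<open>auto simp: l_def\<close>)
  then show ?int2 by (simp add: l_def[abs_def])
qed

lemma bounded_in_Lp_lebesgue_on:
  fixes f :: "'a::euclidean_space \<Rightarrow> 'b::euclidean_space"
  assumes f[measurable]: "f \<in> borel_measurable borel" and S[measurable]: "S \<in> sets borel" and fin: "emeasure lborel S < \<infinity>"
    and bound: "\<And>x. norm (f x) \<le> C" and q: "q \<ge> 0"
  shows "f \<in> Lp q (lebesgue_on S)"
proof -
  have "integrable lborel (\<lambda>x. indicator S x * norm (f x) powr q)"
  proof (rule Bochner_Integration.integrable_bound)
    show "integrable lborel (\<lambda>x. C powr q * indicator S x :: real)" using fin by (simp add: integrable_real_indicator)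
    have "norm (f x) powr q \<le> C powr q" for x using bound[of x] q by (intro powr_mono2) auto
    then show "AE x in lborel. norm (indicator S x * norm (f x) powr q) \<le> norm (C powr q * indicator S x :: real)"
      by (auto simp: indicator_def)
  qed measurable
  then show ?thesis by (simp add: Lp_def borel_measurable_lebesgue_onI integrable_lebesgue_on_iff)
qed

lemma W0_pair_scale:
  fixes \<phi> :: "real^'n \<Rightarrow> real"
  assumes "W0_pair p \<Omega> \<phi> g" "p > 1"
  shows "W0_pair p \<Omega> (\<lambda>x. c * \<phi> x) (\<lambda>x. c *\<^sub>R g x)"
proof (rule W0_pair_compose[OF assms, where H="\<lambda>s. c * s" and H'="\<lambda>_. c" and M="\<bar>c\<bar>"])
  show "continuously_diff k (\<lambda>s. c * s)" for k
    by (rule continuously_diff_bounded_linear) (rule bounded_linear_mult_right)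
  show "((\<lambda>s. c * s) has_real_derivative c) (at s)" for s by (auto intro!: derivative_eq_intros)
qed auto

text \<open>Time regularity comes from \<zeta> alone and spatial regularity from \<phi> alone, so
  each requirement factorizes. Boundedness of \<phi> places it in L^2 of the bounded domain for
  every \<open>p > 1\<close>, which the time derivative and the continuity in L^2 require.\<close>

lemma product_test_function:
  fixes \<phi> :: "real^'n \<Rightarrow> real" and \<zeta> \<zeta>' :: "real \<Rightarrow> real"
  assumes W: "W0_pair p \<Omega> \<phi> g" and p: "p > 1" and \<Omega>: "open \<Omega>" "bounded \<Omega>" and M: "\<And>x. \<bar>\<phi> x\<bar> \<le> M"
    and \<zeta>: "continuous_on UNIV \<zeta>" "\<And>t. \<bar>\<zeta> t\<bar> \<le> 1" "\<zeta> 0 = 0" "\<zeta> T = 0"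
    and \<zeta>': "\<zeta>' \<in> borel_measurable borel" "\<And>t. \<bar>\<zeta>' t\<bar> \<le> C"
    and parts: "\<And>\<eta>. \<eta> \<in> test_functions {0<..<T} \<Longrightarrow>
      (\<integral>t. \<zeta> t * deriv \<eta> t \<partial>lebesgue_on {0<..<T}) = - (\<integral>t. \<zeta>' t * \<eta> t \<partial>lebesgue_on {0<..<T})"
  shows "W0_12_L2 \<Omega> T (\<lambda>z. \<zeta> (snd z) * \<phi> (fst z)) (\<lambda>z. \<zeta>' (snd z) * \<phi> (fst z))"
    and "Lp_W0_1p \<Omega> T p (\<lambda>z. \<zeta> (snd z) * \<phi> (fst z)) (\<lambda>z. \<zeta> (snd z) *\<^sub>R g (fst z))"
proof -
  have [measurable]: "\<phi> \<in> borel_measurable borel" "g \<in> borel_measurable borel" "\<zeta>' \<in> borel_measurable borel"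
    "\<zeta> \<in> borel_measurable borel"
    and gp: "integrable lborel (\<lambda>x. norm (g x) powr p)"
    using W \<zeta>'(1) \<zeta>(1) by (auto simp: W0_pair_def intro: borel_measurable_continuous_onI)
  let ?\<psi> = "\<lambda>z::(real^'n)\<times>real. \<zeta> (snd z) * \<phi> (fst z)"
  have Qb[measurable]: "cylinder \<Omega> T \<in> sets borel" and Qf: "emeasure lborel (cylinder \<Omega> T) < \<infinity>"
    and \<Omega>b[measurable]: "\<Omega> \<in> sets borel" and \<Omega>f: "emeasure lborel \<Omega> < \<infinity>"
    using \<Omega> by (auto intro!: borel_open open_Times emeasure_bounded_finite[unfolded infinity_ennreal_def] bounded_Times)
  have M0: "M \<ge> 0" "C \<ge> 0" using M[of undefined] \<zeta>'(2)[of undefined] by auto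
  have b1: "norm (?\<psi> z) \<le> 1 * M" for z
    unfolding real_norm_def abs_mult by (intro mult_mono \<zeta> M) auto
  have b2: "norm (\<zeta>' (snd z) * \<phi> (fst z)) \<le> C * M" for z
    unfolding real_norm_def abs_mult using M0 by (intro mult_mono \<zeta>' M) auto
  have \<phi>L: "\<phi> \<in> Lp 2 (lebesgue_on \<Omega>)"
    by (rule bounded_in_Lp_lebesgue_on[OF _ \<Omega>b \<Omega>f]) (use M in auto)
  show "W0_12_L2 \<Omega> T ?\<psi> (\<lambda>z. \<zeta>' (snd z) * \<phi> (fst z))"
    unfolding W0_12_L2_def W_12_L2_def
  proof (intro conjI ballI)
    show "?\<psi> \<in> Lp 2 (lebesgue_on (cylinder \<Omega> T))"
      by (rule bounded_in_Lp_lebesgue_on[OF _ Qb Qf b1]) auto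
    show "(\<lambda>z. \<zeta>' (snd z) * \<phi> (fst z)) \<in> Lp 2 (lebesgue_on (cylinder \<Omega> T))"
      by (rule bounded_in_Lp_lebesgue_on[OF _ Qb Qf b2]) auto
    fix \<eta> :: "real \<Rightarrow> real" assume \<eta>: "\<eta> \<in> test_functions {0<..<T}"
    show "AE x in lebesgue_on \<Omega>. (\<integral>t. \<zeta> (snd (x, t)) * \<phi> (fst (x, t)) * deriv \<eta> t \<partial>lebesgue_on {0<..<T}) =
        - (\<integral>t. \<zeta>' (snd (x, t)) * \<phi> (fst (x, t)) * \<eta> t \<partial>lebesgue_on {0<..<T})"
    proof (rule AE_I2)
      fix x
      have "(\<integral>t. \<zeta> t * \<phi> x * deriv \<eta> t \<partial>lebesgue_on {0<..<T}) = (\<integral>t. \<phi> x * (\<zeta> t * deriv \<eta> t) \<partial>lebesgue_on {0<..<T})"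
        by (simp only: mult_ac)
      also have "\<dots> = - (\<integral>t. \<phi> x * (\<zeta>' t * \<eta> t) \<partial>lebesgue_on {0<..<T})"
        using parts[OF \<eta>] by simp
      also have "(\<integral>t. \<phi> x * (\<zeta>' t * \<eta> t) \<partial>lebesgue_on {0<..<T}) = (\<integral>t. \<zeta>' t * \<phi> x * \<eta> t \<partial>lebesgue_on {0<..<T})"
        by (simp only: mult_ac)
      finally show "(\<integral>t. \<zeta> (snd (x, t)) * \<phi> (fst (x, t)) * deriv \<eta> t \<partial>lebesgue_on {0<..<T}) =
        - (\<integral>t. \<zeta>' (snd (x, t)) * \<phi> (fst (x, t)) * \<eta> t \<partial>lebesgue_on {0<..<T})" by simp
    qed
  next
    show "?\<psi> \<in> C_L2 \<Omega> T"
      unfolding C_L2_def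
    proof (intro CollectI conjI ballI)
      fix t assume t: "t \<in> {0..T}"
      show "(\<lambda>x. \<zeta> (snd (x, t)) * \<phi> (fst (x, t))) \<in> Lp 2 (lebesgue_on \<Omega>)"
      proof (rule bounded_in_Lp_lebesgue_on[OF _ \<Omega>b \<Omega>f])
        show "norm (\<zeta> (snd (x, t)) * \<phi> (fst (x, t))) \<le> 1 * M" for x by (rule b1)
      qed auto
      have "Lp_norm 2 (lebesgue_on \<Omega>) (\<lambda>x. \<zeta> (snd (x, s)) * \<phi> (fst (x, s)) - \<zeta> (snd (x, t)) * \<phi> (fst (x, t))) =
          \<bar>\<zeta> s - \<zeta> t\<bar> * Lp_norm 2 (lebesgue_on \<Omega>) \<phi>" for s
      proof -
        have "\<bar>\<zeta> s * \<phi> x - \<zeta> t * \<phi> x\<bar> powr 2 = \<bar>\<zeta> s - \<zeta> t\<bar> powr 2 * \<bar>\<phi> x\<bar> powr 2" for x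
          by (simp only: left_diff_distrib[symmetric] abs_mult powr_mult)
        then have "(\<integral>x. \<bar>\<zeta> s * \<phi> x - \<zeta> t * \<phi> x\<bar> powr 2 \<partial>lebesgue_on \<Omega>) =
            \<bar>\<zeta> s - \<zeta> t\<bar> powr 2 * (\<integral>x. \<bar>\<phi> x\<bar> powr 2 \<partial>lebesgue_on \<Omega>)"
          by (simp only: integral_mult_right_zero)
        then show ?thesis
          unfolding Lp_norm_def fst_conv snd_conv real_norm_def by (simp only: powr_mult powr_powr) simp
      qed
      moreover have "((\<lambda>s. \<bar>\<zeta> s - \<zeta> t\<bar> * Lp_norm 2 (lebesgue_on \<Omega>) \<phi>) \<longlongrightarrow> \<bar>\<zeta> t - \<zeta> t\<bar> * Lp_norm 2 (lebesgue_on \<Omega>) \<phi>) (at t within {0..T})"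
      proof -
        have "(\<zeta> \<longlongrightarrow> \<zeta> t) (at t within {0..T})"
          using continuous_on_subset[OF \<zeta>(1), of "{0..T}"] t by (auto simp: continuous_on_def)
        then show ?thesis by (intro tendsto_intros)
      qed
      ultimately show "((\<lambda>s. Lp_norm 2 (lebesgue_on \<Omega>) (\<lambda>x. \<zeta> (snd (x, s)) * \<phi> (fst (x, s)) - \<zeta> (snd (x, t)) * \<phi> (fst (x, t)))) \<longlongrightarrow> 0) (at t within {0..T})"
        by simp
    qed
  qed (use \<zeta> in auto)
  show "Lp_W0_1p \<Omega> T p ?\<psi> (\<lambda>z. \<zeta> (snd z) *\<^sub>R g (fst z))"
    unfolding Lp_W0_1p_def
  proof (intro conjI)
    show "?\<psi> \<in> Lp p (lebesgue_on (cylinder \<Omega> T))"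
      by (rule bounded_in_Lp_lebesgue_on[OF _ Qb Qf b1]) (use p in auto)
    have "integrable lborel (\<lambda>z. indicator (cylinder \<Omega> T) z * norm (\<zeta> (snd z) *\<^sub>R g (fst z)) powr p)"
    proof (rule Bochner_Integration.integrable_bound)
      let ?c = "\<lambda>z::(real^'n)\<times>real. indicator {0<..<T} (snd z) * norm (g (fst z)) powr p"
      show "integrable lborel ?c"
      proof (rule lborel_prod_integrableI)
        have "(\<integral>t. norm (?c (x, t)) \<partial>lborel) = measure lborel {0<..<T} * norm (g x) powr p" for x
          by (simp add: abs_mult)
        then show "integrable lborel (\<lambda>x. \<integral>t. norm (?c (x, t)) \<partial>lborel)" using gp by simp
        show "integrable lborel (\<lambda>t. ?c (x, t))" for x using integrable_indicator_Ioo[of 0 T] by simp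
      qed measurable
      have "norm (\<zeta> (snd z) *\<^sub>R g (fst z)) powr p \<le> norm (g (fst z)) powr p" for z
      proof (rule powr_mono2)
        show "norm (\<zeta> (snd z) *\<^sub>R g (fst z)) \<le> norm (g (fst z))"
          using mult_right_mono[OF \<zeta>(2)[of "snd z"], of "norm (g (fst z))"] by simp
      qed (use p in auto)
      then show "AE z in lborel. norm (indicator (cylinder \<Omega> T) z * norm (\<zeta> (snd z) *\<^sub>R g (fst z)) powr p) \<le> norm (?c z)"
        by (intro AE_I2) (auto simp: indicator_def)
    qed measurable
    then show "(\<lambda>z. \<zeta> (snd z) *\<^sub>R g (fst z)) \<in> Lp p (lebesgue_on (cylinder \<Omega> T))"
      unfolding Lp_def using borel_measurable_lebesgue_onI[of "\<lambda>z. \<zeta> (snd z) *\<^sub>R g (fst z)" "cylinder \<Omega> T"]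
      by (auto simp: integrable_lebesgue_on_iff)
    show "AE t in lebesgue_on {0<..<T}. (\<lambda>x. \<zeta> (snd (x, t)) * \<phi> (fst (x, t))) \<in> W0_1p \<Omega> p \<and>
        weak_gradient \<Omega> (\<lambda>x. \<zeta> (snd (x, t)) * \<phi> (fst (x, t))) (\<lambda>x. \<zeta> (snd (x, t)) *\<^sub>R g (fst (x, t)))"
      using W0_pair_imp_W0_1p[OF W0_pair_scale[OF W p] p \<Omega>] W0_pair_weak_gradient[OF W0_pair_scale[OF W p] p \<Omega>] by simp
  qed
qed

text \<open>The averages are difference quotients of the primitive of \<open>m\<close> at an
  interior point, along the steps \<open>e n\<close>.\<close>

lemma average_tendsto:
  fixes m :: "real \<Rightarrow> real"
  assumes m: "continuous_on {0..T} m" and s: "0 < s" "s < T" and e: "\<And>n. e n > 0" "\<And>n. s + e n \<le> T" "e \<longlonglongrightarrow> 0"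
  shows "(\<lambda>n. integral {s..s + e n} m / e n) \<longlonglongrightarrow> m s"
proof -
  have "((\<lambda>u. integral {0..u} m) has_vector_derivative m s) (at s within {0..T})"
    by (rule integral_has_vector_derivative[OF m]) (use s in auto)
  moreover have "at s within {0..T} = at s" using s by (intro at_within_interior) auto
  ultimately have "((\<lambda>u. integral {0..u} m) has_real_derivative m s) (at s)"
    by (simp add: has_real_derivative_iff_has_vector_derivative)
  then have "((\<lambda>h. (integral {0..s + h} m - integral {0..s} m) / h) \<longlongrightarrow> m s) (at 0)"
    by (simp add: DERIV_def)
  moreover have "filterlim e (at 0) sequentially"
    using e(1,3) by (auto simp: filterlim_at less_imp_neq[THEN not_sym] intro!: always_eventually)
  ultimately have "(\<lambda>n. (integral {0..s + e n} m - integral {0..s} m) / e n) \<longlonglongrightarrow> m s"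
    by (rule filterlim_compose)
  moreover have "integral {0..s + e n} m - integral {0..s} m = integral {s..s + e n} m" for n
  proof -
    have "m integrable_on {0..s + e n}"
      by (rule integrable_continuous_interval, rule continuous_on_subset[OF m]) (use e(2)[of n] in auto)
    from Henstock_Kurzweil_Integration.integral_combine[OF _ _ this, of s] show ?thesis
      using s e(1)[of n] by simp
  qed
  ultimately show ?thesis by simp
qed

lemma AE_snd_neq: "AE z in lborel. snd (z :: 'a::euclidean_space \<times> real) \<noteq> c"
proof -
  have "negligible {z :: 'a \<times> real. (0, 1) \<bullet> z = c}"
    by (rule negligible_hyperplane) (simp add: zero_prod_def)
  then have "{z :: 'a \<times> real. snd z = c} \<in> null_sets lebesgue"
    by (simp add: negligible_iff_null_sets inner_prod_def)
  from AE_not_in[OF this] have "AE z in lebesgue. snd (z :: 'a \<times> real) \<noteq> c" by simp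
  then show ?thesis by (simp add: AE_completion_iff)
qed

text \<open>The test is \<phi> times a trapezoidal time factor rising just after \<open>t1\<close>
  and falling just after \<open>t2\<close>. Its time derivative produces averages of
  \<open>m s\<close>, the integral of \<open>W s\<close> against \<phi>, near the two times, and
  these converge by continuity of \<open>m\<close>. The time factor itself tends to the indicator of
  the interval in the remaining terms.\<close>

lemma weak_identity_of_product_tests:
  fixes w \<Gamma> :: "(real^'n) \<times> real \<Rightarrow> real" and A :: "(real^'n) \<times> real \<Rightarrow> real^'n" and W :: "real \<Rightarrow> real^'n \<Rightarrow> real"
  assumes p: "p > 1" and \<Omega>: "open \<Omega>" "bounded \<Omega>" and T: "T > 0"
    and Wi: "\<And>t. t \<in> {0..T} \<Longrightarrow> integrable (lebesgue_on \<Omega>) (W t)"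
    and Wc: "\<And>t. t \<in> {0..T} \<Longrightarrow> ((\<lambda>s. \<integral>x. \<bar>W s x - W t x\<bar> \<partial>lebesgue_on \<Omega>) \<longlongrightarrow> 0) (at t within {0..T})"
    and m[measurable]: "w \<in> borel_measurable borel" "\<Gamma> \<in> borel_measurable borel" "A \<in> borel_measurable borel"
    and outside: "\<And>z. z \<notin> cylinder \<Omega> T \<Longrightarrow> w z = 0 \<and> \<Gamma> z = 0 \<and> A z = 0"
    and wi: "integrable lborel w" and \<Gamma>i: "integrable lborel \<Gamma>"
    and Ap: "integrable lborel (\<lambda>z. norm (A z) powr conj_exp p)"
    and slices: "AE t in lborel. t \<in> {0<..<T} \<longrightarrow> (AE x in lebesgue_on \<Omega>. W t x = w (x, t))"
    and tests: "\<And>\<psi> \<psi>t D\<psi> M. W0_12_L2 \<Omega> T \<psi> \<psi>t \<Longrightarrow> Lp_W0_1p \<Omega> T p \<psi> D\<psi> \<Longrightarrow> \<psi> \<in> borel_measurable borel \<Longrightarrow>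
      \<psi>t \<in> borel_measurable borel \<Longrightarrow> D\<psi> \<in> borel_measurable borel \<Longrightarrow> (\<And>z. \<bar>\<psi> z\<bar> \<le> M) \<Longrightarrow> (\<And>z. \<bar>\<psi>t z\<bar> \<le> M) \<Longrightarrow>
      (\<And>x. \<psi> (x, 0) = 0) \<Longrightarrow> (\<And>x. \<psi> (x, T) = 0) \<Longrightarrow>
      (\<integral>z. - (w z * \<psi>t z) + A z \<bullet> D\<psi> z + \<Gamma> z * \<psi> z \<partial>lborel) = 0"
    and W0: "W0_pair p \<Omega> \<phi> g" and M: "\<And>x. \<bar>\<phi> x\<bar> \<le> M" and t: "0 < t1" "t1 < t2" "t2 < T"
  shows "(\<integral>x. (W t2 x - W t1 x) * \<phi> x \<partial>lebesgue_on \<Omega>) =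
    - (\<integral>z. indicator {t1<..<t2} (snd z) * (A z \<bullet> g (fst z) + \<Gamma> z * \<phi> (fst z)) \<partial>lborel)"
proof -
  have \<phi>m[measurable]: "\<phi> \<in> borel_measurable borel" and [measurable]: "g \<in> borel_measurable borel"
    and gp: "integrable lborel (\<lambda>x. norm (g x) powr p)" and \<phi>0: "\<And>x. x \<notin> \<Omega> \<Longrightarrow> \<phi> x = 0"
    using W0 by (auto simp: W0_pair_def)
  have \<Omega>b[measurable]: "\<Omega> \<in> sets borel" using \<Omega> by simp
  have M0: "M \<ge> 0" using M[of undefined] by simp
  define K where "K z = A z \<bullet> g (fst z) + \<Gamma> z * \<phi> (fst z)" for z
  have [measurable]: "K \<in> borel_measurable borel" unfolding K_def by measurable
  have iAg: "integrable lborel (\<lambda>z. A z \<bullet> g (fst z))"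
  proof -
    \<comment> \<open>The function \<open>g\<close> does not depend on time and is p-integrable in
      space-time only after restriction to \<open>(0, T)\<close>. Nothing is lost in the product,
      because \<open>A\<close> vanishes outside the cylinder.\<close>
    let ?B = "\<lambda>z::(real^'n)\<times>real. indicator {0<..<T} (snd z) *\<^sub>R g (fst z)"
    have "integrable lborel (\<lambda>z. norm (?B z) powr p)"
    proof (rule lborel_prod_integrableI)
      have eq: "norm (?B (x, t)) powr p = indicator {0<..<T} t * norm (g x) powr p" for x t
        using p by (simp add: indicator_def)
      have "(\<integral>t. norm (norm (?B (x, t)) powr p) \<partial>lborel) = measure lborel {0<..<T} * norm (g x) powr p" for x
        unfolding eq by (simp add: abs_mult)
      then show "integrable lborel (\<lambda>x. \<integral>t. norm (norm (?B (x, t)) powr p) \<partial>lborel)" using gp by simp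
      show "integrable lborel (\<lambda>t. norm (?B (x, t)) powr p)" for x
        unfolding eq using integrable_indicator_Ioo[of 0 T] by simp
    qed measurable
    then have "integrable lborel (\<lambda>z. A z \<bullet> ?B z)"
      by (intro integrable_inner_conj_exp[OF p _ _ Ap]) measurable
    moreover have "A z \<bullet> ?B z = A z \<bullet> g (fst z)" for z
      using outside[of z] by (cases "z \<in> cylinder \<Omega> T") (auto simp: mem_Times_iff)
    ultimately show ?thesis by (simp only:)
  qed
  have i\<Gamma>: "integrable lborel (\<lambda>z. \<Gamma> z * \<phi> (fst z))" by (rule integrable_mult_bounded[OF \<Gamma>i _ M]) measurable
  have iw: "integrable lborel (\<lambda>z. w z * \<phi> (fst z))" by (rule integrable_mult_bounded[OF wi _ M]) measurable
  have Ki: "integrable lborel K" unfolding K_def using iAg i\<Gamma> by simp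
  define m where "m s = (\<integral>x. W s x * \<phi> x \<partial>lebesgue_on \<Omega>)" for s
  have W\<phi>: "integrable (lebesgue_on \<Omega>) (\<lambda>x. W s x * \<phi> x)" if "s \<in> {0..T}" for s
    by (rule integrable_mult_bounded[OF Wi[OF that] borel_measurable_lebesgue_onI[OF \<phi>m] M])
  have mc: "continuous_on {0..T} m"
    unfolding continuous_on_def
  proof
    fix s assume s: "s \<in> {0..T}"
    have "((\<lambda>r. m r - m s) \<longlongrightarrow> 0) (at s within {0..T})"
    proof (rule Lim_null_comparison)
      show "((\<lambda>r. M * (\<integral>x. \<bar>W r x - W s x\<bar> \<partial>lebesgue_on \<Omega>)) \<longlongrightarrow> 0) (at s within {0..T})"
        using tendsto_mult_left[OF Wc[OF s], of M] by simp
      have "norm (m r - m s) \<le> M * (\<integral>x. \<bar>W r x - W s x\<bar> \<partial>lebesgue_on \<Omega>)" if r: "r \<in> {0..T}" for r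
      proof -
        have "norm (m r - m s) = norm (\<integral>x. W r x * \<phi> x - W s x * \<phi> x \<partial>lebesgue_on \<Omega>)"
          unfolding m_def using W\<phi>[OF r] W\<phi>[OF s] by simp
        also have "\<dots> \<le> (\<integral>x. norm (W r x * \<phi> x - W s x * \<phi> x) \<partial>lebesgue_on \<Omega>)" by (rule integral_norm_bound)
        also have "\<dots> \<le> (\<integral>x. M * \<bar>W r x - W s x\<bar> \<partial>lebesgue_on \<Omega>)"
        proof (rule integral_mono)
          show "norm (W r x * \<phi> x - W s x * \<phi> x) \<le> M * \<bar>W r x - W s x\<bar>" for x
            using mult_right_mono[OF M[of x], of "\<bar>W r x - W s x\<bar>"]
            by (simp only: left_diff_distrib[symmetric] real_norm_def abs_mult mult.commute[of _ "\<bar>\<phi> x\<bar>"] abs_ge_zero)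
        qed (use W\<phi>[OF r] W\<phi>[OF s] Wi[OF r] Wi[OF s] in auto)
        finally show ?thesis by simp
      qed
      then show "\<forall>\<^sub>F r in at s within {0..T}. norm (m r - m s) \<le> M * (\<integral>x. \<bar>W r x - W s x\<bar> \<partial>lebesgue_on \<Omega>)"
        by (auto simp: eventually_at_filter)
    qed
    then show "(m \<longlongrightarrow> m s) (at s within {0..T})" by (rule LIM_zero_cancel)
  qed
  \<comment> \<open>The denominator starts at 2, so even the first descending ramp ends strictly
    before \<open>T\<close>.\<close>
  define e where "e n = (T - t2) / real (n + 2)" for n
  have e: "e n > 0" "t2 + e n < T" "t1 + e n < T" for n
  proof -
    show 1: "e n > 0" using t by (simp add: e_def)
    have "e n < T - t2" using t by (simp add: e_def divide_less_eq mult_less_cancel_left1)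
    then show "t2 + e n < T" "t1 + e n < T" using t by auto
  qed
  have e0: "e \<longlonglongrightarrow> 0"
  proof -
    have "(\<lambda>n. (T - t2) * inverse (real (Suc (n + 1)))) \<longlonglongrightarrow> (T - t2) * 0"
      by (intro tendsto_intros LIMSEQ_ignore_initial_segment LIMSEQ_inverse_real_of_nat)
    then show ?thesis by (simp add: e_def[abs_def] divide_inverse)
  qed
  define \<zeta> where "\<zeta> n s = ramp t1 (e n) s - ramp t2 (e n) s" for n s
  define \<zeta>' where "\<zeta>' n s = indicator {t1<..<t1 + e n} s / e n - indicator {t2<..<t2 + e n} s / e n" for n s
  have \<zeta>c: "continuous_on UNIV (\<zeta> n)" for n unfolding \<zeta>_def by (intro continuous_intros continuous_on_ramp)
  have \<zeta>1: "\<bar>\<zeta> n s\<bar> \<le> 1" for n s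
    using ramp_bounds(1,2)[of t1 "e n" s] ramp_bounds(1,2)[of t2 "e n" s] unfolding \<zeta>_def by linarith
  have \<zeta>0: "\<zeta> n 0 = 0" "\<zeta> n T = 0" for n using t e[of n] by (auto simp: \<zeta>_def ramp_bounds)
  have [measurable]: "\<zeta> n \<in> borel_measurable borel" for n by (rule borel_measurable_continuous_onI[OF \<zeta>c])
  have \<zeta>'m[measurable]: "\<zeta>' n \<in> borel_measurable borel" for n unfolding \<zeta>'_def by measurable
  have \<zeta>'b: "\<bar>\<zeta>' n s\<bar> \<le> 2 / e n" for n s
  proof -
    have "1 / e n \<le> 2 / e n" using e(1)[of n] by (intro divide_right_mono) auto
    then show ?thesis using e(1)[of n] unfolding \<zeta>'_def by (auto simp: indicator_def)
  qed
  have parts: "(\<integral>s. \<zeta> n s * deriv \<eta> s \<partial>lebesgue_on {0<..<T}) = - (\<integral>s. \<zeta>' n s * \<eta> s \<partial>lebesgue_on {0<..<T})"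
    if \<eta>: "\<eta> \<in> test_functions {0<..<T}" for \<eta> n
  proof -
    note r1 = ramp_integration_by_parts[OF \<eta> t(1) e(1)[of n] e(3)[of n]]
    have "0 < t2" using t by simp
    note r2 = ramp_integration_by_parts[OF \<eta> this e(1)[of n] e(2)[of n]]
    have "(\<integral>s. \<zeta> n s * deriv \<eta> s \<partial>lebesgue_on {0<..<T}) =
        (\<integral>s. ramp t1 (e n) s * deriv \<eta> s \<partial>lebesgue_on {0<..<T}) - (\<integral>s. ramp t2 (e n) s * deriv \<eta> s \<partial>lebesgue_on {0<..<T})"
      unfolding \<zeta>_def left_diff_distrib by (rule Bochner_Integration.integral_diff[OF r1(2) r2(2)])
    moreover have "(\<integral>s. \<zeta>' n s * \<eta> s \<partial>lebesgue_on {0<..<T}) =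
        (\<integral>s. indicator {t1<..<t1 + e n} s / e n * \<eta> s \<partial>lebesgue_on {0<..<T}) - (\<integral>s. indicator {t2<..<t2 + e n} s / e n * \<eta> s \<partial>lebesgue_on {0<..<T})"
      unfolding \<zeta>'_def left_diff_distrib by (rule Bochner_Integration.integral_diff[OF r1(3) r2(3)])
    ultimately show ?thesis using r1(1) r2(1) by simp
  qed
  have ident: "(\<integral>z. \<zeta>' n (snd z) * (w z * \<phi> (fst z)) \<partial>lborel) = (\<integral>z. \<zeta> n (snd z) * K z \<partial>lborel)" for n
  proof -
    note pt = product_test_function[OF W0 p \<Omega> M \<zeta>c[of n] \<zeta>1[of n] \<zeta>0[of n] \<zeta>'m[of n] \<zeta>'b[of n] parts[where n=n]]
    have b1: "\<bar>\<zeta> n (snd z) * \<phi> (fst z)\<bar> \<le> max 1 (2 / e n) * M" for z :: "(real^'n) \<times> real"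
      unfolding abs_mult using M0 by (intro mult_mono M order_trans[OF \<zeta>1]) auto
    have b2: "\<bar>\<zeta>' n (snd z) * \<phi> (fst z)\<bar> \<le> max 1 (2 / e n) * M" for z :: "(real^'n) \<times> real"
      unfolding abs_mult using M0 by (intro mult_mono M order_trans[OF \<zeta>'b]) auto
    have zero: "(\<integral>z. - (w z * (\<zeta>' n (snd z) * \<phi> (fst z))) + A z \<bullet> (\<zeta> n (snd z) *\<^sub>R g (fst z)) + \<Gamma> z * (\<zeta> n (snd z) * \<phi> (fst z)) \<partial>lborel) = 0"
      by (rule tests[OF pt _ _ _ b1 b2]) (use \<zeta>0 in auto)
    have eq: "- (w z * (\<zeta>' n (snd z) * \<phi> (fst z))) + A z \<bullet> (\<zeta> n (snd z) *\<^sub>R g (fst z)) + \<Gamma> z * (\<zeta> n (snd z) * \<phi> (fst z)) =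
        \<zeta> n (snd z) * K z - \<zeta>' n (snd z) * (w z * \<phi> (fst z))" for z
      by (simp add: K_def algebra_simps)
    have "(\<integral>z. \<zeta> n (snd z) * K z - \<zeta>' n (snd z) * (w z * \<phi> (fst z)) \<partial>lborel) = 0"
      using zero by (simp only: eq)
    moreover have "integrable lborel (\<lambda>z. \<zeta> n (snd z) * K z)"
    proof -
      have "integrable lborel (\<lambda>z. K z * \<zeta> n (snd z))"
        by (rule integrable_mult_bounded[OF Ki, where C=1]) (auto intro: \<zeta>1)
      then show ?thesis by (simp add: mult.commute)
    qed
    moreover have "integrable lborel (\<lambda>z. \<zeta>' n (snd z) * (w z * \<phi> (fst z)))"
    proof -
      have "integrable lborel (\<lambda>z. (w z * \<phi> (fst z)) * \<zeta>' n (snd z))"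
        by (rule integrable_mult_bounded[OF iw, where C="2 / e n"]) (auto intro: \<zeta>'b)
      then show ?thesis by (simp add: mult.commute)
    qed
    ultimately show ?thesis by simp
  qed
  \<comment> \<open>By Fubini the space-time integral becomes the mean of \<open>m\<close> over
    \<open>[s, s + e n]\<close>, since the slices of \<open>w\<close> and \<open>W\<close> agree at
    almost every time.\<close>
  have avg: "(\<lambda>n. \<integral>z. indicator {s<..<s + e n} (snd z) / e n * (w z * \<phi> (fst z)) \<partial>lborel) \<longlonglongrightarrow> m s"
    and avgi: "\<And>n. integrable lborel (\<lambda>z. indicator {s<..<s + e n} (snd z) / e n * (w z * \<phi> (fst z)))"
    if s: "0 < s" "s < T" "\<And>n. s + e n < T" for s
  proof -
    show ii: "integrable lborel (\<lambda>z. indicator {s<..<s + e n} (snd z) / e n * (w z * \<phi> (fst z)))" for n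
    proof -
      have "\<bar>indicator {s<..<s + e n} (snd z) / e n\<bar> \<le> 1 / e n" for z :: "(real^'n) \<times> real"
        using e(1)[of n] by (auto simp: indicator_def)
      from integrable_mult_bounded[OF iw _ this] show ?thesis by (simp add: mult.commute)
    qed
    have ave: "(\<integral>z. indicator {s<..<s + e n} (snd z) / e n * (w z * \<phi> (fst z)) \<partial>lborel) = integral {s..s + e n} m / e n" for n
    proof -
      have c: "continuous_on {s..s + e n} m" by (rule continuous_on_subset[OF mc]) (use s(1) s(3)[of n] in auto)
      have si: "set_integrable lborel {s..s + e n} m"
        unfolding set_integrable_def by (rule borel_integrable_compact[OF _ c, unfolded indicator_scaleR_eq_if[symmetric]]) simp
      have "(\<integral>z. indicator {s<..<s + e n} (snd z) / e n * (w z * \<phi> (fst z)) \<partial>lborel) =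
          (\<integral>r. (\<integral>x. indicator {s<..<s + e n} (snd (x, r)) / e n * (w (x, r) * \<phi> (fst (x, r))) \<partial>lborel) \<partial>lborel)"
        by (rule lborel_prod_integral_snd[OF ii, symmetric])
      also have "\<dots> = (\<integral>r. (indicator {s..s + e n} r *\<^sub>R m r) / e n \<partial>lborel)"
      proof (rule integral_cong_AE)
        show "(\<lambda>r. \<integral>x. indicator {s<..<s + e n} (snd (x, r)) / e n * (w (x, r) * \<phi> (fst (x, r))) \<partial>lborel) \<in> borel_measurable lborel"
          using lborel_prod_integrable_snd[OF ii[of n]] by auto
        show "(\<lambda>r. (indicator {s..s + e n} r *\<^sub>R m r) / e n) \<in> borel_measurable lborel"
          using si by (auto simp: set_integrable_def)
        show "AE r in lborel. (\<integral>x. indicator {s<..<s + e n} (snd (x, r)) / e n * (w (x, r) * \<phi> (fst (x, r))) \<partial>lborel) = (indicator {s..s + e n} r *\<^sub>R m r) / e n"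
          using slices AE_lborel_singleton[of s] AE_lborel_singleton[of "s + e n"]
        proof eventually_elim
          case (elim r)
          show ?case
          proof (cases "r \<in> {s<..<s + e n}")
            case True
            then have r: "r \<in> {0<..<T}" "r \<in> {0..T}" using s(1) s(3)[of n] by auto
            have sl: "AE x in lebesgue_on \<Omega>. W r x = w (x, r)" using elim r by auto
            have [measurable]: "W r \<in> borel_measurable (lebesgue_on \<Omega>)" using Wi[OF r(2)] by auto
            have mb: "(\<lambda>x. w (x, r) * \<phi> x) \<in> borel_measurable borel" by measurable
            have "(\<integral>x. w (x, r) * \<phi> x \<partial>lborel) = (\<integral>x. w (x, r) * \<phi> x \<partial>lebesgue_on \<Omega>)"
              by (rule integral_lebesgue_on_eq_lborel[symmetric, OF mb \<Omega>b]) (simp add: \<phi>0)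
            also have "\<dots> = m r" unfolding m_def
              by (rule integral_cong_AE) (use sl borel_measurable_lebesgue_onI[OF mb, of \<Omega>] borel_measurable_lebesgue_onI[OF \<phi>m, of \<Omega>] in auto)
            finally show ?thesis using True by simp
          next
            case False
            then have "r \<notin> {s..s + e n}" using elim by auto
            then show ?thesis using False by simp
          qed
        qed
      qed
      also have "\<dots> = integral {s..s + e n} m / e n"
        using set_borel_integral_eq_integral(2)[OF si] by (simp add: set_lebesgue_integral_def)
      finally show ?thesis .
    qed
    show "(\<lambda>n. \<integral>z. indicator {s<..<s + e n} (snd z) / e n * (w z * \<phi> (fst z)) \<partial>lborel) \<longlonglongrightarrow> m s"
      using average_tendsto[OF mc s(1,2) e(1) less_imp_le[OF s(3)] e0] by (simp only: ave)
  qed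
  have t': "0 < t2" "t1 < T" using t by auto
  have "(\<lambda>n. (\<integral>z. indicator {t1<..<t1 + e n} (snd z) / e n * (w z * \<phi> (fst z)) \<partial>lborel) -
      (\<integral>z. indicator {t2<..<t2 + e n} (snd z) / e n * (w z * \<phi> (fst z)) \<partial>lborel)) \<longlonglongrightarrow> m t1 - m t2"
    by (intro tendsto_diff avg t t' e)
  moreover have "(\<integral>z. indicator {t1<..<t1 + e n} (snd z) / e n * (w z * \<phi> (fst z)) \<partial>lborel) -
      (\<integral>z. indicator {t2<..<t2 + e n} (snd z) / e n * (w z * \<phi> (fst z)) \<partial>lborel) = (\<integral>z. \<zeta> n (snd z) * K z \<partial>lborel)" for n
    unfolding ident[symmetric] \<zeta>'_def left_diff_distrib
    by (rule Bochner_Integration.integral_diff[symmetric, OF avgi[OF t(1) t'(2) e(3)] avgi[OF t'(1) t(3) e(2)]])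
  ultimately have l1: "(\<lambda>n. \<integral>z. \<zeta> n (snd z) * K z \<partial>lborel) \<longlonglongrightarrow> m t1 - m t2" by simp
  have l2: "(\<lambda>n. \<integral>z. \<zeta> n (snd z) * K z \<partial>lborel) \<longlonglongrightarrow> (\<integral>z. indicator {t1<..<t2} (snd z) * K z \<partial>lborel)"
  proof (rule integral_dominated_convergence[where w="\<lambda>z. \<bar>K z\<bar>"])
    \<comment> \<open>At time \<open>t2\<close> exactly, the trapezoid is eventually 1 while the
      indicator is 0; this hyperplane is excluded as a null set.\<close>
    show "AE z in lborel. (\<lambda>n. \<zeta> n (snd z) * K z) \<longlonglongrightarrow> indicator {t1<..<t2} (snd z) * K z"
      using AE_snd_neq[of t2]
    proof eventually_elim
      case (elim z)
      have "(\<lambda>n. \<zeta> n (snd z)) \<longlonglongrightarrow> indicator {t1<..<t2} (snd z)"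
      proof (rule tendsto_eventually)
        consider "snd z \<le> t1" | "t1 < snd z" "snd z < t2" | "t2 < snd z" using elim by linarith
        then show "\<forall>\<^sub>F n in sequentially. \<zeta> n (snd z) = indicator {t1<..<t2} (snd z)"
        proof cases
          case 1
          then show ?thesis using t e(1) by (intro always_eventually) (auto simp: \<zeta>_def ramp_bounds)
        next
          case 2
          then have "\<forall>\<^sub>F n in sequentially. e n < snd z - t1" using e0 by (intro order_tendstoD(2)) auto
          then show ?thesis by eventually_elim (use 2 e(1) in \<open>auto simp: \<zeta>_def ramp_bounds\<close>)
        next
          case 3
          then have "\<forall>\<^sub>F n in sequentially. e n < snd z - t2" using e0 by (intro order_tendstoD(2)) auto
          then show ?thesis by eventually_elim (use 3 t e(1) in \<open>auto simp: \<zeta>_def ramp_bounds\<close>)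
        qed
      qed
      then show ?case by (intro tendsto_intros)
    qed
    show "AE z in lborel. norm (\<zeta> n (snd z) * K z) \<le> \<bar>K z\<bar>" for n
      using mult_right_mono[OF \<zeta>1 abs_ge_zero] by (intro AE_I2) (auto simp: abs_mult)
  qed (use Ki in auto)
  have "m t1 - m t2 = (\<integral>z. indicator {t1<..<t2} (snd z) * K z \<partial>lborel)" by (rule LIMSEQ_unique[OF l1 l2])
  moreover have "(\<integral>x. (W t2 x - W t1 x) * \<phi> x \<partial>lebesgue_on \<Omega>) = m t2 - m t1"
    unfolding m_def left_diff_distrib by (rule Bochner_Integration.integral_diff[OF W\<phi> W\<phi>]) (use t in auto)
  ultimately show ?thesis by (simp add: K_def)
qed

text \<open>Near each \<open>t\<close> the squared norm is at most \<open>2 + 2 N t\<close>, from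
  \<open>a^2 \<le> 2 (a - b)^2 + 2 b^2\<close> and continuity in L^2. Compactness of
  \<open>[0, T]\<close> leaves finitely many such neighbourhoods, and the maximum is estimated by a
  sum.\<close>

lemma C_L2_bounded:
  fixes u :: "(real^'n) \<times> real \<Rightarrow> real"
  assumes u: "u \<in> C_L2 \<Omega> T"
  obtains b where "b > 0" "\<And>t. t \<in> {0..T} \<Longrightarrow> (\<integral>x. (u (x, t))\<^sup>2 \<partial>lebesgue_on \<Omega>) \<le> b"
proof -
  define N where "N t = (\<integral>x. (u (x, t))\<^sup>2 \<partial>lebesgue_on \<Omega>)" for t
  have N0: "N t \<ge> 0" for t by (simp add: N_def)
  have m: "(\<lambda>x. u (x, t)) \<in> borel_measurable (lebesgue_on \<Omega>)" and i: "integrable (lebesgue_on \<Omega>) (\<lambda>x. (u (x, t))\<^sup>2)"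
    if "t \<in> {0..T}" for t using u that by (auto simp: C_L2_def Lp_def)
  have "\<exists>d>0. \<forall>s\<in>{0..T}. \<bar>s - t\<bar> < d \<longrightarrow> N s \<le> 2 + 2 * N t" if t: "t \<in> {0..T}" for t
  proof -
    have "((\<lambda>s. Lp_norm 2 (lebesgue_on \<Omega>) (\<lambda>x. u (x, s) - u (x, t))) \<longlongrightarrow> 0) (at t within {0..T})"
      using u t by (auto simp: C_L2_def)
    then have "((\<lambda>s. \<integral>x. norm (u (x, s) - u (x, t)) powr 2 \<partial>lebesgue_on \<Omega>) \<longlongrightarrow> 0) (at t within {0..T})"
      by (subst (asm) tendsto_Lp_norm_zero_iff) auto
    then have "eventually (\<lambda>s. (\<integral>x. norm (u (x, s) - u (x, t)) powr 2 \<partial>lebesgue_on \<Omega>) < 1) (at t within {0..T})"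
      by (rule order_tendstoD(2)) simp
    then obtain d where d: "d > 0" "\<And>s. s \<in> {0..T} \<Longrightarrow> s \<noteq> t \<Longrightarrow> dist s t < d \<Longrightarrow>
        (\<integral>x. norm (u (x, s) - u (x, t)) powr 2 \<partial>lebesgue_on \<Omega>) < 1"
      unfolding eventually_at by blast
    have "N s \<le> 2 + 2 * N t" if s: "s \<in> {0..T}" "\<bar>s - t\<bar> < d" for s
    proof (cases "s = t")
      case True
      then show ?thesis using N0[of t] by simp
    next
      case False
      have sq: "(a - b)\<^sup>2 \<le> 2 * a\<^sup>2 + 2 * b\<^sup>2" "a\<^sup>2 \<le> 2 * (a - b)\<^sup>2 + 2 * b\<^sup>2" for a b :: real
        using zero_le_power2[of "a + b"] zero_le_power2[of "a - 2 * b"] by (auto simp: power2_eq_square algebra_simps)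
      have id: "integrable (lebesgue_on \<Omega>) (\<lambda>x. (u (x, s) - u (x, t))\<^sup>2)"
      proof (rule Bochner_Integration.integrable_bound)
        show "integrable (lebesgue_on \<Omega>) (\<lambda>x. 2 * (u (x, s))\<^sup>2 + 2 * (u (x, t))\<^sup>2)" using i[OF s(1)] i[OF t] by simp
        show "(\<lambda>x. (u (x, s) - u (x, t))\<^sup>2) \<in> borel_measurable (lebesgue_on \<Omega>)" using m[OF s(1)] m[OF t] by simp
      qed (use sq(1) in \<open>auto intro!: AE_I2\<close>)
      have "N s \<le> (\<integral>x. 2 * (u (x, s) - u (x, t))\<^sup>2 + 2 * (u (x, t))\<^sup>2 \<partial>lebesgue_on \<Omega>)"
        unfolding N_def by (rule integral_mono) (use i[OF s(1)] i[OF t] id sq(2) in auto)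
      also have "\<dots> = 2 * (\<integral>x. (u (x, s) - u (x, t))\<^sup>2 \<partial>lebesgue_on \<Omega>) + 2 * N t"
        using id i[OF t] by (simp add: N_def)
      also have "\<dots> \<le> 2 * 1 + 2 * N t"
        using d(2)[OF s(1) False] s(2) by (simp add: dist_real_def)
      finally show ?thesis by simp
    qed
    then show ?thesis using d(1) by blast
  qed
  then obtain d where d: "\<And>t. t \<in> {0..T} \<Longrightarrow> d t > 0"
    "\<And>t s. t \<in> {0..T} \<Longrightarrow> s \<in> {0..T} \<Longrightarrow> \<bar>s - t\<bar> < d t \<Longrightarrow> N s \<le> 2 + 2 * N t" by metis
  have cover: "{0..T} \<subseteq> (\<Union>t\<in>{0..T}. ball t (d t))"
  proof
    fix t assume t: "t \<in> {0..T}"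
    then have "t \<in> ball t (d t)" using d(1) by simp
    with t show "t \<in> (\<Union>t\<in>{0..T}. ball t (d t))" by blast
  qed
  obtain C where C: "C \<subseteq> {0..T}" "finite C" "{0..T} \<subseteq> (\<Union>t\<in>C. ball t (d t))"
    by (rule compactE_image[OF compact_Icc _ cover]) simp
  show ?thesis
  proof (rule that[of "2 + 2 * (\<Sum>t\<in>C. N t)"])
    show "2 + 2 * (\<Sum>t\<in>C. N t) > 0" using N0 by (simp add: add_pos_nonneg sum_nonneg)
    fix s assume s: "s \<in> {0..T}"
    then obtain t where t: "t \<in> C" "s \<in> ball t (d t)" using C(3) by blast
    then have "N s \<le> 2 + 2 * N t" using d(2)[of t s] C(1) s by (auto simp: dist_real_def)
    also have "N t \<le> (\<Sum>t\<in>C. N t)" by (rule member_le_sum[OF t(1)]) (use N0 C(2) in auto)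
    finally show "(\<integral>x. (u (x, s))\<^sup>2 \<partial>lebesgue_on \<Omega>) \<le> 2 + 2 * (\<Sum>t\<in>C. N t)" by (simp add: N_def)
  qed
qed

text \<open>The Gagliardo-Nirenberg inequality is applied on almost every time slice. Its constant
  depends on the slice only through the L^2 bound \<open>b\<close>, which is uniform in time, so the
  inequality can be integrated over \<open>(0, T)\<close>.\<close>

lemma parabolic_embedding:
  fixes w :: "(real^'n) \<times> real \<Rightarrow> real" and Dw :: "(real^'n) \<times> real \<Rightarrow> real^'n" and p :: real
  defines "q \<equiv> p * (real CARD('n) + 2) / real CARD('n)"
  assumes p: "p > 1" and \<Omega>: "open \<Omega>" "bounded \<Omega>"
    and [measurable]: "w \<in> borel_measurable borel" "Dw \<in> borel_measurable borel"
    and outside: "\<And>z. z \<notin> cylinder \<Omega> T \<Longrightarrow> w z = 0"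
    and Dw_p: "integrable lborel (\<lambda>z. norm (Dw z) powr p)"
    and W0: "AE t in lborel. t \<in> {0<..<T} \<longrightarrow> W0_pair p \<Omega> (\<lambda>x. w (x, t)) (\<lambda>x. Dw (x, t))"
    and b: "b > 0" "AE t in lborel. t \<in> {0<..<T} \<longrightarrow> integrable lborel (\<lambda>x. (w (x, t))\<^sup>2) \<and> (\<integral>x. (w (x, t))\<^sup>2 \<partial>lborel) \<le> b"
  shows "integrable lborel (\<lambda>z. \<bar>w z\<bar> powr q)"
proof (rule integrableI_bounded)
  have q0: "q > 0" using p by (simp add: q_def)
  have \<Omega>b[measurable]: "\<Omega> \<in> sets borel" using \<Omega> by simp
  have \<Omega>f: "emeasure lborel \<Omega> < \<infinity>" by (rule emeasure_bounded_finite[OF \<Omega>(2)])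
  define c1 where "c1 = measure lborel (ball 0 1 :: (real^'n) set)"
  define K where "K = ennreal (7 * 4 powr q * 16 powr p * (4 * b / c1) powr (p / real CARD('n)))"
  have slice: "AE t in lborel. (\<integral>\<^sup>+x. ennreal (\<bar>w (x, t)\<bar> powr q) \<partial>lborel) \<le>
      emeasure lborel \<Omega> * indicator {0<..<T} t + K * (\<integral>\<^sup>+x. ennreal (norm (Dw (x, t)) powr p) \<partial>lborel)"
    using W0 b(2)
  proof eventually_elim
    case (elim t)
    show ?case
    proof (cases "t \<in> {0<..<T}")
      case True
      then show ?thesis
        using W0_pair_Gagliardo_Nirenberg[of p \<Omega> "\<lambda>x. w (x, t)" "\<lambda>x. Dw (x, t)" b] elim p \<Omega>b b(1)
        by (simp add: K_def c1_def q_def)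
    next
      case False
      then have "w (x, t) = 0" for x using outside[of "(x, t)"] by auto
      then show ?thesis by simp
    qed
  qed
  have "(\<integral>\<^sup>+z. ennreal (norm (\<bar>w z\<bar> powr q)) \<partial>lborel) = (\<integral>\<^sup>+z. ennreal (\<bar>w z\<bar> powr q) \<partial>(lborel \<Otimes>\<^sub>M lborel))"
    by (simp add: lborel_prod)
  also have "\<dots> = (\<integral>\<^sup>+t. (\<integral>\<^sup>+x. ennreal (\<bar>w (x, t)\<bar> powr q) \<partial>lborel) \<partial>lborel)"
    by (rule lborel_pair.nn_integral_snd[symmetric]) (unfold lborel_prod, measurable)
  also have "\<dots> \<le> (\<integral>\<^sup>+t. emeasure lborel \<Omega> * indicator {0<..<T} t + K * (\<integral>\<^sup>+x. ennreal (norm (Dw (x, t)) powr p) \<partial>lborel) \<partial>lborel)"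
    by (rule nn_integral_mono_AE[OF slice])
  also have "\<dots> = emeasure lborel \<Omega> * emeasure lborel {0<..<T} + K * (\<integral>\<^sup>+t. (\<integral>\<^sup>+x. ennreal (norm (Dw (x, t)) powr p) \<partial>lborel) \<partial>lborel)"
    by (subst nn_integral_add) (auto simp: nn_integral_cmult nn_integral_cmult_indicator)
  also have "(\<integral>\<^sup>+t. (\<integral>\<^sup>+x. ennreal (norm (Dw (x, t)) powr p) \<partial>lborel) \<partial>lborel) = (\<integral>\<^sup>+z. ennreal (norm (Dw z) powr p) \<partial>(lborel \<Otimes>\<^sub>M lborel))"
    by (rule lborel_pair.nn_integral_snd) (unfold lborel_prod, measurable)
  also have "\<dots> = ennreal (\<integral>z. norm (Dw z) powr p \<partial>lborel)"
    unfolding lborel_prod by (rule nn_integral_eq_integral[OF Dw_p]) auto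
  also have "emeasure lborel \<Omega> * emeasure lborel {0<..<T} + K * ennreal (\<integral>z. norm (Dw z) powr p \<partial>lborel) < \<infinity>"
    using \<Omega>f emeasure_bounded_finite[of "{0<..<T}"] by (auto simp: K_def ennreal_mult_less_top)
  finally show "(\<integral>\<^sup>+z. ennreal (norm (\<bar>w z\<bar> powr q)) \<partial>lborel) < \<infinity>" .
qed measurable

text \<open>Borel representatives of the function and its gradient agree with the originals almost
  everywhere on the cylinder, hence on almost every time slice. On those slices they form a Sobolev
  pair, and continuity with values in L^2 provides the uniform bound that the parabolic embedding
  needs.\<close>

lemma Lp_W0_1p_representatives:
  fixes u :: "(real^'n) \<times> real \<Rightarrow> real"
  assumes u: "Lp_W0_1p \<Omega> T p u Du" and uC: "u \<in> C_L2 \<Omega> T" and p: "p > 1" and \<Omega>: "open \<Omega>" "bounded \<Omega>"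
  obtains u' Du' where
    "u' \<in> borel_measurable borel" "Du' \<in> borel_measurable borel"
    "\<And>z. z \<notin> cylinder \<Omega> T \<Longrightarrow> u' z = 0" "\<And>z. z \<notin> cylinder \<Omega> T \<Longrightarrow> Du' z = 0"
    "AE z in lebesgue_on (cylinder \<Omega> T). u z = u' z" "AE z in lebesgue_on (cylinder \<Omega> T). Du z = Du' z"
    "integrable lborel (\<lambda>z. \<bar>u' z\<bar> powr p)" "integrable lborel (\<lambda>z. norm (Du' z) powr p)"
    "AE t in lborel. t \<in> {0<..<T} \<longrightarrow> (AE x in lebesgue_on \<Omega>. u (x, t) = u' (x, t))"
    "AE t in lborel. t \<in> {0<..<T} \<longrightarrow> W0_pair p \<Omega> (\<lambda>x. u' (x, t)) (\<lambda>x. Du' (x, t))"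
    "integrable lborel (\<lambda>z. \<bar>u' z\<bar> powr (p * (real CARD('n) + 2) / real CARD('n)))"
proof -
  let ?Q = "cylinder \<Omega> T"
  have Q[measurable]: "?Q \<in> sets borel" and \<Omega>b[measurable]: "\<Omega> \<in> sets borel"
    using \<Omega> by (auto intro!: borel_open open_Times)
  have um: "u \<in> borel_measurable (lebesgue_on ?Q)" "Du \<in> borel_measurable (lebesgue_on ?Q)"
    and up: "integrable (lebesgue_on ?Q) (\<lambda>z. norm (u z) powr p)" "integrable (lebesgue_on ?Q) (\<lambda>z. norm (Du z) powr p)"
    using u by (auto simp: Lp_W0_1p_def Lp_def)
  obtain u' where u': "u' \<in> borel_measurable borel" "\<And>z. z \<notin> ?Q \<Longrightarrow> u' z = 0" "AE z in lebesgue_on ?Q. u z = u' z"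
    using lebesgue_on_borel_representative[OF um(1) Q] by blast
  obtain Du' where Du': "Du' \<in> borel_measurable borel" "\<And>z. z \<notin> ?Q \<Longrightarrow> Du' z = 0" "AE z in lebesgue_on ?Q. Du z = Du' z"
    using lebesgue_on_borel_representative[OF um(2) Q] by blast
  note [measurable] = u'(1) Du'(1)
  have i: "integrable lborel (\<lambda>z. \<bar>u' z\<bar> powr p)" "integrable lborel (\<lambda>z. norm (Du' z) powr p)"
  proof -
    have "integrable (lebesgue_on ?Q) (\<lambda>z. \<bar>u' z\<bar> powr p)"
      by (rule integrable_cong_AE_imp[OF up(1)])
        (use u'(3) borel_measurable_lebesgue_onI[of "\<lambda>z. \<bar>u' z\<bar> powr p" ?Q] in auto)
    then show "integrable lborel (\<lambda>z. \<bar>u' z\<bar> powr p)"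
      by (subst (asm) integrable_lebesgue_on_iff_lborel) (use u'(2) p in auto)
    have "integrable (lebesgue_on ?Q) (\<lambda>z. norm (Du' z) powr p)"
      by (rule integrable_cong_AE_imp[OF up(2)])
        (use Du'(3) borel_measurable_lebesgue_onI[of "\<lambda>z. norm (Du' z) powr p" ?Q] in auto)
    then show "integrable lborel (\<lambda>z. norm (Du' z) powr p)"
      by (subst (asm) integrable_lebesgue_on_iff_lborel) (use Du'(2) p in auto)
  qed
  \<comment> \<open>Equality almost everywhere on the cylinder is transferred to almost every time
    slice; it is stated for a general value type because it serves for functions and gradients
    alike.\<close>
  have sl: "AE t in lborel. t \<in> {0<..<T} \<longrightarrow> (AE x in lebesgue_on \<Omega>. f (x, t) = g (x, t))"
    if "AE z in lebesgue_on ?Q. f z = g z" for f g :: "(real^'n) \<times> real \<Rightarrow> 'b"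
  proof -
    have "AE z in lborel. z \<in> ?Q \<longrightarrow> f z = g z" using that by (simp only: AE_lebesgue_on_iff[OF Q])
    from lborel_prod_AE_snd[OF this] show ?thesis
    proof eventually_elim
      case (elim t)
      show ?case
      proof
        assume t: "t \<in> {0<..<T}"
        have "AE x in lborel. x \<in> \<Omega> \<longrightarrow> f (x, t) = g (x, t)"
          using elim by eventually_elim (use t in auto)
        then show "AE x in lebesgue_on \<Omega>. f (x, t) = g (x, t)" by (simp only: AE_lebesgue_on_iff[OF \<Omega>b])
      qed
    qed
  qed
  have "AE t in lborel. t \<in> {0<..<T} \<longrightarrow> (\<lambda>x. u (x, t)) \<in> W0_1p \<Omega> p \<and> weak_gradient \<Omega> (\<lambda>x. u (x, t)) (\<lambda>x. Du (x, t))"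
  proof -
    have "AE t in lborel. t \<in> {0<..<T} \<longrightarrow> (\<lambda>x. u (x, t)) \<in> W0_1p \<Omega> p"
      "AE t in lborel. t \<in> {0<..<T} \<longrightarrow> weak_gradient \<Omega> (\<lambda>x. u (x, t)) (\<lambda>x. Du (x, t))"
      using u unfolding Lp_W0_1p_def by (simp_all add: AE_lebesgue_on_iff)
    then show ?thesis by eventually_elim simp
  qed
  then have W: "AE t in lborel. t \<in> {0<..<T} \<longrightarrow> W0_pair p \<Omega> (\<lambda>x. u' (x, t)) (\<lambda>x. Du' (x, t))"
    using sl[OF u'(3)] sl[OF Du'(3)] lborel_prod_AE_integrable_snd[OF i(2)]
  proof eventually_elim
    case (elim t)
    show ?case
    proof
      assume t: "t \<in> {0<..<T}"
      show "W0_pair p \<Omega> (\<lambda>x. u' (x, t)) (\<lambda>x. Du' (x, t))"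
      proof (rule W0_1p_imp_W0_pair[of "\<lambda>x. u (x, t)" _ _ "\<lambda>x. Du (x, t)"])
        show "u' (x, t) = 0" "Du' (x, t) = 0" if "x \<notin> \<Omega>" for x using u'(2)[of "(x, t)"] Du'(2)[of "(x, t)"] that by auto
      qed (use elim t p \<Omega> in auto)
    qed
  qed
  obtain b where b: "b > 0" "\<And>t. t \<in> {0..T} \<Longrightarrow> (\<integral>x. (u (x, t))\<^sup>2 \<partial>lebesgue_on \<Omega>) \<le> b"
    using C_L2_bounded[OF uC] by blast
  have "AE t in lborel. t \<in> {0<..<T} \<longrightarrow> integrable lborel (\<lambda>x. (u' (x, t))\<^sup>2) \<and> (\<integral>x. (u' (x, t))\<^sup>2 \<partial>lborel) \<le> b"
    using sl[OF u'(3)]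
  proof eventually_elim
    case (elim t)
    show ?case
    proof
      assume t: "t \<in> {0<..<T}"
      have um: "(\<lambda>x. u (x, t)) \<in> borel_measurable (lebesgue_on \<Omega>)" and ui: "integrable (lebesgue_on \<Omega>) (\<lambda>x. (u (x, t))\<^sup>2)"
        using uC t by (auto simp: C_L2_def Lp_def)
      have mb: "(\<lambda>x. (u' (x, t))\<^sup>2) \<in> borel_measurable borel" by measurable
      have z: "(u' (x, t))\<^sup>2 = 0" if "x \<notin> \<Omega>" for x using u'(2)[of "(x, t)"] that by auto
      have eq: "AE x in lebesgue_on \<Omega>. (u (x, t))\<^sup>2 = (u' (x, t))\<^sup>2" using elim t by auto
      have "integrable (lebesgue_on \<Omega>) (\<lambda>x. (u' (x, t))\<^sup>2)"
        by (rule integrable_cong_AE_imp[OF ui borel_measurable_lebesgue_onI[OF mb]]) (use eq in auto)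
      moreover have "(\<integral>x. (u' (x, t))\<^sup>2 \<partial>lborel) = (\<integral>x. (u (x, t))\<^sup>2 \<partial>lebesgue_on \<Omega>)"
      proof -
        have "(\<integral>x. (u' (x, t))\<^sup>2 \<partial>lborel) = (\<integral>x. (u' (x, t))\<^sup>2 \<partial>lebesgue_on \<Omega>)"
          using z by (intro integral_lebesgue_on_eq_lborel[symmetric] mb \<Omega>b)
        also have "\<dots> = (\<integral>x. (u (x, t))\<^sup>2 \<partial>lebesgue_on \<Omega>)"
          by (rule integral_cong_AE) (use eq um borel_measurable_lebesgue_onI[OF mb, of \<Omega>] in auto)
        finally show ?thesis .
      qed
      ultimately show "integrable lborel (\<lambda>x. (u' (x, t))\<^sup>2) \<and> (\<integral>x. (u' (x, t))\<^sup>2 \<partial>lborel) \<le> b"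
        using integrable_lebesgue_on_iff_lborel[OF mb \<Omega>b z] b(2)[of t] t by simp
    qed
  qed
  note e = parabolic_embedding[OF p \<Omega> u'(1) Du'(1) u'(2) i(2) W b(1) this]
  show ?thesis by (rule that[OF u'(1) Du'(1) u'(2) Du'(2) u'(3) Du'(3) i sl[OF u'(3)] W e])
qed

section \<open>Integrability of the structural terms and regularity of the difference\<close>

lemma powr_le_one_add_powr:
  fixes x :: real
  assumes "0 \<le> x" "0 \<le> a" "a \<le> b"
  shows "x powr a \<le> 1 + x powr b"
proof (cases "x \<le> 1")
  case True
  then have "x powr a \<le> 1" using powr_mono2[of a x 1] assms by simp
  then show ?thesis by (rule order_trans) simp
next
  case False
  then have "x powr a \<le> x powr b" using assms by (intro powr_mono) auto
  then show ?thesis by simp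
qed

text \<open>Since \<open>(p - 1)\<close> times the conjugate exponent equals \<open>p\<close>,
  raising the growth bound to the conjugate exponent turns its first two terms into p-th powers of
  \<open>s\<close> and \<xi>.\<close>

lemma flux_in_conj_Lp:
  fixes a :: "'z \<Rightarrow> 'b::euclidean_space" and \<xi> :: "'z \<Rightarrow> 'b" and s a1 :: "'z \<Rightarrow> real"
  assumes p: "p > 1" and m: "a \<in> borel_measurable M" "s \<in> borel_measurable M" "\<xi> \<in> borel_measurable M"
    and le: "AE z in M. norm (a z) \<le> \<beta> * (\<bar>s z\<bar> powr (p - 1) + norm (\<xi> z) powr (p - 1) + a1 z)" and \<beta>: "\<beta> > 0"
    and s: "integrable M (\<lambda>z. \<bar>s z\<bar> powr p)" and \<xi>: "integrable M (\<lambda>z. norm (\<xi> z) powr p)"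
    and a1: "a1 \<in> Lp (conj_exp p) M"
  shows "integrable M (\<lambda>z. norm (a z) powr conj_exp p)"
proof -
  let ?q = "conj_exp p"
  note q = conj_exp_bounds[OF p]
  have a1i: "integrable M (\<lambda>z. \<bar>a1 z\<bar> powr ?q)" and [measurable]: "a1 \<in> borel_measurable M" using a1 by (auto simp: Lp_def)
  note [measurable] = m
  define b where "b z = \<beta> powr ?q * (2 powr ?q * (\<bar>s z\<bar> powr p + 2 powr ?q * (norm (\<xi> z) powr p + \<bar>a1 z\<bar> powr ?q)))" for z
  have bi: "integrable M b" unfolding b_def[abs_def] using s \<xi> a1i by simp
  show ?thesis
  proof (rule Bochner_Integration.integrable_bound[OF bi])
    show "AE z in M. norm (norm (a z) powr ?q) \<le> norm (b z)"
      using le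
    proof eventually_elim
      case (elim z)
      define x y w where "x = \<bar>s z\<bar> powr (p - 1)" and "y = norm (\<xi> z) powr (p - 1)" and "w = \<bar>a1 z\<bar>"
      have nn: "x \<ge> 0" "y \<ge> 0" "w \<ge> 0" by (auto simp: x_def y_def w_def)
      have xq: "x powr ?q = \<bar>s z\<bar> powr p" "y powr ?q = norm (\<xi> z) powr p" unfolding x_def y_def powr_powr q(3) by auto
      have "\<beta> * (\<bar>s z\<bar> powr (p - 1) + norm (\<xi> z) powr (p - 1) + a1 z) \<le> \<beta> * (x + (y + w))"
        using \<beta> by (intro mult_left_mono) (auto simp: x_def y_def w_def)
      with elim have "norm (a z) \<le> \<beta> * (x + (y + w))" by linarith
      then have "norm (a z) powr ?q \<le> (\<beta> * (x + (y + w))) powr ?q" using q(1) by (intro powr_mono2) auto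
      also have "\<dots> = \<beta> powr ?q * (x + (y + w)) powr ?q" by (rule powr_mult)
      also have "\<dots> \<le> \<beta> powr ?q * (2 powr ?q * (x powr ?q + (y + w) powr ?q))"
        using nn q(1) by (intro mult_left_mono powr_add_le) auto
      also have "\<dots> \<le> \<beta> powr ?q * (2 powr ?q * (x powr ?q + 2 powr ?q * (y powr ?q + w powr ?q)))"
        using nn q(1) by (intro mult_left_mono add_left_mono powr_add_le) auto
      also have "\<dots> = b z" by (simp add: b_def xq w_def)
      finally show ?case by simp
    qed
  qed measurable
qed

lemma Lp_diff:
  assumes "f \<in> Lp p M" "g \<in> Lp p M" "p \<ge> 0"
  shows "(\<lambda>x. f x - g x) \<in> Lp p M"
proof -
  have [measurable]: "f \<in> borel_measurable M" "g \<in> borel_measurable M" using assms by (auto simp: Lp_def)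
  have "integrable M (\<lambda>x. norm (f x - g x) powr p)"
  proof (rule Bochner_Integration.integrable_bound)
    show "integrable M (\<lambda>x. 2 powr p * (norm (f x) powr p + norm (g x) powr p))" using assms by (auto simp: Lp_def)
    have "norm (f x - g x) powr p \<le> 2 powr p * (norm (f x) powr p + norm (g x) powr p)" for x
      by (rule norm_diff_powr_le[OF assms(3)])
    then show "AE x in M. norm (norm (f x - g x) powr p) \<le> norm (2 powr p * (norm (f x) powr p + norm (g x) powr p))" by simp
  qed measurable
  then show ?thesis by (simp add: Lp_def)
qed

text \<open>On a domain of finite measure the L^1 norm is at most a constant times the L^2 norm, so
  continuity in L^2 of both functions gives continuity in L^1 of their difference.\<close>

lemma C_L2_difference:
  fixes u v :: "(real^'n) \<times> real \<Rightarrow> real"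
  assumes u: "u \<in> C_L2 \<Omega> T" and v: "v \<in> C_L2 \<Omega> T" and \<Omega>: "open \<Omega>" "bounded \<Omega>" and t: "t \<in> {0..T}"
  shows "integrable (lebesgue_on \<Omega>) (\<lambda>x. u (x, t) - v (x, t))"
    and "((\<lambda>s. \<integral>x. \<bar>(u (x, s) - v (x, s)) - (u (x, t) - v (x, t))\<bar> \<partial>lebesgue_on \<Omega>) \<longlongrightarrow> 0) (at t within {0..T})"
proof -
  let ?M = "lebesgue_on \<Omega>"
  have fin: "emeasure ?M (space ?M) < \<infinity>"
    using \<Omega> emeasure_bounded_finite[OF \<Omega>(2)] by (simp add: emeasure_restrict_space)
  have uL: "(\<lambda>x. u (x, s)) \<in> Lp 2 ?M" and vL: "(\<lambda>x. v (x, s)) \<in> Lp 2 ?M" if "s \<in> {0..T}" for s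
    using u v that by (auto simp: C_L2_def)
  show "integrable ?M (\<lambda>x. u (x, t) - v (x, t))"
    using Lp_two_L1_bound(1)[OF uL[OF t] fin] Lp_two_L1_bound(1)[OF vL[OF t] fin] by simp
  define c where "c = measure ?M (space ?M) + 1"
  have le: "(\<integral>x. \<bar>(u (x, s) - v (x, s)) - (u (x, t) - v (x, t))\<bar> \<partial>?M) \<le>
      c * Lp_norm 2 ?M (\<lambda>x. u (x, s) - u (x, t)) + c * Lp_norm 2 ?M (\<lambda>x. v (x, s) - v (x, t))" if s: "s \<in> {0..T}" for s
  proof -
    have Lu: "(\<lambda>x. u (x, s) - u (x, t)) \<in> Lp 2 ?M" by (rule Lp_diff[OF uL[OF s] uL[OF t]]) simp
    have Lv: "(\<lambda>x. v (x, s) - v (x, t)) \<in> Lp 2 ?M" by (rule Lp_diff[OF vL[OF s] vL[OF t]]) simp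
    note bu = Lp_two_L1_bound[OF Lu fin] and bv = Lp_two_L1_bound[OF Lv fin]
    have i: "integrable ?M (\<lambda>x. u (x, s) - u (x, t))" "integrable ?M (\<lambda>x. v (x, s) - v (x, t))" by (rule bu(1) bv(1))+
    have "integrable ?M (\<lambda>x. (u (x, s) - u (x, t)) - (v (x, s) - v (x, t)))" using i by (rule Bochner_Integration.integrable_diff)
    then have "integrable ?M (\<lambda>x. (u (x, s) - v (x, s)) - (u (x, t) - v (x, t)))" by (simp add: algebra_simps)
    then have "(\<integral>x. \<bar>(u (x, s) - v (x, s)) - (u (x, t) - v (x, t))\<bar> \<partial>?M) \<le>
        (\<integral>x. \<bar>u (x, s) - u (x, t)\<bar> + \<bar>v (x, s) - v (x, t)\<bar> \<partial>?M)"
      using i by (intro integral_mono) auto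
    also have "\<dots> = (\<integral>x. \<bar>u (x, s) - u (x, t)\<bar> \<partial>?M) + (\<integral>x. \<bar>v (x, s) - v (x, t)\<bar> \<partial>?M)"
      using i by (intro Bochner_Integration.integral_add) auto
    finally show ?thesis using bu(2) bv(2) by (simp add: c_def)
  qed
  show "((\<lambda>s. \<integral>x. \<bar>(u (x, s) - v (x, s)) - (u (x, t) - v (x, t))\<bar> \<partial>?M) \<longlongrightarrow> 0) (at t within {0..T})"
  proof (rule tendsto_sandwich[OF _ _ tendsto_const])
    have "((\<lambda>s. Lp_norm 2 ?M (\<lambda>x. u (x, s) - u (x, t))) \<longlongrightarrow> 0) (at t within {0..T})"
      "((\<lambda>s. Lp_norm 2 ?M (\<lambda>x. v (x, s) - v (x, t))) \<longlongrightarrow> 0) (at t within {0..T})"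
      using u v t by (auto simp: C_L2_def)
    from tendsto_add[OF tendsto_mult_left[OF this(1), of c] tendsto_mult_left[OF this(2), of c]]
    show "((\<lambda>s. c * Lp_norm 2 ?M (\<lambda>x. u (x, s) - u (x, t)) + c * Lp_norm 2 ?M (\<lambda>x. v (x, s) - v (x, t))) \<longlongrightarrow> 0) (at t within {0..T})"
      by simp
  qed (use le in \<open>auto simp: eventually_at_filter\<close>)
qed

section \<open>Comparison of two weak solutions\<close>

theorem corollary2p1:
  fixes \<Omega> :: "(real^'n) set"
    and T p \<alpha>1 \<beta>1 \<alpha> \<beta> \<rho>1 \<phi> \<epsilon> \<theta> :: real
    and a :: "(real^'n) \<times> real \<Rightarrow> real \<Rightarrow> real^'n \<Rightarrow> real^'n"
    and G :: "(real^'n) \<times> real \<Rightarrow> real \<Rightarrow> real"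
    and a1 c f0 u v :: "(real^'n) \<times> real \<Rightarrow> real"
    and F :: "(real^'n) \<times> real \<Rightarrow> real^'n"
  assumes N: "CARD('n) \<ge> 2"
    and \<Omega>: "open \<Omega>" "bounded \<Omega>"
    and T: "T > 0"
    and carat_a: "caratheodory (lebesgue_on (cylinder \<Omega> T)) (\<lambda>z (s, \<xi>). a z s \<xi>)"
    and carat_G: "caratheodory (lebesgue_on (cylinder \<Omega> T)) G"
    and constants: "\<alpha>1 > 0" "\<beta>1 > 0" "\<alpha> > 0" "\<beta> > 0" "\<rho>1 > 0" "\<phi> \<ge> 0"
    and exponents:
      "(1 < p \<and> p < 2 \<and> \<epsilon> = 0 \<and> \<theta> = 0) \<or>
       (p \<ge> 2 \<and> \<epsilon> > 0 \<and> 0 \<le> \<theta> \<and> \<theta> \<le> p * (real CARD('n) + 2) / (2 * real CARD('n)))"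
    and i: "AE z in lebesgue_on (cylinder \<Omega> T). \<forall>s \<xi>. a z s \<xi> \<bullet> \<xi> \<ge> \<alpha>1 * norm \<xi> powr p"
    and ii: "AE z in lebesgue_on (cylinder \<Omega> T). \<forall>s \<xi>.
      norm (a z s \<xi>) \<le> \<beta>1 * (\<bar>s\<bar> powr (p - 1) + norm \<xi> powr (p - 1) + a1 z)"
    and a1: "a1 \<in> Lp (conj_exp p) (lebesgue_on (cylinder \<Omega> T))"
    and iii: "AE z in lebesgue_on (cylinder \<Omega> T). \<forall>s.
      \<bar>G z s\<bar> \<le> c z * \<bar>s\<bar> powr (p * ((real CARD('n) + 2) / (real CARD('n) + 1)))"
    and c: "c \<in> Lp ((real CARD('n) + p) / real CARD('n)) (lebesgue_on (cylinder \<Omega> T))"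
    and iv: "AE z in lebesgue_on (cylinder \<Omega> T). \<forall>s \<xi> \<xi>'.
      (a z s \<xi> - a z s \<xi>') \<bullet> (\<xi> - \<xi>') \<ge>
        \<alpha> * (\<epsilon> + norm \<xi> + norm \<xi>') powr (p - 2) * norm (\<xi> - \<xi>') ^ 2"
    and v: "AE z in lebesgue_on (cylinder \<Omega> T). \<forall>s s' \<xi>.
      norm (a z s \<xi> - a z s' \<xi>) \<le>
        \<beta> * (\<phi> + norm \<xi> powr (p - 1) + (\<bar>s\<bar> + \<bar>s'\<bar>) powr \<theta>) * \<bar>s - s'\<bar>"
    and vi: "AE z in lebesgue_on (cylinder \<Omega> T). \<forall>s s'. \<bar>G z s - G z s'\<bar> \<le> \<rho>1 * \<bar>s - s'\<bar>"
    and f0: "f0 \<in> Lp (conj_exp (p * (real CARD('n) + 2) / real CARD('n)))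
                    (lebesgue_on (cylinder \<Omega> T))"
    and F: "F \<in> Lp (conj_exp p) (lebesgue_on (cylinder \<Omega> T))"
    and sol_u: "weak_solution \<Omega> T p a G f0 F (\<lambda>x. u (x, 0)) u"
    and sol_v: "weak_solution \<Omega> T p a G f0 F (\<lambda>x. v (x, 0)) v"
    and init: "AE x in lebesgue_on \<Omega>. u (x, 0) \<le> v (x, 0)"
  shows "AE z in lebesgue_on (cylinder \<Omega> T). u z \<le> v z"
proof -
  let ?Q = "cylinder \<Omega> T"
  let ?M = "lebesgue_on ?Q"
  let ?q = "p * (real CARD('n) + 2) / real CARD('n)"
  have p: "p > 1" using exponents by auto
  have Qb[measurable]: "?Q \<in> sets borel" and Qf: "emeasure lborel ?Q < \<infinity>"
    using \<Omega> by (auto intro!: borel_open open_Times emeasure_bounded_finite[unfolded infinity_ennreal_def] bounded_Times)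
  have uC: "u \<in> C_L2 \<Omega> T" and vC: "v \<in> C_L2 \<Omega> T" using sol_u sol_v by (auto simp: weak_solution_def)
  obtain Du where LDu: "Lp_W0_1p \<Omega> T p u Du" and eq_u: "\<And>t \<psi> \<psi>t D\<psi>. t \<in> {0<..T} \<Longrightarrow> W0_12_L2 \<Omega> T \<psi> \<psi>t \<Longrightarrow> Lp_W0_1p \<Omega> T p \<psi> D\<psi> \<Longrightarrow>
      (\<integral>x. u (x, t) * \<psi> (x, t) \<partial>lebesgue_on \<Omega>) +
      (\<integral>z. - (u z * \<psi>t z) + a z (u z) (Du z) \<bullet> D\<psi> z + G z (u z) * \<psi> z \<partial>lebesgue_on (cylinder \<Omega> t)) =
      (\<integral>x. u (x, 0) * \<psi> (x, 0) \<partial>lebesgue_on \<Omega>) + (\<integral>z. f0 z * \<psi> z + F z \<bullet> D\<psi> z \<partial>lebesgue_on (cylinder \<Omega> t))"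
    using sol_u unfolding weak_solution_def by blast
  obtain Dv where LDv: "Lp_W0_1p \<Omega> T p v Dv" and eq_v: "\<And>t \<psi> \<psi>t D\<psi>. t \<in> {0<..T} \<Longrightarrow> W0_12_L2 \<Omega> T \<psi> \<psi>t \<Longrightarrow> Lp_W0_1p \<Omega> T p \<psi> D\<psi> \<Longrightarrow>
      (\<integral>x. v (x, t) * \<psi> (x, t) \<partial>lebesgue_on \<Omega>) +
      (\<integral>z. - (v z * \<psi>t z) + a z (v z) (Dv z) \<bullet> D\<psi> z + G z (v z) * \<psi> z \<partial>lebesgue_on (cylinder \<Omega> t)) =
      (\<integral>x. v (x, 0) * \<psi> (x, 0) \<partial>lebesgue_on \<Omega>) + (\<integral>z. f0 z * \<psi> z + F z \<bullet> D\<psi> z \<partial>lebesgue_on (cylinder \<Omega> t))"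
    using sol_v unfolding weak_solution_def by blast
  show ?thesis
  proof (rule Lp_W0_1p_representatives[OF LDu uC p \<Omega>], rule Lp_W0_1p_representatives[OF LDv vC p \<Omega>], goal_cases)
    case (1 u' Du' v' Dv')
    note U = 1(1-11) and V = 1(12-22)
    note [measurable] = U(1,2) V(1,2)
    have um: "u \<in> borel_measurable ?M" "Du \<in> borel_measurable ?M" "v \<in> borel_measurable ?M" "Dv \<in> borel_measurable ?M"
      and up: "integrable ?M (\<lambda>z. \<bar>u z\<bar> powr p)" "integrable ?M (\<lambda>z. norm (Du z) powr p)"
        "integrable ?M (\<lambda>z. \<bar>v z\<bar> powr p)" "integrable ?M (\<lambda>z. norm (Dv z) powr p)"
      using LDu LDv by (auto simp: Lp_W0_1p_def Lp_def)
    define au av where "au z = a z (u z) (Du z)" and "av z = a z (v z) (Dv z)" for z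
    define Gu Gv where "Gu z = G z (u z)" and "Gv z = G z (v z)" for z
    \<comment> \<open>The flux is viewed as a function of the single argument
      \<open>(s, \<xi>)\<close>, in which it is jointly continuous, and composed with the pair of
      the solution and its gradient.\<close>
    have am: "au \<in> borel_measurable ?M" "av \<in> borel_measurable ?M"
      using caratheodory_compose_measurable[OF carat_a Qb, of "\<lambda>z. (u z, Du z)"]
        caratheodory_compose_measurable[OF carat_a Qb, of "\<lambda>z. (v z, Dv z)"] um
      by (simp_all add: au_def[abs_def] av_def[abs_def])
    have Gm: "Gu \<in> borel_measurable ?M" "Gv \<in> borel_measurable ?M"
      using caratheodory_compose_measurable[OF carat_G Qb um(1)] caratheodory_compose_measurable[OF carat_G Qb um(3)]
      by (simp_all add: Gu_def[abs_def] Gv_def[abs_def])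
    have ap: "integrable ?M (\<lambda>z. norm (au z) powr conj_exp p)" "integrable ?M (\<lambda>z. norm (av z) powr conj_exp p)"
      by (rule flux_in_conj_Lp[OF p am(1) um(1,2) _ constants(2) up(1,2) a1], use ii in \<open>auto simp: au_def\<close>)
        (rule flux_in_conj_Lp[OF p am(2) um(3,4) _ constants(2) up(3,4) a1], use ii in \<open>auto simp: av_def\<close>)
    have u1: "integrable ?M u" and v1: "integrable ?M v"
    proof -
      have "integrable lborel u'" "integrable lborel v'"
        by (rule integrable_norm_powr_imp_integrable[OF p _ Qb Qf]; use U V in simp)+
      then have i: "integrable ?M u'" "integrable ?M v'"
        using integrable_lebesgue_on_iff_lborel[OF U(1) Qb U(3)] integrable_lebesgue_on_iff_lborel[OF V(1) Qb V(3)] by auto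
      show "integrable ?M u" by (rule integrable_cong_AE_imp[OF i(1) um(1)]) (use U(5) in auto)
      show "integrable ?M v" by (rule integrable_cong_AE_imp[OF i(2) um(3)]) (use V(5) in auto)
    qed
    have G1: "integrable ?M Gu" "integrable ?M Gv"
    proof -
      \<comment> \<open>At \<open>s = 0\<close> the growth bound (iii) forces \<open>G\<close> to
        vanish; combined with the Lipschitz bound this gives
        \<open>|G z s| \<le> \<rho>1 |s|\<close>, so the reaction terms are integrable along with
        the solutions.\<close>
      have G0: "AE z in ?M. G z 0 = 0"
        using iii by eventually_elim (metis abs_zero abs_le_zero_iff mult_zero_right powr_zero_eq_one powr_0)
      have "AE z in ?M. norm (Gu z) \<le> norm (\<rho>1 * u z)"
        using G0 vi by eventually_elim (use constants(5) in \<open>auto simp: Gu_def abs_mult dest: spec[of _ 0]\<close>)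
      then show "integrable ?M Gu"
        by (rule Bochner_Integration.integrable_bound[OF integrable_mult_right[OF u1] Gm(1)])
      have "AE z in ?M. norm (Gv z) \<le> norm (\<rho>1 * v z)"
        using G0 vi by eventually_elim (use constants(5) in \<open>auto simp: Gv_def abs_mult dest: spec[of _ 0]\<close>)
      then show "integrable ?M Gv"
        by (rule Bochner_Integration.integrable_bound[OF integrable_mult_right[OF v1] Gm(2)])
    qed
    obtain A where A[measurable]: "A \<in> borel_measurable borel" "\<And>z. z \<notin> ?Q \<Longrightarrow> A z = 0" "AE z in ?M. au z - av z = A z"
      using lebesgue_on_borel_representative[OF borel_measurable_diff[OF am] Qb] by blast
    obtain \<Gamma> where \<Gamma>[measurable]: "\<Gamma> \<in> borel_measurable borel" "\<And>z. z \<notin> ?Q \<Longrightarrow> \<Gamma> z = 0" "AE z in ?M. Gu z - Gv z = \<Gamma> z"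
      using lebesgue_on_borel_representative[OF borel_measurable_diff[OF Gm] Qb] by blast
    define w where "w z = u' z - v' z" for z
    define Dw where "Dw z = Du' z - Dv' z" for z
    \<comment> \<open>The factor \<open>|u - v|\<close> of the Lipschitz bound is left out here; it
      is the factor \<open>|w|\<close> that later meets \<open>H'(w)\<close>.\<close>
    define R where "R z = indicator ?Q z * (\<beta> * (\<phi> + norm (Dv' z) powr (p - 1) + (\<bar>u' z\<bar> + \<bar>v' z\<bar>) powr \<theta>) * norm (Dw z))" for z
    have wm[measurable]: "w \<in> borel_measurable borel" "Dw \<in> borel_measurable borel"
      unfolding w_def[abs_def] Dw_def[abs_def] by measurable
    have Rm[measurable]: "R \<in> borel_measurable borel" unfolding R_def by measurable
    have out: "w z = 0 \<and> \<Gamma> z = 0 \<and> Dw z = 0 \<and> A z = 0" if "z \<notin> ?Q" for z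
      using that U(3,4) V(3,4) A(2) \<Gamma>(2) by (simp add: w_def Dw_def)
    have wp: "integrable lborel (\<lambda>z. norm (w z) powr p)"
      using Lp_diff[of u' p lborel v'] U V p by (simp add: Lp_def w_def)
    have Dwp: "integrable lborel (\<lambda>z. norm (Dw z) powr p)"
      using Lp_diff[of Du' p lborel Dv'] U V p by (simp add: Lp_def Dw_def)
    have wi: "integrable lborel w"
      by (rule integrable_norm_powr_imp_integrable[OF p wm(1) Qb Qf _ wp]) (use out in blast)
    have wq: "AE z in ?M. u z - v z = w z" using U(5) V(5) by eventually_elim (simp add: w_def)
    have growth: "AE z in lborel. \<bar>\<Gamma> z\<bar> \<le> \<rho>1 * \<bar>w z\<bar>"
    proof -
      have "AE z in ?M. \<bar>\<Gamma> z\<bar> \<le> \<rho>1 * \<bar>w z\<bar>"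
        using vi \<Gamma>(3) wq
      proof eventually_elim
        case (elim z)
        have "\<bar>G z (u z) - G z (v z)\<bar> \<le> \<rho>1 * \<bar>u z - v z\<bar>" using elim(1) by blast
        then show ?case unfolding elim(2)[symmetric] elim(3)[symmetric] Gu_def Gv_def .
      qed
      then have "AE z in lborel. z \<in> ?Q \<longrightarrow> \<bar>\<Gamma> z\<bar> \<le> \<rho>1 * \<bar>w z\<bar>" by (simp only: AE_lebesgue_on_iff[OF Qb])
      then show ?thesis
      proof eventually_elim
        case (elim z)
        then show ?case using out[of z] by (cases "z \<in> ?Q") auto
      qed
    qed
    have \<Gamma>p: "integrable lborel (\<lambda>z. norm (\<Gamma> z) powr p)"
    proof (rule Bochner_Integration.integrable_bound)
      show "integrable lborel (\<lambda>z. \<rho>1 powr p * norm (w z) powr p)" using wp by simp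
      show "AE z in lborel. norm (norm (\<Gamma> z) powr p) \<le> norm (\<rho>1 powr p * norm (w z) powr p)"
        using growth
      proof eventually_elim
        case (elim z)
        then have "\<bar>\<Gamma> z\<bar> powr p \<le> (\<rho>1 * \<bar>w z\<bar>) powr p" using p by (intro powr_mono2) auto
        then show ?case by (simp add: powr_mult)
      qed
    qed measurable
    have \<Gamma>i: "integrable lborel \<Gamma>"
      by (rule integrable_norm_powr_imp_integrable[OF p \<Gamma>(1) Qb Qf _ \<Gamma>p]) (use out in blast)
    have Ap: "integrable lborel (\<lambda>z. norm (A z) powr conj_exp p)"
    proof -
      have "(\<lambda>z. au z - av z) \<in> Lp (conj_exp p) ?M"
        by (rule Lp_diff) (use am ap conj_exp_bounds(1)[OF p] in \<open>auto simp: Lp_def\<close>)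
      then have "integrable ?M (\<lambda>z. norm (au z - av z) powr conj_exp p)" by (simp add: Lp_def)
      then have "integrable ?M (\<lambda>z. norm (A z) powr conj_exp p)"
        by (rule integrable_cong_AE_imp)
          (use A(3) borel_measurable_lebesgue_onI[of "\<lambda>z. norm (A z) powr conj_exp p" ?Q] in auto)
      then show ?thesis by (subst (asm) integrable_lebesgue_on_iff_lborel) (use A(2) in auto)
    qed
    have coercive: "AE z in lborel. - (A z \<bullet> Dw z) \<le> R z * \<bar>w z\<bar>"
    proof -
      have "AE z in ?M. z \<in> ?Q \<longrightarrow> - (A z \<bullet> Dw z) \<le> R z * \<bar>w z\<bar>"
        using iv v A(3) U(5,6) V(5,6)
      proof eventually_elim
        case (elim z)
        have "0 \<le> \<alpha> * (\<epsilon> + norm (Du z) + norm (Dv z)) powr (p - 2) * norm (Du z - Dv z) ^ 2" using constants(3) by simp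
        also have "\<dots> \<le> (a z (u z) (Du z) - a z (u z) (Dv z)) \<bullet> (Du z - Dv z)" using elim(1) by blast
        finally have mono: "0 \<le> (a z (u z) (Du z) - a z (u z) (Dv z)) \<bullet> (Du z - Dv z)" .
        have lip: "norm (a z (u z) (Dv z) - a z (v z) (Dv z)) \<le> \<beta> * (\<phi> + norm (Dv z) powr (p - 1) + (\<bar>u z\<bar> + \<bar>v z\<bar>) powr \<theta>) * \<bar>u z - v z\<bar>"
          using elim(2) by blast
        \<comment> \<open>The flux difference is split through the intermediate value
          \<open>a z (u z) (Dv z)\<close>: one part changes only the gradient and is monotone, the
          other changes only \<open>s\<close> and is Lipschitz.\<close>
        have "- ((au z - av z) \<bullet> (Du z - Dv z)) =
            - ((a z (u z) (Du z) - a z (u z) (Dv z)) \<bullet> (Du z - Dv z)) - (a z (u z) (Dv z) - a z (v z) (Dv z)) \<bullet> (Du z - Dv z)"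
          by (simp add: au_def av_def inner_diff_left)
        also have "\<dots> \<le> norm (a z (u z) (Dv z) - a z (v z) (Dv z)) * norm (Du z - Dv z)"
          using mono Cauchy_Schwarz_ineq2[of "a z (u z) (Dv z) - a z (v z) (Dv z)" "Du z - Dv z"] by linarith
        also have "\<dots> \<le> (\<beta> * (\<phi> + norm (Dv z) powr (p - 1) + (\<bar>u z\<bar> + \<bar>v z\<bar>) powr \<theta>) * \<bar>u z - v z\<bar>) * norm (Du z - Dv z)"
          by (rule mult_right_mono[OF lip]) simp
        finally have "- ((au z - av z) \<bullet> (Du z - Dv z)) \<le> (\<beta> * (\<phi> + norm (Dv z) powr (p - 1) + (\<bar>u z\<bar> + \<bar>v z\<bar>) powr \<theta>) * norm (Du z - Dv z)) * \<bar>u z - v z\<bar>"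
          by (simp only: mult_ac)
        then show ?case unfolding elim(3-7) by (simp add: R_def w_def Dw_def)
      qed
      then have "AE z in lborel. z \<in> ?Q \<longrightarrow> - (A z \<bullet> Dw z) \<le> R z * \<bar>w z\<bar>" by (simp add: AE_lebesgue_on_iff[OF Qb])
      then show ?thesis
      proof eventually_elim
        case (elim z)
        then show ?case using out[of z] by (cases "z \<in> ?Q") auto
      qed
    qed
    have \<theta>: "0 \<le> \<theta>" "\<theta> * conj_exp p \<le> ?q"
    proof -
      show "0 \<le> \<theta>" using exponents by auto
      have N: "real CARD('n) > 0" by simp
      have q0: "0 \<le> ?q" using p by simp
      from exponents show "\<theta> * conj_exp p \<le> ?q"
      proof (elim disjE conjE)
        assume "\<theta> = 0" then show ?thesis using q0 by simp
      next
        assume h: "p \<ge> 2" "0 \<le> \<theta>" "\<theta> \<le> p * (real CARD('n) + 2) / (2 * real CARD('n))"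
        \<comment> \<open>For \<open>p \<ge> 2\<close> the conjugate exponent is at most 2, which is
          why the assumed upper bound on \<theta> is half of the exponent of the embedding.\<close>
        have "conj_exp p \<le> 2" using h(1) by (simp add: conj_exp_def divide_le_eq)
        then have "\<theta> * conj_exp p \<le> \<theta> * 2" using h(2) by (rule mult_left_mono)
        also have "\<dots> \<le> p * (real CARD('n) + 2) / (2 * real CARD('n)) * 2" using h(3) by (rule mult_right_mono) simp
        also have "\<dots> = ?q" by simp
        finally show ?thesis .
      qed
    qed
    have Ri: "integrable lborel R"
    proof (rule Bochner_Integration.integrable_bound)
      \<comment> \<open>The three groups majorize the three summands of \<open>R\<close>: the
        constant \<phi>, the power of the gradient and the power \<theta> of the solutions, each
        paired with \<open>|Dw|\<close> by Young's inequality. The last group uses that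
        \<open>u'\<close> and \<open>v'\<close> are integrable to the power of the
        embedding.\<close>
      let ?b = "\<lambda>z. \<beta> * (\<phi> * (indicator ?Q z + norm (Dw z) powr p) + (norm (Dv' z) powr p + norm (Dw z) powr p) +
          (indicator ?Q z + 2 powr ?q * (\<bar>u' z\<bar> powr ?q + \<bar>v' z\<bar> powr ?q) + norm (Dw z) powr p))"
      have iQ: "integrable lborel (\<lambda>z. indicator ?Q z :: real)" using Qf Qb by (simp add: integrable_real_indicator)
      show "integrable lborel ?b"
        using iQ Dwp U(11) V(8,11) by (intro integrable_mult_right Bochner_Integration.integrable_add) auto
      have "\<bar>R z\<bar> \<le> ?b z" for z
      proof (cases "z \<in> ?Q")
        case True
        define s where "s = \<bar>u' z\<bar> + \<bar>v' z\<bar>"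
        have s0: "s \<ge> 0" by (simp add: s_def)
        have 1: "\<phi> * norm (Dw z) \<le> \<phi> * (1 + norm (Dw z) powr p)"
          using le_one_add_powr[OF p, of "norm (Dw z)"] constants(6) by (intro mult_left_mono) auto
        have 2: "norm (Dv' z) powr (p - 1) * norm (Dw z) \<le> norm (Dv' z) powr p + norm (Dw z) powr p"
        proof -
          have "norm (Dv' z) powr (p - 1) * norm (Dw z) \<le> (1 - 1 / p) * norm (Dv' z) powr p + norm (Dw z) powr p / p"
            by (rule powr_conj_mult_le[OF p]) auto
          also have "\<dots> \<le> 1 * norm (Dv' z) powr p + norm (Dw z) powr p"
            using p by (intro add_mono mult_right_mono) (auto simp: divide_le_eq mult_le_cancel_left1)
          finally show ?thesis by simp
        qed
        have 3: "s powr \<theta> * norm (Dw z) \<le> 1 + 2 powr ?q * (\<bar>u' z\<bar> powr ?q + \<bar>v' z\<bar> powr ?q) + norm (Dw z) powr p"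
        proof -
          have "s powr \<theta> * norm (Dw z) \<le> (s powr \<theta>) powr conj_exp p + norm (Dw z) powr p"
            using Young_inner[OF p, of 1 "s powr \<theta>" "norm (Dw z)"] by (simp add: abs_mult)
          also have "(s powr \<theta>) powr conj_exp p \<le> 1 + s powr ?q"
            unfolding powr_powr using s0 \<theta> conj_exp_bounds(1)[OF p] by (intro powr_le_one_add_powr) auto
          also have "s powr ?q \<le> 2 powr ?q * (\<bar>u' z\<bar> powr ?q + \<bar>v' z\<bar> powr ?q)"
            unfolding s_def using p by (intro powr_add_le) auto
          finally show ?thesis by simp
        qed
        have "R z = \<beta> * (\<phi> * norm (Dw z) + norm (Dv' z) powr (p - 1) * norm (Dw z) + s powr \<theta> * norm (Dw z))"
          using True by (simp add: R_def s_def distrib_right distrib_left mult.assoc)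
        moreover have "0 \<le> \<phi> * norm (Dw z) + norm (Dv' z) powr (p - 1) * norm (Dw z) + s powr \<theta> * norm (Dw z)"
          using constants(6) by simp
        moreover have "\<phi> * norm (Dw z) + norm (Dv' z) powr (p - 1) * norm (Dw z) + s powr \<theta> * norm (Dw z) \<le>
            \<phi> * (1 + norm (Dw z) powr p) + (norm (Dv' z) powr p + norm (Dw z) powr p) +
            (1 + 2 powr ?q * (\<bar>u' z\<bar> powr ?q + \<bar>v' z\<bar> powr ?q) + norm (Dw z) powr p)"
          by (intro add_mono 1 2 3)
        ultimately show ?thesis using True constants(4) by (simp add: abs_mult)
      next
        case False
        then show ?thesis using constants(4,6) by (simp add: R_def)
      qed
      then have "norm (R z) \<le> norm (?b z)" for z
        unfolding real_norm_def by (rule order_trans[OF _ abs_ge_self])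
      then show "AE z in lborel. norm (R z) \<le> norm (?b z)" by (rule AE_I2)
    qed measurable
    have sl: "AE t in lborel. t \<in> {0<..<T} \<longrightarrow> (AE x in lebesgue_on \<Omega>. u (x, t) - v (x, t) = w (x, t))"
      using U(9) V(9)
    proof eventually_elim
      case (elim t)
      show ?case
      proof
        assume t: "t \<in> {0<..<T}"
        have "AE x in lebesgue_on \<Omega>. u (x, t) = u' (x, t)" "AE x in lebesgue_on \<Omega>. v (x, t) = v' (x, t)" using elim t by auto
        then show "AE x in lebesgue_on \<Omega>. u (x, t) - v (x, t) = w (x, t)" by eventually_elim (simp add: w_def)
      qed
    qed
    have W0: "AE t in lborel. t \<in> {0<..<T} \<longrightarrow> W0_pair p \<Omega> (\<lambda>x. w (x, t)) (\<lambda>x. Dw (x, t))"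
      using U(10) V(10) by eventually_elim (auto simp: w_def Dw_def intro: W0_pair_diff[OF _ _ p])
    note Cuv = C_L2_difference[OF uC vC \<Omega>]
    have tests: "(\<integral>z. - (w z * \<psi>t z) + A z \<bullet> D\<psi> z + \<Gamma> z * \<psi> z \<partial>lborel) = 0"
      if W: "W0_12_L2 \<Omega> T \<psi> \<psi>t" and L: "Lp_W0_1p \<Omega> T p \<psi> D\<psi>" and m[measurable]: "\<psi> \<in> borel_measurable borel"
        "\<psi>t \<in> borel_measurable borel" "D\<psi> \<in> borel_measurable borel" and b: "\<And>z. \<bar>\<psi> z\<bar> \<le> B" "\<And>z. \<bar>\<psi>t z\<bar> \<le> B"
        and z: "\<And>x. \<psi> (x, 0) = 0" "\<And>x. \<psi> (x, T) = 0" for \<psi> \<psi>t D\<psi> B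
    proof -
      note mM = borel_measurable_lebesgue_onI[OF m(1), of ?Q] borel_measurable_lebesgue_onI[OF m(2), of ?Q] borel_measurable_lebesgue_onI[OF m(3), of ?Q]
      have Lp: "integrable ?M (\<lambda>z. norm (D\<psi> z) powr p)" using L by (auto simp: Lp_W0_1p_def Lp_def)
      \<comment> \<open>Both identities are taken at the final time. The test vanishes at 0 and at
        \<open>T\<close>, so all boundary terms drop out, and the right-hand sides with
        \<open>f0\<close> and \<open>F\<close> are the same expression and cancel.\<close>
      have "T \<in> {0<..T}" using T by simp
      note eqs = eq_u[OF this W L] eq_v[OF this W L]
      have eq: "(\<integral>z. - (u z * \<psi>t z) + au z \<bullet> D\<psi> z + Gu z * \<psi> z \<partial>?M) = (\<integral>z. - (v z * \<psi>t z) + av z \<bullet> D\<psi> z + Gv z * \<psi> z \<partial>?M)"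
        using eqs by (simp add: z au_def av_def Gu_def Gv_def)
      have iu: "integrable ?M (\<lambda>z. - (u z * \<psi>t z) + au z \<bullet> D\<psi> z + Gu z * \<psi> z)"
        by (intro Bochner_Integration.integrable_add Bochner_Integration.integrable_minus integrable_mult_bounded[OF u1 mM(2) b(2)] integrable_mult_bounded[OF G1(1) mM(1) b(1)]
            integrable_inner_conj_exp[OF p am(1) mM(3) ap(1) Lp])
      have iv': "integrable ?M (\<lambda>z. - (v z * \<psi>t z) + av z \<bullet> D\<psi> z + Gv z * \<psi> z)"
        by (intro Bochner_Integration.integrable_add Bochner_Integration.integrable_minus integrable_mult_bounded[OF v1 mM(2) b(2)] integrable_mult_bounded[OF G1(2) mM(1) b(1)]
            integrable_inner_conj_exp[OF p am(2) mM(3) ap(2) Lp])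
      let ?f = "\<lambda>z. - (w z * \<psi>t z) + A z \<bullet> D\<psi> z + \<Gamma> z * \<psi> z"
      have fm: "?f \<in> borel_measurable borel" by measurable
      have "(\<integral>z. ?f z \<partial>lborel) = (\<integral>z. ?f z \<partial>?M)"
        by (rule integral_lebesgue_on_eq_lborel[symmetric, OF fm Qb]) (simp add: out)
      also have "\<dots> = (\<integral>z. (- (u z * \<psi>t z) + au z \<bullet> D\<psi> z + Gu z * \<psi> z) - (- (v z * \<psi>t z) + av z \<bullet> D\<psi> z + Gv z * \<psi> z) \<partial>?M)"
      proof (rule integral_cong_AE)
        show "?f \<in> borel_measurable ?M" by (rule borel_measurable_lebesgue_onI[OF fm])
        show "(\<lambda>z. (- (u z * \<psi>t z) + au z \<bullet> D\<psi> z + Gu z * \<psi> z) - (- (v z * \<psi>t z) + av z \<bullet> D\<psi> z + Gv z * \<psi> z)) \<in> borel_measurable ?M"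
          using iu iv' by auto
        show "AE z in ?M. ?f z = (- (u z * \<psi>t z) + au z \<bullet> D\<psi> z + Gu z * \<psi> z) - (- (v z * \<psi>t z) + av z \<bullet> D\<psi> z + Gv z * \<psi> z)"
          using wq A(3) \<Gamma>(3)
        proof eventually_elim
          case (elim z)
          show ?case unfolding elim[symmetric] by (simp add: algebra_simps inner_diff_left)
        qed
      qed
      also have "\<dots> = 0" using iu iv' eq by simp
      finally show ?thesis .
    qed
    \<comment> \<open>The slices are the everywhere defined \<open>u (x, t) - v (x, t)\<close>,
      which retain the initial trace, while the space-time function is the Borel representative
      \<open>w\<close>.\<close>
    interpret parabolic_difference \<Omega> T p \<rho>1 "\<lambda>t x. u (x, t) - v (x, t)" w \<Gamma> R Dw A
    proof
      fix \<phi>' g B t1 t2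
      assume h: "W0_pair p \<Omega> \<phi>' g" "\<And>x. \<bar>\<phi>' x\<bar> \<le> B" "0 < t1" "t1 < t2" "t2 < T"
      show "(\<integral>x. ((u (x, t2) - v (x, t2)) - (u (x, t1) - v (x, t1))) * \<phi>' x \<partial>lebesgue_on \<Omega>) =
          - (\<integral>z. indicator {t1<..<t2} (snd z) * (A z \<bullet> g (fst z) + \<Gamma> z * \<phi>' (fst z)) \<partial>lborel)"
        by (rule weak_identity_of_product_tests[where W="\<lambda>t x. u (x, t) - v (x, t)" and w=w and M=B,
            OF p \<Omega> T Cuv wm(1) \<Gamma>(1) A(1) _ wi \<Gamma>i Ap sl tests h]) (use out in auto)
    qed (use p \<Omega> T constants Cuv wm \<Gamma> A Rm out wp Dwp \<Gamma>p Ap Ri sl W0 coercive growth in auto)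
    have "AE z in lborel. w z \<le> 0" by (rule nonpositive) (use init in auto)
    then have "AE z in ?M. w z \<le> 0" by (subst AE_lebesgue_on_iff[OF Qb]) auto
    with wq show ?case by eventually_elim simp
  qed
qed

end
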